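(* Let $E/\mathbb{Q}$ be the elliptic curve $y^2=x^3+a_4x+a_6$ with $a_4,a_6\in\mathbb{Z}$, let $\mathcal{P}=\{P_1,\dots,P_r\}$ be a set of $r$ linearly independent points in $E(\mathbb{Q})$, and let $G$ be a subgroup of $E_{\mathrm{tor}}(\mathbb{Q})$. Fix $0<\varepsilon<\frac12$. If $(u,v)\in\mathbb{Z}^2$ is map-suitable for $E$ and $\varepsilon$-bound-suitable for $\mathcal{P}$, and $-D_E(u,v)$ is a negative fundamental discriminant, then $$h(-D_E(u,v))\ge c_G(\mathcal{P})\cdot\Big(T_E(u,v,\varepsilon)^{r/2}-r\sqrt{d(\mathcal{P})}\,T_E(u,v,\varepsilon)^{(r-1)/2}\Big).$$
   Context: $d_E(u,v):=v(u^3+a_4uv^2-a_6v^3)$, $D_E(u,v):=4d_E(u,v)$; $h(-D)$ is the class number of discriminant $-D$. Map-suitable: $u$, $v$, $3u^2+a_4v^2$, $D_E(u,v)$ all positive. Heights: for $x=m/n$ in lowest terms $h_W(x)=\log\max(|m|,|n|)$; for $P=(A/C^2,B/C^3)$ in lowest terms $h_W(P)=h_W(A/C^2)$; $\hat h(P)=\frac12\lim_n h_W(nP)/n^2$; $\langle P,Q\rangle=\frac12(\hat h(P+Q)-\hat h(P)-\hat h(Q))$. $R_{\mathbb{Q}}(\mathcal{P}):=\det(\langle P_i,P_j\rangle)$, $d(\mathcal{P}):=\max_{\delta_i\in\{0,\pm1\}}2\hat h(\sum\delta_iP_i)$, $\Omega_r=\pi^{r/2}/\Gamma(\frac r2+1)$,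 $c_G(\mathcal{P}):=\frac{|G|}{\sqrt{R_{\mathbb{Q}}(\mathcal{P})}}\Omega_r$, $\delta(E):=\frac18h_W(j(E))+\frac1{12}h_W(\Delta(E))+\frac53$ ($j$-invariant and discriminant of the given model), $T_E(u,v,\varepsilon):=\frac18\log\!\left(\frac{4d_E(u,v)^{1-\varepsilon}}{uv+v^2}\right)-\frac{\delta(E)}4$. With $\varepsilon':=\frac{\varepsilon}{1-\varepsilon}$, $(u,v)$ is $\varepsilon$-bound-suitable for $\mathcal{P}$ if $u,v>0$ and $$\Big(\tfrac14(uv+v^2)\Big)^{1+\varepsilon'}e^{2(1+\varepsilon')(\delta(E)+d(\mathcal{P}))}<d_E(u,v)<\big(v^2(uv+v^2)\big)^{1+\varepsilon'}.$$ *)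

theory Defs
  imports "HOL-Analysis.Analysis" "HOL-Computational_Algebra.Squarefree"
begin

text \<open>Rational points of E: y^2 = x^3 + a4 x + a6; None is the point at infinity O.\<close>
type_synonym ecpt = "(rat \<times> rat) option"

definition on_curve :: "int \<Rightarrow> int \<Rightarrow> ecpt \<Rightarrow> bool" where
  "on_curve a4 a6 P = (case P of None \<Rightarrow> True
     | Some (x, y) \<Rightarrow> y ^ 2 = x ^ 3 + of_int a4 * x + of_int a6)"

definition ec_add :: "int \<Rightarrow> ecpt \<Rightarrow> ecpt \<Rightarrow> ecpt" where
  "ec_add a4 P Q = (case P of None \<Rightarrow> Q | Some (x1, y1) \<Rightarrow>
     (case Q of None \<Rightarrow> P | Some (x2, y2) \<Rightarrow>
       (if x1 = x2 \<and> y1 = - y2 then None else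
         (let l = (if x1 = x2 then (3 * x1 ^ 2 + of_int a4) / (2 * y1) else (y2 - y1) / (x2 - x1));
              x3 = l ^ 2 - x1 - x2
          in Some (x3, l * (x1 - x3) - y1)))))"

definition ec_neg :: "ecpt \<Rightarrow> ecpt" where
  "ec_neg P = map_option (\<lambda>(x, y). (x, - y)) P"

fun ec_nmul :: "int \<Rightarrow> nat \<Rightarrow> ecpt \<Rightarrow> ecpt" where
  "ec_nmul a4 0 P = None"
| "ec_nmul a4 (Suc n) P = ec_add a4 P (ec_nmul a4 n P)"

definition ec_mul :: "int \<Rightarrow> int \<Rightarrow> ecpt \<Rightarrow> ecpt" where
  "ec_mul a4 k P = (if k \<ge> 0 then ec_nmul a4 (nat k) P else ec_neg (ec_nmul a4 (nat (- k)) P))"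

fun ec_lincomb :: "int \<Rightarrow> (nat \<Rightarrow> int) \<Rightarrow> (nat \<Rightarrow> ecpt) \<Rightarrow> nat \<Rightarrow> ecpt" where
  "ec_lincomb a4 c Ps 0 = None"
| "ec_lincomb a4 c Ps (Suc n) = ec_add a4 (ec_lincomb a4 c Ps n) (ec_mul a4 (c n) (Ps n))"

definition lin_indep :: "int \<Rightarrow> (nat \<Rightarrow> ecpt) \<Rightarrow> nat \<Rightarrow> bool" where
  "lin_indep a4 Ps r = (\<forall>c. ec_lincomb a4 c Ps r = None \<longrightarrow> (\<forall>i<r. c i = 0))"

definition tors_subgroup :: "int \<Rightarrow> int \<Rightarrow> ecpt set \<Rightarrow> bool" where
  "tors_subgroup a4 a6 G = (None \<in> G \<and> (\<forall>P\<in>G. \<forall>Q\<in>G. ec_add a4 P Q \<in> G)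
     \<and> (\<forall>P\<in>G. ec_neg P \<in> G)
     \<and> (\<forall>P\<in>G. on_curve a4 a6 P \<and> (\<exists>n>0. ec_nmul a4 n P = None)))"

definition hW_rat :: "rat \<Rightarrow> real" where
  "hW_rat x = (case quotient_of x of (m, n) \<Rightarrow> ln (real_of_int (max \<bar>m\<bar> \<bar>n\<bar>)))"

definition hW_pt :: "ecpt \<Rightarrow> real" where
  "hW_pt P = (case P of None \<Rightarrow> 0 | Some (x, y) \<Rightarrow> hW_rat x)"

definition canon_height :: "int \<Rightarrow> ecpt \<Rightarrow> real" where
  "canon_height a4 P = lim (\<lambda>n. hW_pt (ec_nmul a4 n P) / (real n) ^ 2) / 2"

definition height_pairing :: "int \<Rightarrow> ecpt \<Rightarrow> ecpt \<Rightarrow> real" where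
  "height_pairing a4 P Q =
     (canon_height a4 (ec_add a4 P Q) - canon_height a4 P - canon_height a4 Q) / 2"

definition regulator :: "int \<Rightarrow> (nat \<Rightarrow> ecpt) \<Rightarrow> nat \<Rightarrow> real" where
  "regulator a4 Ps r = (\<Sum>p | p permutes {..<r}.
      of_int (sign p) * (\<Prod>i<r. height_pairing a4 (Ps i) (Ps (p i))))"

definition dP :: "int \<Rightarrow> (nat \<Rightarrow> ecpt) \<Rightarrow> nat \<Rightarrow> real" where
  "dP a4 Ps r = Max ((\<lambda>\<delta>. 2 * canon_height a4 (ec_lincomb a4 \<delta> Ps r)) `
      {\<delta>. (\<forall>i<r. \<delta> i \<in> {-1, 0, 1}) \<and> (\<forall>i\<ge>r. \<delta> i = 0)})"

definition Omega :: "nat \<Rightarrow> real" where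
  "Omega r = pi powr (real r / 2) / Gamma (real r / 2 + 1)"

definition cG :: "int \<Rightarrow> ecpt set \<Rightarrow> (nat \<Rightarrow> ecpt) \<Rightarrow> nat \<Rightarrow> real" where
  "cG a4 G Ps r = real (card G) / sqrt (regulator a4 Ps r) * Omega r"

definition ec_disc :: "int \<Rightarrow> int \<Rightarrow> int" where
  "ec_disc a4 a6 = -16 * (4 * a4 ^ 3 + 27 * a6 ^ 2)"

definition j_inv :: "int \<Rightarrow> int \<Rightarrow> rat" where
  "j_inv a4 a6 = rat_of_int (-1728 * (4 * a4) ^ 3) / rat_of_int (ec_disc a4 a6)"

definition deltaE :: "int \<Rightarrow> int \<Rightarrow> real" where
  "deltaE a4 a6 = hW_rat (j_inv a4 a6) / 8 + hW_rat (of_int (ec_disc a4 a6)) / 12 + 5 / 3"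

definition dE :: "int \<Rightarrow> int \<Rightarrow> int \<Rightarrow> int \<Rightarrow> int" where
  "dE a4 a6 u v = v * (u ^ 3 + a4 * u * v ^ 2 - a6 * v ^ 3)"

definition DE :: "int \<Rightarrow> int \<Rightarrow> int \<Rightarrow> int \<Rightarrow> int" where
  "DE a4 a6 u v = 4 * dE a4 a6 u v"

definition TE :: "int \<Rightarrow> int \<Rightarrow> int \<Rightarrow> int \<Rightarrow> real \<Rightarrow> real" where
  "TE a4 a6 u v \<epsilon> = ln (4 * real_of_int (dE a4 a6 u v) powr (1 - \<epsilon>) / real_of_int (u * v + v ^ 2)) / 8
      - deltaE a4 a6 / 4"

definition map_suitable :: "int \<Rightarrow> int \<Rightarrow> int \<Rightarrow> int \<Rightarrow> bool" where
  "map_suitable a4 a6 u v = (u > 0 \<and> v > 0 \<and> 3 * u ^ 2 + a4 * v ^ 2 > 0 \<and> DE a4 a6 u v > 0)"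

definition bound_suitable :: "int \<Rightarrow> int \<Rightarrow> (nat \<Rightarrow> ecpt) \<Rightarrow> nat \<Rightarrow> real \<Rightarrow> int \<Rightarrow> int \<Rightarrow> bool" where
  "bound_suitable a4 a6 Ps r \<epsilon> u v = (let \<epsilon>' = \<epsilon> / (1 - \<epsilon>) in
     u > 0 \<and> v > 0 \<and>
     (real_of_int (u * v + v ^ 2) / 4) powr (1 + \<epsilon>') * exp (2 * (1 + \<epsilon>') * (deltaE a4 a6 + dP a4 Ps r))
       < real_of_int (dE a4 a6 u v) \<and>
     real_of_int (dE a4 a6 u v) < real_of_int (v ^ 2 * (u * v + v ^ 2)) powr (1 + \<epsilon>'))"

text \<open>Class number of a negative discriminant d: number of SL2(Z)-classes of primitive
  positive definite binary quadratic forms a x^2 + b x y + c y^2 with b^2 - 4ac = d.\<close>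
definition prim_pos_forms :: "int \<Rightarrow> (int \<times> int \<times> int) set" where
  "prim_pos_forms d = {(a, b, c). b ^ 2 - 4 * a * c = d \<and> a > 0 \<and> gcd a (gcd b c) = 1}"

definition form_equiv :: "int \<times> int \<times> int \<Rightarrow> int \<times> int \<times> int \<Rightarrow> bool" where
  "form_equiv f g = (case f of (a, b, c) \<Rightarrow> case g of (a', b', c') \<Rightarrow>
     (\<exists>p q r s. p * s - q * r = 1 \<and>
        a' = a * p ^ 2 + b * p * r + c * r ^ 2 \<and>
        b' = 2 * a * p * q + b * (p * s + q * r) + 2 * c * r * s \<and>
        c' = a * q ^ 2 + b * q * s + c * s ^ 2))"

definition class_number :: "int \<Rightarrow> nat" where
  "class_number d = card (prim_pos_forms d //
      {(f, g). f \<in> prim_pos_forms d \<and> g \<in> prim_pos_forms d \<and> form_equiv f g})"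

definition fund_disc :: "int \<Rightarrow> bool" where
  "fund_disc d = ((d mod 4 = 1 \<and> squarefree d) \<or>
     (d mod 4 = 0 \<and> (d div 4) mod 4 \<in> {2, 3} \<and> squarefree (d div 4)))"

end

theory Submission imports Defs "HOL-Algebra.Group" "Jordan_Normal_Form.Determinant"
begin
text \<open>Put \<open>w = sqrt (- d)\<close> with \<open>d = dE a4 a6 u v\<close>. A rational point \<open>P = (A / C\<^sup>2, B / C\<^sup>3)\<close>, specialised against the
  point \<open>(- u / v, w / v\<^sup>2)\<close>, determines an ideal of norm \<open>A v + u C\<^sup>2\<close> in the order of discriminant \<open>- 4 d\<close>, hence
  a form class. If two points \<open>P1 \<noteq> P2\<close> give the same class, the chord through \<open>P1\<close> and \<open>- P2\<close> produces an element
  of norm \<open>v (A3 v + u C3\<^sup>2)\<close>, where \<open>P1 - P2 = (A3 / C3\<^sup>2, _)\<close>. If \<open>P1 - P2\<close> has small height then this norm is below \<open>d\<close>,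
  so the element is rational, \<open>v\<close> divides \<open>C3\<close>, and \<open>C3\<close> is too small for that. Hence points of
  canonical height at most \<open>TE\<close> have different classes, because the naive height exceeds twice the canonical height
  by at most \<open>2 deltaE - ln 4\<close>. The number of such points is bounded below by comparing the ellipsoid
  \<open>canon_height \<le> TE\<close> with the unit cubes at its lattice points, and torsion contributes the factor \<open>card G\<close>.\<close>

section \<open>The group law\<close>

text \<open>The shape of \<open>TE\<close>: two points of canonical height at most t have a
  difference with canonical height at most 4 t, hence with naive height at most 8 t + 2 \<delta> -
  ln 4, and t = \<open>TE\<close> is the value at which the resulting bound for the norm equals d
  powr (1 - \<epsilon>). The term ln 4 is spent there, so the height comparison must be proved with
  this exact constant. Telescoping the duplication map with the plain naive height loses too much:
  at a prime, the whole discriminant even for models that can be scaled down; at the real place, a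
  factor of order |j|, while only its power 3/4 is available. Hence the local terms of the height
  are rescaled: at each prime Z is weighted by the natural size of x on the curve, and for nearly
  singular curves the real coordinate is moved to the near double zero of the cubic. The constants
  then fit without slack: 24 * 5/3 = 40 is the exponent in (exp 10)^4, and 9216 balances the 20736
  from the cancellation in j and all powers of 2.\<close>

definition chord :: "int \<Rightarrow> int \<Rightarrow> rat \<Rightarrow> rat \<Rightarrow> rat \<Rightarrow> rat \<Rightarrow> rat \<Rightarrow> bool" where
  "chord a b m c x1 x2 x3 \<longleftrightarrow> m ^ 2 = x1 + x2 + x3 \<and>
     of_int a - 2 * m * c = x1 * x2 + x1 * x3 + x2 * x3 \<and> c ^ 2 - of_int b = x1 * x2 * x3"

lemma on_curve_None [simp]: "on_curve a b None"
  by (simp add: on_curve_def)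

lemma on_curve_Some [simp]:
  "on_curve a b (Some (x, y)) \<longleftrightarrow> y ^ 2 = x ^ 3 + of_int a * x + of_int b"
  by (simp add: on_curve_def)

lemma ec_add_None [simp]: "ec_add a None Q = Q" "ec_add a P None = P"
  by (auto simp: ec_add_def split: option.splits)

lemma ec_neg_simps [simp]: "ec_neg None = None" "ec_neg (Some (x, y)) = Some (x, - y)"
  by (auto simp: ec_neg_def)

lemma ec_neg_neg [simp]: "ec_neg (ec_neg P) = P"
  by (cases P) (auto simp: ec_neg_def)

lemma on_curve_neg [simp]: "on_curve a b (ec_neg P) \<longleftrightarrow> on_curve a b P"
  by (cases P) (auto simp: ec_neg_def on_curve_def)

lemma ec_add_neg [simp]: "ec_add a P (ec_neg P) = None" "ec_add a (ec_neg P) P = None"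
  by (cases P; auto simp: ec_add_def ec_neg_def)+

lemma chord_eval:
  assumes "chord a b m c x1 x2 x3"
  shows "X ^ 3 + of_int a * X + of_int b - (m * X + c) ^ 2 = (X - x1) * (X - x2) * (X - x3)"
  using assms unfolding chord_def by Groebner_Basis.algebra

lemma chord_perm:
  "chord a b m c x1 x2 x3 \<Longrightarrow> chord a b m c x2 x1 x3"
  "chord a b m c x1 x2 x3 \<Longrightarrow> chord a b m c x1 x3 x2"
  unfolding chord_def by (auto simp: algebra_simps)

lemma chord_neg: "chord a b m c x1 x2 x3 \<Longrightarrow> chord a b (- m) (- c) x1 x2 x3"
  unfolding chord_def by auto

lemma curve_two_pts_y:
  fixes y1 y2 :: rat
  assumes "y1 ^ 2 = x ^ 3 + a * x + b" "y2 ^ 2 = x ^ 3 + a * x + b" "y1 \<noteq> - y2"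
  shows "y1 = y2" "y1 \<noteq> 0"
proof -
  have "(y1 - y2) * (y1 + y2) = 0" using assms by Groebner_Basis.algebra
  then show "y1 = y2" using assms(3) by (simp add: add_eq_0_iff2)
  then show "y1 \<noteq> 0" using assms(3) by auto
qed

text \<open>Chord and tangent are treated at once by Vieta: the abscissas on the line are the zeros
  of the cubic minus (m X + c)^2, so tangency is a repeated zero and \<open>chord\<close> needs no
  case distinction afterwards.\<close>

lemma ec_add_chord:
  assumes "on_curve a b (Some (x1, y1))" "on_curve a b (Some (x2, y2))"
    and "\<not> (x1 = x2 \<and> y1 = - y2)"
  obtains m c x3 where "ec_add a (Some (x1, y1)) (Some (x2, y2)) = Some (x3, - (m * x3 + c))"
    "y1 = m * x1 + c" "y2 = m * x2 + c" "chord a b m c x1 x2 x3"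
proof -
  define m where "m = (if x1 = x2 then (3 * x1 ^ 2 + of_int a) / (2 * y1) else (y2 - y1) / (x2 - x1))"
  define c where "c = y1 - m * x1"
  define x3 where "x3 = m ^ 2 - x1 - x2"
  have e1: "y1 ^ 2 = x1 ^ 3 + of_int a * x1 + of_int b" and e2: "y2 ^ 2 = x2 ^ 3 + of_int a * x2 + of_int b"
    using assms by auto
  have eq: "ec_add a (Some (x1, y1)) (Some (x2, y2)) = Some (x3, - (m * x3 + c))"
    using assms(3) by (simp add: ec_add_def m_def x3_def c_def Let_def algebra_simps)
  \<comment> \<open>The second conjunct expresses the slope as a symmetric difference quotient of
    the cubic, valid for chord and tangent alike; the Vieta relations follow from it by
    elimination.\<close>
  have y2: "y2 = m * x2 + c \<and> m * (y1 + y2) = x1 ^ 2 + x1 * x2 + x2 ^ 2 + of_int a"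
  proof (cases "x1 = x2")
    case True
    with assms have "y1 \<noteq> - y2" by auto
    with curve_two_pts_y[of y1 x1 "of_int a" "of_int b" y2] e1 e2 True have "y1 = y2" "y1 \<noteq> 0" by auto
    with True show ?thesis by (simp add: m_def c_def power2_eq_square field_simps)
  next
    case False
    then have m: "m * (x2 - x1) = y2 - y1" by (simp add: m_def)
    then have "y2 = m * x2 + c" by (simp add: c_def algebra_simps)
    moreover have "(x2 - x1) * (m * (y1 + y2)) = (x2 - x1) * (x1 ^ 2 + x1 * x2 + x2 ^ 2 + of_int a)"
      using m e1 e2 by Groebner_Basis.algebra
    ultimately show ?thesis using False by simp
  qed
  have "chord a b m c x1 x2 x3" unfolding chord_def
    using y2 e1 x3_def c_def by Groebner_Basis.algebra
  moreover have "y1 = m * x1 + c" by (simp add: c_def)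
  ultimately show ?thesis using that eq y2 by blast
qed

text \<open>Converse of \<open>ec_add_chord\<close>: a line with the right intersection abscissas
  must be the one used by \<open>ec_add\<close>, so a sum can be computed by exhibiting any such
  line.\<close>

lemma ec_add_eqI:
  assumes "chord a b m c x1 x2 x3" "y1 = m * x1 + c" "y2 = m * x2 + c"
    and "\<not> (x1 = x2 \<and> y1 = - y2)"
  shows "ec_add a (Some (x1, y1)) (Some (x2, y2)) = Some (x3, - (m * x3 + c))"
proof -
  have ch: "m ^ 2 = x1 + x2 + x3" "of_int a - 2 * m * c = x1 * x2 + x1 * x3 + x2 * x3"
    using assms(1) by (auto simp: chord_def)
  have m: "m = (if x1 = x2 then (3 * x1 ^ 2 + of_int a) / (2 * y1) else (y2 - y1) / (x2 - x1))"
  proof (cases "x1 = x2")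
    case True
    then have "y1 = y2" "y1 \<noteq> 0" using assms by auto
    moreover have "2 * y1 * m = 3 * x1 ^ 2 + of_int a" using ch True assms(2) by Groebner_Basis.algebra
    ultimately show ?thesis using True by (simp add: field_simps)
  next
    case False
    then show ?thesis using assms by (simp add: field_simps)
  qed
  have "ec_add a (Some (x1, y1)) (Some (x2, y2)) = Some (m ^ 2 - x1 - x2, m * (x1 - (m ^ 2 - x1 - x2)) - y1)"
    using assms(4) by (simp only: ec_add_def option.case prod.case if_False Let_def m[symmetric])
  moreover have x3: "m ^ 2 - x1 - x2 = x3" using ch by simp
  ultimately show ?thesis unfolding x3 using assms(2) by (simp add: algebra_simps)
qed

lemma chord_third_on_curve: "chord a b m c x1 x2 x3 \<Longrightarrow> on_curve a b (Some (x3, - (m * x3 + c)))"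
  using chord_eval[of a b m c x1 x2 x3 x3] by (simp add: power2_eq_square algebra_simps)

lemma on_curve_add [intro]:
  assumes "on_curve a b P" "on_curve a b Q" shows "on_curve a b (ec_add a P Q)"
proof (cases "P = None \<or> Q = None")
  case False
  then obtain x1 y1 x2 y2 where [simp]: "P = Some (x1, y1)" "Q = Some (x2, y2)" by auto
  show ?thesis
  proof (cases "x1 = x2 \<and> y1 = - y2")
    case True then show ?thesis by (simp add: ec_add_def)
  next
    case False
    obtain m c x3 where
      "ec_add a P Q = Some (x3, - (m * x3 + c))" "chord a b m c x1 x2 x3"
      by (rule ec_add_chord[of a b x1 y1 x2 y2]) (use assms False in auto)
    then show ?thesis using chord_third_on_curve by metis
  qed
qed (use assms in auto)

lemma ec_add_commute:
  assumes "on_curve a b P" "on_curve a b Q" shows "ec_add a P Q = ec_add a Q P"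
proof (cases "P = None \<or> Q = None")
  case False
  then obtain x1 y1 x2 y2 where [simp]: "P = Some (x1, y1)" "Q = Some (x2, y2)" by auto
  show ?thesis
  proof (cases "x1 = x2 \<and> y1 = - y2")
    case True then show ?thesis by (simp add: ec_add_def)
  next
    case False
    obtain m c x3 where
      c: "ec_add a P Q = Some (x3, - (m * x3 + c))" "y1 = m * x1 + c" "y2 = m * x2 + c" "chord a b m c x1 x2 x3"
      by (rule ec_add_chord[of a b x1 y1 x2 y2]) (use assms False in auto)
    have "ec_add a (Some (x2,y2)) (Some (x1,y1)) = Some (x3, - (m * x3 + c))"
      by (rule ec_add_eqI[OF chord_perm(1)[OF c(4)] c(3,2)]) (use False in auto)
    with c show ?thesis by simp
  qed
qed auto

lemma ec_neg_add:
  assumes "on_curve a b P" "on_curve a b Q"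
  shows "ec_neg (ec_add a P Q) = ec_add a (ec_neg P) (ec_neg Q)"
proof (cases "P = None \<or> Q = None")
  case False
  then obtain x1 y1 x2 y2 where [simp]: "P = Some (x1, y1)" "Q = Some (x2, y2)" by auto
  show ?thesis
  proof (cases "x1 = x2 \<and> y1 = - y2")
    case True then show ?thesis by (simp add: ec_add_def)
  next
    case False
    obtain m c x3 where
      c: "ec_add a P Q = Some (x3, - (m * x3 + c))" "y1 = m * x1 + c" "y2 = m * x2 + c" "chord a b m c x1 x2 x3"
      by (rule ec_add_chord[of a b x1 y1 x2 y2]) (use assms False in auto)
    have "ec_add a (Some (x1,-y1)) (Some (x2,-y2)) = Some (x3, - (- m * x3 + - c))"
      by (rule ec_add_eqI[OF chord_neg[OF c(4)]]) (use False c in auto)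
    with c show ?thesis by simp
  qed
qed auto

lemma curve_nonsingular:
  assumes "4 * a ^ 3 + 27 * b ^ 2 \<noteq> (0::int)" "x ^ 3 + of_int a * x + of_int b = (0::rat)"
  shows "3 * x ^ 2 + of_int a \<noteq> 0"
proof
  assume "3 * x ^ 2 + of_int a = 0"
  with assms(2) have "4 * of_int a ^ 3 + 27 * of_int b ^ 2 = (0::rat)" by Groebner_Basis.algebra
  then have "of_int (4 * a ^ 3 + 27 * b ^ 2) = (0::rat)" by simp
  with assms(1) show False by linarith
qed

text \<open>The line through P and Q, reflected in the X-axis, passes through P + Q and - Q and
  meets the curve again in - P, so the same \<open>chord\<close> data with permuted abscissas
  computes (P + Q) - Q. The degenerate cases of associativity are reduced to this lemma.\<close>

lemma ec_add_cancel:
  assumes D: "4 * a ^ 3 + 27 * b ^ 2 \<noteq> (0::int)"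
    and "on_curve a b P" "on_curve a b Q"
  shows "ec_add a (ec_add a P Q) (ec_neg Q) = P"
proof (cases "P = None \<or> Q = None")
  case False
  then obtain x1 y1 x2 y2 where [simp]: "P = Some (x1, y1)" "Q = Some (x2, y2)" by auto
  show ?thesis
  proof (cases "x1 = x2 \<and> y1 = - y2")
    case True then show ?thesis by (simp add: ec_add_def)
  next
    case False
    obtain m c x3 where
      c: "ec_add a P Q = Some (x3, - (m * x3 + c))" "y1 = m * x1 + c" "y2 = m * x2 + c" "chord a b m c x1 x2 x3"
      by (rule ec_add_chord[of a b x1 y1 x2 y2]) (use assms False in auto)
    \<comment> \<open>If P + Q = Q, the line meets the curve twice at Q with ordinate 0, so x2 is a
      double zero of the cubic, against nonsingularity.\<close>
    have ne: "\<not> (x3 = x2 \<and> - (m * x3 + c) = - (- y2))"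
    proof
      assume *: "x3 = x2 \<and> - (m * x3 + c) = - (- y2)"
      with c have y: "m * x2 + c = 0" by auto
      then have "x2 ^ 3 + of_int a * x2 + of_int b = 0" "3 * x2 ^ 2 + of_int a = 0"
        using c(4) * unfolding chord_def by Groebner_Basis.algebra+
      then show False using curve_nonsingular D by blast
    qed
    have "ec_add a (Some (x3, - (m * x3 + c))) (Some (x2,-y2)) = Some (x1, - (- m * x1 + - c))"
      by (rule ec_add_eqI[OF chord_neg[OF chord_perm(1)[OF chord_perm(2)[OF chord_perm(1)[OF c(4)]]]]])
        (use ne c in auto)
    with c show ?thesis by simp
  qed
next
  case True
  then show ?thesis by auto
qed

section \<open>Associativity\<close>

definition bracket :: "int \<Rightarrow> int \<Rightarrow> rat \<Rightarrow> rat \<Rightarrow> rat \<Rightarrow> rat \<Rightarrow> rat \<Rightarrow> rat \<Rightarrow> rat \<Rightarrow> rat \<Rightarrow> rat \<Rightarrow> rat \<Rightarrow> bool" where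
  "bracket a b l c xs k e x1 x2 x3 xt y3 \<longleftrightarrow> chord a b l c x1 x2 xs \<and> chord a b k e xs x3 xt \<and>
     y3 = k * x3 + e \<and> k * xs + e = - (l * xs + c)"

text \<open>\<open>bracket\<close> records the two lines that compute (P1 + P2) + P3: Y = l X + c
  through P1 and P2 with third abscissa xs, then Y = k X + e through the reflected point and P3 with
  third abscissa xt.\<close>

lemma bracket_exists:
  assumes "on_curve a b (Some (x1, y1))" "on_curve a b (Some (x2, y2))" "on_curve a b (Some (x3, y3))"
    and "Some (x2, y2) \<noteq> ec_neg (Some (x1, y1))"
    and "Some (x3, y3) \<noteq> ec_neg (ec_add a (Some (x1, y1)) (Some (x2, y2)))"
  obtains l c xs k e xt where
    "ec_add a (ec_add a (Some (x1, y1)) (Some (x2, y2))) (Some (x3, y3)) = Some (xt, - (k * xt + e))"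
    "y1 = l * x1 + c" "y2 = l * x2 + c" "bracket a b l c xs k e x1 x2 x3 xt y3"
proof -
  obtain l c xs where 1: "ec_add a (Some (x1, y1)) (Some (x2, y2)) = Some (xs, - (l * xs + c))"
    "y1 = l * x1 + c" "y2 = l * x2 + c" "chord a b l c x1 x2 xs"
    by (rule ec_add_chord[of a b x1 y1 x2 y2]) (use assms in auto)
  obtain k e xt where 2: "ec_add a (Some (xs, - (l * xs + c))) (Some (x3, y3)) = Some (xt, - (k * xt + e))"
    "- (l * xs + c) = k * xs + e" "y3 = k * x3 + e" "chord a b k e xs x3 xt"
    by (rule ec_add_chord[of a b xs "- (l * xs + c)" x3 y3])
      (use assms 1 chord_third_on_curve[OF 1(4)] in auto)
  show ?thesis by (rule that[of xt k e l c xs]) (use 1 2 in \<open>auto simp: bracket_def\<close>)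
qed

text \<open>The function \<open>X\<^sup>2 + \<gamma>X + \<delta> - \<beta>Y\<close>, the product of the two lines divided by \<open>X - x\<^sub>s\<close>,
  vanishes at the three summands and at the negative of their sum. The proof of associativity consists
  in recovering \<open>\<beta>, \<gamma>, \<delta>\<close>, and with them the sum, from the three summands alone.\<close>

lemma bracket_conic:
  assumes "bracket a b l c xs k e x1 x2 x3 xt y3"
  obtains \<gamma> \<delta> where "\<gamma> = l * k + xs"
    "x1 ^ 2 + \<gamma> * x1 + \<delta> = (l + k) * (l * x1 + c)" "x2 ^ 2 + \<gamma> * x2 + \<delta> = (l + k) * (l * x2 + c)"
    "x3 ^ 2 + \<gamma> * x3 + \<delta> = (l + k) * y3" "xt ^ 2 + \<gamma> * xt + \<delta> = (l + k) * (k * xt + e)"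
    "xt = (l + k) ^ 2 - 2 * \<gamma> - x1 - x2 - x3"
proof (rule that[of "l * k + xs" "of_int a + l * e + k * c + (l * k + xs) * xs"])
  show "x1 ^ 2 + (l * k + xs) * x1 + (of_int a + l * e + k * c + (l * k + xs) * xs) = (l + k) * (l * x1 + c)"
    "x2 ^ 2 + (l * k + xs) * x2 + (of_int a + l * e + k * c + (l * k + xs) * xs) = (l + k) * (l * x2 + c)"
    "x3 ^ 2 + (l * k + xs) * x3 + (of_int a + l * e + k * c + (l * k + xs) * xs) = (l + k) * y3"
    "xt ^ 2 + (l * k + xs) * xt + (of_int a + l * e + k * c + (l * k + xs) * xs) = (l + k) * (k * xt + e)"
    "xt = (l + k) ^ 2 - 2 * (l * k + xs) - x1 - x2 - x3"
    using assms unfolding bracket_def chord_def by Groebner_Basis.algebra+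
qed simp

lemma ec_add_assoc_distinct:
  assumes on: "on_curve a b (Some (x1, y1))" "on_curve a b (Some (x2, y2))" "on_curve a b (Some (x3, y3))"
    and ne: "Some (x2, y2) \<noteq> ec_neg (Some (x1, y1))" "Some (x3, y3) \<noteq> ec_neg (Some (x2, y2))"
    "Some (x3, y3) \<noteq> ec_neg (ec_add a (Some (x1, y1)) (Some (x2, y2)))"
    "Some (x1, y1) \<noteq> ec_neg (ec_add a (Some (x2, y2)) (Some (x3, y3)))"
    and x: "x1 \<noteq> x2" "x2 \<noteq> x3" "x1 \<noteq> x3"
  shows "ec_add a (ec_add a (Some (x1, y1)) (Some (x2, y2))) (Some (x3, y3)) =
    ec_add a (ec_add a (Some (x2, y2)) (Some (x3, y3))) (Some (x1, y1))"
proof -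
  obtain l c xs k e xt where 1:
    "ec_add a (ec_add a (Some (x1, y1)) (Some (x2, y2))) (Some (x3, y3)) = Some (xt, - (k * xt + e))"
    "y1 = l * x1 + c" "y2 = l * x2 + c" "bracket a b l c xs k e x1 x2 x3 xt y3"
    by (rule bracket_exists[OF on ne(1,3)])
  obtain l' c' xs' k' e' xt' where 2:
    "ec_add a (ec_add a (Some (x2, y2)) (Some (x3, y3))) (Some (x1, y1)) = Some (xt', - (k' * xt' + e'))"
    "y2 = l' * x2 + c'" "y3 = l' * x3 + c'" "bracket a b l' c' xs' k' e' x2 x3 x1 xt' y1"
    by (rule bracket_exists[OF on(2,3,1) ne(2,4)])
  define \<beta> \<beta>' where "\<beta> = l + k" and "\<beta>' = l' + k'"
  obtain g d where g: "x1 ^ 2 + g * x1 + d = \<beta> * y1" "x2 ^ 2 + g * x2 + d = \<beta> * y2"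
    "x3 ^ 2 + g * x3 + d = \<beta> * y3" "xt ^ 2 + g * xt + d = \<beta> * (k * xt + e)"
    "xt = \<beta> ^ 2 - 2 * g - x1 - x2 - x3"
    using bracket_conic[OF 1(4)] 1(2,3) unfolding \<beta>_def by metis
  obtain g' d' where g': "x1 ^ 2 + g' * x1 + d' = \<beta>' * y1" "x2 ^ 2 + g' * x2 + d' = \<beta>' * y2"
    "x3 ^ 2 + g' * x3 + d' = \<beta>' * y3" "xt' ^ 2 + g' * xt' + d' = \<beta>' * (k' * xt' + e')"
    "xt' = \<beta>' ^ 2 - 2 * g' - x2 - x3 - x1"
    using bracket_conic[OF 2(4)] 2(2,3) unfolding \<beta>'_def by metis
  \<comment> \<open>\<beta>' times the first system minus \<beta> times the second eliminates the
    ordinates and leaves a quadratic in X with leading coefficient \<beta>' - \<beta> and three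
    distinct zeros.\<close>
  have "(\<beta>' - \<beta>) * ((x1 - x2) * (x2 - x3) * (x1 - x3)) = 0" using g(1-3) g'(1-3) by Groebner_Basis.algebra
  with x have \<beta>: "\<beta>' = \<beta>" by simp
  have "(g' - g) * (x1 - x2) = 0" using g(1-2) g'(1-2) \<beta> by Groebner_Basis.algebra
  with x have gg: "g' = g" by simp
  then have dd: "d' = d" using g(1) g'(1) \<beta> by simp
  have xt: "xt' = xt" using g(5) g'(5) \<beta> gg by simp
  have "\<beta> \<noteq> 0"
  proof
    assume "\<beta> = 0"
    then have "(x1 - x2) * (x2 - x3) * (x1 - x3) = 0" using g(1-3) by Groebner_Basis.algebra
    with x show False by simp
  qed
  then have "k * xt + e = k' * xt' + e'" using g(4) g'(4) \<beta> gg dd xt by simp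
  with 1 2 xt show ?thesis by simp
qed

text \<open>With P1 = P2 one interpolation condition is lost. It is replaced by tangency at P1, the
  derivative condition 2 x1 + g = \<beta> l with l the slope of the tangent, which both bracketings
  satisfy.\<close>

lemma ec_add_assoc_double:
  assumes on: "on_curve a b (Some (x1, y1))" "on_curve a b (Some (x3, y3))"
    and ne: "y1 \<noteq> 0" "Some (x3, y3) \<noteq> ec_neg (ec_add a (Some (x1, y1)) (Some (x1, y1)))"
    "Some (x1, y1) \<noteq> ec_neg (ec_add a (Some (x1, y1)) (Some (x3, y3)))"
    and x: "x1 \<noteq> x3"
  shows "ec_add a (ec_add a (Some (x1, y1)) (Some (x1, y1))) (Some (x3, y3)) =
    ec_add a (ec_add a (Some (x1, y1)) (Some (x3, y3))) (Some (x1, y1))"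
proof -
  have ne': "Some (x1, y1) \<noteq> ec_neg (Some (x1, y1))" "Some (x3, y3) \<noteq> ec_neg (Some (x1, y1))" using ne x by auto
  obtain l c xs k e xt where 1:
    "ec_add a (ec_add a (Some (x1, y1)) (Some (x1, y1))) (Some (x3, y3)) = Some (xt, - (k * xt + e))"
    "y1 = l * x1 + c" "bracket a b l c xs k e x1 x1 x3 xt y3"
    by (rule bracket_exists[OF on(1,1,2) ne'(1) ne(2)])
  obtain l' c' xs' k' e' xt' where 2:
    "ec_add a (ec_add a (Some (x1, y1)) (Some (x3, y3))) (Some (x1, y1)) = Some (xt', - (k' * xt' + e'))"
    "y1 = l' * x1 + c'" "y3 = l' * x3 + c'" "bracket a b l' c' xs' k' e' x1 x3 x1 xt' y1"
    by (rule bracket_exists[OF on(1,2,1) ne'(2) ne(3)])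
  define \<beta> \<beta>' where "\<beta> = l + k" and "\<beta>' = l' + k'"
  obtain g d where g: "g = l * k + xs" "x1 ^ 2 + g * x1 + d = \<beta> * y1"
    "x3 ^ 2 + g * x3 + d = \<beta> * y3" "xt ^ 2 + g * xt + d = \<beta> * (k * xt + e)"
    "xt = \<beta> ^ 2 - 2 * g - x1 - x1 - x3"
    using bracket_conic[OF 1(3)] 1(2) unfolding \<beta>_def by metis
  obtain g' d' where g': "g' = l' * k' + xs'" "x1 ^ 2 + g' * x1 + d' = \<beta>' * y1"
    "x3 ^ 2 + g' * x3 + d' = \<beta>' * y3" "xt' ^ 2 + g' * xt' + d' = \<beta>' * (k' * xt' + e')"
    "xt' = \<beta>' ^ 2 - 2 * g' - x1 - x3 - x1"
    using bracket_conic[OF 2(4)] 2(2,3) unfolding \<beta>'_def by metis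
  have t: "2 * x1 + g = \<beta> * l" using 1(3) g(1) unfolding bracket_def chord_def \<beta>_def by Groebner_Basis.algebra
  have f': "3 * x1 ^ 2 + of_int a = 2 * y1 * l"
    using 1(2,3) unfolding bracket_def chord_def by Groebner_Basis.algebra
  have s: "\<beta>' * (x1 - xs') = 2 * y1"
    using 2(2,4) unfolding bracket_def \<beta>'_def by Groebner_Basis.algebra
  then have \<beta>0: "\<beta>' \<noteq> 0" using ne by auto
  \<comment> \<open>The second bracketing is built without the tangent. Differentiating the
    factorisation of the cubic minus the square of the chord at its zero x1 relates the tangent
    slope l to the chord slope l'.\<close>
  have "3 * x1 ^ 2 + of_int a = 2 * y1 * l' + (x1 - x3) * (x1 - xs')"
    using 2(2,4) unfolding bracket_def chord_def by Groebner_Basis.algebra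
  moreover have "l' ^ 2 = x1 + x3 + xs'" using 2(4) unfolding bracket_def chord_def by simp
  ultimately have "2 * y1 * (2 * x1 + g') = 2 * y1 * (\<beta>' * l)"
    using s f' g'(1) \<beta>'_def by Groebner_Basis.algebra
  then have t': "2 * x1 + g' = \<beta>' * l" using ne by simp
  have "(\<beta>' - \<beta>) * (x1 - x3) ^ 2 = 0" using g(2,3) g'(2,3) t t' by Groebner_Basis.algebra
  with x have \<beta>: "\<beta>' = \<beta>" by simp
  have gg: "g' = g" using t t' \<beta> by simp
  then have dd: "d' = d" using g(2) g'(2) \<beta> by simp
  have xt: "xt' = xt" using g(5) g'(5) \<beta> gg by simp
  have "k * xt + e = k' * xt' + e'" using g(4) g'(4) \<beta> gg dd xt \<beta>0 by simp
  with 1 2 xt show ?thesis by simp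
qed

text \<open>Configurations in which two points or all three cancel are settled by
  \<open>ec_add_cancel\<close>. The core lemmas compare (P + Q) + R with its cyclic shift (Q + R) +
  P, and commutativity turns this into associativity; the case R = P needs commutativity
  only.\<close>

theorem ec_add_assoc:
  assumes D: "4 * a ^ 3 + 27 * b ^ 2 \<noteq> (0::int)"
    and on: "on_curve a b P" "on_curve a b Q" "on_curve a b R"
  shows "ec_add a (ec_add a P Q) R = ec_add a P (ec_add a Q R)"
proof -
  note comm = ec_add_commute[of a b]
  note canc = ec_add_cancel[OF D]
  consider "P = None \<or> Q = None \<or> R = None" | "Q = ec_neg P" | "R = ec_neg Q" | "R = ec_neg P"
    | "R = ec_neg (ec_add a P Q)" | "P = ec_neg (ec_add a Q R)"
    | x1 y1 x2 y2 x3 y3 where "P = Some (x1, y1)" "Q = Some (x2, y2)" "R = Some (x3, y3)"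
      "Q \<noteq> ec_neg P" "R \<noteq> ec_neg Q" "R \<noteq> ec_neg P" "R \<noteq> ec_neg (ec_add a P Q)" "P \<noteq> ec_neg (ec_add a Q R)"
    by (metis option.exhaust surj_pair)
  then show ?thesis
  proof cases
    case 1
    then show ?thesis by auto
  next
    case 2
    have "ec_add a P (ec_add a Q R) = ec_add a (ec_add a R Q) (ec_neg Q)"
      using comm on 2 by (metis ec_neg_neg on_curve_add)
    also have "\<dots> = R" using canc on by blast
    finally show ?thesis using 2 by simp
  next
    case 3
    then show ?thesis using canc[of P Q] on by simp
  next
    case 4
    have "ec_add a (ec_add a P Q) R = Q" using canc[of Q P] on 4 comm by metis
    moreover have "ec_add a (ec_add a Q R) (ec_neg R) = Q" using canc on by blast
    ultimately show ?thesis using 4 comm on by (metis ec_neg_neg on_curve_add)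
  next
    case 5
    then have "ec_add a Q R = ec_add a (ec_add a (ec_neg P) (ec_neg Q)) (ec_neg (ec_neg Q))"
      using ec_neg_add[of a b P Q] comm on by (metis ec_neg_neg)
    also have "\<dots> = ec_neg P" using canc[of "ec_neg P" "ec_neg Q"] on by simp
    finally show ?thesis using 5 by simp
  next
    case 6
    then have "ec_add a P Q = ec_add a (ec_add a (ec_neg R) (ec_neg Q)) (ec_neg (ec_neg Q))"
      using ec_neg_add[of a b Q R] comm[of "ec_neg R" "ec_neg Q"] on by simp
    also have "\<dots> = ec_neg R" using canc[of "ec_neg R" "ec_neg Q"] on by simp
    finally show ?thesis using 6 by simp
  next
    case 7
    note on' = on[unfolded 7(1-3)] and ne = 7(4-8)[unfolded 7(1-3)]
    have c: "ec_add a P (ec_add a Q R) = ec_add a (ec_add a Q R) P"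
      by (rule comm[OF on(1) on_curve_add[OF on(2,3)]])
    have y: "y1 \<noteq> 0" if "Q = P" using 7(4) that 7(1) by auto
    have y': "y2 \<noteq> 0" if "R = Q" using 7(5) that 7(2) by auto
    have PQ: "x1 = x2 \<Longrightarrow> Q = P" and QR: "x2 = x3 \<Longrightarrow> R = Q" and PR: "x1 = x3 \<Longrightarrow> R = P"
      using on' ne(1-3) curve_two_pts_y(1)[of y1 x1 "of_int a" "of_int b" y2]
        curve_two_pts_y(1)[of y2 x2 "of_int a" "of_int b" y3] curve_two_pts_y(1)[of y1 x1 "of_int a" "of_int b" y3]
      by (auto simp: 7(1-3))
    show ?thesis
    proof (cases "R = P")
      case True
      have "ec_add a P Q = ec_add a Q P" by (rule comm[OF on(1,2)])
      then show ?thesis unfolding True c[unfolded True] by simp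
    next
      case RP: False
      show ?thesis
      proof (cases "Q = P")
        case True
        have "ec_add a (ec_add a P P) R = ec_add a (ec_add a P R) P"
          unfolding 7(1,3)
          by (rule ec_add_assoc_double[OF on'(1,3) y[OF True]])
            (use True RP PR 7(1,3,7,8) in auto)
        then show ?thesis unfolding c unfolding True .
      next
        case QP: False
        show ?thesis
        proof (cases "R = Q")
          case True
          have PQ': "ec_add a P Q = ec_add a Q P" by (rule comm[OF on(1,2)])
          have "ec_add a (ec_add a Q Q) P = ec_add a (ec_add a Q P) Q"
            unfolding 7(1,2)
            by (rule ec_add_assoc_double[OF on'(2,1) y'[OF True]])
              (use True QP PQ PQ' 7(1,2,7,8) in auto)
          then show ?thesis unfolding c unfolding True PQ' by simp
        next
          case False
          show ?thesis unfolding c unfolding 7(1-3)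
            by (rule ec_add_assoc_distinct[OF on' ne(1,2,4,5)])
              (use False QP RP PQ QR PR in auto)
        qed
      qed
    qed
  qed
qed

section \<open>Duplication at the finite primes\<close>

text \<open>Numerator and denominator of the duplication formula x(2P) = F / G, made homogeneous in
  x = A / Z.\<close>

definition dupF :: "int \<Rightarrow> int \<Rightarrow> int \<Rightarrow> int \<Rightarrow> int" where
  "dupF a b A Z = A ^ 4 - 2 * a * A ^ 2 * Z ^ 2 - 8 * b * A * Z ^ 3 + a ^ 2 * Z ^ 4"

definition dupG :: "int \<Rightarrow> int \<Rightarrow> int \<Rightarrow> int \<Rightarrow> int" where
  "dupG a b A Z = 4 * Z * (A ^ 3 + a * A * Z ^ 2 + b * Z ^ 3)"

text \<open>Multiplied by \<lambda>^6 when (a, b) becomes (\<lambda>^2 a, \<lambda>^3 b): at each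
  prime it measures how far the model can be scaled down.\<close>

definition twist_gcd :: "int \<Rightarrow> int \<Rightarrow> int" where
  "twist_gcd a b = gcd (a ^ 3) (b ^ 2)"

text \<open>The extra factor 3 that can be saved in the duplication estimate for models that are
  not minimal at 3, such as those coming from a general Weierstrass equation.\<close>

definition three_gain :: "int \<Rightarrow> int \<Rightarrow> int" where
  "three_gain a b = (if \<forall>k. 3 ^ k dvd twist_gcd a b \<longrightarrow> 3 ^ (k + 3) dvd a ^ 3 then 3 else 1)"

text \<open>\<open>content_six\<close> is the inverse sixth power of \<open>\<Prod>\<^sub>p max \<bar>A\<bar>\<^sub>p (H\<^sub>p \<bar>Z\<bar>\<^sub>p)\<close>, where
  \<open>H\<^sub>p = max (\<bar>a\<bar>\<^sub>p powr (1/2)) (\<bar>b\<bar>\<^sub>p powr (1/3))\<close>; sixth powers keep everything integral.\<close>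

definition content_six :: "int \<Rightarrow> int \<Rightarrow> int \<Rightarrow> int \<Rightarrow> int" where
  "content_six a b A Z = gcd (A ^ 6) (twist_gcd a b * Z ^ 6)"

section \<open>Local estimates at a prime\<close>

lemma prime_power_dvd_root:
  fixes p x :: int
  assumes "prime p" "p ^ q dvd x ^ n" "n * m < q"
  shows "p ^ Suc m dvd x"
proof (cases "x = 0")
  case False
  have "q \<le> multiplicity p (x ^ n)"
    using assms False by (intro multiplicity_geI) (auto simp: not_prime_unit)
  also have "\<dots> = n * multiplicity p x"
    using assms False by (intro prime_elem_multiplicity_power_distrib) auto
  finally have "n * m < n * multiplicity p x" using assms by linarith
  then have "Suc m \<le> multiplicity p x" by simp
  then show ?thesis by (rule multiplicity_dvd')
qed auto

text \<open>That p^q divides x^6 means that the valuation of x is at least q / 6; this is the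
  ultrametric inequality for such fractional bounds.\<close>

lemma prime_power_dvd_six_add:
  fixes p x y :: int
  assumes "prime p" "p ^ q dvd x ^ 6" "p ^ q dvd y ^ 6"
  shows "p ^ q dvd (x + y) ^ 6"
proof -
  define m where "m = (q + 5) div 6"
  have "p ^ m dvd x \<and> p ^ m dvd y"
  proof (cases m)
    case (Suc k)
    then have "6 * k < q" unfolding m_def by linarith
    then show ?thesis using prime_power_dvd_root assms Suc by blast
  qed auto
  then have "(p ^ m) ^ 6 dvd (x + y) ^ 6" by (intro dvd_power_same) auto
  moreover have "p ^ q dvd (p ^ m) ^ 6"
    unfolding power_mult[symmetric] by (rule le_imp_power_dvd) (simp add: m_def)
  ultimately show ?thesis by (rule dvd_trans[rotated])
qed

lemma prime_power_dvd_six_minus: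
  fixes p x y :: int
  assumes "prime p" "p ^ q dvd x ^ 6" "p ^ q dvd y ^ 6"
  shows "p ^ q dvd (x - y) ^ 6"
  using prime_power_dvd_six_add[of p q x "- y"] assms by simp

lemma twist_gcd_nonzero: "4 * a ^ 3 + 27 * b ^ 2 \<noteq> 0 \<Longrightarrow> twist_gcd a b \<noteq> 0"
  by (auto simp: twist_gcd_def)

text \<open>Where the gain is 3, its defining condition puts an extra factor 3 into a^3, and 27 b^2
  carries one anyway.\<close>

lemma three_gain_dvd: "three_gain a b * twist_gcd a b dvd 4 * a ^ 3 + 27 * b ^ 2"
proof (cases "twist_gcd a b = 0")
  case True
  then show ?thesis by (auto simp: twist_gcd_def)
next
  case False
  define h where "h = twist_gcd a b"
  have not_is_unit_3: "\<not> is_unit (3::int)" by simp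
  have h: "h dvd a ^ 3" "h dvd b ^ 2" by (auto simp: h_def twist_gcd_def)
  show ?thesis
  proof (cases "\<forall>k. 3 ^ k dvd h \<longrightarrow> 3 ^ (k + 3) dvd a ^ 3")
    case True
    obtain m h' where h': "h = 3 ^ m * h'" "\<not> 3 dvd h'"
      using multiplicity_decompose'[OF False[folded h_def], of 3] by (metis not_is_unit_3)
    have "3 ^ m dvd h" using h' by simp
    with True have "3 ^ (m + 3) dvd a ^ 3" by blast
    then have 1: "3 ^ Suc m dvd a ^ 3" by (rule power_le_dvd) simp
    have "coprime (3 ^ Suc m) h'"
      using h'(2) by (simp add: prime_imp_coprime)
    moreover have "h' dvd a ^ 3" using h h' by (metis dvd_mult_right)
    ultimately have "3 ^ Suc m * h' dvd a ^ 3" using 1 by (intro divides_mult)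
    then have "3 * h dvd a ^ 3" using h'(1) by (simp add: mult.assoc)
    moreover have "3 * h dvd 27 * b ^ 2" using h by (intro mult_dvd_mono) auto
    ultimately have "3 * h dvd 4 * a ^ 3 + 27 * b ^ 2" by (intro dvd_add) auto
    then show ?thesis using True by (simp add: three_gain_def h_def)
  next
    case False
    then have "three_gain a b = 1" by (auto simp: three_gain_def h_def)
    then show ?thesis using h by (simp add: h_def)
  qed
qed

text \<open>Bezout form of the resultant of F and G. With weights 1, 2, 3 for A, a, b the cofactors
  are isobaric of weights 2 and 3, which makes them divisible themselves when x is p-adically
  small.\<close>

lemma dup_identity:
  "(12 * A ^ 2 * Z + 16 * a * Z ^ 3) * dupF a b A Z - (3 * A ^ 3 - 5 * a * A * Z ^ 2 - 27 * b * Z ^ 3) * dupG a b A Z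
    = 4 * (4 * a ^ 3 + 27 * b ^ 2) * Z ^ 7"
  unfolding dupF_def dupG_def by Groebner_Basis.algebra

text \<open>Two regimes, with p^\<eta> exactly dividing \<open>twist_gcd\<close>. If x is p-adically
  larger than its natural size, A^4 strictly dominates F, and F keeps only the four-fold valuation
  of A. Otherwise the cofactors in \<open>dup_identity\<close> have valuations at least \<eta> / 3
  and \<eta> / 2, which refunds part of the discriminant.\<close>

lemma dup_content_local:
  fixes a b A Z p :: int
  assumes D: "4 * a ^ 3 + 27 * b ^ 2 \<noteq> 0" and cop: "coprime A Z" and p: "prime p"
    and k: "p ^ k dvd dupF a b A Z ^ 6" "p ^ k dvd twist_gcd a b * dupG a b A Z ^ 6"
  shows "k + 6 * multiplicity p (twist_gcd a b) + 6 * multiplicity p (three_gain a b)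
    \<le> 4 * multiplicity p (content_six a b A Z) + 6 * multiplicity p (4 * (4 * a ^ 3 + 27 * b ^ 2))"
proof -
  define h where "h = twist_gcd a b"
  define \<Delta> where "\<Delta> = 4 * a ^ 3 + 27 * b ^ 2"
  define \<eta> where "\<eta> = multiplicity p h"
  define n where "n = content_six a b A Z"
  have h0: "h \<noteq> 0" using twist_gcd_nonzero D by (simp add: h_def)
  have pe: "prime_elem p" "\<not> is_unit p" using p by (auto simp: not_prime_unit)
  have \<Delta>0: "4 * \<Delta> \<noteq> 0" using D by (simp add: \<Delta>_def)
  have ph: "p ^ \<eta> dvd h" unfolding \<eta>_def by (rule multiplicity_dvd)
  have pa: "p ^ \<eta> dvd a ^ 3" and pb: "p ^ \<eta> dvd b ^ 2"
    using ph by (auto simp: h_def twist_gcd_def)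
  have A0: "\<not> p dvd Z" if "p dvd A" using cop p that by (meson coprime_common_divisor not_prime_unit)
  have n0: "n \<noteq> 0" using cop h0 by (auto simp: n_def content_six_def h_def)
  show ?thesis
  proof (cases "\<not> p dvd Z \<and> p ^ \<eta> dvd A ^ 6")
    case False
    have "A \<noteq> 0" using False A0 by (auto simp: power_0_left)
    define s where "s = multiplicity p A"
    have s: "p ^ s dvd A" unfolding s_def by (rule multiplicity_dvd)
    have cases: "s = 0 \<and> p dvd Z \<or> 6 * s < \<eta> \<and> \<not> p dvd Z"
    proof (cases "p dvd Z")
      case True
      then have "\<not> p dvd A" using A0 by blast
      then show ?thesis using True by (simp add: s_def not_dvd_imp_multiplicity_0)
    next
      case pZ: False
      have "\<not> \<eta> \<le> 6 * s"
      proof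
        assume "\<eta> \<le> 6 * s"
        then have "p ^ \<eta> dvd (p ^ s) ^ 6" by (simp add: power_mult[symmetric] le_imp_power_dvd mult.commute)
        also have "\<dots> dvd A ^ 6" using s by (intro dvd_power_same)
        finally show False using False pZ by simp
      qed
      then show ?thesis using pZ by simp
    qed
    \<comment> \<open>The other terms of F are p-adically smaller than A^4: either through the
      powers of Z, or because a and b have valuations above 2 s and 3 s.\<close>
    have rest: "p ^ Suc (4 * s) dvd - 2 * a * A ^ 2 * Z ^ 2 - 8 * b * A * Z ^ 3 + a ^ 2 * Z ^ 4"
      using cases
    proof
      assume "s = 0 \<and> p dvd Z"
      then have "p dvd Z ^ 2" "p dvd Z ^ 3" "p dvd Z ^ 4" by (auto simp: eval_nat_numeral intro: dvd_mult2)
      then show ?thesis using \<open>s = 0 \<and> _\<close> by (auto intro!: dvd_add dvd_diff dvd_mult)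
    next
      assume *: "6 * s < \<eta> \<and> \<not> p dvd Z"
      have a: "p ^ Suc (2 * s) dvd a" by (rule prime_power_dvd_root[OF p pa]) (use * in simp)
      have b: "p ^ Suc (3 * s) dvd b" by (rule prime_power_dvd_root[OF p pb]) (use * in simp)
      have "p ^ Suc (2 * s) * (p ^ s) ^ 2 dvd a * A ^ 2" using a s by (intro mult_dvd_mono dvd_power_same)
      moreover have "p ^ Suc (3 * s) * p ^ s dvd b * A" using b s by (intro mult_dvd_mono)
      moreover have "(p ^ Suc (2 * s)) ^ 2 dvd a ^ 2" using a by (rule dvd_power_same)
      then have "p ^ (Suc (4 * s) + 1) dvd a ^ 2" by (simp add: power_mult[symmetric] algebra_simps power2_eq_square power_add[symmetric])
      then have "p ^ Suc (4 * s) dvd a ^ 2" by (rule power_le_dvd) simp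
      moreover have "p ^ Suc (2 * s) * (p ^ s) ^ 2 = p ^ Suc (4 * s)" "p ^ Suc (3 * s) * p ^ s = p ^ Suc (4 * s)"
        by (simp_all add: power_mult[symmetric] power_add[symmetric] algebra_simps)
      ultimately have "p ^ Suc (4 * s) dvd a * A ^ 2" "p ^ Suc (4 * s) dvd b * A" "p ^ Suc (4 * s) dvd a ^ 2" by metis+
      then have "p ^ Suc (4 * s) dvd (a * A ^ 2) * (- 2 * Z ^ 2) - (b * A) * (8 * Z ^ 3) + a ^ 2 * Z ^ 4"
        by (intro dvd_add dvd_diff) (rule dvd_mult2, assumption)+
      then show ?thesis by (simp add: algebra_simps)
    qed
    have "multiplicity p (A ^ 4) = 4 * s"
      using pe \<open>A \<noteq> 0\<close> by (simp add: s_def prime_elem_multiplicity_power_distrib)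
    then have "\<not> p ^ Suc (4 * s) dvd A ^ 4"
      using pe \<open>A \<noteq> 0\<close> by (simp add: power_dvd_iff_le_multiplicity del: power_Suc)
    moreover have "dupF a b A Z = A ^ 4 + (- 2 * a * A ^ 2 * Z ^ 2 - 8 * b * A * Z ^ 3 + a ^ 2 * Z ^ 4)"
      by (simp add: dupF_def)
    ultimately have F: "\<not> p ^ Suc (4 * s) dvd dupF a b A Z" using rest by (metis dvd_add_left_iff)
    have "k \<le> 24 * s"
    proof (rule ccontr)
      assume "\<not> k \<le> 24 * s"
      then have "p ^ Suc (4 * s) dvd dupF a b A Z" by (intro prime_power_dvd_root[OF p k(1)]) simp
      with F show False by simp
    qed
    moreover have "6 * s \<le> multiplicity p n"
    proof -
      have "(p ^ s) ^ 6 dvd A ^ 6" using s by (intro dvd_power_same)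
      moreover have "(p ^ s) ^ 6 dvd h * Z ^ 6"
        using cases
      proof
        assume "6 * s < \<eta> \<and> \<not> p dvd Z"
        then have "p ^ (s * 6) dvd p ^ \<eta>" by (intro le_imp_power_dvd) simp
        also note ph
        finally show ?thesis by (simp add: power_mult)
      qed auto
      ultimately have "p ^ (6 * s) dvd n"
        by (simp add: n_def content_six_def h_def power_mult[symmetric] mult.commute)
      then show ?thesis using n0 pe by (intro multiplicity_geI) auto
    qed
    moreover have "\<eta> + multiplicity p (three_gain a b) \<le> multiplicity p (4 * \<Delta>)"
    proof -
      have "three_gain a b * h dvd 4 * \<Delta>" using dvd_mult[OF three_gain_dvd[of a b]] unfolding h_def \<Delta>_def .
      then have "multiplicity p (three_gain a b * h) \<le> multiplicity p (4 * \<Delta>)"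
        using \<Delta>0 by (rule dvd_imp_multiplicity_le)
      moreover have "multiplicity p (three_gain a b * h) = multiplicity p (three_gain a b) + \<eta>"
        using h0 pe by (auto simp: \<eta>_def prime_elem_multiplicity_mult_distrib three_gain_def)
      ultimately show ?thesis by simp
    qed
    ultimately show ?thesis unfolding h_def[symmetric] n_def[symmetric] \<Delta>_def[symmetric] \<eta>_def[symmetric]
      by linarith
  next
    case True
    then have pZ: "\<not> p dvd Z" and pA: "p ^ \<eta> dvd A ^ 6" by auto
    define \<tau> where "\<tau> = 6 * multiplicity p (three_gain a b)"
    have \<tau>: "\<tau> = 0 \<or> \<tau> = 6 \<and> p = 3 \<and> three_gain a b = 3"
    proof (cases "three_gain a b = 3 \<and> p = 3")
      case True then show ?thesis by (simp add: \<tau>_def)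
    next
      case False
      have "\<not> p dvd three_gain a b"
      proof
        assume *: "p dvd three_gain a b"
        have "three_gain a b = 1 \<or> three_gain a b = 3" by (simp add: three_gain_def)
        then have "three_gain a b = 3" using * pe(2) by metis
        then have "p dvd 3" using * by metis
        moreover have "prime (3::int)" by simp
        ultimately have "p = 3" by (intro primes_dvd_imp_eq[OF p])
        with False \<open>three_gain a b = 3\<close> show False by simp
      qed
      then show ?thesis by (simp add: \<tau>_def not_dvd_imp_multiplicity_0)
    qed
    have pa2: "p ^ (2 * \<eta>) dvd a ^ 6"
      using dvd_power_same[OF pa, of 2] by (simp add: power_mult[symmetric] mult.commute)
    have pb3: "p ^ (3 * \<eta>) dvd b ^ 6"
      using dvd_power_same[OF pb, of 3] by (simp add: power_mult[symmetric] mult.commute)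
    have pA2: "p ^ (2 * \<eta>) dvd (A ^ 2) ^ 6"
      using dvd_power_same[OF pA, of 2] by (simp add: power_mult[symmetric] mult.commute)
    have pA3: "p ^ (3 * \<eta>) dvd (A ^ 3) ^ 6"
      using dvd_power_same[OF pA, of 3] by (simp add: power_mult[symmetric] mult.commute)
    have scale: "p ^ q dvd (x * y) ^ 6" if "p ^ q dvd x ^ 6" for q x y
      using that by (simp add: power_mult_distrib)
    have three: "p ^ (q + \<tau>) dvd (3 * x) ^ 6" if "p ^ q dvd x ^ 6" for q x
    proof (cases "\<tau> = 0")
      case True then show ?thesis using that by (simp add: power_mult_distrib)
    next
      case False
      then have "p = 3" "\<tau> = 6" using \<tau> by auto
      then show ?thesis using that unfolding power_mult_distrib power_add by (subst mult.commute) (auto intro!: mult_dvd_mono)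
    qed
    \<comment> \<open>The coefficients 16 and 5 are prime to 3, so in the terms with a the
      additional 3 has to come from a itself; the condition in \<open>three_gain\<close> is made for
      this.\<close>
    have pa\<tau>: "p ^ (2 * \<eta> + \<tau>) dvd a ^ 6"
    proof (cases "\<tau> = 0")
      case True then show ?thesis using pa2 by simp
    next
      case False
      then have t: "p = 3" "\<tau> = 6" "three_gain a b = 3" using \<tau> by auto
      then have "3 ^ (\<eta> + 3) dvd a ^ 3" using ph unfolding three_gain_def h_def by (auto split: if_splits)
      from dvd_power_same[OF this, of 2] show ?thesis
        unfolding t by (simp add: power_mult[symmetric] algebra_simps)
    qed
    have U: "p ^ (2 * \<eta> + \<tau>) dvd (12 * A ^ 2 * Z + 16 * a * Z ^ 3) ^ 6"
    proof (rule prime_power_dvd_six_add[OF p])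
      have "12 * A ^ 2 * Z = (3 * A ^ 2) * (4 * Z)" by simp
      then show "p ^ (2 * \<eta> + \<tau>) dvd (12 * A ^ 2 * Z) ^ 6" using scale[OF three[OF pA2]] by metis
      have "16 * a * Z ^ 3 = a * (16 * Z ^ 3)" by simp
      then show "p ^ (2 * \<eta> + \<tau>) dvd (16 * a * Z ^ 3) ^ 6" using scale[OF pa\<tau>] by metis
    qed
    have V: "p ^ (3 * \<eta> + \<tau>) dvd (3 * A ^ 3 - 5 * a * A * Z ^ 2 - 27 * b * Z ^ 3) ^ 6"
    proof (intro prime_power_dvd_six_minus[OF p])
      show "p ^ (3 * \<eta> + \<tau>) dvd (3 * A ^ 3) ^ 6" by (rule three[OF pA3])
      have "p ^ (2 * \<eta> + \<tau>) * p ^ \<eta> dvd a ^ 6 * A ^ 6" using pa\<tau> pA by (rule mult_dvd_mono)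
      then have "p ^ (3 * \<eta> + \<tau>) dvd (a * A) ^ 6" by (simp add: power_add[symmetric] power_mult_distrib algebra_simps)
      from scale[OF this, of "5 * Z ^ 2"] show "p ^ (3 * \<eta> + \<tau>) dvd (5 * a * A * Z ^ 2) ^ 6"
        by (simp add: algebra_simps)
      from scale[OF three[OF pb3], of "9 * Z ^ 3"] show "p ^ (3 * \<eta> + \<tau>) dvd (27 * b * Z ^ 3) ^ 6"
        by (simp add: algebra_simps)
    qed
    \<comment> \<open>\<open>content_six\<close> weighs G with h, so \<eta> has to be deducted here;
      the weight 3 of the cofactor of G, against 2 for that of F, makes up for it.\<close>
    have G: "p ^ (k - \<eta>) dvd dupG a b A Z ^ 6"
    proof (cases "k \<le> \<eta>")
      case False
      obtain h' where h': "h = p ^ \<eta> * h'" "\<not> p dvd h'"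
        using multiplicity_decompose'[OF h0 pe(2)] unfolding \<eta>_def by metis
      have pk: "p ^ k = p ^ \<eta> * p ^ (k - \<eta>)" unfolding power_add[symmetric] using False by simp
      have "p ^ \<eta> * p ^ (k - \<eta>) dvd p ^ \<eta> * (h' * dupG a b A Z ^ 6)"
        using k(2)[folded h_def, unfolded h'(1) pk] by (simp only: mult.assoc)
      moreover have "p ^ \<eta> \<noteq> 0" using pe(1) by (auto dest: prime_elem_not_zeroI)
      ultimately have "p ^ (k - \<eta>) dvd h' * dupG a b A Z ^ 6" using dvd_mult_cancel_left by blast
      moreover have "coprime p h'" by (rule prime_imp_coprime[OF p h'(2)])
      then have "coprime (p ^ (k - \<eta>)) h'" by simp
      ultimately show ?thesis by (simp add: coprime_dvd_mult_right_iff)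
    qed auto
    have "p ^ (2 * \<eta> + \<tau> + k) dvd ((12 * A ^ 2 * Z + 16 * a * Z ^ 3) * dupF a b A Z) ^ 6"
      unfolding power_add[of p _ k] power_mult_distrib[of _ "dupF a b A Z"] by (rule mult_dvd_mono[OF U k(1)])
    moreover have "p ^ (2 * \<eta> + \<tau> + k) dvd ((3 * A ^ 3 - 5 * a * A * Z ^ 2 - 27 * b * Z ^ 3) * dupG a b A Z) ^ 6"
    proof -
      have "p ^ (3 * \<eta> + \<tau>) * p ^ (k - \<eta>) dvd ((3 * A ^ 3 - 5 * a * A * Z ^ 2 - 27 * b * Z ^ 3) * dupG a b A Z) ^ 6"
        unfolding power_mult_distrib[of _ "dupG a b A Z"] by (rule mult_dvd_mono[OF V G])
      moreover have "p ^ (2 * \<eta> + \<tau> + k) dvd p ^ (3 * \<eta> + \<tau>) * p ^ (k - \<eta>)"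
        unfolding power_add[symmetric] by (rule le_imp_power_dvd) simp
      ultimately show ?thesis by (rule dvd_trans[rotated])
    qed
    ultimately have "p ^ (2 * \<eta> + \<tau> + k) dvd (4 * \<Delta> * Z ^ 7) ^ 6"
      unfolding \<Delta>_def dup_identity[of A Z a b, symmetric] by (rule prime_power_dvd_six_minus[OF p])
    moreover have "coprime (p ^ (2 * \<eta> + \<tau> + k)) ((Z ^ 7) ^ 6)"
      using pZ p by (simp add: prime_imp_coprime)
    ultimately have "p ^ (2 * \<eta> + \<tau> + k) dvd (4 * \<Delta>) ^ 6"
      by (simp add: power_mult_distrib coprime_dvd_mult_left_iff)
    then have "2 * \<eta> + \<tau> + k \<le> multiplicity p ((4 * \<Delta>) ^ 6)"
      using \<Delta>0 pe by (intro multiplicity_geI) auto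
    also have "\<dots> = 6 * multiplicity p (4 * \<Delta>)" by (rule prime_elem_multiplicity_power_distrib[OF pe(1) \<Delta>0])
    finally have 1: "2 * \<eta> + \<tau> + k \<le> 6 * multiplicity p (4 * \<Delta>)" .
    have "p ^ \<eta> dvd n" using pA ph by (simp add: n_def content_six_def h_def)
    then have "\<eta> \<le> multiplicity p n" using n0 pe by (intro multiplicity_geI) auto
    with 1 show ?thesis unfolding h_def[symmetric] n_def[symmetric] \<Delta>_def[symmetric] \<eta>_def[symmetric] \<tau>_def
      by linarith
  qed
qed

theorem dup_content_dvd:
  fixes a b A Z :: int
  assumes D: "4 * a ^ 3 + 27 * b ^ 2 \<noteq> 0" and cop: "coprime A Z" and ne: "dupF a b A Z \<noteq> 0 \<or> dupG a b A Z \<noteq> 0"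
  shows "content_six a b (dupF a b A Z) (dupG a b A Z) * (twist_gcd a b * three_gain a b) ^ 6
    dvd content_six a b A Z ^ 4 * (4 * (4 * a ^ 3 + 27 * b ^ 2)) ^ 6"
proof (rule multiplicity_le_imp_dvd)
  have h0: "twist_gcd a b \<noteq> 0" using twist_gcd_nonzero D by simp
  have s0: "three_gain a b \<noteq> 0" by (simp add: three_gain_def)
  have X0: "content_six a b (dupF a b A Z) (dupG a b A Z) \<noteq> 0" using ne h0 by (auto simp: content_six_def)
  have n0: "content_six a b A Z \<noteq> 0" using cop h0 by (auto simp: content_six_def)
  show "content_six a b (dupF a b A Z) (dupG a b A Z) * (twist_gcd a b * three_gain a b) ^ 6 \<noteq> 0"
    using h0 s0 X0 by simp
  fix p :: int assume p: "prime p"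
  define k where "k = multiplicity p (content_six a b (dupF a b A Z) (dupG a b A Z))"
  have "p ^ k dvd content_six a b (dupF a b A Z) (dupG a b A Z)" unfolding k_def by (rule multiplicity_dvd)
  then have "k + 6 * multiplicity p (twist_gcd a b) + 6 * multiplicity p (three_gain a b)
    \<le> 4 * multiplicity p (content_six a b A Z) + 6 * multiplicity p (4 * (4 * a ^ 3 + 27 * b ^ 2))"
    unfolding content_six_def[of a b "dupF a b A Z"] by (intro dup_content_local[OF D cop p]) auto
  moreover have "multiplicity p (x * (y * z) ^ 6) = multiplicity p x + 6 * multiplicity p y + 6 * multiplicity p z"
    if "x \<noteq> 0" "y \<noteq> 0" "z \<noteq> 0" for x y z :: int
    using that prime_imp_prime_elem[OF p] by (simp add: prime_elem_multiplicity_mult_distrib prime_elem_multiplicity_power_distrib)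
  moreover have "multiplicity p (x ^ 4 * y ^ 6) = 4 * multiplicity p x + 6 * multiplicity p y"
    if "x \<noteq> 0" "y \<noteq> 0" for x y :: int
    using that prime_imp_prime_elem[OF p] by (simp add: prime_elem_multiplicity_mult_distrib prime_elem_multiplicity_power_distrib)
  ultimately show "multiplicity p (content_six a b (dupF a b A Z) (dupG a b A Z) * (twist_gcd a b * three_gain a b) ^ 6)
    \<le> multiplicity p (content_six a b A Z ^ 4 * (4 * (4 * a ^ 3 + 27 * b ^ 2)) ^ 6)"
    using h0 s0 X0 n0 D unfolding k_def by (metis mult_eq_0_iff zero_neq_numeral)
qed

text \<open>Bounds the cancellation between numerator and denominator of j. A common divisor divides
  27 * 6912 a^3 = 186624 a^3 and 4 * 46656 b^2, hence 186624 h = 9 * 20736 h. If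
  \<open>three_gain\<close> is 1, the 9 is saved: 27 b^2 is divisible by 3^(\<eta> + 3) and 4 a^3 is
  not, so the discriminant has 3-adic valuation at most \<eta> + 2.\<close>

theorem j_content_dvd:
  fixes a b :: int
  assumes D: "4 * a ^ 3 + 27 * b ^ 2 \<noteq> 0"
  shows "gcd (6912 * a ^ 3) (4 * a ^ 3 + 27 * b ^ 2) dvd 20736 * twist_gcd a b * three_gain a b ^ 2"
proof -
  define h where "h = twist_gcd a b"
  define c where "c = gcd (6912 * a ^ 3) (4 * a ^ 3 + 27 * b ^ 2)"
  have h0: "h \<noteq> 0" using twist_gcd_nonzero D by (simp add: h_def)
  have "c dvd 6912 * a ^ 3" by (simp add: c_def)
  moreover have "c dvd 1728 * (4 * a ^ 3 + 27 * b ^ 2)" by (rule dvd_mult) (simp add: c_def)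
  ultimately have "c dvd 1728 * (4 * a ^ 3 + 27 * b ^ 2) - 6912 * a ^ 3" by (intro dvd_diff)
  moreover have "1728 * (4 * a ^ 3 + 27 * b ^ 2) - 6912 * a ^ 3 = 46656 * b ^ 2" by simp
  ultimately have "c dvd 46656 * b ^ 2" by metis
  then have "c dvd 4 * (46656 * b ^ 2)" by (rule dvd_mult)
  moreover have "c dvd 27 * (6912 * a ^ 3)" using \<open>c dvd 6912 * a ^ 3\<close> by (rule dvd_mult)
  ultimately have "c dvd gcd (186624 * a ^ 3) (186624 * b ^ 2)" by simp
  also have "gcd (186624 * a ^ 3) (186624 * b ^ 2) = 186624 * h"
    by (simp add: h_def twist_gcd_def gcd_mult_left abs_mult)
  finally have c1: "c dvd 186624 * h" .
  show ?thesis
  proof (cases "three_gain a b = 3")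
    case True
    then show ?thesis using c1 by (simp add: c_def h_def)
  next
    case False
    then have t1: "three_gain a b = 1" unfolding three_gain_def by meson
    have "\<not> (\<forall>k. 3 ^ k dvd h \<longrightarrow> 3 ^ (k + 3) dvd a ^ 3)"
    proof
      assume "\<forall>k. 3 ^ k dvd h \<longrightarrow> 3 ^ (k + 3) dvd a ^ 3"
      then have "three_gain a b = 3" unfolding three_gain_def h_def by (rule if_P)
      with False show False by simp
    qed
    then obtain k where k: "3 ^ k dvd h" "\<not> 3 ^ (k + 3) dvd a ^ 3" by blast
    define \<eta> where "\<eta> = multiplicity 3 h"
    have "k \<le> \<eta>" using k h0 unfolding \<eta>_def by (intro multiplicity_geI) auto
    then have na: "\<not> 3 ^ (\<eta> + 3) dvd a ^ 3" using k(2) by (meson add_le_cancel_right power_le_dvd)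
    have "3 ^ \<eta> dvd b ^ 2" unfolding \<eta>_def by (metis dvd_trans gcd_dvd2 h_def multiplicity_dvd twist_gcd_def)
    then have "3 ^ \<eta> * 27 dvd b ^ 2 * 27" by (rule mult_dvd_mono) simp
    then have b: "3 ^ (\<eta> + 3) dvd 27 * b ^ 2" by (simp add: power_add mult.commute)
    have "\<not> 3 ^ (\<eta> + 3) dvd 4 * a ^ 3"
    proof
      assume "3 ^ (\<eta> + 3) dvd 4 * a ^ 3"
      moreover have "coprime (3 ^ (\<eta> + 3)) (4::int)" by (simp add: coprime_commute prime_imp_coprime)
      ultimately show False using na by (simp add: coprime_dvd_mult_right_iff)
    qed
    then have "\<not> 3 ^ (\<eta> + 3) dvd 4 * a ^ 3 + 27 * b ^ 2" using b by (metis dvd_add_left_iff)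
    then have nc: "\<not> 3 ^ (\<eta> + 3) dvd c" by (auto simp: c_def)
    have c0: "c \<noteq> 0" using D by (auto simp: c_def)
    have u3: "\<not> is_unit (3::int)" by simp
    obtain j c' where c': "c = 3 ^ j * c'" "\<not> 3 dvd c'"
      using multiplicity_decompose'[OF c0 u3] by metis
    obtain h' where h': "h = 3 ^ \<eta> * h'" "\<not> 3 dvd h'"
      using multiplicity_decompose'[OF h0 u3] unfolding \<eta>_def by metis
    have j: "j \<le> \<eta> + 2"
    proof (rule ccontr)
      assume "\<not> j \<le> \<eta> + 2"
      then have "3 ^ (\<eta> + 3) dvd (3::int) ^ j" by (intro le_imp_power_dvd) simp
      with nc show False using c'(1) by (metis dvd_mult2)
    qed
    have "c' dvd 186624 * h" using c1 c' by (metis dvd_mult_right)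
    then have "c' dvd 3 ^ (\<eta> + 6) * (256 * h')" using h' by (simp add: power_add mult_ac)
    moreover have "coprime c' (3 ^ (\<eta> + 6))"
    proof -
      have "coprime 3 c'" using c'(2) by (intro prime_imp_coprime) auto
      then have "coprime (3 ^ (\<eta> + 6)) c'" by simp
      then show ?thesis by (subst coprime_commute)
    qed
    ultimately have "c' dvd 256 * h'" by (simp add: coprime_dvd_mult_right_iff)
    moreover have "(3::int) ^ j dvd 3 ^ (\<eta> + 2)" using j by (rule le_imp_power_dvd)
    ultimately have "c dvd 3 ^ (\<eta> + 2) * (256 * h')" using c'(1) by (metis mult_dvd_mono)
    also have "3 ^ (\<eta> + 2) * (256 * h') dvd 20736 * h"
      by (rule dvdI[of _ _ 9]) (simp add: h'(1) power_add)
    finally show ?thesis using t1 by (simp add: c_def h_def)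
  qed
qed

section \<open>Duplication at the real place\<close>

text \<open>In all three cases below the point is that \<open>ln (max \<bar>x - x0\<bar> R)\<close> is almost multiplied by four
  under duplication; the constants \<open>S\<close> (comparison with \<open>max \<bar>x\<bar> 1\<close>) and \<open>K\<close> (loss in one duplication)
  enter the height bound through \<open>S\<^sup>1\<^sup>2 K\<^sup>4\<close>.\<close>

definition dup_bound :: "real \<Rightarrow> real \<Rightarrow> real \<Rightarrow> real \<Rightarrow> real \<Rightarrow> bool" where
  "dup_bound a b x0 R K \<longleftrightarrow> (\<forall>x. x ^ 3 + a * x + b \<ge> 0 \<longrightarrow>
     (max \<bar>x - x0\<bar> R) ^ 4 \<le> K * max \<bar>x ^ 4 - 2 * a * x ^ 2 - 8 * b * x + a ^ 2 - x0 * (4 * (x ^ 3 + a * x + b))\<bar>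
        (R * (4 * (x ^ 3 + a * x + b))))"

text \<open>\<open>dup_identity\<close> at Z = 1: the discriminant is a combination of F and 4 f
  with cofactors that are bounded for |x| \<le> R, so F and f cannot both be small.\<close>

lemma dup_resultant_bound:
  fixes a b x R K :: real
  assumes "\<bar>x\<bar> \<le> R" "R > 0" "K \<ge> 0"
    and K: "R ^ 4 * (15 / 4 * R ^ 2 + 21 / 4 * \<bar>a\<bar> + 27 / 4 * \<bar>b\<bar> / R) \<le> K * \<bar>4 * a ^ 3 + 27 * b ^ 2\<bar>"
    and D: "4 * a ^ 3 + 27 * b ^ 2 \<noteq> 0"
  shows "(max \<bar>x\<bar> R) ^ 4 \<le> K * max \<bar>x ^ 4 - 2 * a * x ^ 2 - 8 * b * x + a ^ 2\<bar> \<bar>R * (4 * (x ^ 3 + a * x + b))\<bar>"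
proof -
  define F where "F = x ^ 4 - 2 * a * x ^ 2 - 8 * b * x + a ^ 2"
  define f where "f = x ^ 3 + a * x + b"
  define M where "M = max \<bar>F\<bar> \<bar>R * (4 * f)\<bar>"
  have "4 * a ^ 3 + 27 * b ^ 2 = (3 * x ^ 2 + 4 * a) * F - (3 * x ^ 3 - 5 * a * x - 27 * b) / (4 * R) * (R * (4 * f))"
    using \<open>R > 0\<close> unfolding F_def f_def by (simp add: field_simps power2_eq_square power3_eq_cube power4_eq_xxxx)
  also have "\<bar>\<dots>\<bar> \<le> \<bar>(3 * x ^ 2 + 4 * a)\<bar> * \<bar>F\<bar> + \<bar>(3 * x ^ 3 - 5 * a * x - 27 * b) / (4 * R)\<bar> * \<bar>R * (4 * f)\<bar>"
    unfolding abs_mult[symmetric] by linarith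
  also have "\<dots> \<le> (3 * R ^ 2 + 4 * \<bar>a\<bar>) * M + ((3 * R ^ 2 + 5 * \<bar>a\<bar> + 27 * \<bar>b\<bar> / R) / 4) * M"
  proof (intro add_mono mult_mono)
    have x2: "x ^ 2 \<le> R ^ 2" using assms by (metis abs_le_square_iff abs_of_pos)
    then show "\<bar>3 * x ^ 2 + 4 * a\<bar> \<le> 3 * R ^ 2 + 4 * \<bar>a\<bar>"
      using zero_le_power2[of x] by linarith
    have "\<bar>x ^ 3\<bar> \<le> R ^ 3" using assms power_mono[of "\<bar>x\<bar>" R 3] by (simp add: power_abs)
    moreover have "\<bar>a * x\<bar> \<le> \<bar>a\<bar> * R" using assms by (simp add: abs_mult mult_left_mono)
    ultimately have "\<bar>3 * x ^ 3 - 5 * a * x - 27 * b\<bar> \<le> 3 * R ^ 3 + 5 * \<bar>a\<bar> * R + 27 * \<bar>b\<bar>"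
      by linarith
    then show "\<bar>(3 * x ^ 3 - 5 * a * x - 27 * b) / (4 * R)\<bar> \<le> (3 * R ^ 2 + 5 * \<bar>a\<bar> + 27 * \<bar>b\<bar> / R) / 4"
      using \<open>R > 0\<close> by (simp add: field_simps power2_eq_square power3_eq_cube)
  qed (use assms in \<open>auto simp: M_def\<close>)
  also have "\<dots> = (15 / 4 * R ^ 2 + 21 / 4 * \<bar>a\<bar> + 27 / 4 * \<bar>b\<bar> / R) * M"
    by (simp add: field_simps)
  finally have *: "\<bar>4 * a ^ 3 + 27 * b ^ 2\<bar> \<le> (15 / 4 * R ^ 2 + 21 / 4 * \<bar>a\<bar> + 27 / 4 * \<bar>b\<bar> / R) * M" .
  have "R ^ 4 * \<bar>4 * a ^ 3 + 27 * b ^ 2\<bar> \<le> R ^ 4 * ((15 / 4 * R ^ 2 + 21 / 4 * \<bar>a\<bar> + 27 / 4 * \<bar>b\<bar> / R) * M)"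
    by (rule mult_left_mono[OF *]) (use assms in auto)
  also have "\<dots> \<le> (K * \<bar>4 * a ^ 3 + 27 * b ^ 2\<bar>) * M"
    unfolding mult.assoc[symmetric] by (rule mult_right_mono) (use K in \<open>auto simp: M_def mult.assoc\<close>)
  finally have "\<bar>4 * a ^ 3 + 27 * b ^ 2\<bar> * R ^ 4 \<le> \<bar>4 * a ^ 3 + 27 * b ^ 2\<bar> * (K * M)"
    by (simp only: mult.commute mult.left_commute mult.assoc)
  then have "R ^ 4 \<le> K * M" using D by (simp add: mult_le_cancel_left)
  then show ?thesis using assms by (simp add: M_def F_def f_def max_absorb2)
qed

text \<open>This regime leaves little freedom: S = 1 and J may be 1, so K must stay below exp 10 /
  9216, about 2.39. With radius 4/3 \<beta> the resultant bound gives about 2.333 in the worst case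
  |a| = \<beta>^2.\<close>

lemma dup_bound_small_j:
  fixes a b \<beta> :: real
  assumes \<beta>: "\<beta> > 0" "\<bar>b\<bar> = \<beta> ^ 3" "\<bar>a\<bar> \<le> \<beta> ^ 2"
  shows "dup_bound a b 0 (4 / 3 * \<beta>) (117 / 50)"
  unfolding dup_bound_def
proof (intro allI impI)
  fix x :: real
  assume f: "x ^ 3 + a * x + b \<ge> 0"
  define R where "R = 4 / 3 * \<beta>"
  define F where "F = x ^ 4 - 2 * a * x ^ 2 - 8 * b * x + a ^ 2"
  define M where "M = max \<bar>F\<bar> (R * (4 * (x ^ 3 + a * x + b)))"
  have R: "R > 0" using \<beta> by (simp add: R_def)
  have "\<bar>a\<bar> ^ 3 \<le> (\<beta> ^ 2) ^ 3" by (rule power_mono) (use \<beta> in auto)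
  then have a3: "\<bar>a\<bar> ^ 3 \<le> \<beta> ^ 6" by simp
  have b2: "b ^ 2 = \<beta> ^ 6" using \<beta>(2) by (metis power2_abs power_mult mult_2_right numeral_Bit0 numeral_3_eq_3 power_mult_numeral mult_2 num_double numeral_times_numeral semiring_norm(14))
  have a3': "\<bar>a ^ 3\<bar> = \<bar>a\<bar> ^ 3" by (simp add: power_abs)
  have Dge: "\<bar>4 * a ^ 3 + 27 * b ^ 2\<bar> \<ge> 27 * \<beta> ^ 6 - 4 * \<bar>a\<bar> ^ 3"
    using b2 a3' by linarith
  have \<beta>6: "\<beta> ^ 6 > 0" using \<beta> by simp
  have D0: "4 * a ^ 3 + 27 * b ^ 2 \<noteq> 0"
  proof
    assume "4 * a ^ 3 + 27 * b ^ 2 = 0"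
    then have "27 * \<beta> ^ 6 \<le> 4 * \<bar>a\<bar> ^ 3" using Dge by simp
    with a3 \<beta>6 show False by linarith
  qed
  have a3t: "\<bar>a\<bar> ^ 3 \<le> \<beta> ^ 4 * \<bar>a\<bar>"
  proof -
    have "\<bar>a\<bar> ^ 2 \<le> (\<beta> ^ 2) ^ 2" by (rule power_mono) (use \<beta> in auto)
    then have "\<bar>a\<bar> ^ 2 * \<bar>a\<bar> \<le> \<beta> ^ 4 * \<bar>a\<bar>" by (intro mult_right_mono) auto
    then show ?thesis by (simp add: power3_eq_cube power2_eq_square)
  qed
  have "M * (117 / 50) \<ge> (max \<bar>x\<bar> R) ^ 4"
  proof (cases "\<bar>x\<bar> \<le> R")
    case True
    have "R ^ 4 * (15 / 4 * R ^ 2 + 21 / 4 * \<bar>a\<bar> + 27 / 4 * \<bar>b\<bar> / R) =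
        9008 / 243 * \<beta> ^ 6 + 448 / 27 * (\<beta> ^ 4 * \<bar>a\<bar>)"
      using \<beta> unfolding R_def by (simp add: field_simps power2_eq_square power3_eq_cube power4_eq_xxxx eval_nat_numeral)
    also have "\<dots> \<le> 117 / 50 * (27 * \<beta> ^ 6 - 4 * (\<beta> ^ 4 * \<bar>a\<bar>))"
    proof -
      have "\<beta> ^ 4 * \<bar>a\<bar> \<le> \<beta> ^ 4 * \<beta> ^ 2" by (rule mult_left_mono) (use \<beta> in auto)
      also have "\<dots> = \<beta> ^ 6" by (simp add: power_add[symmetric])
      finally have le: "\<beta> ^ 4 * \<bar>a\<bar> \<le> \<beta> ^ 6" .
      have "9008 / 243 * p + 448 / 27 * q \<le> 117 / 50 * (27 * p - 4 * q)" if "q \<le> p" "0 < p" for p q :: real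
        using that by (simp add: field_simps)
      from this[OF le \<beta>6] show ?thesis .
    qed
    also have "\<dots> \<le> 117 / 50 * \<bar>4 * a ^ 3 + 27 * b ^ 2\<bar>"
      by (intro mult_left_mono order_trans[OF _ Dge]) (use a3t in auto)
    finally have rb: "R ^ 4 * (15 / 4 * R ^ 2 + 21 / 4 * \<bar>a\<bar> + 27 / 4 * \<bar>b\<bar> / R) \<le> 117 / 50 * \<bar>4 * a ^ 3 + 27 * b ^ 2\<bar>" .
    have "(max \<bar>x\<bar> R) ^ 4 \<le> 117 / 50 * max \<bar>F\<bar> \<bar>R * (4 * (x ^ 3 + a * x + b))\<bar>"
      unfolding F_def
      by (rule dup_resultant_bound[OF True R _ rb D0]) simp
    also have "\<bar>R * (4 * (x ^ 3 + a * x + b))\<bar> = R * (4 * (x ^ 3 + a * x + b))"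
      using R f by simp
    finally show ?thesis by (simp add: M_def mult.commute)
  next
    case False
    then have xR: "\<bar>x\<bar> > 4 / 3 * \<beta>" by (simp add: R_def)
    then have x2: "x ^ 2 \<ge> 16 / 9 * \<beta> ^ 2"
    proof -
      have "(4 / 3 * \<beta>) ^ 2 \<le> \<bar>x\<bar> ^ 2" by (rule power_mono) (use xR \<beta> in auto)
      then show ?thesis by (simp add: power2_eq_square)
    qed
    have xa: "\<bar>a\<bar> \<le> 9 / 16 * x ^ 2" using x2 \<beta> by linarith
    \<comment> \<open>For x < - 4/3 \<beta> the cubic is negative, so there are no real points on
      that side.\<close>
    have x0: "x > 0"
    proof (rule ccontr)
      assume "\<not> x > 0"
      define y where "y = - x"
      have y: "y > 4 / 3 * \<beta>" using xR \<open>\<not> x > 0\<close> by (simp add: y_def)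
      have "y * (y ^ 2 - \<bar>a\<bar>) \<ge> y * (7 / 9 * \<beta> ^ 2)"
        by (rule mult_left_mono) (use x2 \<beta> y in \<open>auto simp: y_def\<close>)
      moreover have "y * (7 / 9 * \<beta> ^ 2) \<ge> 4 / 3 * \<beta> * (7 / 9 * \<beta> ^ 2)"
        by (rule mult_right_mono) (use y in auto)
      ultimately have "y ^ 3 - \<bar>a\<bar> * y \<ge> 28 / 27 * \<beta> ^ 3"
        by (simp add: power3_eq_cube power2_eq_square algebra_simps)
      moreover have "- a * y \<le> \<bar>a\<bar> * y" using y \<beta> by (intro mult_right_mono) auto
      moreover have "x ^ 3 + a * x + b = - (y ^ 3) - a * y + b" by (simp add: y_def)
      moreover have "\<beta> ^ 3 > 0" using \<beta> by simp
      ultimately show False using f \<beta>(2) by linarith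
    qed
    have x4: "x ^ 4 = x ^ 2 * x ^ 2" by (simp add: power2_eq_square power4_eq_xxxx)
    have "\<bar>a\<bar> * x ^ 2 \<le> \<beta> ^ 2 * x ^ 2" by (rule mult_right_mono) (use \<beta> in auto)
    then have ax: "a * x ^ 2 \<le> \<beta> ^ 2 * x ^ 2" using abs_ge_self[of "a * x ^ 2"] by (simp add: abs_mult)
    \<comment> \<open>For b < 0 the term 8 \<beta>^3 x of F offsets 2 a x^2 up to x = 4 \<beta>. For
      b > 0 it has the wrong sign, F may vanish, and on this range R * 4 f takes over.\<close>
    have "x ^ 4 \<le> M * (117 / 50)"
    proof (cases "b < 0")
      case True
      then have b: "b = - (\<beta> ^ 3)" using \<beta> by simp
      have Feq: "F = x ^ 4 - 2 * (a * x ^ 2) + 8 * (\<beta> ^ 3 * x) + a ^ 2" unfolding F_def b by simp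
      have "F \<ge> 7 / 8 * x ^ 4"
      proof (cases "x \<le> 4 * \<beta>")
        case x: True
        have "2 * (\<beta> ^ 2 * x ^ 2) = (2 * \<beta> ^ 2 * x) * x" by (simp add: power2_eq_square)
        also have "\<dots> \<le> (2 * \<beta> ^ 2 * x) * (4 * \<beta>)" using x \<beta> x0 by (intro mult_left_mono) auto
        also have "\<dots> = 8 * (\<beta> ^ 3 * x)" by (simp add: power2_eq_square power3_eq_cube)
        finally have "F \<ge> x ^ 4" using ax zero_le_power2[of a] unfolding Feq by linarith
        moreover have "x ^ 4 \<ge> 0" by simp
        ultimately show ?thesis by linarith
      next
        case x: False
        have "(4 * \<beta>) ^ 2 \<le> x ^ 2" by (rule power_mono) (use x \<beta> in auto)
        then have "(16 * \<beta> ^ 2) * x ^ 2 \<le> x ^ 2 * x ^ 2" by (intro mult_right_mono) (auto simp: power_mult_distrib)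
        then have "16 * (\<beta> ^ 2 * x ^ 2) \<le> x ^ 4" unfolding x4 by (simp only: mult.assoc)
        moreover have "\<beta> ^ 3 * x \<ge> 0" using \<beta> x0 by simp
        ultimately show ?thesis using ax zero_le_power2[of a] unfolding Feq by linarith
      qed
      then have "M \<ge> 7 / 8 * x ^ 4" unfolding M_def by linarith
      moreover have "x ^ 4 \<ge> 0" by simp
      ultimately show ?thesis by linarith
    next
      case False
      then have b: "b = \<beta> ^ 3" using \<beta> by simp
      have Feq: "F = x ^ 4 - 2 * (a * x ^ 2) - 8 * (\<beta> ^ 3 * x) + a ^ 2" unfolding F_def b by simp
      show ?thesis
      proof (cases "x \<le> 4 * \<beta>")
        case x: True
        have "- a * x \<le> 9 / 16 * x ^ 2 * x" using xa x0 by (intro mult_right_mono) auto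
        then have "- (a * x) \<le> 9 / 16 * x ^ 3" by (simp add: power3_eq_cube power2_eq_square)
        moreover have "\<beta> ^ 3 > 0" using \<beta> by simp
        ultimately have "x ^ 3 + a * x + b \<ge> 7 / 16 * x ^ 3" unfolding b by linarith
        then have "R * (4 * (x ^ 3 + a * x + b)) \<ge> R * (4 * (7 / 16 * x ^ 3))"
          using R by (intro mult_left_mono) auto
        moreover have "R * (4 * (7 / 16 * x ^ 3)) = 7 / 12 * (4 * \<beta>) * x ^ 3" by (simp add: R_def)
        moreover have "7 / 12 * (4 * \<beta>) * x ^ 3 \<ge> 7 / 12 * x * x ^ 3"
          using x x0 by (intro mult_right_mono) auto
        moreover have "7 / 12 * x * x ^ 3 = 7 / 12 * x ^ 4" by (simp add: eval_nat_numeral)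
        ultimately have "M \<ge> 7 / 12 * x ^ 4" unfolding M_def by linarith
        moreover have "x ^ 4 \<ge> 0" by simp
        ultimately show ?thesis by linarith
      next
        case x: False
        have "(4 * \<beta>) ^ 2 \<le> x ^ 2" by (rule power_mono) (use x \<beta> in auto)
        then have "(16 * \<beta> ^ 2) * x ^ 2 \<le> x ^ 2 * x ^ 2" by (intro mult_right_mono) (auto simp: power_mult_distrib)
        then have "16 * (\<beta> ^ 2 * x ^ 2) \<le> x ^ 4" unfolding x4 by (simp only: mult.assoc)
        moreover have "(4 * \<beta>) ^ 3 * x \<le> x ^ 3 * x" by (intro mult_right_mono power_mono) (use x x0 \<beta> in auto)
        then have "64 * (\<beta> ^ 3 * x) \<le> x ^ 4" by (simp add: eval_nat_numeral algebra_simps)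
        ultimately have "F \<ge> 3 / 4 * x ^ 4" using ax zero_le_power2[of a] unfolding Feq by linarith
        then have "M \<ge> 3 / 4 * x ^ 4" unfolding M_def by linarith
        moreover have "x ^ 4 \<ge> 0" by simp
        ultimately show ?thesis by linarith
      qed
    qed
    then show ?thesis using False R x0 by (simp add: max_absorb1)
  qed
  then show "(max \<bar>x - 0\<bar> (4 / 3 * \<beta>)) ^ 4 \<le> 117 / 50 * max \<bar>x ^ 4 - 2 * a * x ^ 2 - 8 * b * x + a ^ 2 - 0 * (4 * (x ^ 3 + a * x + b))\<bar>
        (4 / 3 * \<beta> * (4 * (x ^ 3 + a * x + b)))"
    by (simp add: M_def F_def R_def mult.commute)
qed

text \<open>Outside the radius F alone has to dominate: 1 - 2 (20/47)^2 - 8 (20/47)^3 is just above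
  1/48, hence K \<ge> 48. Inside, 880 rounds up the cofactor bound of
  \<open>dup_resultant_bound\<close> for this radius.\<close>

lemma dup_bound_medium_j:
  fixes a b \<gamma> K :: real
  assumes \<gamma>: "\<gamma> > 0" "\<bar>a\<bar> = \<gamma> ^ 2" "\<bar>b\<bar> \<le> \<gamma> ^ 3"
    and D: "4 * a ^ 3 + 27 * b ^ 2 \<noteq> 0"
    and K: "K \<ge> 48" "880 * \<gamma> ^ 6 \<le> K * \<bar>4 * a ^ 3 + 27 * b ^ 2\<bar>"
  shows "dup_bound a b 0 (47 / 20 * \<gamma>) K"
  unfolding dup_bound_def
proof (intro allI impI)
  fix x :: real
  assume f: "x ^ 3 + a * x + b \<ge> 0"
  define R where "R = 47 / 20 * \<gamma>"
  define F where "F = x ^ 4 - 2 * a * x ^ 2 - 8 * b * x + a ^ 2"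
  define M where "M = max \<bar>F\<bar> (R * (4 * (x ^ 3 + a * x + b)))"
  have R: "R > 0" using \<gamma> by (simp add: R_def)
  have "K * M \<ge> (max \<bar>x\<bar> R) ^ 4"
  proof (cases "\<bar>x\<bar> \<le> R")
    case True
    have "R ^ 4 * (15 / 4 * R ^ 2 + 21 / 4 * \<bar>a\<bar> + 27 / 4 * \<bar>b\<bar> / R) \<le>
        R ^ 4 * (15 / 4 * R ^ 2 + 21 / 4 * \<gamma> ^ 2 + 27 / 4 * \<gamma> ^ 3 / R)"
      using \<gamma> R by (intro mult_left_mono add_mono divide_right_mono) auto
    also have "\<dots> = (47 / 20) ^ 4 * (15 / 4 * (47 / 20) ^ 2 + 21 / 4 + 27 / 4 * 20 / 47) * \<gamma> ^ 6"
      using \<gamma> unfolding R_def by (simp add: field_simps power2_eq_square power3_eq_cube power4_eq_xxxx eval_nat_numeral)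
    also have "\<dots> \<le> 880 * \<gamma> ^ 6"
      using \<gamma> by (intro mult_right_mono) (auto simp: eval_nat_numeral)
    also note K(2)
    finally have "(max \<bar>x\<bar> R) ^ 4 \<le> K * max \<bar>F\<bar> \<bar>R * (4 * (x ^ 3 + a * x + b))\<bar>"
      unfolding F_def using K(1) D by (intro dup_resultant_bound[OF True R]) auto
    also have "\<bar>R * (4 * (x ^ 3 + a * x + b))\<bar> = R * (4 * (x ^ 3 + a * x + b))"
      using R f by simp
    finally show ?thesis by (simp add: M_def)
  next
    case False
    then have xR: "\<bar>x\<bar> > 47 / 20 * \<gamma>" by (simp add: R_def)
    have "(47 / 20 * \<gamma>) ^ 2 \<le> \<bar>x\<bar> ^ 2" by (rule power_mono) (use xR \<gamma> in auto)
    then have "(2209 / 400 * \<gamma> ^ 2) * x ^ 2 \<le> x ^ 2 * x ^ 2" by (intro mult_right_mono) (auto simp: power2_eq_square)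
    then have 1: "2209 / 400 * (\<gamma> ^ 2 * x ^ 2) \<le> x ^ 4" by (simp add: power2_eq_square power4_eq_xxxx)
    have "(47 / 20 * \<gamma>) ^ 3 * \<bar>x\<bar> \<le> \<bar>x\<bar> ^ 3 * \<bar>x\<bar>" by (intro mult_right_mono power_mono) (use xR \<gamma> in auto)
    also have "\<bar>x\<bar> ^ 3 * \<bar>x\<bar> = x ^ 4"
      by (metis abs_mult_self_eq mult.assoc power3_eq_cube power4_eq_xxxx)
    finally have 2: "103823 / 8000 * (\<gamma> ^ 3 * \<bar>x\<bar>) \<le> x ^ 4" by (simp add: eval_nat_numeral algebra_simps)
    have "\<bar>b * x\<bar> \<le> \<gamma> ^ 3 * \<bar>x\<bar>" using \<gamma> by (simp add: abs_mult mult_right_mono)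
    moreover have "\<bar>a * x ^ 2\<bar> = \<gamma> ^ 2 * x ^ 2" using \<gamma> by (simp add: abs_mult)
    ultimately have "F \<ge> 1 / 48 * x ^ 4" using 1 2 zero_le_power2[of a] unfolding F_def by linarith
    then have M: "M \<ge> 1 / 48 * x ^ 4" unfolding M_def by linarith
    have "K * M \<ge> 48 * (1 / 48 * x ^ 4)" by (rule mult_mono) (use M K in auto)
    then show ?thesis using False R by (simp add: max_absorb1 power_abs)
  qed
  then show "(max \<bar>x - 0\<bar> (47 / 20 * \<gamma>)) ^ 4 \<le> K * max \<bar>x ^ 4 - 2 * a * x ^ 2 - 8 * b * x + a ^ 2 - 0 * (4 * (x ^ 3 + a * x + b))\<bar>
        (47 / 20 * \<gamma> * (4 * (x ^ 3 + a * x + b)))"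
    by (simp add: M_def F_def R_def)
qed


text \<open>For \<eta> = 0 the cubic is (x - e)^2 (x + 2 e) with a node at e, so \<eta> measures the
  distance from a singular cubic. In t = x - e the shifted numerator has constant term close to - 4
  \<eta> e^2, and R is the scale at which |\<eta>| e^2 equals t^4. Centring at e yields a K
  independent of j; closeness to the node is paid for by S instead.\<close>

lemma dup_bound_large_j:
  fixes a b e \<eta> R :: real
  assumes e: "e \<noteq> 0" "a = - 3 * e ^ 2 + \<eta>" "b = 2 * e ^ 3 - 2 / 3 * \<eta> * e"
    and R: "R > 0" "R ^ 4 = \<bar>\<eta>\<bar> * e ^ 2" "R \<le> \<bar>e\<bar> / 2" and \<eta>: "\<bar>\<eta>\<bar> \<le> e ^ 2 / 16"
  shows "dup_bound a b e R 3"
  unfolding dup_bound_def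
proof (intro allI impI)
  fix x :: real
  assume f0: "x ^ 3 + a * x + b \<ge> 0"
  define t where "t = x - e"
  define f where "f = t ^ 3 + 3 * e * t ^ 2 + \<eta> * t + \<eta> * e / 3"
  define F where "F = t ^ 4 - 2 * \<eta> * t ^ 2 - 8 / 3 * \<eta> * e * t + \<eta> ^ 2 - 4 * \<eta> * e ^ 2"
  define M where "M = max \<bar>F\<bar> (R * (4 * f))"
  have xt: "x = t + e" by (simp add: t_def)
  have f: "x ^ 3 + a * x + b = f"
    unfolding f_def e(2,3) xt by (simp add: eval_nat_numeral algebra_simps)
  have F: "x ^ 4 - 2 * a * x ^ 2 - 8 * b * x + a ^ 2 - e * (4 * f) = F"
    unfolding F_def f_def e(2,3) xt by (simp add: eval_nat_numeral algebra_simps)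
  have f0: "f \<ge> 0" using f0 f by simp
  have et0: "\<bar>e\<bar> * \<bar>t\<bar> \<ge> 0" by simp
  have e2: "e ^ 2 > 0" using e by simp
  have \<eta>e: "\<bar>\<eta> * e * t\<bar> = \<bar>\<eta>\<bar> * (\<bar>e\<bar> * \<bar>t\<bar>)" by (simp add: abs_mult)
  have "(max \<bar>t\<bar> R) ^ 4 \<le> 3 * M"
  proof (cases "\<eta> \<le> 0")
    case True
    \<comment> \<open>No cancellation for \<eta> \<le> 0: three quarters of the constant term absorb
      the term linear in t.\<close>
    define n where "n = - \<eta>"
    have n: "n \<ge> 0" "\<bar>\<eta>\<bar> = n" using True by (auto simp: n_def)
    have "t ^ 2 * 2 + 8 / 3 * e * t + e ^ 2 * 3 \<ge> 0"
    proof -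
      have "t ^ 2 * 2 + 8 / 3 * e * t + e ^ 2 * 3 = 2 * (t + 2 / 3 * e) ^ 2 + 19 / 9 * e ^ 2"
        by (simp add: power2_eq_square algebra_simps)
      then show ?thesis by simp
    qed
    then have "n * (t ^ 2 * 2 + 8 / 3 * e * t + e ^ 2 * 3) \<ge> 0" using n by simp
    moreover have "F = t ^ 4 + n * (t ^ 2 * 2 + 8 / 3 * e * t + e ^ 2 * 3) + n ^ 2 + n * e ^ 2"
      by (simp add: F_def n_def algebra_simps)
    moreover have "R ^ 4 = n * e ^ 2" using R(2) n by simp
    ultimately have "F \<ge> t ^ 4 + R ^ 4" using zero_le_power2[of n] by linarith
    moreover have "t ^ 4 \<ge> 0" "R ^ 4 \<ge> 0" by simp_all
    ultimately have "M \<ge> t ^ 4" "M \<ge> R ^ 4" "M \<ge> 0" unfolding M_def by linarith+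
    then show ?thesis by (auto simp: max_def power_abs)
  next
    case False
    then have \<eta>0: "\<eta> > 0" by simp
    have R4: "R ^ 4 = \<eta> * e ^ 2" using R \<eta>0 by simp
    consider "\<bar>t\<bar> \<le> R" | "\<bar>t\<bar> \<ge> 2 * R" | "R \<le> \<bar>t\<bar>" "\<bar>t\<bar> \<le> 2 * R" by linarith
    then show ?thesis
    proof cases
      case 1
      have "\<bar>t\<bar> ^ 4 \<le> R ^ 4" by (rule power_mono) (use 1 in auto)
      then have t4: "t ^ 4 \<le> R ^ 4" by (simp add: power_abs)
      have "\<bar>e\<bar> * \<bar>t\<bar> \<le> \<bar>e\<bar> * (\<bar>e\<bar> / 2)" by (rule mult_left_mono) (use 1 R in auto)
      then have "\<bar>e\<bar> * \<bar>t\<bar> \<le> e ^ 2 / 2" by (simp add: power2_eq_square)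
      then have "\<eta> * (\<bar>e\<bar> * \<bar>t\<bar>) \<le> \<eta> * (e ^ 2 / 2)" using \<eta>0 by (intro mult_left_mono) auto
      then have "\<bar>\<eta> * e * t\<bar> \<le> R ^ 4 / 2" using \<eta>e \<eta>0 R4 by simp
      moreover have "\<eta> * \<eta> \<le> \<eta> * (e ^ 2 / 16)" using \<eta> \<eta>0 by (intro mult_left_mono) auto
      then have "\<eta> ^ 2 \<le> R ^ 4 / 16" using R4 by (simp add: power2_eq_square)
      moreover have "\<eta> * t ^ 2 \<ge> 0" using \<eta>0 by simp
      moreover have "\<eta> * e ^ 2 = R ^ 4" using R4 by simp
      moreover have "R ^ 4 > 0" using R(1) by simp
      ultimately have "F \<le> - (R ^ 4)" using t4 unfolding F_def by linarith
      then have "3 * M \<ge> R ^ 4" using \<open>R ^ 4 > 0\<close> unfolding M_def by linarith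
      then show ?thesis using 1 by (simp add: max_absorb2)
    next
      case 2
      have "(2 * R) ^ 4 \<le> \<bar>t\<bar> ^ 4" by (rule power_mono) (use 2 R in auto)
      moreover have "(2 * R) ^ 4 = 16 * R ^ 4" "\<bar>t\<bar> ^ 4 = t ^ 4" by (simp_all add: power_mult_distrib)
      ultimately have t4: "16 * R ^ 4 \<le> t ^ 4" by linarith
      have "R ^ 4 * \<bar>t\<bar> \<le> \<bar>e\<bar> * (\<bar>t\<bar> ^ 4 / 16)"
      proof -
        have "R ^ 4 * \<bar>t\<bar> = R * (R ^ 3 * \<bar>t\<bar>)" by (simp add: eval_nat_numeral)
        also have "\<dots> \<le> \<bar>e\<bar> / 2 * ((\<bar>t\<bar> / 2) ^ 3 * \<bar>t\<bar>)"
          by (intro mult_mono power_mono mult_nonneg_nonneg zero_le_power) (use 2 R in auto)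
        finally show ?thesis by (simp add: eval_nat_numeral)
      qed
      then have "\<bar>e\<bar> * (\<eta> * (\<bar>e\<bar> * \<bar>t\<bar>)) \<le> \<bar>e\<bar> * (t ^ 4 / 16)"
        using R4 by (simp add: power2_eq_square power_abs mult_ac)
      then have "\<eta> * (\<bar>e\<bar> * \<bar>t\<bar>) \<le> t ^ 4 / 16" using e by (simp add: mult_le_cancel_left)
      then have 1: "\<bar>\<eta> * e * t\<bar> \<le> t ^ 4 / 16" using \<eta>e \<eta>0 by simp
      have "e ^ 2 * (\<eta> * t ^ 2) = R ^ 2 * (R ^ 2 * t ^ 2)" using R4 by (simp add: eval_nat_numeral algebra_simps)
      also have "\<dots> \<le> (\<bar>e\<bar> / 2) ^ 2 * ((\<bar>t\<bar> / 2) ^ 2 * t ^ 2)"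
        by (intro mult_mono[OF power_mono mult_right_mono[OF power_mono]]) (use 2 R in auto)
      also have "\<dots> = e ^ 2 * (t ^ 4 / 16)" by (simp add: eval_nat_numeral)
      finally have "\<eta> * t ^ 2 \<le> t ^ 4 / 16" using e2 by (simp add: mult_le_cancel_left)
      moreover have "\<eta> * e ^ 2 \<le> t ^ 4 / 16" using t4 R4 by linarith
      moreover have "t ^ 4 \<ge> 0" by simp
      ultimately have "F \<ge> 11 / 24 * t ^ 4" using 1 zero_le_power2[of \<eta>] unfolding F_def by linarith
      then have "3 * M \<ge> t ^ 4" using \<open>t ^ 4 \<ge> 0\<close> unfolding M_def by linarith
      moreover have "max \<bar>t\<bar> R = \<bar>t\<bar>" using 2 R(1) by simp
      ultimately show ?thesis by simp
    next
      case 3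
      \<comment> \<open>The range where F may vanish. With e < 0 the cubic would be negative here;
        with e > 0 it is at least 3 R^3, so the denominator term is large.\<close>
      have t2: "t ^ 2 \<ge> R ^ 2" using 3 R power_mono[of R "\<bar>t\<bar>" 2] by simp
      have eR: "\<bar>e\<bar> * R ^ 2 \<ge> 2 * R * R ^ 2" using R by (intro mult_right_mono) auto
      then have eR: "\<bar>e\<bar> * R ^ 2 \<ge> 2 * R ^ 3" by (simp add: eval_nat_numeral)
      have "(\<eta> * \<bar>e\<bar>) * (2 * R) \<le> (\<eta> * \<bar>e\<bar>) * \<bar>e\<bar>"
        by (rule mult_left_mono) (use R(3) \<eta>0 in auto)
      then have "2 * (\<eta> * \<bar>e\<bar>) * R \<le> (\<eta> * \<bar>e\<bar>) * \<bar>e\<bar>" by (simp add: mult_ac)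
      also have "\<dots> = R ^ 3 * R" using R4 by (simp add: eval_nat_numeral)
      finally have \<eta>eR: "2 * (\<eta> * \<bar>e\<bar>) \<le> R ^ 3" using R by (simp add: mult_le_cancel_right)
      have R3: "R ^ 3 > 0" using R by simp
      have fe: "f = t ^ 2 * (t + 3 * e) + \<eta> * (t + e / 3)" by (simp add: f_def eval_nat_numeral algebra_simps)
      have "e > 0"
      proof (rule ccontr)
        assume "\<not> e > 0"
        then have e0: "\<bar>e\<bar> = - e" by simp
        have "\<bar>e\<bar> * R ^ 2 \<le> \<bar>e\<bar> * t ^ 2" using t2 by (intro mult_left_mono) auto
        moreover have "t ^ 2 * (t + 3 * e) \<le> t ^ 2 * (- (2 * \<bar>e\<bar>))"
          by (rule mult_left_mono) (use 3 R e0 in auto)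
        moreover have "\<eta> * (t + e / 3) \<le> \<eta> * \<bar>e\<bar>" by (rule mult_left_mono) (use 3 R e0 \<eta>0 in auto)
        moreover have "t ^ 2 * (- (2 * \<bar>e\<bar>)) = - 2 * (\<bar>e\<bar> * t ^ 2)" by simp
        ultimately have "f < 0" using eR \<eta>eR R3 unfolding fe by linarith
        with f0 show False by simp
      qed
      then have "e * R ^ 2 \<le> e * t ^ 2" using t2 by (intro mult_left_mono) auto
      moreover have "t ^ 2 * (t + 3 * e) \<ge> t ^ 2 * (2 * e)"
        by (rule mult_left_mono) (use 3 R \<open>e > 0\<close> in auto)
      moreover have "\<eta> * (t + e / 3) \<ge> \<eta> * (- e)" by (rule mult_left_mono) (use 3 R \<open>e > 0\<close> \<eta>0 in auto)
      moreover have "t ^ 2 * (2 * e) = 2 * (e * t ^ 2)" "\<eta> * (- e) = - (\<eta> * e)" by simp_all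
      moreover have ae: "\<bar>e\<bar> = e" using \<open>e > 0\<close> by simp
      ultimately have "f \<ge> 3 * R ^ 3" using eR \<eta>eR R3 unfolding fe ae by linarith
      then have "R * (4 * f) \<ge> R * (4 * (3 * R ^ 3))" using R by (intro mult_left_mono) auto
      then have "M \<ge> 12 * R ^ 4" unfolding M_def by (simp add: eval_nat_numeral)
      moreover have "t ^ 4 \<le> 16 * R ^ 4"
      proof -
        have "\<bar>t\<bar> ^ 4 \<le> (2 * R) ^ 4" by (rule power_mono) (use 3 in auto)
        moreover have "(2 * R) ^ 4 = 16 * R ^ 4" "\<bar>t\<bar> ^ 4 = t ^ 4" by (simp_all add: power_mult_distrib)
        ultimately show ?thesis by linarith
      qed
      moreover have "R ^ 4 > 0" using R(1) by simp
      ultimately have "t ^ 4 \<le> 3 * M" by linarith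
      moreover have "max \<bar>t\<bar> R = \<bar>t\<bar>" using 3 by simp
      ultimately show ?thesis by simp
    qed
  qed
  then show "(max \<bar>x - e\<bar> R) ^ 4 \<le> 3 * max \<bar>x ^ 4 - 2 * a * x ^ 2 - 8 * b * x + a ^ 2 - e * (4 * (x ^ 3 + a * x + b))\<bar>
        (R * (4 * (x ^ 3 + a * x + b)))"
    unfolding f F M_def t_def .
qed


lemma exp10_ge: "exp (10::real) \<ge> 119 / 50 * 9216"
proof -
  have "(2718 / 1000 :: real) \<le> exp 1" using e_approx_32 by (simp add: abs_if split: if_splits)
  then have "(2718 / 1000 :: real) ^ 10 \<le> exp 1 ^ 10" by (rule power_mono) auto
  also have "exp 1 ^ 10 = exp (10::real)" by (simp add: exp_of_nat_mult[symmetric])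
  finally show ?thesis by (simp add: eval_nat_numeral)
qed

text \<open>The middle regime ends at 110592 = 16 * 6912. Up to there K = 880 / 6912 * J satisfies
  K^4 \<le> J^3 * (119/50)^4, which would fail only above about 122000; beyond it |a|^3 > 16
  |\<Delta>|, close enough to a node for \<open>dup_bound_large_j\<close>. The number 119/50 is a
  rational lower bound for exp 10 / 9216.\<close>

theorem dup_bound_exists:
  fixes a b :: int
  assumes D: "4 * a ^ 3 + 27 * b ^ 2 \<noteq> 0"
  defines "J \<equiv> max 1 (6912 * \<bar>real_of_int a\<bar> ^ 3 / \<bar>real_of_int (4 * a ^ 3 + 27 * b ^ 2)\<bar>)"
  obtains x0 R S K :: real where "R > 0" "S \<ge> 1" "K \<ge> 1" "dup_bound (of_int a) (of_int b) x0 R K"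
    "\<And>x. max \<bar>x\<bar> 1 \<le> S * max \<bar>x - x0\<bar> R" "S ^ 12 * K ^ 4 \<le> J ^ 3 * (exp 10 / 9216) ^ 4"
proof -
  define A B where "A = real_of_int a" and "B = real_of_int b"
  define \<Delta> where "\<Delta> = 4 * A ^ 3 + 27 * B ^ 2"
  have \<Delta>eq: "real_of_int (4 * a ^ 3 + 27 * b ^ 2) = \<Delta>" by (simp add: \<Delta>_def A_def B_def)
  have \<Delta>0: "\<Delta> \<noteq> 0" using D unfolding \<Delta>eq[symmetric] of_int_eq_0_iff .
  have int1: "\<bar>real_of_int k\<bar> \<ge> 1" if "k \<noteq> 0" for k using that by linarith
  have \<Delta>1: "\<bar>\<Delta>\<bar> \<ge> 1" using int1[OF D] unfolding \<Delta>eq[symmetric] .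
  have J: "J = max 1 (6912 * \<bar>A\<bar> ^ 3 / \<bar>\<Delta>\<bar>)" unfolding J_def \<Delta>eq A_def ..
  have J1: "J \<ge> 1" by (simp add: J)
  have c: "(119 / 50) ^ 4 \<le> (exp 10 / 9216 :: real) ^ 4"
    by (rule power_mono) (use exp10_ge in auto)
  have fin: "S ^ 12 * K ^ 4 \<le> J ^ 3 * (exp 10 / 9216) ^ 4" if "S ^ 12 * K ^ 4 \<le> J ^ 3 * (119 / 50) ^ 4" for S K
    by (rule order_trans[OF that], rule mult_left_mono[OF c]) (use J1 in simp)
  have A3: "\<bar>A ^ 3\<bar> = \<bar>A\<bar> ^ 3" by (simp add: power_abs)
  consider "\<bar>A\<bar> ^ 3 \<le> B ^ 2" | "B ^ 2 \<le> \<bar>A\<bar> ^ 3" "J \<le> 110592" | "B ^ 2 \<le> \<bar>A\<bar> ^ 3" "J > 110592" by linarith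
  then show ?thesis
  proof cases
    case 1
    have "B \<noteq> 0" using 1 \<Delta>0 by (auto simp: \<Delta>_def)
    define \<beta> where "\<beta> = root 3 \<bar>B\<bar>"
    have \<beta>: "\<beta> > 0" "\<bar>B\<bar> = \<beta> ^ 3" using \<open>B \<noteq> 0\<close> by (auto simp: \<beta>_def)
    have "\<bar>B\<bar> \<ge> 1" using int1[of b] \<open>B \<noteq> 0\<close> by (simp add: B_def)
    then have \<beta>1: "\<beta> \<ge> 1" by (simp add: \<beta>_def)
    have "\<bar>A\<bar> ^ 3 \<le> (\<beta> ^ 2) ^ 3"
    proof -
      have "B ^ 2 = \<bar>B\<bar> ^ 2" by simp
      also have "\<dots> = (\<beta> ^ 2) ^ 3" unfolding \<beta>(2) by (simp add: power_mult[symmetric])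
      finally show ?thesis using 1 by simp
    qed
    then have "\<bar>A\<bar> \<le> \<beta> ^ 2" using power_mono_iff[of "\<bar>A\<bar>" "\<beta> ^ 2" 3] by simp
    from dup_bound_small_j[OF \<beta> this] have "dup_bound A B 0 (4 / 3 * \<beta>) (117 / 50)" .
    moreover have "(1::real) ^ 12 * (117 / 50) ^ 4 \<le> J ^ 3 * (119 / 50) ^ 4"
    proof -
      have "(1::real) ^ 12 * (117 / 50) ^ 4 \<le> 1 * (119 / 50) ^ 4" by (simp add: eval_nat_numeral)
      also have "\<dots> \<le> J ^ 3 * (119 / 50) ^ 4" using J1 by (intro mult_right_mono) auto
      finally show ?thesis .
    qed
    ultimately show ?thesis
      using that[of "4 / 3 * \<beta>" 1 "117 / 50" 0] \<beta>1 fin[of 1 "117 / 50"] unfolding A_def B_def by auto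
  next
    case 2
    have A0: "A \<noteq> 0" using 2 \<Delta>0 by (auto simp: \<Delta>_def)
    have A1: "\<bar>A\<bar> \<ge> 1" using int1[of a] A0 by (simp add: A_def)
    define \<gamma> where "\<gamma> = sqrt \<bar>A\<bar>"
    have \<gamma>: "\<gamma> > 0" "\<bar>A\<bar> = \<gamma> ^ 2" "\<gamma> \<ge> 1" using A0 A1 by (auto simp: \<gamma>_def)
    have g6: "\<bar>A\<bar> ^ 3 = \<gamma> ^ 6" unfolding \<gamma>(2) by (simp add: power_mult[symmetric])
    have "\<bar>B\<bar> ^ 2 \<le> (\<gamma> ^ 3) ^ 2" using 2(1) g6 by (simp add: power_mult[symmetric])
    then have B: "\<bar>B\<bar> \<le> \<gamma> ^ 3" by (rule power2_le_imp_le) (use \<gamma> in auto)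
    have "\<bar>\<Delta>\<bar> \<le> 31 * \<bar>A\<bar> ^ 3" unfolding \<Delta>_def using 2(1) A3 zero_le_power2[of B] by linarith
    then have "6912 / 31 \<le> 6912 * \<bar>A\<bar> ^ 3 / \<bar>\<Delta>\<bar>" using \<Delta>1 by (simp add: field_simps)
    then have J2: "J \<ge> 6912 / 31" "J = 6912 * \<bar>A\<bar> ^ 3 / \<bar>\<Delta>\<bar>" by (auto simp: J)
    define K where "K = max 48 (880 / 6912 * J)"
    have K: "K \<ge> 48" by (simp add: K_def)
    have "880 * \<gamma> ^ 6 \<le> K * \<bar>\<Delta>\<bar>"
    proof -
      have "880 * \<gamma> ^ 6 = (880 / 6912 * J) * \<bar>\<Delta>\<bar>" using J2(2) \<Delta>1 g6 by simp
      also have "\<dots> \<le> K * \<bar>\<Delta>\<bar>" by (intro mult_right_mono) (auto simp: K_def)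
      finally show ?thesis .
    qed
    from dup_bound_medium_j[OF \<gamma>(1,2) B \<Delta>0[unfolded \<Delta>_def] K this[unfolded \<Delta>_def]]
    have "dup_bound A B 0 (47 / 20 * \<gamma>) K" .
    moreover have "1 ^ 12 * K ^ 4 \<le> J ^ 3 * (119 / 50) ^ 4"
    proof (cases "K = 48")
      case True
      have "(6912 / 31) ^ 3 \<le> J ^ 3" by (rule power_mono) (use J2 in auto)
      then have "(6912 / 31) ^ 3 * (119 / 50) ^ 4 \<le> J ^ 3 * (119 / 50) ^ 4" by (intro mult_right_mono) auto
      then show ?thesis using True by (simp add: eval_nat_numeral)
    next
      case False
      then have K': "K = 880 / 6912 * J" by (auto simp: K_def)
      have "K ^ 4 = J ^ 3 * ((880 / 6912) ^ 4 * J)" unfolding K' power_mult_distrib by (simp add: eval_nat_numeral)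
      also have "\<dots> \<le> J ^ 3 * ((880 / 6912) ^ 4 * 110592)" using 2(2) J1 by (intro mult_left_mono) auto
      also have "\<dots> \<le> J ^ 3 * (119 / 50) ^ 4" using J1 by (intro mult_left_mono) (auto simp: eval_nat_numeral)
      finally show ?thesis by simp
    qed
    ultimately show ?thesis
      using that[of "47 / 20 * \<gamma>" 1 K 0] \<gamma> K fin[of 1 K] unfolding A_def B_def by auto
  next
    case 3
    then have J3: "J = 6912 * \<bar>A\<bar> ^ 3 / \<bar>\<Delta>\<bar>" by (auto simp: J max_def split: if_splits)
    then have "J * \<bar>\<Delta>\<bar> = 6912 * \<bar>A\<bar> ^ 3" using \<Delta>1 by simp
    moreover have "110592 * \<bar>\<Delta>\<bar> < J * \<bar>\<Delta>\<bar>" using 3(2) \<Delta>1 by (intro mult_strict_right_mono) auto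
    ultimately have \<Delta>A: "\<bar>A\<bar> ^ 3 > 16 * \<bar>\<Delta>\<bar>" by linarith
    have neg: "A < 0"
    proof (rule ccontr)
      assume "\<not> A < 0"
      then have "\<bar>A\<bar> ^ 3 = A ^ 3" "A ^ 3 \<ge> 0" by auto
      then have "\<bar>\<Delta>\<bar> \<ge> \<bar>A\<bar> ^ 3" unfolding \<Delta>_def using zero_le_power2[of B] by linarith
      with \<Delta>A \<Delta>1 show False by linarith
    qed
    define \<alpha> where "\<alpha> = - A"
    \<comment> \<open>Integrality: \<alpha> \<le> 2 contradicts |a|^3 > 16 |\<Delta>| \<ge> 16. The
      bound later gives |e| \<ge> 2/3, needed for the comparison with 1.\<close>
    have \<alpha>3: "\<alpha> \<ge> 3"
    proof (rule ccontr)
      assume "\<not> \<alpha> \<ge> 3"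
      then have "- a < 3" unfolding \<alpha>_def A_def by linarith
      then have "- a \<le> 2" by simp
      then have "\<alpha> \<le> 2" unfolding \<alpha>_def A_def by linarith
      then have "\<alpha> ^ 3 \<le> 2 ^ 3" using neg by (intro power_mono) (auto simp: \<alpha>_def)
      moreover have "\<bar>A\<bar> = \<alpha>" using neg by (simp add: \<alpha>_def)
      ultimately show False using \<Delta>A \<Delta>1 by simp
    qed
    have aA: "\<bar>A\<bar> = \<alpha>" using neg by (simp add: \<alpha>_def)
    \<comment> \<open>Solution of a = - 3 e^2 + \<eta>, b = 2 e^3 - 2/3 \<eta> e: since 3 e^2 -
      \<eta> = \<alpha>, the second equation reads b = 2/3 \<alpha> e.\<close>
    define e where "e = 3 * B / (2 * \<alpha>)"
    define \<eta> where "\<eta> = \<Delta> / (4 * \<alpha> ^ 2)"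
    have eq1: "A = - 3 * e ^ 2 + \<eta>" and eq2: "B = 2 * e ^ 3 - 2 / 3 * \<eta> * e"
    proof -
      have A: "A = - \<alpha>" by (simp add: \<alpha>_def)
      have \<alpha>0: "\<alpha> \<noteq> 0" using \<alpha>3 by simp
      show "A = - 3 * e ^ 2 + \<eta>" using \<alpha>0 unfolding e_def \<eta>_def \<Delta>_def A
        by (simp add: field_simps eval_nat_numeral)
      then have \<eta>': "\<eta> = 3 * e ^ 2 - \<alpha>" using A by simp
      have "B = 2 / 3 * \<alpha> * e" using \<alpha>0 by (simp add: e_def)
      then show "B = 2 * e ^ 3 - 2 / 3 * \<eta> * e" unfolding \<eta>' by (simp add: eval_nat_numeral algebra_simps)
    qed
    have \<eta>a: "\<bar>\<eta>\<bar> * (4 * \<alpha> ^ 2) = \<bar>\<Delta>\<bar>" using \<alpha>3 by (simp add: \<eta>_def abs_mult)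
    have \<eta>1: "\<bar>\<eta>\<bar> \<le> \<alpha> / 64"
    proof -
      have "\<alpha> ^ 2 * (64 * \<bar>\<eta>\<bar>) \<le> \<alpha> ^ 2 * \<alpha>"
        using \<Delta>A \<eta>a unfolding aA by (simp add: eval_nat_numeral algebra_simps)
      then show ?thesis using \<alpha>3 by (simp add: mult_le_cancel_left)
    qed
    have e2: "3 * e ^ 2 = \<alpha> + \<eta>" using eq1 by (simp add: \<alpha>_def)
    have e2l: "e ^ 2 \<ge> 21 / 64 * \<alpha>" "e ^ 2 \<le> 65 / 192 * \<alpha>" using e2 \<eta>1 by (auto simp: abs_le_iff)
    then have e0: "e \<noteq> 0" using \<alpha>3 by auto
    have \<eta>0: "\<eta> \<noteq> 0" using \<Delta>0 \<alpha>3 by (simp add: \<eta>_def)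
    have \<eta>e: "\<bar>\<eta>\<bar> \<le> e ^ 2 / 21" using \<eta>1 e2l by linarith
    define R where "R = root 4 (\<bar>\<eta>\<bar> * e ^ 2)"
    have pos: "\<bar>\<eta>\<bar> * e ^ 2 > 0" using \<eta>0 e0 by simp
    have R: "R > 0" "R ^ 4 = \<bar>\<eta>\<bar> * e ^ 2" using pos unfolding R_def by (auto simp: less_imp_le)
    have Re: "R \<le> \<bar>e\<bar> / 2"
    proof -
      have "\<bar>\<eta>\<bar> * e ^ 2 \<le> e ^ 2 / 16 * e ^ 2" using \<eta>e e2l \<alpha>3 by (intro mult_right_mono) auto
      also have "\<dots> = (\<bar>e\<bar> / 2) ^ 4" by (simp add: power_divide power_abs eval_nat_numeral)
      finally have "R ^ 4 \<le> (\<bar>e\<bar> / 2) ^ 4" using R by simp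
      then show ?thesis using power_mono_iff[of R "\<bar>e\<bar> / 2" 4] R by simp
    qed
    have db: "dup_bound A B e R 3"
      by (rule dup_bound_large_j[OF e0 eq1 eq2 R Re]) (use \<eta>e zero_le_power2[of e] in linarith)
    \<comment> \<open>Recentring costs a factor of order |e| / R, and (|e| / R)^4 = e^2 / |\<eta>|
      is of order J. So S^12 is of order J^3, which the coefficient 1/8 of the height of j in
      \<open>deltaE\<close> pays for.\<close>
    define S where "S = 3 / 2 * (\<bar>e\<bar> / R)"
    have eR: "\<bar>e\<bar> / R \<ge> 2" using Re R by (simp add: field_simps)
    have S1: "S \<ge> 1" using eR by (simp add: S_def)
    have Sx: "max \<bar>x\<bar> 1 \<le> S * max \<bar>x - e\<bar> R" for x
    proof -
      define m where "m = max \<bar>x - e\<bar> R"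
      have m: "m \<ge> R" "m \<ge> \<bar>x - e\<bar>" by (auto simp: m_def)
      define p where "p = \<bar>e\<bar> / R * m"
      have Sp: "S * m = 3 / 2 * p" by (simp add: S_def p_def)
      have em: "\<bar>e\<bar> \<le> p"
      proof -
        have "\<bar>e\<bar> / R * R \<le> \<bar>e\<bar> / R * m" using m R by (intro mult_left_mono) auto
        then show ?thesis using R by (simp add: p_def)
      qed
      have "1 * m \<le> \<bar>e\<bar> / R / 2 * m" by (rule mult_right_mono) (use Re R(1) m in simp_all)
      then have mp: "m \<le> p / 2" by (simp add: p_def)
      have "\<bar>x\<bar> \<le> \<bar>x - e\<bar> + \<bar>e\<bar>" by linarith
      then have "\<bar>x\<bar> \<le> S * m" using m(2) em mp unfolding Sp by linarith
      moreover have "1 \<le> S * m"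
      proof -
        have "(2 / 3) ^ 2 \<le> \<bar>e\<bar> ^ 2" using e2l \<alpha>3 by (simp add: power2_eq_square)
        then have "2 / 3 \<le> \<bar>e\<bar>" by (rule power2_le_imp_le) auto
        then show ?thesis using em unfolding Sp by linarith
      qed
      ultimately show ?thesis unfolding m_def by simp
    qed
    have "S ^ 12 * 3 ^ 4 \<le> J ^ 3 * (119 / 50) ^ 4"
    proof -
      have "S ^ 4 = 81 / 16 * (e ^ 4 / R ^ 4)" by (simp add: S_def power_mult_distrib power_divide power_abs eval_nat_numeral)
      also have "e ^ 4 / R ^ 4 = e ^ 2 / \<bar>\<eta>\<bar>" using e0 \<eta>0 unfolding R(2) by (simp add: field_simps eval_nat_numeral)
      finally have S4: "S ^ 4 = 81 / 16 * (e ^ 2 / \<bar>\<eta>\<bar>)" .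
      have "J = 6912 * \<alpha> ^ 3 / (\<bar>\<eta>\<bar> * (4 * \<alpha> ^ 2))" using J3 \<eta>a aA by simp
      also have "\<dots> = 1728 * \<alpha> / \<bar>\<eta>\<bar>" using \<alpha>3 \<eta>0 by (simp add: field_simps eval_nat_numeral)
      finally have J4: "J = 1728 * \<alpha> / \<bar>\<eta>\<bar>" .
      have "S ^ 4 \<le> J / 100"
        unfolding S4 J4 using e2l \<alpha>3 \<eta>0 by (simp add: field_simps)
      then have "(S ^ 4) ^ 3 \<le> (J / 100) ^ 3" by (rule power_mono) auto
      then have "S ^ 12 * 3 ^ 4 \<le> (J / 100) ^ 3 * 3 ^ 4" by (intro mult_right_mono) (auto simp: power_mult[symmetric])
      also have "\<dots> = J ^ 3 * (81 / 1000000)" by (simp add: power_divide)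
      also have "\<dots> \<le> J ^ 3 * (119 / 50) ^ 4" using J1 by (intro mult_left_mono) (auto simp: eval_nat_numeral)
      finally show ?thesis .
    qed
    then show ?thesis using that[of R S 3 e] R S1 db Sx fin[of S 3] unfolding A_def B_def by auto
  qed
qed

section \<open>Naive and modified heights\<close>

text \<open>O receives (1, 0), the infinite point of the projective line, so that the homogeneous
  formulas hold for every point.\<close>

definition xfrac :: "ecpt \<Rightarrow> int \<times> int" where
  "xfrac P = (case P of None \<Rightarrow> (1, 0) | Some (x, y) \<Rightarrow> quotient_of x)"

lemma xfrac_None [simp]: "xfrac None = (1, 0)"
  by (simp add: xfrac_def)

lemma xfrac_Some: "xfrac (Some (x, y)) = (A, Z) \<Longrightarrow> x = of_int A / of_int Z \<and> Z > 0"
  by (auto simp: xfrac_def quotient_of_div quotient_of_denom_pos)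

lemma xfrac_coprime: "xfrac P = (A, Z) \<Longrightarrow> coprime A Z"
  by (auto simp: xfrac_def quotient_of_coprime split: option.splits)

lemma xfrac_nonneg: "xfrac P = (A, Z) \<Longrightarrow> Z \<ge> 0"
  by (auto simp: xfrac_def split: option.splits dest: quotient_of_denom_pos)

lemma xfrac_neg [simp]: "xfrac (ec_neg P) = xfrac P"
  by (cases P) (auto simp: xfrac_def)

lemma xfrac_max_ge_1: "xfrac P = (A, Z) \<Longrightarrow> max \<bar>A\<bar> \<bar>Z\<bar> \<ge> 1"
  using xfrac_coprime[of P A Z] by (cases "Z = 0") auto

lemma hW_pt_xfrac: "xfrac P = (A, Z) \<Longrightarrow> hW_pt P = ln (real_of_int (max \<bar>A\<bar> \<bar>Z\<bar>))"
  by (cases P) (auto simp: xfrac_def hW_pt_def hW_rat_def)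

lemma hW_pt_nonneg: "hW_pt P \<ge> 0"
proof -
  obtain A Z where "xfrac P = (A, Z)" by fastforce
  then show ?thesis using hW_pt_xfrac xfrac_max_ge_1[of P A Z] by (simp del: of_int_max)
qed

lemma hW_pt_neg [simp]: "hW_pt (ec_neg P) = hW_pt P"
  by (cases P) (auto simp: hW_pt_def)

lemma xfrac_scale:
  assumes "xfrac (Some (x, y)) = (A, Z)" "x = of_int F / of_int G" "G > 0"
  obtains g where "g > 0" "F = g * A" "G = g * Z"
proof -
  have x: "x = of_int A / of_int Z" and Z: "Z > 0" using xfrac_Some[OF assms(1)] by auto
  have "rat_of_int (A * G) = rat_of_int (F * Z)"
    using x assms(2,3) Z by (simp add: field_simps)
  then have eq: "A * G = F * Z" by linarith
  then have "Z dvd A * G" by simp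
  with xfrac_coprime[OF assms(1)] have "Z dvd G" by (simp add: coprime_commute coprime_dvd_mult_right_iff)
  then obtain g where "G = Z * g" by (elim dvdE)
  then have g: "G = g * Z" by simp
  moreover have "g > 0" using g assms(3) Z by (simp add: zero_less_mult_iff)
  moreover have "F = g * A" using eq g Z by (simp add: mult.commute mult.left_commute)
  ultimately show ?thesis using that by blast
qed

lemma dup_rational:
  fixes x :: "'a :: field_char_0" and A Z a b :: int
  assumes "x = of_int A / of_int Z" "Z > 0"
  shows "of_int (dupF a b A Z) = of_int Z ^ 4 * (x ^ 4 - 2 * of_int a * x ^ 2 - 8 * of_int b * x + of_int a ^ 2)"
    "of_int (dupG a b A Z) = of_int Z ^ 4 * (4 * (x ^ 3 + of_int a * x + of_int b))"
proof -
  have A: "of_int A = x * of_int Z" using assms by simp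
  show "of_int (dupF a b A Z) = of_int Z ^ 4 * (x ^ 4 - 2 * of_int a * x ^ 2 - 8 * of_int b * x + of_int a ^ 2)"
    "of_int (dupG a b A Z) = of_int Z ^ 4 * (4 * (x ^ 3 + of_int a * x + of_int b))"
    unfolding dupF_def dupG_def of_int_add of_int_diff of_int_mult of_int_power of_int_numeral A by Groebner_Basis.algebra+
qed

lemma xfrac_double:
  assumes D: "4 * a ^ 3 + 27 * b ^ 2 \<noteq> (0::int)" and on: "on_curve a b P"
    and xf: "xfrac P = (A, Z)" "xfrac (ec_add a P P) = (A', Z')"
  obtains g where "g > 0" "dupF a b A Z = g * A'" "dupG a b A Z = g * Z'"
proof (cases P)
  case None
  then show ?thesis using xf that[of 1] by (auto simp: dupF_def dupG_def)
next
  case (Some p)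
  then obtain x y where P: "P = Some (x, y)" by fastforce
  have x: "x = of_int A / of_int Z" and Z: "Z > 0" using xfrac_Some xf(1) P by auto
  have y: "y ^ 2 = x ^ 3 + of_int a * x + of_int b" using on P by simp
  note dup = dup_rational[OF x Z, of a b]
  show ?thesis
  proof (cases "y = 0")
    case True
    then have "(A', Z') = (1, 0)" using xf(2) P by (simp add: ec_add_def)
    moreover have "rat_of_int (dupG a b A Z) = 0" unfolding dup(2) y[symmetric] using True by simp
    then have "dupG a b A Z = 0" by simp
    \<comment> \<open>At a point of order 2 the numerator is the square of the derivative of the
      cubic, nonzero by nonsingularity; so g = F and G = 0.\<close>
    moreover have "x ^ 4 - 2 * of_int a * x ^ 2 - 8 * of_int b * x + of_int a ^ 2 = (3 * x ^ 2 + of_int a) ^ 2"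
      using y True by Groebner_Basis.algebra
    moreover have "3 * x ^ 2 + of_int a \<noteq> 0" using curve_nonsingular[OF D] y True by simp
    ultimately have "rat_of_int (dupF a b A Z) > 0" unfolding dup(1) using Z by simp
    then have "dupF a b A Z > 0" by simp
    then show ?thesis using that[of "dupF a b A Z"] \<open>(A', Z') = (1, 0)\<close> \<open>dupG a b A Z = 0\<close> by simp
  next
    case False
    obtain m c x3 where c: "ec_add a P P = Some (x3, - (m * x3 + c))" "y = m * x + c" "chord a b m c x x x3"
      by (rule ec_add_chord[of a b x y x y]) (use P on False in auto)
    define N where "N = x ^ 4 - 2 * of_int a * x ^ 2 - 8 * of_int b * x + of_int a ^ 2"
    have "x3 * (4 * y ^ 2) = N"
      using c(2,3) y unfolding chord_def N_def by Groebner_Basis.algebra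
    moreover have "4 * y ^ 2 \<noteq> 0" using False by simp
    ultimately have "x3 = N / (4 * y ^ 2)" by (metis nonzero_eq_divide_eq)
    then have "x3 = rat_of_int (dupF a b A Z) / rat_of_int (dupG a b A Z)"
      unfolding dup y[symmetric] N_def[symmetric] using Z by simp
    moreover have "rat_of_int (dupG a b A Z) > 0" unfolding dup(2) y[symmetric] using Z False by simp
    then have "dupG a b A Z > 0" by simp
    ultimately show ?thesis using xfrac_scale[of x3 _ A' Z'] xf(2) c(1) that by metis
  qed
qed

section \<open>The height with modified local terms\<close>

definition proj_sup :: "real \<Rightarrow> real \<Rightarrow> int \<Rightarrow> int \<Rightarrow> real" where
  "proj_sup x0 R A Z = max \<bar>of_int A - x0 * of_int Z\<bar> (R * \<bar>of_int Z\<bar>)"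

definition mod_height :: "int \<Rightarrow> int \<Rightarrow> real \<Rightarrow> real \<Rightarrow> int \<Rightarrow> int \<Rightarrow> real" where
  "mod_height a b x0 R A Z = ln (proj_sup x0 R A Z) - ln (of_int (content_six a b A Z)) / 6"

lemma proj_sup_pos: "R > 0 \<Longrightarrow> A \<noteq> 0 \<or> Z \<noteq> 0 \<Longrightarrow> proj_sup x0 R A Z > 0"
  by (cases "Z = 0") (auto simp: proj_sup_def less_max_iff_disj)

lemma content_six_pos:
  "4 * a ^ 3 + 27 * b ^ 2 \<noteq> 0 \<Longrightarrow> A \<noteq> 0 \<or> Z \<noteq> 0 \<Longrightarrow> content_six a b A Z > 0"
  using twist_gcd_nonzero[of a b] by (auto simp: content_six_def)

text \<open>The product formula. It lets the height of 2 P be evaluated on the unreduced pair (F,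
  G), to which the local estimates apply.\<close>

lemma mod_height_scale:
  assumes "g > 0" "R > 0" "A \<noteq> 0 \<or> Z \<noteq> 0" "4 * a ^ 3 + 27 * b ^ 2 \<noteq> 0"
  shows "mod_height a b x0 R (g * A) (g * Z) = mod_height a b x0 R A Z"
proof -
  have "proj_sup x0 R (g * A) (g * Z) = of_int g * proj_sup x0 R A Z"
  proof -
    have "\<bar>of_int (g * A) - x0 * of_int (g * Z)\<bar> = of_int g * \<bar>of_int A - x0 * of_int Z\<bar>"
    proof -
      have "of_int (g * A) - x0 * of_int (g * Z) = of_int g * (of_int A - x0 * of_int Z)" by (simp add: algebra_simps)
      then show ?thesis using assms(1) by (simp add: abs_mult)
    qed
    then show ?thesis using assms(1) by (simp add: proj_sup_def abs_mult max_mult_distrib_left mult.left_commute)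
  qed
  moreover have "content_six a b (g * A) (g * Z) = g ^ 6 * content_six a b A Z"
  proof -
    have eq: "twist_gcd a b * (g * Z) ^ 6 = g ^ 6 * (twist_gcd a b * Z ^ 6)" by (simp add: power_mult_distrib)
    show ?thesis using assms(1) unfolding content_six_def eq power_mult_distrib[of g A]
      by (simp add: gcd_mult_left)
  qed
  moreover have "ln (real_of_int g ^ 6) = 6 * ln (real_of_int g)" using assms(1) by (simp add: ln_realpow)
  ultimately show ?thesis
    using assms proj_sup_pos[OF assms(2,3), of x0] content_six_pos[OF assms(4,3)]
    by (simp add: mod_height_def ln_mult add_divide_distrib)
qed

lemma mod_height_double:
  assumes D: "4 * a ^ 3 + 27 * b ^ 2 \<noteq> (0::int)" and on: "on_curve a b P"
    and db: "R > 0" "K \<ge> 1" "dup_bound (of_int a) (of_int b) x0 R K"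
    and xf: "xfrac P = (A, Z)" "xfrac (ec_add a P P) = (A', Z')"
  shows "mod_height a b x0 R A' Z' \<ge> 4 * mod_height a b x0 R A Z - ln K
    - ln (4 * \<bar>of_int (4 * a ^ 3 + 27 * b ^ 2)\<bar>) + ln (of_int (twist_gcd a b)) + ln (of_int (three_gain a b))"
proof -
  define F G where "F = dupF a b A Z" and "G = dupG a b A Z"
  define \<Delta> where "\<Delta> = 4 * a ^ 3 + 27 * b ^ 2"
  obtain g where g: "g > 0" "F = g * A'" "G = g * Z'"
    using xfrac_double[OF D on xf] unfolding F_def G_def by blast
  have AZ': "A' \<noteq> 0 \<or> Z' \<noteq> 0" using xfrac_max_ge_1[OF xf(2)] by auto
  have AZ: "A \<noteq> 0 \<or> Z \<noteq> 0" using xfrac_max_ge_1[OF xf(1)] by auto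
  have FG: "F \<noteq> 0 \<or> G \<noteq> 0" using g AZ' by auto
  have M: "proj_sup x0 R A Z ^ 4 \<le> K * proj_sup x0 R F G"
  proof (cases P)
    case None
    then show ?thesis using xf(1) db(2) by (simp add: F_def G_def dupF_def dupG_def proj_sup_def)
  next
    case (Some p)
    then obtain x y where P: "P = Some (x, y)" by fastforce
    have x: "x = of_int A / of_int Z" and Z: "Z > 0" using xfrac_Some xf(1) P by auto
    define X where "X = real_of_rat x"
    have X: "X = of_int A / of_int Z" by (simp add: X_def x of_rat_divide)
    have fX: "X ^ 3 + of_int a * X + of_int b = (of_rat y)\<^sup>2"
    proof -
      have "y ^ 2 = x ^ 3 + of_int a * x + of_int b" using on P by simp
      then have "real_of_rat (y ^ 2) = of_rat (x ^ 3 + of_int a * x + of_int b)" by simp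
      then show ?thesis by (simp add: X_def of_rat_add of_rat_mult of_rat_power)
    qed
    define F' where "F' = X ^ 4 - 2 * of_int a * X ^ 2 - 8 * of_int b * X + of_int a ^ 2"
    define f where "f = X ^ 3 + of_int a * X + of_int b"
    have F: "real_of_int F = of_int Z ^ 4 * F'" and G: "real_of_int G = of_int Z ^ 4 * (4 * f)"
      unfolding F_def G_def F'_def f_def by (rule dup_rational[OF X Z])+
    have f0: "f \<ge> 0" unfolding f_def fX by simp
    have "proj_sup x0 R A Z = of_int Z * max \<bar>X - x0\<bar> R"
    proof -
      have "of_int A - x0 * of_int Z = of_int Z * (X - x0)" using Z by (simp add: X field_simps)
      then have "\<bar>of_int A - x0 * of_int Z\<bar> = of_int Z * \<bar>X - x0\<bar>" using Z by (simp add: abs_mult)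
      then show ?thesis using Z by (simp add: proj_sup_def max_mult_distrib_left mult.commute)
    qed
    then have "proj_sup x0 R A Z ^ 4 = of_int Z ^ 4 * (max \<bar>X - x0\<bar> R) ^ 4" by (simp add: power_mult_distrib)
    also have "\<dots> \<le> of_int Z ^ 4 * (K * max \<bar>F' - x0 * (4 * f)\<bar> (R * (4 * f)))"
      using db(3) f0 Z unfolding dup_bound_def F'_def f_def by (intro mult_left_mono) auto
    also have "\<dots> = K * proj_sup x0 R F G"
    proof -
      have e1: "\<bar>of_int F - x0 * of_int G\<bar> = of_int Z ^ 4 * \<bar>F' - x0 * (4 * f)\<bar>"
      proof -
        have "of_int F - x0 * of_int G = of_int Z ^ 4 * (F' - x0 * (4 * f))" by (simp add: F G algebra_simps)
        then show ?thesis using Z by (simp add: abs_mult)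
      qed
      have e2: "R * \<bar>of_int G\<bar> = of_int Z ^ 4 * (R * (4 * f))" using f0 Z by (simp add: G abs_mult)
      have e3: "max (of_int Z ^ 4 * p) (of_int Z ^ 4 * q) = of_int Z ^ 4 * max p q" for p q :: real
        using Z by (simp add: max_mult_distrib_left)
      show ?thesis unfolding proj_sup_def e1 e2 e3 by (rule mult.left_commute)
    qed
    finally show ?thesis .
  qed
  have pos: "proj_sup x0 R A Z > 0" "proj_sup x0 R F G > 0" using proj_sup_pos db(1) AZ FG by blast+
  have "4 * ln (proj_sup x0 R A Z) = ln (proj_sup x0 R A Z ^ 4)" using pos by (simp add: ln_realpow)
  also have "\<dots> \<le> ln (K * proj_sup x0 R F G)" using M pos db(2) by simp
  also have "\<dots> = ln K + ln (proj_sup x0 R F G)" using pos db(2) by (simp add: ln_mult)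
  finally have 1: "4 * ln (proj_sup x0 R A Z) \<le> ln K + ln (proj_sup x0 R F G)" .
  define h where "h = twist_gcd a b"
  define \<sigma> where "\<sigma> = three_gain a b"
  have h: "h > 0" using twist_gcd_nonzero[OF D] by (auto simp: h_def twist_gcd_def)
  have \<sigma>: "\<sigma> > 0" by (simp add: \<sigma>_def three_gain_def)
  have n: "content_six a b A Z > 0" "content_six a b F G > 0" using content_six_pos[OF D] AZ FG by blast+
  have \<Delta>: "\<Delta> \<noteq> 0" using D by (simp add: \<Delta>_def)
  have "content_six a b F G * (h * \<sigma>) ^ 6 dvd content_six a b A Z ^ 4 * (4 * \<Delta>) ^ 6"
    unfolding F_def G_def h_def \<sigma>_def \<Delta>_def
    by (rule dup_content_dvd[OF D xfrac_coprime[OF xf(1)]]) (use FG in \<open>auto simp: F_def G_def\<close>)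
  then have "content_six a b F G * (h * \<sigma>) ^ 6 \<le> content_six a b A Z ^ 4 * (4 * \<Delta>) ^ 6"
    using n \<Delta> by (intro zdvd_imp_le) auto
  then have "real_of_int (content_six a b F G * (h * \<sigma>) ^ 6) \<le> real_of_int (content_six a b A Z ^ 4 * (4 * \<Delta>) ^ 6)"
    by (simp only: of_int_le_iff)
  also have "real_of_int (content_six a b A Z ^ 4 * (4 * \<Delta>) ^ 6) = of_int (content_six a b A Z) ^ 4 * (4 * \<bar>of_int \<Delta>\<bar>) ^ 6"
    by (simp add: power_mult_distrib power_even_abs_numeral)
  finally have "real_of_int (content_six a b F G) * (of_int h * of_int \<sigma>) ^ 6 \<le> of_int (content_six a b A Z) ^ 4 * (4 * \<bar>of_int \<Delta>\<bar>) ^ 6"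
    by simp
  then have le: "ln (real_of_int (content_six a b F G) * (of_int h * of_int \<sigma>) ^ 6) \<le> ln (of_int (content_six a b A Z) ^ 4 * (4 * \<bar>of_int \<Delta>\<bar>) ^ 6)"
    using n h \<sigma> \<Delta> by (subst ln_le_cancel_iff) auto
  then have 2: "ln (real_of_int (content_six a b F G)) + 6 * (ln (of_int h) + ln (of_int \<sigma>)) \<le>
      4 * ln (of_int (content_six a b A Z)) + 6 * ln (4 * \<bar>real_of_int \<Delta>\<bar>)"
  proof -
    have "ln (c * (p * q) ^ 6) = ln c + 6 * (ln p + ln q)" if "c > 0" "p > 0" "q > 0" for c p q :: real
      using that by (simp add: ln_mult ln_realpow)
    moreover have "ln (c ^ 4 * p ^ 6) = 4 * ln c + 6 * ln p" if "c > 0" "p > 0" for c p :: real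
      using that by (simp add: ln_mult ln_realpow)
    moreover have "4 * \<bar>real_of_int \<Delta>\<bar> > 0" using \<Delta> by simp
    ultimately show ?thesis
      using n h \<sigma> le by (metis of_int_0_less_iff)
  qed
  have "mod_height a b x0 R A' Z' = mod_height a b x0 R F G"
    unfolding g(2,3) by (rule mod_height_scale[symmetric, OF g(1) db(1) AZ' D])
  then show ?thesis using 1 2 unfolding mod_height_def h_def[symmetric] \<sigma>_def[symmetric] \<Delta>_def[symmetric] by argo
qed

text \<open>This direction enters the final constant: S is the cost at the real place, and
  \<open>content_six\<close> divides h because it is coprime to Z. The reverse comparison that
  follows may be crude, as its error only has to be bounded.\<close>

lemma hW_pt_le_mod_height:
  assumes D: "4 * a ^ 3 + 27 * b ^ 2 \<noteq> (0::int)" and xf: "xfrac P = (A, Z)"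
    and S: "S \<ge> 1" "R > 0" "\<And>x. max \<bar>x\<bar> 1 \<le> S * max \<bar>x - x0\<bar> R"
  shows "hW_pt P \<le> mod_height a b x0 R A Z + ln S + ln (of_int (twist_gcd a b)) / 6"
proof -
  have AZ: "A \<noteq> 0 \<or> Z \<noteq> 0" using xfrac_max_ge_1[OF xf] by auto
  have h: "twist_gcd a b > 0" using twist_gcd_nonzero[OF D] by (auto simp: twist_gcd_def)
  have pos: "proj_sup x0 R A Z > 0" using proj_sup_pos S(2) AZ by blast
  have "content_six a b A Z dvd twist_gcd a b"
  proof -
    have "coprime (content_six a b A Z) (Z ^ 6)"
      using xfrac_coprime[OF xf] by (auto simp: content_six_def intro: coprime_divisors[of _ "A ^ 6" _ "Z ^ 6"])
    moreover have "content_six a b A Z dvd twist_gcd a b * Z ^ 6" by (simp add: content_six_def)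
    ultimately show ?thesis by (simp add: coprime_dvd_mult_left_iff)
  qed
  then have "content_six a b A Z \<le> twist_gcd a b" using h by (rule zdvd_imp_le)
  then have n: "ln (real_of_int (content_six a b A Z)) \<le> ln (of_int (twist_gcd a b))"
    using content_six_pos[OF D AZ] by simp
  have "real_of_int (max \<bar>A\<bar> \<bar>Z\<bar>) \<le> S * proj_sup x0 R A Z"
  proof (cases "Z = 0")
    case True
    then show ?thesis using S(1) by (auto simp: proj_sup_def intro: mult_right_mono[of 1 S "\<bar>of_int A\<bar>", simplified])
  next
    case False
    then have Z: "Z > 0" using xfrac_nonneg[OF xf] by simp
    have "max \<bar>real_of_int A\<bar> \<bar>of_int Z\<bar> = of_int Z * max \<bar>of_int A / of_int Z\<bar> 1"
      using Z by (simp add: max_mult_distrib_left)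
    also have "\<dots> \<le> of_int Z * (S * max \<bar>of_int A / of_int Z - x0\<bar> R)"
      by (rule mult_left_mono[OF S(3)]) (use Z in simp)
    also have "\<dots> = S * proj_sup x0 R A Z"
    proof -
      have "of_int A - x0 * of_int Z = of_int Z * (of_int A / of_int Z - x0)" using Z by (simp add: field_simps)
      then have "\<bar>of_int A - x0 * of_int Z\<bar> = of_int Z * \<bar>of_int A / of_int Z - x0\<bar>" using Z by (simp add: abs_mult)
      moreover have "max (of_int Z * p) (R * \<bar>of_int Z\<bar>) = of_int Z * max p R" for p
        using Z by (simp add: max_mult_distrib_left mult.commute)
      ultimately show ?thesis unfolding proj_sup_def by simp
    qed
    finally show ?thesis by (simp add: of_int_max)
  qed
  then have "hW_pt P \<le> ln (S * proj_sup x0 R A Z)"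
    unfolding hW_pt_xfrac[OF xf] using xfrac_max_ge_1[OF xf] pos S(1) by (subst ln_le_cancel_iff) (auto simp del: of_int_max)
  also have "\<dots> = ln S + ln (proj_sup x0 R A Z)" using S(1) pos by (simp add: ln_mult)
  finally show ?thesis using n unfolding mod_height_def by linarith
qed

lemma mod_height_le_hW_pt:
  assumes D: "4 * a ^ 3 + 27 * b ^ 2 \<noteq> (0::int)" and xf: "xfrac P = (A, Z)" and R: "R > 0"
  shows "mod_height a b x0 R A Z \<le> hW_pt P + ln (1 + \<bar>x0\<bar> + R)"
proof -
  have AZ: "A \<noteq> 0 \<or> Z \<noteq> 0" using xfrac_max_ge_1[OF xf] by auto
  have pos: "proj_sup x0 R A Z > 0" using proj_sup_pos R AZ by blast
  define M where "M = real_of_int (max \<bar>A\<bar> \<bar>Z\<bar>)"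
  have M: "\<bar>of_int A\<bar> \<le> M" "\<bar>of_int Z\<bar> \<le> M" "M \<ge> 1"
    using xfrac_max_ge_1[OF xf] by (auto simp: M_def simp del: of_int_abs)
  have 1: "\<bar>x0\<bar> * \<bar>of_int Z\<bar> \<le> \<bar>x0\<bar> * M" "R * \<bar>of_int Z\<bar> \<le> R * M" using M R by (auto intro!: mult_left_mono)
  have "\<bar>of_int A - x0 * of_int Z\<bar> \<le> \<bar>of_int A\<bar> + \<bar>x0\<bar> * \<bar>of_int Z\<bar>" by (simp add: abs_mult[symmetric])
  moreover have "R * M > 0" "\<bar>x0\<bar> * M \<ge> 0" using R M by auto
  ultimately have "proj_sup x0 R A Z \<le> (1 + \<bar>x0\<bar> + R) * M"
  proof -
    have "(1 + \<bar>x0\<bar> + R) * M = M + \<bar>x0\<bar> * M + R * M" by (simp add: algebra_simps)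
    then show ?thesis using M 1 \<open>\<bar>of_int A - x0 * of_int Z\<bar> \<le> \<bar>of_int A\<bar> + \<bar>x0\<bar> * \<bar>of_int Z\<bar>\<close>
        \<open>R * M > 0\<close> \<open>\<bar>x0\<bar> * M \<ge> 0\<close> unfolding proj_sup_def max.bounded_iff by linarith
  qed
  then have "ln (proj_sup x0 R A Z) \<le> ln ((1 + \<bar>x0\<bar> + R) * M)" using pos by (simp add: ln_le_cancel_iff)
  also have "\<dots> = ln (1 + \<bar>x0\<bar> + R) + ln M" using M R by (subst ln_mult) auto
  also have "ln M = hW_pt P" using hW_pt_xfrac[OF xf] by (simp add: M_def)
  finally have "ln (proj_sup x0 R A Z) \<le> ln (1 + \<bar>x0\<bar> + R) + hW_pt P" .
  moreover have "ln (real_of_int (content_six a b A Z)) \<ge> 0" using content_six_pos[OF D AZ] by simp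
  ultimately show ?thesis unfolding mod_height_def by linarith
qed

section \<open>The canonical height\<close>

definition ec_group :: "int \<Rightarrow> int \<Rightarrow> ecpt monoid" where
  "ec_group a b = \<lparr>carrier = {P. on_curve a b P}, monoid.mult = ec_add a, one = None\<rparr>"

lemma carrier_ec_group: "P \<in> carrier (ec_group a b) \<longleftrightarrow> on_curve a b P"
  by (simp add: ec_group_def)

lemma mult_ec_group: "P \<otimes>\<^bsub>ec_group a b\<^esub> Q = ec_add a P Q"
  by (simp add: ec_group_def)

lemma one_ec_group: "\<one>\<^bsub>ec_group a b\<^esub> = None"
  by (simp add: ec_group_def)

section \<open>Tate's limit, and products of linear forms\<close>

lemma tate_limit:
  fixes s :: "nat \<Rightarrow> real"
  assumes "\<And>k. \<bar>s (Suc k) - 4 * s k\<bar> \<le> C"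
  shows "convergent (\<lambda>k. s k / 4 ^ k)" "\<bar>lim (\<lambda>k. s k / 4 ^ k) - s 0\<bar> \<le> C / 3"
proof -
  define t where "t k = s k / 4 ^ k" for k
  have step: "\<bar>t (Suc k) - t k\<bar> \<le> C / 4 * (1 / 4) ^ k" for k
  proof -
    have "t (Suc k) - t k = (s (Suc k) - 4 * s k) / 4 ^ Suc k" by (simp add: t_def field_simps)
    then have "\<bar>t (Suc k) - t k\<bar> = \<bar>s (Suc k) - 4 * s k\<bar> / 4 ^ Suc k" by (simp add: abs_divide)
    also have "\<dots> \<le> C / 4 ^ Suc k" using assms by (intro divide_right_mono) auto
    finally show ?thesis by (simp add: field_simps)
  qed
  have geo: "(\<lambda>k. C / 4 * (1 / 4) ^ k) sums (C / 4 * (1 / (1 - 1 / 4)))"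
    by (intro sums_mult geometric_sums) auto
  have summ: "summable (\<lambda>k. \<bar>t (Suc k) - t k\<bar>)"
    by (rule summable_comparison_test'[OF sums_summable[OF geo]]) (use step in auto)
  then have summ': "summable (\<lambda>k. t (Suc k) - t k)" by (rule summable_rabs_cancel)
  then have "(\<lambda>n. \<Sum>k<n. t (Suc k) - t k) \<longlonglongrightarrow> (\<Sum>k. t (Suc k) - t k)" by (rule summable_LIMSEQ)
  then have "(\<lambda>n. t n - t 0) \<longlonglongrightarrow> (\<Sum>k. t (Suc k) - t k)" by (simp add: sum_lessThan_telescope)
  then have lim: "t \<longlonglongrightarrow> (\<Sum>k. t (Suc k) - t k) + t 0"
    using tendsto_add[OF _ tendsto_const[of "t 0"]] by fastforce
  then show "convergent (\<lambda>k. s k / 4 ^ k)" unfolding t_def[symmetric] convergent_def by blast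
  have "\<bar>\<Sum>k. t (Suc k) - t k\<bar> \<le> (\<Sum>k. \<bar>t (Suc k) - t k\<bar>)" by (rule summable_rabs[OF summ])
  also have "\<dots> \<le> (\<Sum>k. C / 4 * (1 / 4) ^ k)" by (rule suminf_le[OF step summ sums_summable[OF geo]])
  also have "\<dots> = C / 3" using sums_unique[OF geo] by simp
  finally have "\<bar>lim t - t 0\<bar> \<le> C / 3" using limI[OF lim] by simp
  moreover have "t = (\<lambda>k. s k / 4 ^ k)" "t 0 = s 0" by (auto simp: t_def)
  ultimately show "\<bar>lim (\<lambda>k. s k / 4 ^ k) - s 0\<bar> \<le> C / 3" by simp
qed

text \<open>One-sided, because only the lower duplication estimate has a sharp constant, and only
  that one enters the comparison of heights.\<close>

lemma tate_limit_ge: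
  fixes s :: "nat \<Rightarrow> real"
  assumes step: "\<And>k. s (Suc k) \<ge> 4 * s k - C" and lim: "(\<lambda>k. s k / 4 ^ k) \<longlonglongrightarrow> l"
  shows "s 0 - C / 3 \<le> l"
proof -
  have "s k / 4 ^ k \<ge> s 0 - C / 3 + C / 3 / 4 ^ k" for k
  proof (induction k)
    case (Suc k)
    have "s 0 - C / 3 + C / 3 / 4 ^ Suc k \<le> (4 * s k - C) / 4 ^ Suc k"
      using Suc.IH by (simp add: field_simps)
    also have "\<dots> \<le> s (Suc k) / 4 ^ Suc k" using step[of k] by (intro divide_right_mono) auto
    finally show ?case .
  qed simp
  moreover have "(\<lambda>k. s 0 - C / 3 + C / 3 / 4 ^ k) \<longlonglongrightarrow> s 0 - C / 3 + 0"
    by (intro tendsto_add tendsto_const LIMSEQ_divide_realpow_zero) simp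
  ultimately show ?thesis using lim by (intro LIMSEQ_le) auto
qed

text \<open>Gauss's lemma: the product of the primitive linear forms with coefficients (Z3, A3) and
  (Z4, A4) is primitive.\<close>

lemma coprime_sym_product_dvd:
  fixes A3 Z3 A4 Z4 N :: int
  assumes "coprime A3 Z3" "coprime A4 Z4"
    and "Z3 * Z4 dvd N * (A3 * Z4 + A4 * Z3)" "Z3 * Z4 dvd N * (A3 * A4)"
  shows "Z3 * Z4 dvd N"
proof -
  have "coprime (Z3 * Z4) (gcd (A3 * Z4 + A4 * Z3) (A3 * A4))"
  proof (rule coprimeI)
    fix c assume c: "c dvd Z3 * Z4" "c dvd gcd (A3 * Z4 + A4 * Z3) (A3 * A4)"
    show "is_unit c"
    proof (rule ccontr)
      assume nu: "\<not> is_unit c"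
      have "c \<noteq> 0"
      proof
        assume "c = 0"
        with c have "Z3 * Z4 = 0" "A3 * A4 = 0" "A3 * Z4 + A4 * Z3 = 0" by auto
        with assms(1,2) show False by auto
      qed
      then obtain p where p: "prime p" "p dvd c" using prime_divisor_exists nu by blast
      have cop: "\<not> (p dvd x \<and> p dvd y)" if "coprime x y" for x y
        using that p(1) by (meson coprime_common_divisor not_prime_unit)
      have d: "p dvd Z3 * Z4" "p dvd A3 * Z4 + A4 * Z3" "p dvd A3 * A4"
        using c p(2) by (auto intro: dvd_trans)
      from d(1) p(1) have "p dvd Z3 \<or> p dvd Z4" by (simp add: prime_dvd_mult_iff)
      then show False
      proof
        assume z: "p dvd Z3"
        then have "\<not> p dvd A3" using cop assms(1) by blast
        then have "p dvd A4" using d(3) p(1) by (simp add: prime_dvd_mult_iff)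
        then have "\<not> p dvd Z4" using cop assms(2) by blast
        moreover have "p dvd A3 * Z4" using d(2) z by (metis dvd_add_left_iff dvd_mult)
        ultimately show False using \<open>\<not> p dvd A3\<close> p(1) by (simp add: prime_dvd_mult_iff)
      next
        assume z: "p dvd Z4"
        then have "\<not> p dvd A4" using cop assms(2) by blast
        then have "p dvd A3" using d(3) p(1) by (simp add: prime_dvd_mult_iff)
        then have "\<not> p dvd Z3" using cop assms(1) by blast
        moreover have "p dvd A4 * Z3" using d(2) z by (metis dvd_add_right_iff dvd_mult)
        ultimately show False using \<open>\<not> p dvd A4\<close> p(1) by (simp add: prime_dvd_mult_iff)
      qed
    qed
  qed
  moreover have "Z3 * Z4 dvd gcd (N * (A3 * Z4 + A4 * Z3)) (N * (A3 * A4))" using assms(3,4) by simp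
  then have "Z3 * Z4 dvd N * gcd (A3 * Z4 + A4 * Z3) (A3 * A4)"
    by (simp add: gcd_mult_left)
  ultimately show ?thesis by (simp add: coprime_dvd_mult_left_iff)
qed

text \<open>Heights of two linear forms against the height of their product. If the dominant
  coefficients sit at opposite ends, their product is recovered from the middle coefficient, at the
  price of the factor 2.\<close>

lemma max_mult_max_le:
  fixes A3 Z3 A4 Z4 :: int
  shows "max \<bar>A3\<bar> \<bar>Z3\<bar> * max \<bar>A4\<bar> \<bar>Z4\<bar> \<le> 2 * max \<bar>A3 * A4\<bar> (max \<bar>Z3 * Z4\<bar> \<bar>A3 * Z4 + A4 * Z3\<bar>)"
proof -
  define m where "m = max \<bar>A3 * A4\<bar> (max \<bar>Z3 * Z4\<bar> \<bar>A3 * Z4 + A4 * Z3\<bar>)"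
  have m: "\<bar>A3 * A4\<bar> \<le> m" "\<bar>Z3 * Z4\<bar> \<le> m" "\<bar>A3 * Z4 + A4 * Z3\<bar> \<le> m" by (auto simp: m_def)
  have cross: "\<bar>A * Z'\<bar> \<le> 2 * m" if "\<bar>Z\<bar> \<le> \<bar>A\<bar>" "\<bar>A' * Z + A * Z'\<bar> \<le> m" "\<bar>A * A'\<bar> \<le> m" for A Z A' Z' :: int
  proof -
    have "\<bar>A' * Z\<bar> \<le> \<bar>A * A'\<bar>" using that(1) by (simp add: abs_mult mult.commute mult_left_mono)
    then show ?thesis using that(2,3) by linarith
  qed
  consider "\<bar>A3\<bar> \<ge> \<bar>Z3\<bar>" "\<bar>A4\<bar> \<ge> \<bar>Z4\<bar>" | "\<bar>A3\<bar> \<ge> \<bar>Z3\<bar>" "\<bar>A4\<bar> \<le> \<bar>Z4\<bar>" | "\<bar>A3\<bar> \<le> \<bar>Z3\<bar>" "\<bar>A4\<bar> \<ge> \<bar>Z4\<bar>"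
    | "\<bar>A3\<bar> \<le> \<bar>Z3\<bar>" "\<bar>A4\<bar> \<le> \<bar>Z4\<bar>" by linarith
  then show ?thesis unfolding m_def[symmetric]
  proof cases
    case 1
    then have "max \<bar>A3\<bar> \<bar>Z3\<bar> * max \<bar>A4\<bar> \<bar>Z4\<bar> = \<bar>A3 * A4\<bar>" by (simp add: abs_mult)
    then show "max \<bar>A3\<bar> \<bar>Z3\<bar> * max \<bar>A4\<bar> \<bar>Z4\<bar> \<le> 2 * m" using m by linarith
  next
    case 2
    then have "max \<bar>A3\<bar> \<bar>Z3\<bar> * max \<bar>A4\<bar> \<bar>Z4\<bar> = \<bar>A3 * Z4\<bar>" by (simp add: abs_mult max_def)
    then show "max \<bar>A3\<bar> \<bar>Z3\<bar> * max \<bar>A4\<bar> \<bar>Z4\<bar> \<le> 2 * m" using cross[of Z3 A3 A4 Z4] m 2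
      by (metis add.commute)
  next
    case 3
    then have "max \<bar>A3\<bar> \<bar>Z3\<bar> * max \<bar>A4\<bar> \<bar>Z4\<bar> = \<bar>A4 * Z3\<bar>" by (simp add: abs_mult max_def mult.commute)
    then show "max \<bar>A3\<bar> \<bar>Z3\<bar> * max \<bar>A4\<bar> \<bar>Z4\<bar> \<le> 2 * m" using cross[of Z4 A4 A3 Z3] m 3
      by (metis mult.commute)
  next
    case 4
    then have "max \<bar>A3\<bar> \<bar>Z3\<bar> * max \<bar>A4\<bar> \<bar>Z4\<bar> = \<bar>Z3 * Z4\<bar>" by (simp add: abs_mult)
    then show "max \<bar>A3\<bar> \<bar>Z3\<bar> * max \<bar>A4\<bar> \<bar>Z4\<bar> \<le> 2 * m" using m by linarith
  qed
qed

section \<open>The group of rational points and inequalities for the naive height\<close>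

locale elliptic_curve =
  fixes a b :: int
  assumes disc: "4 * a ^ 3 + 27 * b ^ 2 \<noteq> 0"
begin

abbreviation "E \<equiv> ec_group a b"

lemma comm_group_E: "comm_group E"
proof (rule comm_groupI)
  fix P Q R assume "P \<in> carrier E" "Q \<in> carrier E" "R \<in> carrier E"
  then show "P \<otimes>\<^bsub>E\<^esub> Q \<otimes>\<^bsub>E\<^esub> R = P \<otimes>\<^bsub>E\<^esub> (Q \<otimes>\<^bsub>E\<^esub> R)"
    unfolding carrier_ec_group mult_ec_group by (rule ec_add_assoc[OF disc])
next
  fix P Q assume PQ: "P \<in> carrier E" "Q \<in> carrier E"
  then show "P \<otimes>\<^bsub>E\<^esub> Q \<in> carrier E" unfolding carrier_ec_group mult_ec_group by (rule on_curve_add)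
  show "P \<otimes>\<^bsub>E\<^esub> Q = Q \<otimes>\<^bsub>E\<^esub> P"
    using PQ unfolding carrier_ec_group mult_ec_group by (rule ec_add_commute)
next
  fix P assume "P \<in> carrier E"
  then show "\<exists>Q\<in>carrier E. Q \<otimes>\<^bsub>E\<^esub> P = \<one>\<^bsub>E\<^esub>"
    by (intro bexI[of _ "ec_neg P"]) (simp_all add: carrier_ec_group mult_ec_group one_ec_group)
qed (simp_all add: carrier_ec_group mult_ec_group one_ec_group)

sublocale comm_group E by (rule comm_group_E)

lemma inv_E: "P \<in> carrier E \<Longrightarrow> inv\<^bsub>E\<^esub> P = ec_neg P"
  by (rule inv_equality) (auto simp: carrier_ec_group mult_ec_group one_ec_group)

lemma ec_nmul_eq_pow: "P \<in> carrier E \<Longrightarrow> ec_nmul a n P = P [^]\<^bsub>E\<^esub> n"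
proof (induction n)
  case (Suc n)
  then have "ec_nmul a (Suc n) P = P \<otimes>\<^bsub>E\<^esub> P [^]\<^bsub>E\<^esub> n" by (simp add: mult_ec_group)
  also have "\<dots> = P [^]\<^bsub>E\<^esub> Suc n" using Suc.prems m_comm[of P "P [^]\<^bsub>E\<^esub> n"] by simp
  finally show ?case .
qed (simp add: one_ec_group)

lemma ec_mul_eq_pow:
  assumes "P \<in> carrier E" shows "ec_mul a k P = P [^]\<^bsub>E\<^esub> k"
proof (cases "k \<ge> 0")
  case True
  then show ?thesis unfolding ec_mul_def int_pow_def2 ec_nmul_eq_pow[OF assms] by simp
next
  case False
  moreover have "inv\<^bsub>E\<^esub> (P [^]\<^bsub>E\<^esub> nat (- k)) = ec_neg (P [^]\<^bsub>E\<^esub> nat (- k))"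
    by (rule inv_E[OF nat_pow_closed[OF assms]])
  ultimately show ?thesis unfolding ec_mul_def int_pow_def2 ec_nmul_eq_pow[OF assms] by simp
qed

lemma hW_pt_inv [simp]: "P \<in> carrier E \<Longrightarrow> hW_pt (inv\<^bsub>E\<^esub> P) = hW_pt P"
  by (simp add: inv_E)

lemma hW_pt_double_upper:
  obtains C where "\<And>P. P \<in> carrier E \<Longrightarrow> hW_pt (P \<otimes>\<^bsub>E\<^esub> P) \<le> 4 * hW_pt P + C" "C \<ge> 0"
proof
  define C where "C = (4 + 6 * \<bar>a\<bar> + 12 * \<bar>b\<bar> + \<bar>a\<bar> ^ 2)"
  have C1: "C \<ge> 1" by (simp add: C_def add_nonneg_nonneg)
  show "ln (real_of_int C) \<ge> 0" using C1 by simp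
  fix P assume P: "P \<in> carrier E"
  obtain A Z where AZ: "xfrac P = (A, Z)" by fastforce
  obtain A' Z' where AZ': "xfrac (P \<otimes>\<^bsub>E\<^esub> P) = (A', Z')" by fastforce
  obtain g where g: "g > 0" "dupF a b A Z = g * A'" "dupG a b A Z = g * Z'"
    by (rule xfrac_double[OF disc P[unfolded carrier_ec_group] AZ AZ'[unfolded mult_ec_group]])
  define M where "M = max \<bar>A\<bar> \<bar>Z\<bar>"
  have M1: "M \<ge> 1" unfolding M_def by (rule xfrac_max_ge_1[OF AZ])
  have pw: "\<bar>A ^ i * Z ^ j\<bar> \<le> M ^ 4" if "i + j = 4" for i j
  proof -
    have "\<bar>A ^ i * Z ^ j\<bar> = \<bar>A\<bar> ^ i * \<bar>Z\<bar> ^ j" by (simp add: abs_mult power_abs)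
    also have "\<dots> \<le> M ^ i * M ^ j" by (intro mult_mono power_mono) (auto simp: M_def)
    finally show ?thesis using that by (simp add: power_add[symmetric])
  qed
  have t: "\<bar>c * (A ^ i * Z ^ j)\<bar> \<le> \<bar>c\<bar> * M ^ 4" if "i + j = 4" for i j c
    using pw[OF that] by (simp add: abs_mult mult_left_mono)
  have s: "4 + 0 = (4::nat)" "3 + 1 = (4::nat)" "2 + 2 = (4::nat)" "1 + 3 = (4::nat)" "0 + 4 = (4::nat)" by simp_all
  have "dupF a b A Z = A ^ 4 * Z ^ 0 - (2 * a) * (A ^ 2 * Z ^ 2) - (8 * b) * (A ^ 1 * Z ^ 3) + a ^ 2 * (A ^ 0 * Z ^ 4)"
    by (simp add: dupF_def)
  also have "\<bar>\<dots>\<bar> \<le> M ^ 4 + \<bar>2 * a\<bar> * M ^ 4 + \<bar>8 * b\<bar> * M ^ 4 + \<bar>a ^ 2\<bar> * M ^ 4"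
  proof -
    have "\<bar>x - y - z + w\<bar> \<le> x' + y' + z' + w'" if "\<bar>x\<bar> \<le> x'" "\<bar>y\<bar> \<le> y'" "\<bar>z\<bar> \<le> z'" "\<bar>w\<bar> \<le> w'" for x y z w x' y' z' w' :: int
      using that by linarith
    from this[OF pw[OF s(1)] t[OF s(3)] t[OF s(4)] t[OF s(5)]] show ?thesis .
  qed
  also have "\<dots> = (1 + 2 * \<bar>a\<bar> + 8 * \<bar>b\<bar> + \<bar>a\<bar> ^ 2) * M ^ 4" by (simp add: algebra_simps abs_mult)
  also have "\<dots> \<le> C * M ^ 4" using M1 by (intro mult_right_mono) (auto simp: C_def)
  finally have F: "\<bar>dupF a b A Z\<bar> \<le> C * M ^ 4" .
  have "dupG a b A Z = 4 * (A ^ 3 * Z ^ 1) + (4 * a) * (A ^ 1 * Z ^ 3) + (4 * b) * (A ^ 0 * Z ^ 4)"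
    by (simp add: dupG_def algebra_simps eval_nat_numeral)
  also have "\<bar>\<dots>\<bar> \<le> \<bar>4\<bar> * M ^ 4 + \<bar>4 * a\<bar> * M ^ 4 + \<bar>4 * b\<bar> * M ^ 4"
  proof -
    have "\<bar>x + y + z\<bar> \<le> x' + y' + z'" if "\<bar>x\<bar> \<le> x'" "\<bar>y\<bar> \<le> y'" "\<bar>z\<bar> \<le> z'" for x y z x' y' z' :: int
      using that by linarith
    from this[OF t[OF s(2)] t[OF s(4)] t[OF s(5)]] show ?thesis .
  qed
  also have "\<dots> = (4 + 4 * \<bar>a\<bar> + 4 * \<bar>b\<bar>) * M ^ 4" by (simp add: algebra_simps abs_mult)
  also have "\<dots> \<le> C * M ^ 4" using M1 by (intro mult_right_mono) (auto simp: C_def)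
  finally have G: "\<bar>dupG a b A Z\<bar> \<le> C * M ^ 4" .
  have le: "\<bar>x\<bar> \<le> \<bar>g * x\<bar>" for x using g(1) by (simp add: abs_mult mult_le_cancel_right1)
  have "max \<bar>A'\<bar> \<bar>Z'\<bar> \<le> C * M ^ 4"
    using order_trans[OF le F[unfolded g]] order_trans[OF le G[unfolded g]] by simp
  then have "real_of_int (max \<bar>A'\<bar> \<bar>Z'\<bar>) \<le> real_of_int (C * M ^ 4)" by (simp only: of_int_le_iff)
  then have "ln (real_of_int (max \<bar>A'\<bar> \<bar>Z'\<bar>)) \<le> ln (real_of_int (C * M ^ 4))"
    using xfrac_max_ge_1[OF AZ'] C1 M1 by (subst ln_le_cancel_iff) (auto simp del: of_int_max)
  also have "\<dots> = ln (real_of_int C) + 4 * ln (real_of_int M)" using C1 M1 by (simp add: ln_mult ln_realpow)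
  finally show "hW_pt (P \<otimes>\<^bsub>E\<^esub> P) \<le> 4 * hW_pt P + ln (real_of_int C)"
    unfolding hW_pt_xfrac[OF AZ] hW_pt_xfrac[OF AZ'] M_def by simp
qed

lemma hW_pt_double_lower:
  obtains C where "\<And>P. P \<in> carrier E \<Longrightarrow> 4 * hW_pt P - C \<le> hW_pt (P \<otimes>\<^bsub>E\<^esub> P)"
proof -
  obtain x0 R S K :: real where k: "R > 0" "S \<ge> 1" "K \<ge> 1" "dup_bound (of_int a) (of_int b) x0 R K"
    "\<And>x. max \<bar>x\<bar> 1 \<le> S * max \<bar>x - x0\<bar> R"
    using dup_bound_exists[OF disc] by metis
  define c where "c = ln K + ln (4 * \<bar>of_int (4 * a ^ 3 + 27 * b ^ 2)\<bar>) - ln (of_int (twist_gcd a b)) - ln (of_int (three_gain a b))"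
  show ?thesis
  proof (rule that)
    fix P assume P: "P \<in> carrier E"
    obtain A Z where AZ: "xfrac P = (A, Z)" by fastforce
    obtain A' Z' where AZ': "xfrac (ec_add a P P) = (A', Z')" by fastforce
    have on: "on_curve a b P" using P by (simp add: carrier_ec_group)
    show "4 * hW_pt P - (4 * (ln S + ln (of_int (twist_gcd a b)) / 6) + c + ln (1 + \<bar>x0\<bar> + R)) \<le> hW_pt (P \<otimes>\<^bsub>E\<^esub> P)"
    proof -
      have "4 * h - (4 * (s + t / 6) + (k + l - t - g) + r) \<le> h'"
        if "4 * m - k - l + t + g \<le> m'" "h \<le> m + s + t / 6" "m' \<le> h' + r" for h s t k l g r h' m m' :: real
        using that by argo
      from this[OF mod_height_double[OF disc on k(1,3,4) AZ AZ'] hW_pt_le_mod_height[OF disc AZ k(2,1,5)]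
        mod_height_le_hW_pt[OF disc AZ' k(1)]] show ?thesis unfolding mult_ec_group c_def .
    qed
  qed
qed

text \<open>x(P + Q) and x(P - Q) are the zeros of a quadratic polynomial whose coefficients are, up
  to sign, N0, N1, N2, forms of degree 2 in each of (A1, Z1) and (A2, Z2). Removing their common
  factor g only lowers the heights on the left, so no bound for g is required; the cases Q = P and Q
  = - P come from duplication.\<close>

lemma hW_pt_parallelogram:
  obtains C where "\<And>P Q. P \<in> carrier E \<Longrightarrow> Q \<in> carrier E \<Longrightarrow>
    hW_pt (P \<otimes>\<^bsub>E\<^esub> Q) + hW_pt (P \<otimes>\<^bsub>E\<^esub> inv\<^bsub>E\<^esub> Q) \<le> 2 * hW_pt P + 2 * hW_pt Q + C"
proof -
  obtain C1 where C1: "\<And>P. P \<in> carrier E \<Longrightarrow> hW_pt (P \<otimes>\<^bsub>E\<^esub> P) \<le> 4 * hW_pt P + C1" "C1 \<ge> 0"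
    using hW_pt_double_upper by blast
  define C2 where "C2 = 10 + 10 * \<bar>a\<bar> + 20 * \<bar>b\<bar> + \<bar>a\<bar> ^ 2"
  have C2: "C2 \<ge> 1" by (simp add: C2_def add_nonneg_nonneg)
  have h0: "hW_pt None = 0" by (simp add: hW_pt_def)
  have dbl: "hW_pt (P \<otimes>\<^bsub>E\<^esub> Q) + hW_pt (P \<otimes>\<^bsub>E\<^esub> inv\<^bsub>E\<^esub> Q) \<le> 2 * hW_pt P + 2 * hW_pt Q + C1"
    if P: "P \<in> carrier E" and Q: "Q = P \<or> Q = inv\<^bsub>E\<^esub> P" for P Q
    using C1(1)[OF P] Q P h0 by (auto simp: one_ec_group)
  have gen: "hW_pt (P \<otimes>\<^bsub>E\<^esub> Q) + hW_pt (P \<otimes>\<^bsub>E\<^esub> inv\<^bsub>E\<^esub> Q) \<le> 2 * hW_pt P + 2 * hW_pt Q + ln (2 * of_int C2)"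
    if P: "P = Some (x1, y1)" "P \<in> carrier E" and Q: "Q = Some (x2, y2)" "Q \<in> carrier E" and x: "x1 \<noteq> x2" for P Q x1 y1 x2 y2
  proof -
    have on: "on_curve a b (Some (x1, y1))" "on_curve a b (Some (x2, y2))" "on_curve a b (Some (x2, - y2))"
      using P Q by (auto simp: carrier_ec_group)
    obtain m c x3 where 3: "P \<otimes>\<^bsub>E\<^esub> Q = Some (x3, - (m * x3 + c))" "y1 = m * x1 + c" "y2 = m * x2 + c" "chord a b m c x1 x2 x3"
      unfolding mult_ec_group P Q by (rule ec_add_chord[OF on(1,2)]) (use x in auto)
    obtain m' c' x4 where 4: "P \<otimes>\<^bsub>E\<^esub> inv\<^bsub>E\<^esub> Q = Some (x4, - (m' * x4 + c'))" "y1 = m' * x1 + c'" "- y2 = m' * x2 + c'" "chord a b m' c' x1 x2 x4"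
      unfolding mult_ec_group inv_E[OF Q(2)] unfolding P Q ec_neg_simps by (rule ec_add_chord[OF on(1,3)]) (use x in auto)
    obtain A1 Z1 where AZ1: "xfrac P = (A1, Z1)" by fastforce
    obtain A2 Z2 where AZ2: "xfrac Q = (A2, Z2)" by fastforce
    obtain A3 Z3 where AZ3: "xfrac (P \<otimes>\<^bsub>E\<^esub> Q) = (A3, Z3)" by fastforce
    obtain A4 Z4 where AZ4: "xfrac (P \<otimes>\<^bsub>E\<^esub> inv\<^bsub>E\<^esub> Q) = (A4, Z4)" by fastforce
    have f: "x1 = of_int A1 / of_int Z1" "Z1 > 0" "x2 = of_int A2 / of_int Z2" "Z2 > 0"
      "x3 = of_int A3 / of_int Z3" "Z3 > 0" "x4 = of_int A4 / of_int Z4" "Z4 > 0"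
      using xfrac_Some AZ1 AZ2 AZ3 AZ4 P(1) Q(1) 3(1) 4(1) by metis+
    have s: "(x1 - x2) ^ 2 * (x3 + x4) = 2 * (x1 * x2 + of_int a) * (x1 + x2) + 4 * of_int b"
      using 3(2-4) 4(2-4) unfolding chord_def by Groebner_Basis.algebra
    have p: "(x1 - x2) ^ 2 * (x3 * x4) = (x1 * x2 - of_int a) ^ 2 - 4 * of_int b * (x1 + x2)"
    proof -
      have e: "y1 ^ 2 = x1 ^ 3 + of_int a * x1 + of_int b" "y2 ^ 2 = x2 ^ 3 + of_int a * x2 + of_int b"
        using on by auto
      have "(x1 - x2) ^ 2 * x3 = (y2 - y1) ^ 2 - (x1 + x2) * (x1 - x2) ^ 2"
        using 3(2-4) unfolding chord_def by Groebner_Basis.algebra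
      moreover have "(x1 - x2) ^ 2 * x4 = (y2 + y1) ^ 2 - (x1 + x2) * (x1 - x2) ^ 2"
        using 4(2-4) unfolding chord_def by Groebner_Basis.algebra
      ultimately have "(x1 - x2) ^ 2 * ((x1 - x2) ^ 2 * (x3 * x4)) =
          (x1 - x2) ^ 2 * ((x1 * x2 - of_int a) ^ 2 - 4 * of_int b * (x1 + x2))"
        using e by Groebner_Basis.algebra
      moreover have "(x1 - x2) ^ 2 \<noteq> 0" using x by simp
      ultimately show ?thesis using mult_left_cancel by blast
    qed
    define N0 where "N0 = (A1 * Z2 - A2 * Z1) ^ 2"
    define N1 where "N1 = 2 * (A1 * A2 + a * Z1 * Z2) * (A1 * Z2 + A2 * Z1) + 4 * b * Z1 ^ 2 * Z2 ^ 2"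
    define N2 where "N2 = (A1 * A2 - a * Z1 * Z2) ^ 2 - 4 * b * Z1 * Z2 * (A1 * Z2 + A2 * Z1)"
    have A: "rat_of_int A1 = x1 * of_int Z1" "rat_of_int A2 = x2 * of_int Z2" "rat_of_int A3 = x3 * of_int Z3" "rat_of_int A4 = x4 * of_int Z4"
      using f by auto
    have N1: "N1 * (Z3 * Z4) = N0 * (A3 * Z4 + A4 * Z3)"
    proof -
      have "rat_of_int (N1 * (Z3 * Z4)) = of_int (N0 * (A3 * Z4 + A4 * Z3))"
        unfolding N1_def N0_def of_int_add of_int_diff of_int_mult of_int_power of_int_numeral A using s by Groebner_Basis.algebra
      then show ?thesis by (simp only: of_int_eq_iff)
    qed
    have N2: "N2 * (Z3 * Z4) = N0 * (A3 * A4)"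
    proof -
      have "rat_of_int (N2 * (Z3 * Z4)) = of_int (N0 * (A3 * A4))"
        unfolding N2_def N0_def of_int_add of_int_diff of_int_mult of_int_power of_int_numeral A using p by Groebner_Basis.algebra
      then show ?thesis by (simp only: of_int_eq_iff)
    qed
    have "Z3 * Z4 dvd N0"
      by (rule coprime_sym_product_dvd[OF xfrac_coprime[OF AZ3] xfrac_coprime[OF AZ4]])
        (use N1 N2 in \<open>metis dvd_triv_right\<close>)+
    then obtain g where g: "N0 = g * (Z3 * Z4)" by (metis dvdE mult.commute)
    have Z34: "Z3 * Z4 \<noteq> 0" using f by simp
    have "N1 * (Z3 * Z4) = (g * (A3 * Z4 + A4 * Z3)) * (Z3 * Z4)" unfolding N1 g by simp
    then have g1: "N1 = g * (A3 * Z4 + A4 * Z3)" using Z34 by (simp only: mult_cancel_right) simp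
    have "N2 * (Z3 * Z4) = (g * (A3 * A4)) * (Z3 * Z4)" unfolding N2 g by simp
    then have g2: "N2 = g * (A3 * A4)" using Z34 by (simp only: mult_cancel_right) simp
    have "A1 * Z2 \<noteq> A2 * Z1"
    proof
      assume "A1 * Z2 = A2 * Z1"
      then have "rat_of_int A1 * of_int Z2 = of_int A2 * of_int Z1" by (metis of_int_mult)
      with x f show False by (simp add: field_simps)
    qed
    then have "N0 \<noteq> 0" by (simp add: N0_def)
    then have g0: "g \<noteq> 0" using g by auto
    have "\<bar>g\<bar> \<ge> 1" using g0 by linarith
    then have le: "\<bar>t\<bar> \<le> \<bar>g * t\<bar>" for t by (simp add: abs_mult mult_le_cancel_right1)
    define M1 M2 where "M1 = max \<bar>A1\<bar> \<bar>Z1\<bar>" and "M2 = max \<bar>A2\<bar> \<bar>Z2\<bar>"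
    have M: "M1 \<ge> 1" "M2 \<ge> 1" using xfrac_max_ge_1 AZ1 AZ2 by (auto simp: M1_def M2_def)
    define S where "S = M1 * M2"
    have "\<bar>A1 * A2\<bar> \<le> S" "\<bar>Z1 * Z2\<bar> \<le> S" "\<bar>A1 * Z2\<bar> \<le> S" "\<bar>Z1 * A2\<bar> \<le> S"
      unfolding S_def abs_mult by (auto simp: M1_def M2_def intro!: mult_mono)
    then have b: "\<bar>A1 * A2\<bar> \<le> S" "\<bar>Z1 * Z2\<bar> \<le> S" "\<bar>A1 * Z2\<bar> \<le> S" "\<bar>A2 * Z1\<bar> \<le> S"
      by (simp_all add: mult.commute)
    have S0: "S \<ge> 1" using M unfolding S_def by (metis mult_mono mult_1 zero_le_one order_trans)
    have sq: "\<bar>u * v\<bar> \<le> (p * q) * S ^ 2" if "\<bar>u\<bar> \<le> p * S" "\<bar>v\<bar> \<le> q * S" for u v p q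
    proof -
      have "\<bar>u * v\<bar> \<le> (p * S) * (q * S)" unfolding abs_mult by (rule mult_mono) (use that abs_ge_zero[of u] in linarith)+
      then show ?thesis by (simp add: power2_eq_square mult_ac)
    qed
    have aZ: "\<bar>a * (Z1 * Z2)\<bar> \<le> \<bar>a\<bar> * S" and bZ: "\<bar>b * (Z1 * Z2)\<bar> \<le> \<bar>b\<bar> * S"
      unfolding abs_mult[of a] abs_mult[of b] using b(2) by (auto intro: mult_left_mono)
    have s1: "\<bar>A1 * Z2 - A2 * Z1\<bar> \<le> 2 * S" "\<bar>A1 * Z2 + A2 * Z1\<bar> \<le> 2 * S" using b by linarith+
    have s2: "\<bar>A1 * A2 + a * (Z1 * Z2)\<bar> \<le> (1 + \<bar>a\<bar>) * S" "\<bar>A1 * A2 - a * (Z1 * Z2)\<bar> \<le> (1 + \<bar>a\<bar>) * S"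
    proof -
      have "\<bar>x + y\<bar> \<le> (1 + \<bar>a\<bar>) * S" "\<bar>x - y\<bar> \<le> (1 + \<bar>a\<bar>) * S" if "\<bar>x\<bar> \<le> S" "\<bar>y\<bar> \<le> \<bar>a\<bar> * S" for x y
        using that unfolding distrib_right mult_1 by linarith+
      from this[OF b(1) aZ] show "\<bar>A1 * A2 + a * (Z1 * Z2)\<bar> \<le> (1 + \<bar>a\<bar>) * S" "\<bar>A1 * A2 - a * (Z1 * Z2)\<bar> \<le> (1 + \<bar>a\<bar>) * S" .
    qed
    have bounds: "\<bar>N0\<bar> \<le> C2 * S ^ 2" "\<bar>N1\<bar> \<le> C2 * S ^ 2" "\<bar>N2\<bar> \<le> C2 * S ^ 2"
    proof -
      have S2: "S ^ 2 \<ge> 0" by simp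
      have aS: "\<bar>a\<bar> * S ^ 2 \<ge> 0" "\<bar>b\<bar> * S ^ 2 \<ge> 0" "\<bar>a\<bar> ^ 2 * S ^ 2 \<ge> 0" by auto
      have C2S: "C2 * S ^ 2 = 10 * S ^ 2 + 10 * (\<bar>a\<bar> * S ^ 2) + 20 * (\<bar>b\<bar> * S ^ 2) + \<bar>a\<bar> ^ 2 * S ^ 2"
        by (simp add: C2_def algebra_simps)
      have "\<bar>N0\<bar> \<le> 4 * S ^ 2" using sq[OF s1(1) s1(1)] by (simp add: N0_def power2_eq_square)
      then show "\<bar>N0\<bar> \<le> C2 * S ^ 2" using S2 aS unfolding C2S by linarith
      have "N1 = 2 * ((A1 * A2 + a * (Z1 * Z2)) * (A1 * Z2 + A2 * Z1)) + 4 * ((b * (Z1 * Z2)) * (Z1 * Z2))"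
        by (simp add: N1_def power2_eq_square algebra_simps)
      moreover have "\<bar>(A1 * A2 + a * (Z1 * Z2)) * (A1 * Z2 + A2 * Z1)\<bar> \<le> ((1 + \<bar>a\<bar>) * 2) * S ^ 2"
        by (rule sq[OF s2(1) s1(2)])
      moreover have "((1 + \<bar>a\<bar>) * 2) * S ^ 2 = 2 * S ^ 2 + 2 * (\<bar>a\<bar> * S ^ 2)" by (simp add: algebra_simps)
      moreover have "\<bar>(b * (Z1 * Z2)) * (Z1 * Z2)\<bar> \<le> (\<bar>b\<bar> * 1) * S ^ 2" by (rule sq[OF bZ]) (use b in simp)
      moreover have "\<bar>2 * x + 4 * y\<bar> \<le> 2 * x' + 4 * y'" if "\<bar>x\<bar> \<le> x'" "\<bar>y\<bar> \<le> y'" for x y x' y' :: int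
        using that by linarith
      ultimately have "\<bar>N1\<bar> \<le> 2 * (2 * S ^ 2 + 2 * (\<bar>a\<bar> * S ^ 2)) + 4 * (\<bar>b\<bar> * S ^ 2)" by (metis mult_1_right)
      also have "\<dots> = 4 * S ^ 2 + 4 * (\<bar>a\<bar> * S ^ 2) + 4 * (\<bar>b\<bar> * S ^ 2)" by simp
      also have "\<dots> \<le> C2 * S ^ 2" using S2 aS unfolding C2S by linarith
      finally show "\<bar>N1\<bar> \<le> C2 * S ^ 2" .
      have "N2 = (A1 * A2 - a * (Z1 * Z2)) * (A1 * A2 - a * (Z1 * Z2)) - 4 * ((b * (Z1 * Z2)) * (A1 * Z2 + A2 * Z1))"
        by (simp add: N2_def power2_eq_square algebra_simps)
      moreover have "\<bar>(A1 * A2 - a * (Z1 * Z2)) * (A1 * A2 - a * (Z1 * Z2))\<bar> \<le> ((1 + \<bar>a\<bar>) * (1 + \<bar>a\<bar>)) * S ^ 2"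
        by (rule sq[OF s2(2) s2(2)])
      moreover have "((1 + \<bar>a\<bar>) * (1 + \<bar>a\<bar>)) * S ^ 2 = S ^ 2 + 2 * (\<bar>a\<bar> * S ^ 2) + \<bar>a\<bar> ^ 2 * S ^ 2"
        by (simp add: algebra_simps power2_eq_square)
      moreover have "\<bar>(b * (Z1 * Z2)) * (A1 * Z2 + A2 * Z1)\<bar> \<le> (\<bar>b\<bar> * 2) * S ^ 2" by (rule sq[OF bZ s1(2)])
      moreover have "\<bar>x - 4 * y\<bar> \<le> x' + 4 * y'" if "\<bar>x\<bar> \<le> x'" "\<bar>y\<bar> \<le> y'" for x y x' y' :: int
        using that by linarith
      ultimately have "\<bar>N2\<bar> \<le> (S ^ 2 + 2 * (\<bar>a\<bar> * S ^ 2) + \<bar>a\<bar> ^ 2 * S ^ 2) + 4 * ((\<bar>b\<bar> * 2) * S ^ 2)" by metis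
      also have "\<dots> = S ^ 2 + 2 * (\<bar>a\<bar> * S ^ 2) + \<bar>a\<bar> ^ 2 * S ^ 2 + 8 * (\<bar>b\<bar> * S ^ 2)" by simp
      also have "\<dots> \<le> C2 * S ^ 2" using S2 aS unfolding C2S by linarith
      finally show "\<bar>N2\<bar> \<le> C2 * S ^ 2" .
    qed
    have "max \<bar>A3 * A4\<bar> (max \<bar>Z3 * Z4\<bar> \<bar>A3 * Z4 + A4 * Z3\<bar>) \<le> C2 * S ^ 2"
      using order_trans[OF le bounds(1)[unfolded g]] order_trans[OF le bounds(2)[unfolded g1]]
        order_trans[OF le bounds(3)[unfolded g2]] by simp
    with max_mult_max_le[of A3 Z3 A4 Z4]
    have "max \<bar>A3\<bar> \<bar>Z3\<bar> * max \<bar>A4\<bar> \<bar>Z4\<bar> \<le> 2 * C2 * S ^ 2" by linarith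
    then have "real_of_int (max \<bar>A3\<bar> \<bar>Z3\<bar> * max \<bar>A4\<bar> \<bar>Z4\<bar>) \<le> real_of_int (2 * C2 * S ^ 2)"
      by (simp only: of_int_le_iff)
    then have "real_of_int (max \<bar>A3\<bar> \<bar>Z3\<bar>) * real_of_int (max \<bar>A4\<bar> \<bar>Z4\<bar>) \<le> 2 * of_int C2 * (of_int M1 * of_int M2) ^ 2"
      by (simp add: S_def del: of_int_max)
    moreover have p34: "real_of_int (max \<bar>A3\<bar> \<bar>Z3\<bar>) > 0" "real_of_int (max \<bar>A4\<bar> \<bar>Z4\<bar>) > 0"
      using xfrac_max_ge_1[OF AZ3] xfrac_max_ge_1[OF AZ4] by (simp_all del: of_int_max)
    moreover have p12: "real_of_int M1 > 0" "real_of_int M2 > 0" "real_of_int C2 > 0" using M C2 by auto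
    ultimately have "ln (real_of_int (max \<bar>A3\<bar> \<bar>Z3\<bar>) * real_of_int (max \<bar>A4\<bar> \<bar>Z4\<bar>)) \<le> ln (2 * of_int C2 * (of_int M1 * of_int M2) ^ 2)"
      by (subst ln_le_cancel_iff) (auto simp del: of_int_max)
    also have "\<dots> = ln (2 * of_int C2) + 2 * ln (of_int M1) + 2 * ln (of_int M2)"
    proof -
      have "ln (2 * c * (p * q) ^ 2) = ln (2 * c) + 2 * ln p + 2 * ln q" if "c > 0" "p > 0" "q > 0" for c p q :: real
        using that by (simp add: ln_mult ln_realpow)
      then show ?thesis using p12 by blast
    qed
    also have "ln (real_of_int (max \<bar>A3\<bar> \<bar>Z3\<bar>) * real_of_int (max \<bar>A4\<bar> \<bar>Z4\<bar>)) =
        ln (real_of_int (max \<bar>A3\<bar> \<bar>Z3\<bar>)) + ln (real_of_int (max \<bar>A4\<bar> \<bar>Z4\<bar>))"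
      using p34 by (simp add: ln_mult del: of_int_max)
    finally show ?thesis
      unfolding hW_pt_xfrac[OF AZ1] hW_pt_xfrac[OF AZ2] hW_pt_xfrac[OF AZ3] hW_pt_xfrac[OF AZ4] M1_def M2_def by linarith
  qed
  show ?thesis
  proof (rule that[of "C1 + ln (2 * of_int C2)"])
    fix P Q assume PQ: "P \<in> carrier E" "Q \<in> carrier E"
    have l: "ln (2 * real_of_int C2) \<ge> 0" using C2 by simp
    consider "P = None" | "Q = None" | x1 y1 x2 y2 where "P = Some (x1, y1)" "Q = Some (x2, y2)"
      by (metis option.exhaust surj_pair)
    then show "hW_pt (P \<otimes>\<^bsub>E\<^esub> Q) + hW_pt (P \<otimes>\<^bsub>E\<^esub> inv\<^bsub>E\<^esub> Q) \<le> 2 * hW_pt P + 2 * hW_pt Q + (C1 + ln (2 * of_int C2))"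
    proof cases
      case 1
      then show ?thesis using PQ l C1(2) h0 by (simp add: mult_ec_group inv_E)
    next
      case 2
      then show ?thesis using PQ l C1(2) h0 by (simp add: mult_ec_group inv_E)
    next
      case 3
      show ?thesis
      proof (cases "x1 = x2")
        case False
        then show ?thesis using gen[OF 3(1) PQ(1) 3(2) PQ(2)] C1(2) by linarith
      next
        case True
        have "Q = P \<or> Q = inv\<^bsub>E\<^esub> P"
          using PQ 3 True curve_two_pts_y(1)[of y1 x1 "of_int a" "of_int b" y2]
          by (auto simp: carrier_ec_group inv_E)
        then show ?thesis using dbl[OF PQ(1)] l by force
      qed
    qed
  qed
qed


end

section \<open>The canonical height as a quadratic form\<close>

context elliptic_curve
begin

text \<open>Twice \<open>canon_height\<close>: Tate's limit without the factor 1/2.\<close>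

definition hhat :: "ecpt \<Rightarrow> real" where
  "hhat P = lim (\<lambda>k. hW_pt (P [^]\<^bsub>E\<^esub> (2 ^ k :: nat)) / 4 ^ k)"

lemma pow_two_Suc: "P \<in> carrier E \<Longrightarrow>
    P [^]\<^bsub>E\<^esub> (2 ^ Suc k :: nat) = P [^]\<^bsub>E\<^esub> (2 ^ k :: nat) \<otimes>\<^bsub>E\<^esub> P [^]\<^bsub>E\<^esub> (2 ^ k :: nat)"
  by (simp add: nat_pow_mult mult_2)

lemma hhat_bound:
  obtains C where "\<And>P. P \<in> carrier E \<Longrightarrow>
    (\<lambda>k. hW_pt (P [^]\<^bsub>E\<^esub> (2 ^ k :: nat)) / 4 ^ k) \<longlonglongrightarrow> hhat P \<and> \<bar>hhat P - hW_pt P\<bar> \<le> C"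
proof -
  obtain C1 where C1: "\<And>P. P \<in> carrier E \<Longrightarrow> hW_pt (P \<otimes>\<^bsub>E\<^esub> P) \<le> 4 * hW_pt P + C1" "C1 \<ge> 0"
    using hW_pt_double_upper by blast
  obtain C2 where C2: "\<And>P. P \<in> carrier E \<Longrightarrow> 4 * hW_pt P - C2 \<le> hW_pt (P \<otimes>\<^bsub>E\<^esub> P)"
    using hW_pt_double_lower by blast
  show ?thesis
  proof (rule that)
    fix P assume P: "P \<in> carrier E"
    have "\<bar>hW_pt (P [^]\<^bsub>E\<^esub> (2 ^ Suc k :: nat)) - 4 * hW_pt (P [^]\<^bsub>E\<^esub> (2 ^ k :: nat))\<bar> \<le> max C1 C2" for k
    proof -
      have R: "P [^]\<^bsub>E\<^esub> (2 ^ k :: nat) \<in> carrier E" using P by (rule nat_pow_closed)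
      show ?thesis unfolding pow_two_Suc[OF P] using C1(1)[OF R] C2[OF R] by linarith
    qed
    from tate_limit[of "\<lambda>k. hW_pt (P [^]\<^bsub>E\<^esub> (2 ^ k :: nat))", OF this]
    show "(\<lambda>k. hW_pt (P [^]\<^bsub>E\<^esub> (2 ^ k :: nat)) / 4 ^ k) \<longlonglongrightarrow> hhat P \<and> \<bar>hhat P - hW_pt P\<bar> \<le> max C1 C2 / 3"
      using P by (simp add: hhat_def convergent_LIMSEQ_iff)
  qed
qed

lemma hhat_LIMSEQ:
  "P \<in> carrier E \<Longrightarrow> (\<lambda>k. hW_pt (P [^]\<^bsub>E\<^esub> (2 ^ k :: nat)) / 4 ^ k) \<longlonglongrightarrow> hhat P"
  using hhat_bound by blast

lemma hhat_nonneg: "P \<in> carrier E \<Longrightarrow> hhat P \<ge> 0"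
  by (rule LIMSEQ_le_const[OF hhat_LIMSEQ]) (auto simp: hW_pt_nonneg)

lemma hhat_double: "P \<in> carrier E \<Longrightarrow> hhat (P \<otimes>\<^bsub>E\<^esub> P) = 4 * hhat P"
proof -
  assume P: "P \<in> carrier E"
  have eq: "hW_pt ((P \<otimes>\<^bsub>E\<^esub> P) [^]\<^bsub>E\<^esub> (2 ^ k :: nat)) / 4 ^ k = 4 * (hW_pt (P [^]\<^bsub>E\<^esub> (2 ^ Suc k :: nat)) / 4 ^ Suc k)" for k
    using P by (simp only: nat_pow_distrib pow_two_Suc) simp
  have "(\<lambda>k. 4 * (hW_pt (P [^]\<^bsub>E\<^esub> (2 ^ Suc k :: nat)) / 4 ^ Suc k)) \<longlonglongrightarrow> 4 * hhat P"
    using LIMSEQ_Suc[OF hhat_LIMSEQ[OF P]] by (rule tendsto_mult_left)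
  moreover have "(\<lambda>k. 4 * (hW_pt (P [^]\<^bsub>E\<^esub> (2 ^ Suc k :: nat)) / 4 ^ Suc k)) \<longlonglongrightarrow> hhat (P \<otimes>\<^bsub>E\<^esub> P)"
    using hhat_LIMSEQ[of "P \<otimes>\<^bsub>E\<^esub> P"] P unfolding eq by simp
  ultimately show ?thesis using LIMSEQ_unique by blast
qed

lemma hhat_parallelogram_le:
  assumes P: "P \<in> carrier E" and Q: "Q \<in> carrier E"
  shows "hhat (P \<otimes>\<^bsub>E\<^esub> Q) + hhat (P \<otimes>\<^bsub>E\<^esub> inv\<^bsub>E\<^esub> Q) \<le> 2 * hhat P + 2 * hhat Q"
proof -
  obtain C where C: "\<And>P Q. P \<in> carrier E \<Longrightarrow> Q \<in> carrier E \<Longrightarrow>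
    hW_pt (P \<otimes>\<^bsub>E\<^esub> Q) + hW_pt (P \<otimes>\<^bsub>E\<^esub> inv\<^bsub>E\<^esub> Q) \<le> 2 * hW_pt P + 2 * hW_pt Q + C"
    using hW_pt_parallelogram by blast
  let ?h = "\<lambda>R k. hW_pt (R [^]\<^bsub>E\<^esub> (2 ^ k :: nat))"
  have le: "?h (P \<otimes>\<^bsub>E\<^esub> Q) k / 4 ^ k + ?h (P \<otimes>\<^bsub>E\<^esub> inv\<^bsub>E\<^esub> Q) k / 4 ^ k \<le> 2 * (?h P k / 4 ^ k) + 2 * (?h Q k / 4 ^ k) + C / 4 ^ k" for k
  proof -
    have "?h (P \<otimes>\<^bsub>E\<^esub> Q) k + ?h (P \<otimes>\<^bsub>E\<^esub> inv\<^bsub>E\<^esub> Q) k \<le> 2 * ?h P k + 2 * ?h Q k + C"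
      using C[of "P [^]\<^bsub>E\<^esub> (2 ^ k :: nat)" "Q [^]\<^bsub>E\<^esub> (2 ^ k :: nat)"] P Q
      by (simp add: nat_pow_distrib nat_pow_inv)
    then have "(?h (P \<otimes>\<^bsub>E\<^esub> Q) k + ?h (P \<otimes>\<^bsub>E\<^esub> inv\<^bsub>E\<^esub> Q) k) / 4 ^ k \<le> (2 * ?h P k + 2 * ?h Q k + C) / 4 ^ k"
      by (intro divide_right_mono) auto
    then show ?thesis by (simp add: add_divide_distrib)
  qed
  have "(\<lambda>k. ?h (P \<otimes>\<^bsub>E\<^esub> Q) k / 4 ^ k + ?h (P \<otimes>\<^bsub>E\<^esub> inv\<^bsub>E\<^esub> Q) k / 4 ^ k) \<longlonglongrightarrow> hhat (P \<otimes>\<^bsub>E\<^esub> Q) + hhat (P \<otimes>\<^bsub>E\<^esub> inv\<^bsub>E\<^esub> Q)"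
    using P Q by (intro tendsto_add hhat_LIMSEQ) auto
  moreover have "(\<lambda>k. 2 * (?h P k / 4 ^ k) + 2 * (?h Q k / 4 ^ k) + C / 4 ^ k) \<longlonglongrightarrow> 2 * hhat P + 2 * hhat Q + 0"
    using P Q by (intro tendsto_add tendsto_mult tendsto_const hhat_LIMSEQ LIMSEQ_divide_realpow_zero) auto
  ultimately show ?thesis using le by (intro LIMSEQ_le) auto
qed

text \<open>The reverse inequality is the same one for P + Q and P - Q, whose sum and difference are
  2 P and 2 Q; this is why an upper bound for the naive heights was enough.\<close>

lemma hhat_parallelogram:
  assumes P: "P \<in> carrier E" and Q: "Q \<in> carrier E"
  shows "hhat (P \<otimes>\<^bsub>E\<^esub> Q) + hhat (P \<otimes>\<^bsub>E\<^esub> inv\<^bsub>E\<^esub> Q) = 2 * hhat P + 2 * hhat Q"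
proof (rule antisym[OF hhat_parallelogram_le[OF P Q]])
  let ?S = "P \<otimes>\<^bsub>E\<^esub> Q" and ?D = "P \<otimes>\<^bsub>E\<^esub> inv\<^bsub>E\<^esub> Q"
  have "?S \<otimes>\<^bsub>E\<^esub> ?D = P \<otimes>\<^bsub>E\<^esub> P \<otimes>\<^bsub>E\<^esub> (Q \<otimes>\<^bsub>E\<^esub> inv\<^bsub>E\<^esub> Q)" using P Q by (simp only: m_ac m_closed inv_closed)
  then have "?S \<otimes>\<^bsub>E\<^esub> ?D = P \<otimes>\<^bsub>E\<^esub> P" using P Q by simp
  moreover have "inv\<^bsub>E\<^esub> ?D = inv\<^bsub>E\<^esub> P \<otimes>\<^bsub>E\<^esub> Q" using P Q by (simp add: inv_mult)
  then have "?S \<otimes>\<^bsub>E\<^esub> inv\<^bsub>E\<^esub> ?D = Q \<otimes>\<^bsub>E\<^esub> Q \<otimes>\<^bsub>E\<^esub> (P \<otimes>\<^bsub>E\<^esub> inv\<^bsub>E\<^esub> P)"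
    using P Q by (simp only: m_ac m_closed inv_closed)
  then have "?S \<otimes>\<^bsub>E\<^esub> inv\<^bsub>E\<^esub> ?D = Q \<otimes>\<^bsub>E\<^esub> Q" using P Q by simp
  ultimately show "2 * hhat P + 2 * hhat Q \<le> hhat ?S + hhat ?D"
    using hhat_parallelogram_le[of ?S ?D] P Q by (simp add: hhat_double)
qed

lemma hhat_one [simp]: "hhat \<one>\<^bsub>E\<^esub> = 0"
  using hhat_double[of "\<one>\<^bsub>E\<^esub>"] by simp

lemma hhat_inv [simp]: "P \<in> carrier E \<Longrightarrow> hhat (inv\<^bsub>E\<^esub> P) = hhat P"
  using hhat_parallelogram[of "\<one>\<^bsub>E\<^esub>" P] by simp

lemma hhat_pow: "P \<in> carrier E \<Longrightarrow> hhat (P [^]\<^bsub>E\<^esub> (n :: nat)) = real n ^ 2 * hhat P"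
proof (induction n rule: induct_nat_012)
  case (ge2 n)
  have "P [^]\<^bsub>E\<^esub> Suc n \<otimes>\<^bsub>E\<^esub> inv\<^bsub>E\<^esub> P = P [^]\<^bsub>E\<^esub> n" using ge2.prems by (simp add: m_assoc)
  then show ?case using hhat_parallelogram[of "P [^]\<^bsub>E\<^esub> Suc n" P] ge2
    by (simp add: power2_eq_square algebra_simps)
qed auto

text \<open>\<open>hhat\<close> is a limit along powers of 2, \<open>canon_height\<close> along all
  n. The gap between \<open>hW_pt\<close> and \<open>hhat\<close> is bounded, also at n P, and
  \<open>hhat\<close> of n P is n^2 times \<open>hhat\<close> of P, so the error is of order 1 /
  n^2.\<close>

lemma canon_height_eq: "P \<in> carrier E \<Longrightarrow> canon_height a P = hhat P / 2"
proof -
  assume P: "P \<in> carrier E"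
  obtain C where C: "\<And>P. P \<in> carrier E \<Longrightarrow> \<bar>hhat P - hW_pt P\<bar> \<le> C" using hhat_bound by metis
  have "(\<lambda>n. hW_pt (P [^]\<^bsub>E\<^esub> n) / real n ^ 2 - hhat P) \<longlonglongrightarrow> 0"
  proof (rule Lim_null_comparison)
    show "\<forall>\<^sub>F n in sequentially. norm (hW_pt (P [^]\<^bsub>E\<^esub> n) / real n ^ 2 - hhat P) \<le> C / real n ^ 2"
    proof (rule eventually_sequentiallyI[of 1])
      fix n :: nat assume n: "1 \<le> n"
      have "hW_pt (P [^]\<^bsub>E\<^esub> n) / real n ^ 2 - hhat P = (hW_pt (P [^]\<^bsub>E\<^esub> n) - hhat (P [^]\<^bsub>E\<^esub> n)) / real n ^ 2"
        using n P by (simp add: hhat_pow diff_divide_distrib)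
      then show "norm (hW_pt (P [^]\<^bsub>E\<^esub> n) / real n ^ 2 - hhat P) \<le> C / real n ^ 2"
        using C[of "P [^]\<^bsub>E\<^esub> n"] P by (simp add: abs_divide divide_right_mono abs_minus_commute)
    qed
    show "(\<lambda>n. C / real n ^ 2) \<longlonglongrightarrow> 0"
      by (intro real_tendsto_divide_at_top[OF tendsto_const] filterlim_pow_at_top filterlim_real_sequentially) auto
  qed
  then have "(\<lambda>n. hW_pt (P [^]\<^bsub>E\<^esub> n) / real n ^ 2) \<longlonglongrightarrow> hhat P" by (simp add: LIM_zero_iff)
  then show ?thesis using P by (simp add: canon_height_def ec_nmul_eq_pow limI)
qed

definition bil :: "ecpt \<Rightarrow> ecpt \<Rightarrow> real" where
  "bil P Q = hhat (P \<otimes>\<^bsub>E\<^esub> Q) - hhat P - hhat Q"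

lemma bil_commute: "P \<in> carrier E \<Longrightarrow> Q \<in> carrier E \<Longrightarrow> bil P Q = bil Q P"
  by (simp add: bil_def m_comm)

text \<open>The argument of Jordan and von Neumann: a linear combination of four parallelogram
  laws.\<close>

lemma bil_add:
  assumes x: "x \<in> carrier E" and y: "y \<in> carrier E" and z: "z \<in> carrier E"
  shows "bil (x \<otimes>\<^bsub>E\<^esub> y) z = bil x z + bil y z"
proof -
  note c = x y z
  have 1: "hhat (x \<otimes>\<^bsub>E\<^esub> y \<otimes>\<^bsub>E\<^esub> z) + hhat (x \<otimes>\<^bsub>E\<^esub> y \<otimes>\<^bsub>E\<^esub> inv\<^bsub>E\<^esub> z) = 2 * hhat (x \<otimes>\<^bsub>E\<^esub> y) + 2 * hhat z"
    using c by (intro hhat_parallelogram) auto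
  have "hhat (x \<otimes>\<^bsub>E\<^esub> (y \<otimes>\<^bsub>E\<^esub> inv\<^bsub>E\<^esub> z)) + hhat (x \<otimes>\<^bsub>E\<^esub> inv\<^bsub>E\<^esub> (y \<otimes>\<^bsub>E\<^esub> inv\<^bsub>E\<^esub> z)) = 2 * hhat x + 2 * hhat (y \<otimes>\<^bsub>E\<^esub> inv\<^bsub>E\<^esub> z)"
    using c by (intro hhat_parallelogram) auto
  moreover have "x \<otimes>\<^bsub>E\<^esub> (y \<otimes>\<^bsub>E\<^esub> inv\<^bsub>E\<^esub> z) = x \<otimes>\<^bsub>E\<^esub> y \<otimes>\<^bsub>E\<^esub> inv\<^bsub>E\<^esub> z" using c by (simp add: m_assoc)
  moreover have "x \<otimes>\<^bsub>E\<^esub> inv\<^bsub>E\<^esub> (y \<otimes>\<^bsub>E\<^esub> inv\<^bsub>E\<^esub> z) = x \<otimes>\<^bsub>E\<^esub> z \<otimes>\<^bsub>E\<^esub> inv\<^bsub>E\<^esub> y" using c by (simp add: inv_mult m_ac)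
  ultimately have 2: "hhat (x \<otimes>\<^bsub>E\<^esub> y \<otimes>\<^bsub>E\<^esub> inv\<^bsub>E\<^esub> z) + hhat (x \<otimes>\<^bsub>E\<^esub> z \<otimes>\<^bsub>E\<^esub> inv\<^bsub>E\<^esub> y) = 2 * hhat x + 2 * hhat (y \<otimes>\<^bsub>E\<^esub> inv\<^bsub>E\<^esub> z)"
    by simp
  have "hhat (x \<otimes>\<^bsub>E\<^esub> z \<otimes>\<^bsub>E\<^esub> y) + hhat (x \<otimes>\<^bsub>E\<^esub> z \<otimes>\<^bsub>E\<^esub> inv\<^bsub>E\<^esub> y) = 2 * hhat (x \<otimes>\<^bsub>E\<^esub> z) + 2 * hhat y"
    using c by (intro hhat_parallelogram) auto
  moreover have "x \<otimes>\<^bsub>E\<^esub> z \<otimes>\<^bsub>E\<^esub> y = x \<otimes>\<^bsub>E\<^esub> y \<otimes>\<^bsub>E\<^esub> z" using c by (simp add: m_ac)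
  ultimately have 3: "hhat (x \<otimes>\<^bsub>E\<^esub> y \<otimes>\<^bsub>E\<^esub> z) + hhat (x \<otimes>\<^bsub>E\<^esub> z \<otimes>\<^bsub>E\<^esub> inv\<^bsub>E\<^esub> y) = 2 * hhat (x \<otimes>\<^bsub>E\<^esub> z) + 2 * hhat y"
    by simp
  have 4: "hhat (y \<otimes>\<^bsub>E\<^esub> z) + hhat (y \<otimes>\<^bsub>E\<^esub> inv\<^bsub>E\<^esub> z) = 2 * hhat y + 2 * hhat z"
    using c by (intro hhat_parallelogram) auto
  show ?thesis unfolding bil_def using 1 2 3 4 by linarith
qed

lemma bil_one [simp]: "P \<in> carrier E \<Longrightarrow> bil \<one>\<^bsub>E\<^esub> P = 0"
  by (simp add: bil_def)

lemma bil_pow: "P \<in> carrier E \<Longrightarrow> Q \<in> carrier E \<Longrightarrow> bil (P [^]\<^bsub>E\<^esub> (n::nat)) Q = real n * bil P Q"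
  by (induction n) (auto simp: bil_add algebra_simps)

lemma bil_inv: "P \<in> carrier E \<Longrightarrow> Q \<in> carrier E \<Longrightarrow> bil (inv\<^bsub>E\<^esub> P) Q = - bil P Q"
  using bil_add[of "inv\<^bsub>E\<^esub> P" P Q] by simp

lemma bil_int_pow:
  assumes "P \<in> carrier E" "Q \<in> carrier E" shows "bil (P [^]\<^bsub>E\<^esub> (n::int)) Q = of_int n * bil P Q"
  using assms by (cases n rule: int_cases2) (simp_all add: int_pow_int int_pow_neg_int bil_pow bil_inv)

lemma bil_self: "P \<in> carrier E \<Longrightarrow> bil P P = 2 * hhat P"
  by (simp add: bil_def hhat_double)

lemma height_pairing_eq: "P \<in> carrier E \<Longrightarrow> Q \<in> carrier E \<Longrightarrow> height_pairing a P Q = bil P Q / 4"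
  unfolding height_pairing_def bil_def mult_ec_group[where a = a and b = b, symmetric] by (simp add: canon_height_eq field_simps)

end

section \<open>Ideals attached to rational points\<close>

lemma odd_square_mod_4:
  fixes x :: int
  assumes "odd x" shows "x ^ 2 mod 4 = 1"
proof -
  from assms obtain k where "x = 2 * k + 1" by (elim oddE)
  then have "x ^ 2 = 1 + (k ^ 2 + k) * 4" by (simp add: power2_eq_square algebra_simps)
  then show ?thesis by (simp only: mod_mult_self1) simp
qed

text \<open>Write \<open>w = sqrt (- d)\<close>. The hypotheses say that the forms \<open>(\<alpha>1, 2 b1, _)\<close> and \<open>(\<alpha>2, 2 b2, _)\<close> are
  equivalent and that \<open>x + c w\<close>, of norm \<open>v \<alpha>1 \<alpha>2 \<alpha>3\<close>, lies in the ideals of both points. Equivalence provides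
  an element \<open>e + r w\<close> of norm \<open>\<alpha>1 \<alpha>2\<close>, and the quotient \<open>(x + c w) / (e + r w)\<close> turns out to be integral.\<close>

lemma common_norm_descent:
  fixes d v \<alpha>1 \<alpha>2 \<alpha>3 b1 b2 c1 c2 p q r s x c :: int
  assumes sf: "squarefree d" and d4: "d mod 4 \<noteq> 3" and pos: "\<alpha>1 > 0" "\<alpha>2 > 0"
    and det: "p * s - q * r = 1"
    and \<alpha>2: "\<alpha>2 = \<alpha>1 * p ^ 2 + 2 * b1 * p * r + c1 * r ^ 2"
    and b2: "b2 = \<alpha>1 * p * q + b1 * (p * s + q * r) + c1 * r * s"
    and c2: "c2 = \<alpha>1 * q ^ 2 + 2 * b1 * q * s + c1 * s ^ 2"
    and d1: "b1 ^ 2 + d = \<alpha>1 * c1"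
    and N: "x ^ 2 + d * c ^ 2 = v * \<alpha>1 * \<alpha>2 * \<alpha>3"
    and L1: "\<alpha>1 dvd x - b1 * c" and L2: "\<alpha>2 dvd x + b2 * c"
    and loc: "\<And>\<pi>. prime \<pi> \<Longrightarrow> \<pi> dvd \<alpha>1 \<Longrightarrow> \<pi> dvd \<alpha>2 \<Longrightarrow> \<pi> dvd x \<Longrightarrow> \<pi> dvd c \<Longrightarrow> \<not> \<pi> dvd d \<Longrightarrow> \<pi> dvd b1 - b2"
  obtains X Y where "X ^ 2 + d * Y ^ 2 = v * \<alpha>3"
proof -
  define e where "e = p * \<alpha>1 + r * b1"
  \<comment> \<open>X + Y w = (x + c w) (e - r w), and M is the norm of e + r w. The quotient is (X
    + Y w) / M, so its integrality means that M divides X and Y.\<close>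
  define X where "X = x * e + d * c * r"
  define Y where "Y = c * e - x * r"
  define M where "M = \<alpha>1 * \<alpha>2"
  have M0: "M > 0" using pos by (simp add: M_def)
  obtain j where "x - b1 * c = \<alpha>1 * j" using L1 by (elim dvdE)
  then have j: "x = b1 * c + \<alpha>1 * j" by simp
  obtain i where "x + b2 * c = \<alpha>2 * i" using L2 by (elim dvdE)
  then have i: "x = - b2 * c + \<alpha>2 * i" by simp
  have e2: "e = \<alpha>2 * s - b2 * r" using det \<alpha>2 b2 unfolding e_def by Groebner_Basis.algebra
  have d2: "b2 ^ 2 + d = \<alpha>2 * c2" using det \<alpha>2 b2 c2 d1 by Groebner_Basis.algebra
  have Ne: "e ^ 2 + d * r ^ 2 = \<alpha>1 * \<alpha>2" using \<alpha>2 d1 unfolding e_def by Groebner_Basis.algebra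
  have NXY: "X ^ 2 + d * Y ^ 2 = v * \<alpha>3 * M ^ 2"
  proof -
    have "X ^ 2 + d * Y ^ 2 = (x ^ 2 + d * c ^ 2) * (e ^ 2 + d * r ^ 2)" unfolding X_def Y_def by Groebner_Basis.algebra
    then show ?thesis unfolding N Ne M_def by Groebner_Basis.algebra
  qed
  \<comment> \<open>Membership of x + c w in both ideals makes \<alpha>1 and \<alpha>2 divide Y, and
    M divide X + b1 Y and X - b2 Y; what is still missing concerns only primes dividing both
    \<alpha>1 and \<alpha>2.\<close>
  have Y1: "Y = \<alpha>1 * (c * p - j * r)" using j unfolding Y_def e_def by Groebner_Basis.algebra
  have Y2: "Y = \<alpha>2 * (c * s - i * r)" using i e2 unfolding Y_def by Groebner_Basis.algebra
  have Xb1: "X + b1 * Y = M * (p * i - c * q)"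
  proof -
    have "p * b1 + r * c1 - p * b2 = - q * \<alpha>2" using det \<alpha>2 b2 by Groebner_Basis.algebra
    moreover have "X + b1 * Y = \<alpha>1 * (p * x + c * (p * b1 + r * c1))" using d1 unfolding X_def Y_def e_def by Groebner_Basis.algebra
    ultimately show ?thesis using i unfolding M_def by Groebner_Basis.algebra
  qed
  have Xb2: "X - b2 * Y = M * (s * j - c * q)"
  proof -
    have "b1 * s + r * c2 - b2 * s = - q * \<alpha>1" using det \<alpha>2 b2 c2 by Groebner_Basis.algebra
    moreover have "X - b2 * Y = \<alpha>2 * (x * s + c * (r * c2 - b2 * s))" using d2 e2 unfolding X_def Y_def by Groebner_Basis.algebra
    ultimately show ?thesis using j unfolding M_def by Groebner_Basis.algebra
  qed
  define k where "k = s * j - c * q"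
  \<comment> \<open>2 x (X + Y w) is the sum of the products of X + Y w with x + c w and with x - c
    w, and M divides each of the two; this step and the next are its two coordinates.\<close>
  have t1: "2 * x * Y = M * (i * (c * p - j * r) + c * k - v * \<alpha>3 * r)"
  proof -
    have "2 * x * Y = (x * Y + c * X) - (x ^ 2 + d * c ^ 2) * r" unfolding X_def Y_def by Groebner_Basis.algebra
    moreover have "x * Y + c * X = M * (i * (c * p - j * r) + c * k)"
      using Xb2 Y1 i unfolding M_def k_def by Groebner_Basis.algebra
    ultimately show ?thesis unfolding N M_def by Groebner_Basis.algebra
  qed
  have t2: "2 * x * X = M * ((c * p - j * r) * (i * b2 - c * c2) + x * k + v * \<alpha>3 * e)"
  proof -
    have "2 * x * X = (x * X - d * c * Y) + (x ^ 2 + d * c ^ 2) * e" unfolding X_def Y_def by Groebner_Basis.algebra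
    moreover have "x * X - d * c * Y = M * ((c * p - j * r) * (i * b2 - c * c2) + x * k)"
    proof -
      have "x * b2 - d * c = \<alpha>2 * (i * b2 - c * c2)" using d2 i by Groebner_Basis.algebra
      then show ?thesis using Xb2 Y1 unfolding M_def k_def by Groebner_Basis.algebra
    qed
    ultimately show ?thesis unfolding N M_def by Groebner_Basis.algebra
  qed
  define g where "g = gcd M (gcd X Y)"
  have g0: "g > 0" using M0 by (simp add: g_def)
  obtain n where n: "M = g * n" using gcd_dvd1[of M "gcd X Y"] unfolding g_def by (elim dvdE)
  have "g dvd X" "g dvd Y" unfolding g_def by (meson gcd_dvd1 gcd_dvd2 dvd_trans)+
  then obtain X' Y' where X': "X = g * X'" and Y': "Y = g * Y'" by (elim dvdE)
  have cop: "gcd n (gcd X' Y') = 1"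
  proof -
    have "g = gcd (g * n) (gcd (g * X') (g * Y'))"
      unfolding n[symmetric] X'[symmetric] Y'[symmetric] by (rule g_def)
    also have "\<dots> = g * gcd n (gcd X' Y')" using g0 by (simp add: gcd_mult_left)
    finally show ?thesis using g0 by simp
  qed
  have n0: "n \<noteq> 0" using M0 n by auto
  have N': "X' ^ 2 + d * Y' ^ 2 = v * \<alpha>3 * n ^ 2"
  proof -
    have "g ^ 2 * (X' ^ 2 + d * Y' ^ 2) = g ^ 2 * (v * \<alpha>3 * n ^ 2)"
      using NXY unfolding X' Y' n by Groebner_Basis.algebra
    then show ?thesis using g0 by simp
  qed
  have red: "n dvd t" if "g * t = M * z" for t z
  proof -
    have "g * t = g * (n * z)" using that unfolding n by (simp add: mult.assoc)
    then show ?thesis using g0 by simp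
  qed
  \<comment> \<open>n is the denominator of the quotient. A prime \<pi> dividing n divides none of
    X', Y', d, 2, but all of \<alpha>1, \<alpha>2, x, c. Then \<open>loc\<close> gives b1 = b2
    modulo \<pi>, while divisibility by M gives b1 = - b2, so \<pi> divides b1 and with it
    X'.\<close>
  have "is_unit n"
  proof (rule ccontr)
    assume "\<not> is_unit n"
    then obtain \<pi> where \<pi>: "prime \<pi>" "\<pi> dvd n" using n0 prime_divisor_exists by blast
    note pm = prime_dvd_mult_iff[OF \<pi>(1)] and pp = prime_dvd_power_iff[OF \<pi>(1)]
    have nu: "\<not> is_unit \<pi>" using \<pi>(1) not_prime_unit by blast
    have nXY: "\<not> (\<pi> dvd X' \<and> \<pi> dvd Y')"
    proof
      assume "\<pi> dvd X' \<and> \<pi> dvd Y'"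
      then have "\<pi> dvd gcd n (gcd X' Y')" using \<pi>(2) by simp
      then show False using cop nu by simp
    qed
    have "\<pi> ^ 2 dvd n ^ 2" using \<pi>(2) by (rule dvd_power_same)
    then have sq: "\<pi> ^ 2 dvd X' ^ 2 + d * Y' ^ 2" unfolding N' by (rule dvd_mult)
    have nX: "\<not> \<pi> dvd X'"
    proof
      assume *: "\<pi> dvd X'"
      then have "\<pi> ^ 2 dvd X' ^ 2" by (rule dvd_power_same)
      then have dY: "\<pi> ^ 2 dvd d * Y' ^ 2" using sq by (simp add: dvd_add_right_iff)
      have "coprime \<pi> Y'" using nXY * \<pi>(1) by (intro prime_imp_coprime) auto
      then have "coprime (\<pi> ^ 2) (Y' ^ 2)" by simp
      then have "\<pi> ^ 2 dvd d" using dY by (simp add: coprime_dvd_mult_left_iff)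
      then show False using squarefreeD[OF sf] nu by blast
    qed
    have "\<pi> dvd \<pi> ^ 2" by (simp add: power2_eq_square)
    from dvd_trans[OF this sq] have sq1: "\<pi> dvd X' ^ 2 + d * Y' ^ 2" .
    have nY: "\<not> \<pi> dvd Y'"
    proof
      assume "\<pi> dvd Y'"
      then have "\<pi> dvd d * Y' ^ 2" by (simp add: pp)
      then have "\<pi> dvd X' ^ 2" using sq1 by (simp add: dvd_add_left_iff)
      then show False using nX by (simp add: pp)
    qed
    have nd: "\<not> \<pi> dvd d"
    proof
      assume "\<pi> dvd d"
      then have "\<pi> dvd X' ^ 2" using sq1 by (simp add: dvd_add_left_iff)
      then show False using nX by (simp add: pp)
    qed
    have n2: "\<not> \<pi> dvd 2"
    proof
      assume "\<pi> dvd 2"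
      then have "\<pi> = 2" using primes_dvd_imp_eq[OF \<pi>(1)] by auto
      then have "odd X'" "odd Y'" "4 dvd X' ^ 2 + d * Y' ^ 2" using nX nY sq by auto
      then have "X' ^ 2 mod 4 = 1" "Y' ^ 2 mod 4 = 1" using odd_square_mod_4 by blast+
      then obtain s t where "X' ^ 2 = 4 * s + 1" "Y' ^ 2 = 4 * t + 1" by (metis mult_div_mod_eq)
      then have "X' ^ 2 + d * Y' ^ 2 = (1 + d) + 4 * (s + d * t)" by (simp add: algebra_simps)
      with \<open>4 dvd X' ^ 2 + d * Y' ^ 2\<close> have "4 dvd 1 + d" by (simp add: dvd_add_left_iff)
      with d4 show False by presburger
    qed
    have "n dvd \<alpha>1 * Y'" by (rule red[of _ "c * s - i * r"]) (use Y2 Y' M_def in Groebner_Basis.algebra)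
    from dvd_trans[OF \<pi>(2) this] have a1: "\<pi> dvd \<alpha>1" using nY by (simp add: pm)
    have "n dvd \<alpha>2 * Y'" by (rule red[of _ "c * p - j * r"]) (use Y1 Y' M_def in Groebner_Basis.algebra)
    from dvd_trans[OF \<pi>(2) this] have a2: "\<pi> dvd \<alpha>2" using nY by (simp add: pm)
    have "n dvd 2 * x * Y'" by (rule red[OF trans[OF _ t1]]) (use Y' in Groebner_Basis.algebra)
    from dvd_trans[OF \<pi>(2) this] have px: "\<pi> dvd x" using nY n2 by (simp add: pm)
    have "\<pi> dvd x ^ 2 + d * c ^ 2" unfolding N using a1 by simp
    then have "\<pi> dvd d * c ^ 2" using px by (simp add: dvd_add_right_iff pp)
    then have pc: "\<pi> dvd c" using nd by (simp add: pm pp)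
    have b12: "\<pi> dvd b1 - b2" by (rule loc[OF \<pi>(1) a1 a2 px pc nd])
    have "n dvd X' + b1 * Y'" by (rule red[of _ "p * i - c * q"]) (use Xb1 X' Y' in Groebner_Basis.algebra)
    then have 1: "\<pi> dvd X' + b1 * Y'" using \<pi>(2) by (rule dvd_trans[rotated])
    have "n dvd X' - b2 * Y'" by (rule red[of _ "s * j - c * q"]) (use Xb2 X' Y' in Groebner_Basis.algebra)
    then have 2: "\<pi> dvd X' - b2 * Y'" using \<pi>(2) by (rule dvd_trans[rotated])
    have "\<pi> dvd (X' + b1 * Y') - (X' - b2 * Y')" using 1 2 by (rule dvd_diff)
    then have "\<pi> dvd (b1 + b2) * Y'" by (simp add: algebra_simps)
    then have "\<pi> dvd b1 + b2" using nY by (simp add: pm)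
    then have "\<pi> dvd (b1 + b2) + (b1 - b2)" using b12 by (rule dvd_add)
    then have "\<pi> dvd 2 * b1" by simp
    then have "\<pi> dvd b1" using n2 by (simp add: pm)
    then have "\<pi> dvd X'" using 1 by (simp add: dvd_add_left_iff)
    with nX show False by simp
  qed
  then have "n = 1 \<or> n = - 1" by auto
  then have "n ^ 2 = 1" by auto
  then show ?thesis using that[of X' Y'] N' by simp
qed

lemma squarefree_dvd_square:
  fixes v x :: int
  assumes "squarefree v" "v dvd x ^ 2" shows "v dvd x"
proof (cases "x = 0")
  case False
  have v0: "v \<noteq> 0" using assms(1) by auto
  show ?thesis
  proof (rule multiplicity_le_imp_dvd[OF v0])
    fix p :: int assume p: "prime p"
    have "multiplicity p v \<le> 1"
      using assms(1)[unfolded squarefree_factorial_semiring''[OF v0]] p by simp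
    moreover have "1 \<le> multiplicity p x" if "multiplicity p v \<noteq> 0"
    proof -
      have "p dvd v" by (rule ccontr) (use that not_dvd_imp_multiplicity_0[of p v] in simp)
      then have "p dvd x ^ 2" using assms(2) by (rule dvd_trans)
      then have "p dvd x" using p by (rule prime_dvd_power[rotated])
      then show ?thesis using False p by (intro multiplicity_geI) (auto simp: not_prime_unit)
    qed
    ultimately show "multiplicity p v \<le> multiplicity p x" by linarith
  qed
qed auto

lemma norm_less_contradiction:
  fixes u v d A C X Y :: int
  assumes "squarefree v" "coprime u v" "v > 0" and N: "X ^ 2 + d * Y ^ 2 = v * (A * v + u * C ^ 2)"
    and "v * (A * v + u * C ^ 2) < d" "C > 0" "C ^ 2 < v ^ 2" "d > 0"
  shows False
proof -
  have "Y = 0"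
  proof (rule ccontr)
    assume "Y \<noteq> 0"
    then have "Y ^ 2 \<ge> 1" by (metis abs_ge_zero int_one_le_iff_zero_less power2_less_eq_zero_iff linorder_not_le)
    then have "d * 1 \<le> d * Y ^ 2" using assms(8) by (intro mult_left_mono) auto
    then show False using N assms(5) zero_le_power2[of X] by linarith
  qed
  then have X: "X ^ 2 = v * (A * v + u * C ^ 2)" using N by simp
  have "v dvd X" by (rule squarefree_dvd_square[OF assms(1)]) (simp add: X)
  then obtain k where "X = v * k" by (elim dvdE)
  then have "v * (v * k ^ 2) = v * (A * v + u * C ^ 2)" using X by (simp add: power2_eq_square algebra_simps)
  then have "v * k ^ 2 = A * v + u * C ^ 2" using assms(3) by simp
  then have "u * C ^ 2 = v * (k ^ 2 - A)" by (simp add: algebra_simps)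
  then have "v dvd u * C ^ 2" by simp
  then have "v dvd C ^ 2" using assms(2) by (simp add: coprime_commute coprime_dvd_mult_right_iff)
  then have "v dvd C" by (rule squarefree_dvd_square[OF assms(1)])
  then have "v \<le> C" using assms(6) by (rule zdvd_imp_le)
  then have "v ^ 2 \<le> C ^ 2" using assms(3) by (intro power_mono) auto
  with assms(7) show False by simp
qed

text \<open>The point at infinity gets the coordinates \<open>(1, 1, 0)\<close>, which satisfy the same equations as the others.\<close>

definition pt_coords :: "ecpt \<Rightarrow> int \<Rightarrow> int \<Rightarrow> int \<Rightarrow> bool" where
  "pt_coords P A B C = (case P of None \<Rightarrow> A = 1 \<and> B = 1 \<and> C = 0
     | Some (x, y) \<Rightarrow> C > 0 \<and> coprime A C \<and> x = of_int A / of_int C ^ 2 \<and> y = of_int B / of_int C ^ 3)"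

text \<open>The reduced denominators n of x and q of y satisfy q^2 = n^3 by the curve equation, so C
  = q / n is an integer with n = C^2 and q = C^3.\<close>

lemma pt_coords_exist:
  assumes "on_curve a b P" obtains A B C where "pt_coords P A B C"
proof (cases P)
  case None
  then show ?thesis using that[of 1 1 0] by (simp add: pt_coords_def)
next
  case (Some xy)
  then obtain x y where P: "P = Some (x, y)" by fastforce
  obtain m n where mn: "quotient_of x = (m, n)" by fastforce
  obtain p q where pq: "quotient_of y = (p, q)" by fastforce
  have n: "n > 0" "coprime m n" "x = of_int m / of_int n"
    using mn by (auto simp: quotient_of_denom_pos quotient_of_coprime quotient_of_div)
  have q: "q > 0" "coprime p q" "y = of_int p / of_int q"
    using pq by (auto simp: quotient_of_denom_pos quotient_of_coprime quotient_of_div)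
  have y: "y ^ 2 = x ^ 3 + of_int a * x + of_int b" using assms P by simp
  have mp: "rat_of_int m = x * of_int n" "rat_of_int p = y * of_int q" using n q by auto
  have "rat_of_int (p ^ 2 * n ^ 3) = of_int (q ^ 2 * (m ^ 3 + n * (a * m * n + b * n ^ 2)))"
    unfolding of_int_mult of_int_power of_int_add mp using y by Groebner_Basis.algebra
  then have eq: "p ^ 2 * n ^ 3 = q ^ 2 * (m ^ 3 + n * (a * m * n + b * n ^ 2))" by (simp only: of_int_eq_iff)
  have "coprime n (m ^ 3 + n * (a * m * n + b * n ^ 2))"
  proof (rule coprimeI)
    fix t assume t: "t dvd n" "t dvd m ^ 3 + n * (a * m * n + b * n ^ 2)"
    then have "t dvd m ^ 3" by (simp add: dvd_add_left_iff)
    moreover have "coprime (m ^ 3) n" using n by simp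
    ultimately show "is_unit t" using t(1) by (metis coprime_common_divisor)
  qed
  then have "coprime (n ^ 3) (m ^ 3 + n * (a * m * n + b * n ^ 2))" by simp
  moreover have "n ^ 3 dvd q ^ 2 * (m ^ 3 + n * (a * m * n + b * n ^ 2))" unfolding eq[symmetric] by (rule dvd_triv_right)
  ultimately have "n ^ 3 dvd q ^ 2" by (rule coprime_dvd_mult_left_iff[THEN iffD1])
  moreover have "q ^ 2 dvd n ^ 3"
  proof -
    have "coprime q p" using q(2) by (subst coprime_commute)
    then have "coprime (q ^ 2) (p ^ 2)" by simp
    moreover have "q ^ 2 dvd p ^ 2 * n ^ 3" unfolding eq by (rule dvd_triv_left)
    ultimately show ?thesis by (rule coprime_dvd_mult_right_iff[THEN iffD1])
  qed
  ultimately have qn: "q ^ 2 = n ^ 3" using n q by (simp add: zdvd_antisym_nonneg)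
  then have "n ^ 2 dvd q ^ 2" by (simp add: power3_eq_cube power2_eq_square)
  then have "n dvd q" by simp
  then obtain C where C: "q = n * C" by (elim dvdE)
  have C0: "C > 0" using C n q by (simp add: zero_less_mult_iff)
  have "n ^ 2 * C ^ 2 = n ^ 2 * n" using qn C by (simp add: power_mult_distrib power3_eq_cube power2_eq_square)
  then have nC: "n = C ^ 2" using n by simp
  then have qC: "q = C ^ 3" using C by (simp add: power3_eq_cube power2_eq_square)
  have "coprime m C" using n(2) nC by simp
  then have "pt_coords P m p C" using C0 n(3) q(3) unfolding nC qC by (simp add: P pt_coords_def)
  then show ?thesis by (rule that)
qed

lemma pt_coords_xfrac:
  assumes "pt_coords P A B C" shows "xfrac P = (A, C ^ 2)"
proof (cases P)
  case (Some xy)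
  obtain x y where P: "P = Some (x, y)" using Some by fastforce
  obtain A0 Z0 where AZ: "xfrac P = (A0, Z0)" by fastforce
  have c: "C > 0" "coprime A C" "x = of_int A / of_int (C ^ 2)" using assms P by (auto simp: pt_coords_def)
  obtain g where g: "g > 0" "A = g * A0" "C ^ 2 = g * Z0"
    by (rule xfrac_scale[OF AZ[unfolded P] c(3)]) (use c in auto)
  have "coprime A (C ^ 2)" using c by simp
  moreover have "g dvd A" "g dvd C ^ 2" unfolding g(2,3) by simp_all
  ultimately have "is_unit g" by (rule coprime_common_divisor)
  then have "g = 1" using g(1) by simp
  then show ?thesis unfolding AZ g(2,3) by simp
qed (use assms in \<open>simp add: pt_coords_def\<close>)

lemma pt_coords_curve:
  assumes "pt_coords P A B C" "on_curve a b P"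
  shows "B ^ 2 = A ^ 3 + a * A * C ^ 4 + b * C ^ 6" "coprime A C" "C \<ge> 0"
proof -
  show "B ^ 2 = A ^ 3 + a * A * C ^ 4 + b * C ^ 6"
  proof (cases P)
    case (Some xy)
    then obtain x y where P: "P = Some (x, y)" by fastforce
    have C: "C > 0" "x = of_int A / of_int C ^ 2" "y = of_int B / of_int C ^ 3" using assms P by (auto simp: pt_coords_def)
    have AB: "rat_of_int A = x * of_int C ^ 2" "rat_of_int B = y * of_int C ^ 3" using C by auto
    have "y ^ 2 = x ^ 3 + of_int a * x + of_int b" using assms P by simp
    then have "rat_of_int (B ^ 2) = of_int (A ^ 3 + a * A * C ^ 4 + b * C ^ 6)"
      unfolding of_int_mult of_int_power of_int_add AB by Groebner_Basis.algebra
    then show ?thesis by (simp only: of_int_eq_iff)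
  qed (use assms in \<open>simp add: pt_coords_def\<close>)
  show "coprime A C" "C \<ge> 0" using assms by (auto simp: pt_coords_def split: option.splits)
qed

lemma rat_of_int_square:
  fixes x :: rat
  assumes "x ^ 2 = of_int n" obtains k where "x = of_int k"
proof -
  obtain p q where pq: "quotient_of x = (p, q)" by fastforce
  have q: "q > 0" "coprime p q" "x = of_int p / of_int q"
    using pq by (auto simp: quotient_of_denom_pos quotient_of_coprime quotient_of_div)
  have "rat_of_int (p ^ 2) = of_int (n * q ^ 2)" using assms q by (simp add: power_divide field_simps)
  then have "p ^ 2 = n * q ^ 2" by (simp only: of_int_eq_iff)
  then have "q ^ 2 dvd p ^ 2" by simp
  then have "q dvd p" by simp
  then have "is_unit q" using q(2) by (metis coprime_common_divisor dvd_refl)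
  then have "q = 1" using q(1) by simp
  then show ?thesis using q(3) that[of p] by simp
qed

text \<open>The three collinear points of a chord, cleared of denominators: \<open>l\<close> and \<open>m\<close> are the slope and
  the intercept of the chord times \<open>C1 C2 C3\<close>, integral because their squares are.\<close>

lemma chord_integral:
  assumes ch: "chord a b sl ic x1 x2 x3" and y: "y1 = sl * x1 + ic" "y2 = sl * x2 + ic"
    and x: "x1 = of_int A1 / of_int C1 ^ 2" "x2 = of_int A2 / of_int C2 ^ 2" "x3 = of_int A3 / of_int C3 ^ 2"
    and yy: "y1 = of_int B1 / of_int C1 ^ 3" "y2 = of_int B2 / of_int C2 ^ 3"
    and C: "C1 > 0" "C2 > 0" "C3 > 0"
  obtains l m where
    "l ^ 2 = A1 * C2 ^ 2 * C3 ^ 2 + A2 * C1 ^ 2 * C3 ^ 2 + A3 * C1 ^ 2 * C2 ^ 2"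
    "a * (C1 * C2 * C3) ^ 2 - 2 * l * m = A1 * A2 * C3 ^ 2 + A1 * A3 * C2 ^ 2 + A2 * A3 * C1 ^ 2"
    "m ^ 2 - b * (C1 * C2 * C3) ^ 2 = A1 * A2 * A3"
    "B1 * C2 * C3 = A1 * l + C1 ^ 2 * m" "B2 * C1 * C3 = A2 * l + C2 ^ 2 * m"
proof -
  define c where "c = rat_of_int (C1 * C2 * C3)"
  have A: "rat_of_int A1 = x1 * of_int C1 ^ 2" "rat_of_int A2 = x2 * of_int C2 ^ 2" "rat_of_int A3 = x3 * of_int C3 ^ 2"
    "rat_of_int B1 = y1 * of_int C1 ^ 3" "rat_of_int B2 = y2 * of_int C2 ^ 3"
    using x yy C by auto
  note defs = of_int_mult of_int_power of_int_add of_int_diff of_int_numeral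
  have c: "c = of_int C1 * of_int C2 * of_int C3" by (simp add: c_def)
  have "(c * sl) ^ 2 = of_int (A1 * C2 ^ 2 * C3 ^ 2 + A2 * C1 ^ 2 * C3 ^ 2 + A3 * C1 ^ 2 * C2 ^ 2)"
    unfolding defs A c using ch unfolding chord_def by Groebner_Basis.algebra
  then obtain l where l: "c * sl = of_int l" by (rule rat_of_int_square)
  have "(c * ic) ^ 2 = of_int (b * (C1 * C2 * C3) ^ 2 + A1 * A2 * A3)"
    unfolding defs A c using ch unfolding chord_def by Groebner_Basis.algebra
  then obtain m where m: "c * ic = of_int m" by (rule rat_of_int_square)
  have r1: "rat_of_int (l ^ 2) = of_int (A1 * C2 ^ 2 * C3 ^ 2 + A2 * C1 ^ 2 * C3 ^ 2 + A3 * C1 ^ 2 * C2 ^ 2)"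
    unfolding defs A l[symmetric] c using ch unfolding chord_def by Groebner_Basis.algebra
  have r2: "rat_of_int (a * (C1 * C2 * C3) ^ 2 - 2 * l * m) = of_int (A1 * A2 * C3 ^ 2 + A1 * A3 * C2 ^ 2 + A2 * A3 * C1 ^ 2)"
    unfolding defs A l[symmetric] m[symmetric] c using ch unfolding chord_def by Groebner_Basis.algebra
  have r3: "rat_of_int (m ^ 2 - b * (C1 * C2 * C3) ^ 2) = of_int (A1 * A2 * A3)"
    unfolding defs A m[symmetric] c using ch unfolding chord_def by Groebner_Basis.algebra
  have r4: "rat_of_int (B1 * C2 * C3) = of_int (A1 * l + C1 ^ 2 * m)"
    unfolding defs A l[symmetric] m[symmetric] c y by Groebner_Basis.algebra
  have r5: "rat_of_int (B2 * C1 * C3) = of_int (A2 * l + C2 ^ 2 * m)"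
    unfolding defs A l[symmetric] m[symmetric] c y by Groebner_Basis.algebra
  show ?thesis using r1 r2 r3 r4 r5 unfolding of_int_eq_iff by (rule that)
qed

lemma (in elliptic_curve) third_point_coords:
  assumes P: "P1 \<in> carrier E" "P2 \<in> carrier E" and ne: "P1 \<noteq> P2"
    and c1: "pt_coords P1 A1 B1 C1" "C1 > 0" and c2: "pt_coords P2 A2 B2 C2" "C2 > 0"
    and c3: "pt_coords (P1 \<otimes>\<^bsub>E\<^esub> inv\<^bsub>E\<^esub> P2) A3 B3 C3"
  obtains l m where "C3 > 0"
    "l ^ 2 = A1 * C2 ^ 2 * C3 ^ 2 + A2 * C1 ^ 2 * C3 ^ 2 + A3 * C1 ^ 2 * C2 ^ 2"
    "a * (C1 * C2 * C3) ^ 2 - 2 * l * m = A1 * A2 * C3 ^ 2 + A1 * A3 * C2 ^ 2 + A2 * A3 * C1 ^ 2"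
    "m ^ 2 - b * (C1 * C2 * C3) ^ 2 = A1 * A2 * A3"
    "B1 * C2 * C3 = A1 * l + C1 ^ 2 * m" "- B2 * C1 * C3 = A2 * l + C2 ^ 2 * m"
proof -
  obtain x1 y1 where P1: "P1 = Some (x1, y1)" "x1 = of_int A1 / of_int C1 ^ 2" "y1 = of_int B1 / of_int C1 ^ 3"
    using c1 by (auto simp: pt_coords_def split: option.splits)
  obtain x2 y2 where P2: "P2 = Some (x2, y2)" "x2 = of_int A2 / of_int C2 ^ 2" "y2 = of_int B2 / of_int C2 ^ 3"
    using c2 by (auto simp: pt_coords_def split: option.splits)
  have on: "on_curve a b (Some (x1, y1))" "on_curve a b (Some (x2, - y2))"
    using P on_curve_neg[of a b P2] unfolding carrier_ec_group P1(1) P2(1) by (auto simp: ec_neg_simps)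
  have nn: "\<not> (x1 = x2 \<and> y1 = - (- y2))" using ne P1(1) P2(1) by auto
  have D: "P1 \<otimes>\<^bsub>E\<^esub> inv\<^bsub>E\<^esub> P2 = ec_add a (Some (x1, y1)) (Some (x2, - y2))"
    using P unfolding mult_ec_group P1(1) P2(1) by (simp add: inv_E ec_neg_simps)
  obtain sl ic x3 where ch: "chord a b sl ic x1 x2 x3" "y1 = sl * x1 + ic" "- y2 = sl * x2 + ic"
    and S: "ec_add a (Some (x1, y1)) (Some (x2, - y2)) = Some (x3, - (sl * x3 + ic))"
    using ec_add_chord[OF on nn] by metis
  have C3: "C3 > 0" "x3 = of_int A3 / of_int C3 ^ 2" using c3 unfolding D S by (auto simp: pt_coords_def)
  have y2: "- y2 = of_int (- B2) / of_int C2 ^ 3" using P2(3) by simp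
  show ?thesis
    by (rule chord_integral[OF ch P1(2) P2(2) C3(2) P1(3) y2 c1(2) c2(2) C3(1)]) (rule that[OF C3(1)])
qed

section \<open>The form attached to a point\<close>

lemma coprime_primeI:
  fixes x y :: int
  assumes "x \<noteq> 0" and no: "\<And>\<pi>. prime \<pi> \<Longrightarrow> \<pi> dvd x \<Longrightarrow> \<pi> dvd y \<Longrightarrow> False"
  shows "coprime x y"
proof (rule ccontr)
  assume "\<not> coprime x y"
  then have nu: "\<not> is_unit (gcd x y)" by (simp add: coprime_iff_gcd_eq_1)
  have "gcd x y \<noteq> 0" using assms(1) by simp
  then obtain \<pi> where \<pi>: "prime \<pi>" "\<pi> dvd gcd x y" using prime_divisor_exists[OF _ nu] by metis
  show False by (rule no[OF \<pi>(1)]) (use \<pi>(2) in simp_all)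
qed

text \<open>Write v = v' g and C = C' g, so that \<alpha>0 = A v' + u C' C. A prime dividing
  \<alpha>0 and C divides v' and also C' or g. The former contradicts coprimality of v' and C', the
  latter squarefreeness of v.\<close>

lemma coprime_reduced_form_coeff:
  fixes u v A C \<alpha>0 :: int
  assumes sf: "squarefree v" and v: "v > 0" and AC: "coprime A C"
    and \<alpha>: "A * v + u * C ^ 2 = gcd v C * \<alpha>0" and "\<alpha>0 \<noteq> 0"
  shows "coprime \<alpha>0 C"
proof (rule coprime_primeI[OF assms(5)])
  fix \<pi> assume \<pi>: "prime \<pi>" "\<pi> dvd \<alpha>0" "\<pi> dvd C"
  note pm = prime_dvd_mult_iff[OF \<pi>(1)]
  define g where "g = gcd v C"
  have g0: "g \<noteq> 0" using v by (simp add: g_def)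
  then obtain v' C' where v': "v = v' * g" and C': "C = C' * g" and vC: "coprime v' C'"
    using gcd_coprime_exists[of v C] unfolding g_def by metis
  have nu: "\<not> is_unit \<pi>" using \<pi>(1) by (metis not_prime_unit)
  have "g * \<alpha>0 = g * (A * v' + u * C' * C)" unfolding \<alpha>[folded g_def, symmetric] v' C'
    by (simp add: power2_eq_square algebra_simps)
  then have eq: "\<alpha>0 = A * v' + u * C' * C" using g0 by simp
  have "\<pi> dvd A * v'" using \<pi>(2,3) unfolding eq by (simp add: dvd_add_left_iff)
  moreover have "\<not> \<pi> dvd A"
  proof
    assume "\<pi> dvd A"
    from coprime_common_divisor[OF AC this \<pi>(3)] nu show False by simp
  qed
  ultimately have pv: "\<pi> dvd v'" by (simp add: pm)
  from \<pi>(3) C' have "\<pi> dvd C' \<or> \<pi> dvd g" by (simp add: pm)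
  then show False
  proof
    assume "\<pi> dvd C'"
    from coprime_common_divisor[OF vC pv this] nu show False by simp
  next
    assume "\<pi> dvd g"
    then have "\<pi> * \<pi> dvd v' * g" using pv by (intro mult_dvd_mono)
    then have "\<pi> ^ 2 dvd v" unfolding v' by (simp add: power2_eq_square)
    from squarefreeD[OF sf this] nu show False by simp
  qed
qed

text \<open>C need not be invertible modulo \<alpha>, since g = gcd v C divides both. It is
  invertible modulo \<alpha>0 = \<alpha> / g, which fixes \<beta> there; modulo g the choice \<beta>
  = 0 works because g divides d, and g and \<alpha>0 are coprime.\<close>

lemma form_coeff_exists:
  fixes u v A B C d \<alpha> w :: int
  assumes sf: "squarefree v" and v: "v > 0" and AC: "coprime A C"
    and \<alpha>: "\<alpha> = A * v + u * C ^ 2" "\<alpha> > 0" and N: "v ^ 4 * B ^ 2 + d * C ^ 6 = \<alpha> * w" and vd: "v dvd d"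
  obtains \<beta> where "gcd v C dvd \<beta>" "\<alpha> dvd gcd v C * (C ^ 3 * \<beta> + v ^ 2 * B)" "\<alpha> dvd \<beta> ^ 2 + d"
proof -
  define g where "g = gcd v C"
  have g0: "g \<noteq> 0" using v by (simp add: g_def)
  have gv: "g dvd v" and gC: "g dvd C" by (simp_all add: g_def)
  have "g dvd \<alpha>" unfolding \<alpha>(1) using gv gC by (simp add: power2_eq_square)
  then obtain \<alpha>0 where \<alpha>0: "\<alpha> = g * \<alpha>0" by (elim dvdE)
  have nz: "\<alpha>0 \<noteq> 0" using \<alpha>0 \<alpha>(2) by (metis less_irrefl mult_zero_right)
  have cC: "coprime \<alpha>0 C"
    by (rule coprime_reduced_form_coeff[OF sf v AC _ nz, where u = u]) (use \<alpha>(1) \<alpha>0 g_def in simp)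
  then have cg: "coprime \<alpha>0 g" using gC coprime_divisors[of \<alpha>0 \<alpha>0 g C] by simp
  then have gc: "coprime g \<alpha>0" by (subst coprime_commute)
  have "gcd (C ^ 3 * g) \<alpha>0 = 1" using cC cg by (simp add: coprime_iff_gcd_eq_1[symmetric] ac_simps)
  then obtain s t where st: "s * (C ^ 3 * g) + t * \<alpha>0 = 1" using bezout_int[of "C ^ 3 * g" \<alpha>0] by metis
  \<comment> \<open>s inverts C^3 g modulo \<alpha>0; the factor g makes \<beta> vanish modulo
    g.\<close>
  define \<beta> where "\<beta> = - g * s * v ^ 2 * B"
  have gb: "g dvd \<beta>" by (simp add: \<beta>_def)
  have "C ^ 3 * \<beta> + v ^ 2 * B = \<alpha>0 * (t * v ^ 2 * B)" using st unfolding \<beta>_def by Groebner_Basis.algebra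
  then have a0: "\<alpha>0 dvd C ^ 3 * \<beta> + v ^ 2 * B" by simp
  then have 2: "\<alpha> dvd g * (C ^ 3 * \<beta> + v ^ 2 * B)" unfolding \<alpha>0 by (rule mult_dvd_mono[OF dvd_refl])
  have "C ^ 6 * (\<beta> ^ 2 + d) = (C ^ 3 * \<beta> + v ^ 2 * B) * (C ^ 3 * \<beta> - v ^ 2 * B) + \<alpha>0 * (g * w)"
    using N unfolding \<alpha>0 by Groebner_Basis.algebra
  then have "\<alpha>0 dvd C ^ 6 * (\<beta> ^ 2 + d)" using a0 by simp
  moreover have "coprime \<alpha>0 (C ^ 6)" using cC by simp
  ultimately have "\<alpha>0 dvd \<beta> ^ 2 + d" using coprime_dvd_mult_right_iff[of \<alpha>0 "C ^ 6"] by blast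
  moreover have "g dvd \<beta> ^ 2 + d" using gb dvd_trans[OF gv vd] by (simp add: power2_eq_square)
  ultimately have "\<alpha> dvd \<beta> ^ 2 + d" unfolding \<alpha>0 by (intro divides_mult gc)
  with gb 2 show ?thesis by (intro that) (simp_all add: g_def)
qed

text \<open>The conditions on d say that - 4 d is fundamental. A common prime \<pi> of the
  coefficients has \<pi>^2 dividing \<beta>^2 + d, so either \<pi>^2 divides d, or \<pi> = 2 with
  \<beta> odd, which forces d = 3 modulo 4.\<close>

lemma prim_form:
  fixes \<alpha> \<beta> d :: int
  assumes sf: "squarefree d" and d4: "d mod 4 = 1 \<or> d mod 4 = 2" and \<alpha>: "\<alpha> > 0" "\<alpha> dvd \<beta> ^ 2 + d"
  shows "(\<alpha>, 2 * \<beta>, (\<beta> ^ 2 + d) div \<alpha>) \<in> prim_pos_forms (- 4 * d)"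
proof -
  define \<gamma> where "\<gamma> = (\<beta> ^ 2 + d) div \<alpha>"
  have eq: "\<beta> ^ 2 + d = \<alpha> * \<gamma>" using \<alpha>(2) by (simp add: \<gamma>_def)
  have "coprime \<alpha> (gcd (2 * \<beta>) \<gamma>)"
  proof (rule coprime_primeI)
    fix \<pi> :: int assume \<pi>: "prime \<pi>" "\<pi> dvd \<alpha>" "\<pi> dvd gcd (2 * \<beta>) \<gamma>"
    then have p2: "\<pi> dvd 2 * \<beta>" "\<pi> dvd \<gamma>" by simp_all
    have "\<pi> * \<pi> dvd \<alpha> * \<gamma>" using \<pi>(2) p2(2) by (rule mult_dvd_mono)
    then have sq: "\<pi> ^ 2 dvd \<beta> ^ 2 + d" unfolding eq by (simp add: power2_eq_square)
    show False
    proof (cases "\<pi> dvd \<beta>")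
      case True
      then have "\<pi> ^ 2 dvd \<beta> ^ 2" by (rule dvd_power_same)
      then have "\<pi> ^ 2 dvd d" using sq by (simp add: dvd_add_right_iff)
      from squarefreeD[OF sf this] \<pi>(1) show False by (metis not_prime_unit)
    next
      case False
      then have "\<pi> dvd 2" using p2(1) prime_dvd_mult_iff[OF \<pi>(1)] by blast
      then have "\<pi> = 2" using primes_dvd_imp_eq[OF \<pi>(1)] by auto
      then have "odd \<beta>" "4 dvd \<beta> ^ 2 + d" using False sq by auto
      from this(1) have "\<beta> ^ 2 mod 4 = 1" by (rule odd_square_mod_4)
      with \<open>4 dvd \<beta> ^ 2 + d\<close> d4 show False by presburger
    qed
  qed (use \<alpha> in simp)
  moreover have "(2 * \<beta>) ^ 2 - 4 * \<alpha> * \<gamma> = - 4 * d" using eq by (simp add: power_mult_distrib)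
  ultimately show ?thesis unfolding \<gamma>_def[symmetric] using \<alpha>(1) by (simp add: prim_pos_forms_def)
qed

section \<open>Inequivalence of the forms of different points\<close>

locale map_suitable_curve = elliptic_curve +
  fixes u v d :: int
  assumes uv: "u > 0" "v > 0" and deriv_pos: "3 * u ^ 2 + a * v ^ 2 > 0"
    and d_eq: "d = v * (u ^ 3 + a * u * v ^ 2 - b * v ^ 3)" and d_pos: "d > 0"
    and sf: "squarefree d" and d4: "d mod 4 = 1 \<or> d mod 4 = 2"
begin

lemma v_dvd_d: "v dvd d"
  by (simp add: d_eq)

lemma sf_v: "squarefree v"
  using v_dvd_d sf by (rule squarefree_mono)

lemma coprime_uv: "coprime u v"
proof -
  define g where "g = gcd u v"
  have "g dvd u" "g dvd v" by (simp_all add: g_def)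
  then obtain u' v' where u': "u = g * u'" and v': "v = g * v'" by (elim dvdE)
  have "d = g ^ 2 * (v' * (g ^ 2 * u' ^ 3 + g ^ 2 * a * u' * v' ^ 2 - g ^ 2 * b * v' ^ 3))"
    unfolding d_eq u' v' by Groebner_Basis.algebra
  then have "g ^ 2 dvd d" by simp
  from squarefreeD[OF sf this] show ?thesis unfolding g_def by (simp add: coprime_iff_gcd_eq_1)
qed

text \<open>With f the cubic, d = - v^4 f(- u / v). For C \<noteq> 0 the identity is v^4 C^6 times
  the factorisation of f(A / C^2) - f(- u / v) by the difference of the arguments.\<close>

lemma alpha_norm:
  assumes "B ^ 2 = A ^ 3 + a * A * C ^ 4 + b * C ^ 6"
  shows "v ^ 4 * B ^ 2 + d * C ^ 6 =
    (A * v + u * C ^ 2) * (v * (v ^ 2 * A ^ 2 - u * v * A * C ^ 2 + (u ^ 2 + a * v ^ 2) * C ^ 4))"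
  unfolding assms d_eq by Groebner_Basis.algebra

text \<open>d > 0 says that the cubic is negative at - u / v, and 3 u^2 + a v^2 > 0 makes it
  increasing to the left of this value. So no point of the curve has abscissa at most - u /
  v.\<close>

lemma alpha_pos:
  assumes c: "pt_coords P A B C" and on: "on_curve a b P"
  shows "A * v + u * C ^ 2 > 0"
proof (cases "C = 0")
  case True
  then have "A = 1" using c by (auto simp: pt_coords_def split: option.splits)
  then show ?thesis using uv True by simp
next
  case False
  note cc = pt_coords_curve[OF c on]
  have C: "C > 0" using False cc(3) by simp
  show ?thesis
  proof (rule ccontr)
    assume "\<not> ?thesis"
    then have le: "A * v + u * C ^ 2 \<le> 0" by simp
    define s where "s = - (A * v)"
    define t where "t = u * C ^ 2"
    have t: "t > 0" and s: "s \<ge> t" using uv C le by (auto simp: s_def t_def)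
    have "s ^ 2 \<ge> t ^ 2" "s * t \<ge> t * t" using s t by (auto intro: power_mono mult_right_mono)
    then have st: "s ^ 2 + s * t - 2 * t ^ 2 \<ge> 0" by (simp add: power2_eq_square)
    have "v ^ 2 * A ^ 2 - u * v * A * C ^ 2 + (u ^ 2 + a * v ^ 2) * C ^ 4
      = (s ^ 2 + s * t - 2 * t ^ 2) + (3 * u ^ 2 + a * v ^ 2) * C ^ 4"
      unfolding s_def t_def by Groebner_Basis.algebra
    moreover have "(3 * u ^ 2 + a * v ^ 2) * C ^ 4 \<ge> 0" using deriv_pos by simp
    ultimately have "v * (v ^ 2 * A ^ 2 - u * v * A * C ^ 2 + (u ^ 2 + a * v ^ 2) * C ^ 4) \<ge> 0"
      using st uv by simp
    then have "v ^ 4 * B ^ 2 + d * C ^ 6 \<le> 0" unfolding alpha_norm[OF cc(1)] using le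
      by (intro mult_nonpos_nonneg)
    moreover have "d * C ^ 6 > 0" using d_pos C by simp
    moreover have "v ^ 4 * B ^ 2 \<ge> 0" by simp
    ultimately show False by linarith
  qed
qed

text \<open>The ideal \<open>(\<alpha>, \<beta> + w)\<close> attached to a point \<open>P = (A / C\<^sup>2, B / C\<^sup>3)\<close>: with \<open>Q = (- u / v, w / v\<^sup>2)\<close> on the
  curve over the quadratic field, \<open>\<alpha>\<close> is the numerator of \<open>x(P) - x(Q)\<close> and modulo \<open>\<alpha> / gcd v C\<close> the
  residue \<open>- \<beta>\<close> of \<open>w\<close> makes \<open>y(Q)\<close> congruent to \<open>y(P)\<close>.\<close>

definition form_data :: "ecpt \<Rightarrow> int \<Rightarrow> int \<Rightarrow> bool" where
  "form_data P \<alpha> \<beta> \<longleftrightarrow> (\<exists>A B C. pt_coords P A B C \<and> \<alpha> = A * v + u * C ^ 2 \<and> gcd v C dvd \<beta> \<and>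
     \<alpha> dvd gcd v C * (C ^ 3 * \<beta> + v ^ 2 * B) \<and> \<alpha> dvd \<beta> ^ 2 + d)"

lemma form_data_exists:
  assumes "P \<in> carrier E" obtains \<alpha> \<beta> where "form_data P \<alpha> \<beta>"
proof -
  have on: "on_curve a b P" using assms unfolding carrier_ec_group .
  obtain A B C where c: "pt_coords P A B C" by (rule pt_coords_exist[OF on])
  note cc = pt_coords_curve[OF c on]
  obtain \<beta> where "gcd v C dvd \<beta>" "A * v + u * C ^ 2 dvd gcd v C * (C ^ 3 * \<beta> + v ^ 2 * B)" "A * v + u * C ^ 2 dvd \<beta> ^ 2 + d"
    by (rule form_coeff_exists[OF sf_v uv(2) cc(2) refl alpha_pos[OF c on] alpha_norm[OF cc(1)] v_dvd_d])
  then have "form_data P (A * v + u * C ^ 2) \<beta>" unfolding form_data_def using c by blast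
  then show ?thesis by (rule that)
qed

lemma form_data_prim:
  assumes "P \<in> carrier E" "form_data P \<alpha> \<beta>"
  shows "(\<alpha>, 2 * \<beta>, (\<beta> ^ 2 + d) div \<alpha>) \<in> prim_pos_forms (- 4 * d)"
proof -
  have on: "on_curve a b P" using assms(1) unfolding carrier_ec_group .
  obtain A B C where c: "pt_coords P A B C" "\<alpha> = A * v + u * C ^ 2" "\<alpha> dvd \<beta> ^ 2 + d"
    using assms(2) unfolding form_data_def by metis
  show ?thesis using prim_form[OF sf d4 _ c(3)] alpha_pos[OF c(1) on] c(2) by metis
qed

text \<open>Modulo \<alpha>0 the point Q over the quadratic field reduces to P, which lies on the
  line, so the scaled value of the line at Q agrees with the ordinate given by \<beta>. Modulo gcd v
  C both terms vanish, because v and C do.\<close>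

lemma form_data_congruence:
  fixes A B C A' C' C3 l m \<alpha> \<beta> :: int
  assumes AC: "coprime A C" and \<alpha>: "\<alpha> = A * v + u * C ^ 2" "\<alpha> > 0" and gb: "gcd v C dvd \<beta>"
    and dv: "\<alpha> dvd gcd v C * (C ^ 3 * \<beta> + v ^ 2 * B)" and line: "B * C' = A * l + C ^ 2 * m"
  shows "\<alpha> dvd v * (u * l - v * m) - \<beta> * (C * C')"
proof -
  define g where "g = gcd v C"
  have g0: "g \<noteq> 0" using uv by (simp add: g_def)
  have gv: "g dvd v" and gC: "g dvd C" by (simp_all add: g_def)
  have "g dvd \<alpha>" unfolding \<alpha>(1) using gv gC by (simp add: power2_eq_square)
  then obtain \<alpha>0 where \<alpha>0: "\<alpha> = g * \<alpha>0" by (elim dvdE)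
  have nz: "\<alpha>0 \<noteq> 0" using \<alpha>0 \<alpha>(2) by (metis less_irrefl mult_zero_right)
  have cC: "coprime \<alpha>0 C"
    by (rule coprime_reduced_form_coeff[OF sf_v uv(2) AC _ nz, where u = u]) (use \<alpha>(1) \<alpha>0 g_def in simp)
  then have cg: "coprime \<alpha>0 g" using gC coprime_divisors[of \<alpha>0 \<alpha>0 g C] by simp
  then have gc: "coprime g \<alpha>0" by (subst coprime_commute)
  let ?x = "v * (u * l - v * m)"
  have a0: "\<alpha>0 dvd C ^ 3 * \<beta> + v ^ 2 * B" using dv g0 unfolding \<alpha>0 g_def[symmetric] by simp
  have "C ^ 2 * (?x - \<beta> * (C * C')) = \<alpha>0 * (g * v * l) - (C ^ 3 * \<beta> + v ^ 2 * B) * C'"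
    using line \<alpha>(1) \<alpha>0 by Groebner_Basis.algebra
  then have "\<alpha>0 dvd C ^ 2 * (?x - \<beta> * (C * C'))" using a0 by simp
  moreover have "coprime \<alpha>0 (C ^ 2)" using cC by simp
  ultimately have "\<alpha>0 dvd ?x - \<beta> * (C * C')" using coprime_dvd_mult_right_iff[of \<alpha>0 "C ^ 2"] by blast
  moreover have "g dvd ?x - \<beta> * (C * C')" using gv gC by simp
  ultimately show ?thesis unfolding \<alpha>0 by (intro divides_mult gc)
qed

text \<open>Supplies the hypothesis \<open>loc\<close> of \<open>common_norm_descent\<close>. Such a
  \<pi> divides C3 but neither C1 nor C2: P1 - P2 reduces to O, so P1 and P2 reduce to the same
  point modulo \<pi>, and this point determines \<beta>1 and \<beta>2 modulo \<pi>.\<close>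

lemma form_data_local:
  fixes A1 B1 C1 A2 B2 C2 A3 C3 l m \<beta>1 \<beta>2 \<alpha>1 \<alpha>2 :: int
  assumes cop: "coprime A1 C1" "coprime A2 C2" "coprime A3 C3"
    and \<alpha>: "\<alpha>1 = A1 * v + u * C1 ^ 2" "\<alpha>2 = A2 * v + u * C2 ^ 2"
    and dv: "\<alpha>1 dvd gcd v C1 * (C1 ^ 3 * \<beta>1 + v ^ 2 * B1)" "\<alpha>2 dvd gcd v C2 * (C2 ^ 3 * \<beta>2 + v ^ 2 * B2)"
    and l: "l ^ 2 = A1 * C2 ^ 2 * C3 ^ 2 + A2 * C1 ^ 2 * C3 ^ 2 + A3 * C1 ^ 2 * C2 ^ 2"
    and lm: "a * (C1 * C2 * C3) ^ 2 - 2 * l * m = A1 * A2 * C3 ^ 2 + A1 * A3 * C2 ^ 2 + A2 * A3 * C1 ^ 2"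
    and line: "B1 * C2 * C3 = A1 * l + C1 ^ 2 * m" "- B2 * C1 * C3 = A2 * l + C2 ^ 2 * m"
    and C: "C1 > 0" "C2 > 0" "C3 > 0"
    and \<pi>: "prime \<pi>" "\<pi> dvd \<alpha>1" "\<pi> dvd \<alpha>2" "\<pi> dvd C1 * C2 * C3" "\<not> \<pi> dvd d"
  shows "\<pi> dvd \<beta>1 - \<beta>2"
proof -
  note pm = prime_dvd_mult_iff[OF \<pi>(1)] and pp = prime_dvd_power_iff[OF \<pi>(1)]
  have nu: "\<not> is_unit \<pi>" using \<pi>(1) by (metis not_prime_unit)
  have nv: "\<not> \<pi> dvd v" using \<pi>(5) v_dvd_d by (metis dvd_trans)
  have not_both: "\<not> (\<pi> dvd A \<and> \<pi> dvd C)" if "coprime A C" for A C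
    using coprime_common_divisor[OF that, of \<pi>] nu by metis
  have nC: "\<not> \<pi> dvd C" if "coprime A C" "\<pi> dvd A * v + u * C ^ 2" for A C
  proof
    assume *: "\<pi> dvd C"
    then have "\<pi> dvd A * v" using that(2) by (simp add: dvd_add_left_iff pp)
    then have "\<pi> dvd A" using nv by (simp add: pm)
    with not_both[OF that(1)] * show False by simp
  qed
  have n1: "\<not> \<pi> dvd C1" using nC[OF cop(1)] \<pi>(2) \<alpha>(1) by simp
  have n2: "\<not> \<pi> dvd C2" using nC[OF cop(2)] \<pi>(3) \<alpha>(2) by simp
  have p3: "\<pi> dvd C3" using \<pi>(4) n1 n2 by (simp add: pm)
  have ng: "\<not> \<pi> dvd gcd v C" for C using nv by simp
  have e1: "\<pi> dvd C1 ^ 3 * \<beta>1 + v ^ 2 * B1" using dvd_trans[OF \<pi>(2) dv(1)] ng by (simp only: pm) simp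
  have e2: "\<pi> dvd C2 ^ 3 * \<beta>2 + v ^ 2 * B2" using dvd_trans[OF \<pi>(3) dv(2)] ng by (simp only: pm) simp
  have nl: "\<not> \<pi> dvd l"
  proof
    assume "\<pi> dvd l"
    then have "\<pi> dvd l ^ 2" by (simp add: pp)
    moreover have "\<pi> dvd A1 * C2 ^ 2 * C3 ^ 2 + A2 * C1 ^ 2 * C3 ^ 2" using p3 by (simp add: pp)
    ultimately have "\<pi> dvd A3 * C1 ^ 2 * C2 ^ 2" unfolding l by (simp add: dvd_add_right_iff)
    then have "\<pi> dvd A3" using n1 n2 by (simp add: pm pp)
    with not_both[OF cop(3)] p3 show False by simp
  qed
  \<comment> \<open>After cancelling C1 C2 C3 the right side keeps a factor C3, divisible by \<pi>,
    while l is prime to \<pi>; hence B1 / C1^3 and B2 / C2^3 are congruent modulo \<pi>.\<close>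
  have "C1 * C2 * C3 * (l * (B1 * C2 ^ 3 - B2 * C1 ^ 3))
    = C1 * C2 * C3 * (C3 * ((A1 * C2 ^ 2 + A2 * C1 ^ 2) ^ 2 - A1 * A2 * C1 ^ 2 * C2 ^ 2 + a * C1 ^ 4 * C2 ^ 4))"
    using l lm line by Groebner_Basis.algebra
  then have "l * (B1 * C2 ^ 3 - B2 * C1 ^ 3)
    = C3 * ((A1 * C2 ^ 2 + A2 * C1 ^ 2) ^ 2 - A1 * A2 * C1 ^ 2 * C2 ^ 2 + a * C1 ^ 4 * C2 ^ 4)" using C by simp
  then have "\<pi> dvd l * (B1 * C2 ^ 3 - B2 * C1 ^ 3)" using p3 by simp
  then have e3: "\<pi> dvd B1 * C2 ^ 3 - B2 * C1 ^ 3" using nl by (simp add: pm)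
  have "C1 ^ 3 * C2 ^ 3 * (\<beta>1 - \<beta>2) = C2 ^ 3 * (C1 ^ 3 * \<beta>1 + v ^ 2 * B1)
    - (C1 ^ 3 * (C2 ^ 3 * \<beta>2 + v ^ 2 * B2) + v ^ 2 * (B1 * C2 ^ 3 - B2 * C1 ^ 3))" by Groebner_Basis.algebra
  moreover have "\<pi> dvd \<dots>" by (rule dvd_diff[OF dvd_mult[OF e1] dvd_add[OF dvd_mult[OF e2] dvd_mult[OF e3]]])
  ultimately have "\<pi> dvd C1 ^ 3 * C2 ^ 3 * (\<beta>1 - \<beta>2)" by simp
  then show ?thesis using n1 n2 by (simp add: pm pp)
qed

lemma form_equiv_norm:
  assumes P: "P1 \<in> carrier E" "P2 \<in> carrier E" and ne: "P1 \<noteq> P2"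
    and F: "form_data P1 \<alpha>1 \<beta>1" "form_data P2 \<alpha>2 \<beta>2"
    and eqv: "form_equiv (\<alpha>1, 2 * \<beta>1, (\<beta>1 ^ 2 + d) div \<alpha>1) (\<alpha>2, 2 * \<beta>2, (\<beta>2 ^ 2 + d) div \<alpha>2)"
    and c3: "pt_coords (P1 \<otimes>\<^bsub>E\<^esub> inv\<^bsub>E\<^esub> P2) A3 B3 C3"
  obtains X Y where "X ^ 2 + d * Y ^ 2 = v * (A3 * v + u * C3 ^ 2)"
proof -
  obtain A1 B1 C1 where c1: "pt_coords P1 A1 B1 C1" "\<alpha>1 = A1 * v + u * C1 ^ 2"
    and g1: "gcd v C1 dvd \<beta>1" "\<alpha>1 dvd gcd v C1 * (C1 ^ 3 * \<beta>1 + v ^ 2 * B1)" "\<alpha>1 dvd \<beta>1 ^ 2 + d"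
    using F(1) unfolding form_data_def by metis
  obtain A2 B2 C2 where c2: "pt_coords P2 A2 B2 C2" "\<alpha>2 = A2 * v + u * C2 ^ 2"
    and g2: "gcd v C2 dvd \<beta>2" "\<alpha>2 dvd gcd v C2 * (C2 ^ 3 * \<beta>2 + v ^ 2 * B2)" "\<alpha>2 dvd \<beta>2 ^ 2 + d"
    using F(2) unfolding form_data_def by metis
  have on: "on_curve a b P1" "on_curve a b P2" using P unfolding carrier_ec_group .
  note k1 = pt_coords_curve[OF c1(1) on(1)] and k2 = pt_coords_curve[OF c2(1) on(2)]
  have pos: "\<alpha>1 > 0" "\<alpha>2 > 0" using alpha_pos[OF c1(1) on(1)] alpha_pos[OF c2(1) on(2)] c1(2) c2(2) by metis+
  define \<gamma>1 where "\<gamma>1 = (\<beta>1 ^ 2 + d) div \<alpha>1"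
  define \<gamma>2 where "\<gamma>2 = (\<beta>2 ^ 2 + d) div \<alpha>2"
  have d1: "\<beta>1 ^ 2 + d = \<alpha>1 * \<gamma>1" using g1(3) by (simp add: \<gamma>1_def)
  obtain p q r s where det: "p * s - q * r = 1" and a2: "\<alpha>2 = \<alpha>1 * p ^ 2 + 2 * \<beta>1 * p * r + \<gamma>1 * r ^ 2"
    and b2: "2 * \<beta>2 = 2 * \<alpha>1 * p * q + 2 * \<beta>1 * (p * s + q * r) + 2 * \<gamma>1 * r * s"
    and cc2: "\<gamma>2 = \<alpha>1 * q ^ 2 + 2 * \<beta>1 * q * s + \<gamma>1 * s ^ 2"
    using eqv unfolding form_equiv_def \<gamma>1_def[symmetric] \<gamma>2_def[symmetric] prod.case by metis
  have b2': "\<beta>2 = \<alpha>1 * p * q + \<beta>1 * (p * s + q * r) + \<gamma>1 * r * s"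
  proof -
    have "2 * \<beta>2 = 2 * (\<alpha>1 * p * q + \<beta>1 * (p * s + q * r) + \<gamma>1 * r * s)" using b2 by Groebner_Basis.algebra
    then show ?thesis by simp
  qed
  have Ne: "(p * \<alpha>1 + r * \<beta>1) ^ 2 + d * r ^ 2 = \<alpha>1 * \<alpha>2" using a2 d1 by Groebner_Basis.algebra
  show ?thesis
  proof (cases "P1 = None \<or> P2 = None")
    case True
    \<comment> \<open>If one of the points is O, its \<alpha> is v and P1 - P2 is the other point up
      to sign, so the element provided by the equivalence already has the required norm.\<close>
    then show ?thesis
    proof
      assume P1: "P1 = None"
      then have "\<alpha>1 = v" using c1 by (simp add: pt_coords_def)
      have "P1 = \<one>\<^bsub>E\<^esub>" using P1 by (simp add: one_ec_group)
      then have "P1 \<otimes>\<^bsub>E\<^esub> inv\<^bsub>E\<^esub> P2 = ec_neg P2" using P by (simp add: inv_E[symmetric])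
      then have "xfrac (P1 \<otimes>\<^bsub>E\<^esub> inv\<^bsub>E\<^esub> P2) = xfrac P2" by simp
      then have "A3 = A2" "C3 ^ 2 = C2 ^ 2" using pt_coords_xfrac[OF c3] pt_coords_xfrac[OF c2(1)] by simp_all
      then have "\<alpha>2 = A3 * v + u * C3 ^ 2" using c2(2) by simp
      then show ?thesis using that[of "p * \<alpha>1 + r * \<beta>1" r] Ne \<open>\<alpha>1 = v\<close> by simp
    next
      assume P2: "P2 = None"
      then have "\<alpha>2 = v" using c2 by (simp add: pt_coords_def)
      have "P2 = \<one>\<^bsub>E\<^esub>" using P2 by (simp add: one_ec_group)
      then have "P1 \<otimes>\<^bsub>E\<^esub> inv\<^bsub>E\<^esub> P2 = P1" using P by simp
      then have "A3 = A1" "C3 ^ 2 = C1 ^ 2" using pt_coords_xfrac[OF c3] pt_coords_xfrac[OF c1(1)] by simp_all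
      then have "\<alpha>1 = A3 * v + u * C3 ^ 2" using c1(2) by simp
      then show ?thesis using that[of "p * \<alpha>1 + r * \<beta>1" r] Ne \<open>\<alpha>2 = v\<close> by (simp add: mult.commute)
    qed
  next
    case False
    then have C12: "C1 > 0" "C2 > 0" using c1(1) c2(1) by (auto simp: pt_coords_def split: option.splits)
    obtain l m where C3: "C3 > 0"
      and l: "l ^ 2 = A1 * C2 ^ 2 * C3 ^ 2 + A2 * C1 ^ 2 * C3 ^ 2 + A3 * C1 ^ 2 * C2 ^ 2"
      and lm: "a * (C1 * C2 * C3) ^ 2 - 2 * l * m = A1 * A2 * C3 ^ 2 + A1 * A3 * C2 ^ 2 + A2 * A3 * C1 ^ 2"
      and m: "m ^ 2 - b * (C1 * C2 * C3) ^ 2 = A1 * A2 * A3"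
      and line: "B1 * C2 * C3 = A1 * l + C1 ^ 2 * m" "- B2 * C1 * C3 = A2 * l + C2 ^ 2 * m"
      by (rule third_point_coords[OF P ne c1(1) C12(1) c2(1) C12(2) c3])
    have on3: "on_curve a b (P1 \<otimes>\<^bsub>E\<^esub> inv\<^bsub>E\<^esub> P2)" using P unfolding carrier_ec_group[symmetric] by simp
    note k3 = pt_coords_curve[OF c3 on3]
    \<comment> \<open>x + c w is the equation Y - (slope X + intercept) of the chord through P1 and
      - P2, evaluated at (- u / v, w / v^2) and multiplied by v^2 C1 C2 C3. Up to scaling its norm
      is the product of the three differences of abscissas, which yields v times the three values A
      v + u C^2.\<close>
    define x where "x = v * (u * l - v * m)"
    define c where "c = C1 * C2 * C3"
    have N: "x ^ 2 + d * c ^ 2 = v * \<alpha>1 * \<alpha>2 * (A3 * v + u * C3 ^ 2)"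
      using l lm m unfolding x_def c_def c1(2) c2(2) d_eq by Groebner_Basis.algebra
    have L1: "\<alpha>1 dvd x - \<beta>1 * c"
      using form_data_congruence[OF k1(2) c1(2) pos(1) g1(1,2), of "C2 * C3" l m] line(1)
      unfolding x_def c_def by (simp add: mult.assoc)
    have L2: "\<alpha>2 dvd x + \<beta>2 * c"
    proof -
      have "\<alpha>2 dvd gcd v C2 * (C2 ^ 3 * - \<beta>2 + v ^ 2 * - B2)"
      proof -
        have "gcd v C2 * (C2 ^ 3 * - \<beta>2 + v ^ 2 * - B2) = - (gcd v C2 * (C2 ^ 3 * \<beta>2 + v ^ 2 * B2))" by Groebner_Basis.algebra
        then show ?thesis using g2(2) by simp
      qed
      from form_data_congruence[OF k2(2) c2(2) pos(2) _ this, of "C1 * C3" l m]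
      have "\<alpha>2 dvd v * (u * l - v * m) - - \<beta>2 * (C2 * (C1 * C3))" using g2(1) line(2) by (simp add: mult.assoc)
      then show ?thesis unfolding x_def c_def by (simp add: ac_simps)
    qed
    have loc: "\<pi> dvd \<beta>1 - \<beta>2" if "prime \<pi>" "\<pi> dvd \<alpha>1" "\<pi> dvd \<alpha>2" "\<pi> dvd c" "\<not> \<pi> dvd d" for \<pi>
      by (rule form_data_local[OF k1(2) k2(2) k3(2) c1(2) c2(2) g1(2) g2(2) l lm line C12 C3 that(1-3) _ that(5)])
        (use that(4) in \<open>simp add: c_def\<close>)
    have dm: "d mod 4 \<noteq> 3" using d4 by auto
    show ?thesis
      by (rule common_norm_descent[OF sf dm pos det a2 b2' cc2 d1 N L1 L2]) (use loc that in auto)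
  qed
qed

lemma form_inequiv:
  assumes P: "P1 \<in> carrier E" "P2 \<in> carrier E" and ne: "P1 \<noteq> P2"
    and F: "form_data P1 \<alpha>1 \<beta>1" "form_data P2 \<alpha>2 \<beta>2"
    and x: "xfrac (P1 \<otimes>\<^bsub>E\<^esub> inv\<^bsub>E\<^esub> P2) = (A, Z)" "v * (A * v + u * Z) < d" "Z < v ^ 2"
  shows "\<not> form_equiv (\<alpha>1, 2 * \<beta>1, (\<beta>1 ^ 2 + d) div \<alpha>1) (\<alpha>2, 2 * \<beta>2, (\<beta>2 ^ 2 + d) div \<alpha>2)"
proof
  assume eqv: "form_equiv (\<alpha>1, 2 * \<beta>1, (\<beta>1 ^ 2 + d) div \<alpha>1) (\<alpha>2, 2 * \<beta>2, (\<beta>2 ^ 2 + d) div \<alpha>2)"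
  let ?D = "P1 \<otimes>\<^bsub>E\<^esub> inv\<^bsub>E\<^esub> P2"
  have D: "?D \<in> carrier E" using P by simp
  have on: "on_curve a b ?D" using D unfolding carrier_ec_group .
  obtain A3 B3 C3 where c: "pt_coords ?D A3 B3 C3" by (rule pt_coords_exist[OF on])
  have AZ: "A = A3" "Z = C3 ^ 2" using pt_coords_xfrac[OF c] x(1) by simp_all
  have "?D \<noteq> None"
  proof
    assume "?D = None"
    then have "?D = \<one>\<^bsub>E\<^esub>" by (simp add: one_ec_group)
    then have "P1 = P2" using P by (metis inv_closed inv_inv inv_equality inv_unique')
    with ne show False ..
  qed
  then have C3: "C3 > 0" using c by (auto simp: pt_coords_def split: option.splits)
  obtain X Y where "X ^ 2 + d * Y ^ 2 = v * (A3 * v + u * C3 ^ 2)"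
    by (rule form_equiv_norm[OF P ne F eqv c])
  from norm_less_contradiction[OF sf_v coprime_uv uv(2) this _ C3 _ d_pos] x(2,3) AZ show False by simp
qed

end

section \<open>Classes of binary forms\<close>

lemma form_equiv_refl: "form_equiv f f"
proof -
  obtain a b c where "f = (a, b, c)" by (rule prod_cases3)
  then show ?thesis unfolding form_equiv_def
    by simp (rule exI[of _ 1], rule exI[of _ 0], rule exI[of _ 0], rule exI[of _ 1], simp)
qed

lemma form_equiv_sym:
  assumes "form_equiv f g" shows "form_equiv g f"
proof -
  obtain a b c a' b' c' where fg: "f = (a, b, c)" "g = (a', b', c')" by (cases f, cases g)
  obtain p q r s where 1: "p * s - q * r = 1" "a' = a * p ^ 2 + b * p * r + c * r ^ 2"
    "b' = 2 * a * p * q + b * (p * s + q * r) + 2 * c * r * s" "c' = a * q ^ 2 + b * q * s + c * s ^ 2"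
    using assms unfolding fg form_equiv_def prod.case by metis
  have "s * p - (- q) * (- r) = 1" using 1(1) by Groebner_Basis.algebra
  moreover have "a = a' * s ^ 2 + b' * s * (- r) + c' * (- r) ^ 2" using 1 by Groebner_Basis.algebra
  moreover have "b = 2 * a' * s * (- q) + b' * (s * p + (- q) * (- r)) + 2 * c' * (- r) * p" using 1 by Groebner_Basis.algebra
  moreover have "c = a' * (- q) ^ 2 + b' * (- q) * p + c' * p ^ 2" using 1 by Groebner_Basis.algebra
  ultimately show ?thesis unfolding fg form_equiv_def prod.case by blast
qed

lemma form_equiv_trans:
  assumes "form_equiv f g" "form_equiv g h" shows "form_equiv f h"
proof -
  obtain a b c a' b' c' a2 b2 c2 where fg: "f = (a, b, c)" "g = (a', b', c')" "h = (a2, b2, c2)" by (cases f, cases g, cases h)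
  obtain p q r s where 1: "p * s - q * r = 1" "a' = a * p ^ 2 + b * p * r + c * r ^ 2"
    "b' = 2 * a * p * q + b * (p * s + q * r) + 2 * c * r * s" "c' = a * q ^ 2 + b * q * s + c * s ^ 2"
    using assms(1) unfolding fg form_equiv_def prod.case by metis
  obtain P Q R S where 2: "P * S - Q * R = 1" "a2 = a' * P ^ 2 + b' * P * R + c' * R ^ 2"
    "b2 = 2 * a' * P * Q + b' * (P * S + Q * R) + 2 * c' * R * S" "c2 = a' * Q ^ 2 + b' * Q * S + c' * S ^ 2"
    using assms(2) unfolding fg form_equiv_def prod.case by metis
  define p' q' r' s' where d: "p' = p * P + q * R" "q' = p * Q + q * S" "r' = r * P + s * R" "s' = r * Q + s * S"
  have "p' * s' - q' * r' = 1" using 1(1) 2(1) unfolding d by Groebner_Basis.algebra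
  moreover have "a2 = a * p' ^ 2 + b * p' * r' + c * r' ^ 2" unfolding d 2(2) 1(2-4) by Groebner_Basis.algebra
  moreover have "b2 = 2 * a * p' * q' + b * (p' * s' + q' * r') + 2 * c * r' * s'" unfolding d 2(3) 1(2-4) by Groebner_Basis.algebra
  moreover have "c2 = a * q' ^ 2 + b * q' * s' + c * s' ^ 2" unfolding d 2(4) 1(2-4) by Groebner_Basis.algebra
  ultimately show ?thesis unfolding fg form_equiv_def prod.case by blast
qed

text \<open>Positivity comes from 4 a a' = (2 a p + b r)^2 - D r^2; primitivity from the inverse
  substitution, since each form's coefficients are integral combinations of the other's.\<close>

lemma form_equiv_prim:
  assumes D: "D < 0" and f: "f \<in> prim_pos_forms D" and e: "form_equiv f g"
  shows "g \<in> prim_pos_forms D"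
proof -
  obtain a b c a' b' c' where fg: "f = (a, b, c)" "g = (a', b', c')" by (cases f, cases g)
  have f': "b ^ 2 - 4 * a * c = D" "a > 0" "gcd a (gcd b c) = 1" using f by (auto simp: fg prim_pos_forms_def)
  obtain p q r s where 1: "p * s - q * r = 1" "a' = a * p ^ 2 + b * p * r + c * r ^ 2"
    "b' = 2 * a * p * q + b * (p * s + q * r) + 2 * c * r * s" "c' = a * q ^ 2 + b * q * s + c * s ^ 2"
    using e unfolding fg form_equiv_def prod.case by metis
  obtain P Q R S where 2: "a = a' * P ^ 2 + b' * P * R + c' * R ^ 2"
    "b = 2 * a' * P * Q + b' * (P * S + Q * R) + 2 * c' * R * S" "c = a' * Q ^ 2 + b' * Q * S + c' * S ^ 2"
    using form_equiv_sym[OF e] unfolding fg form_equiv_def prod.case by metis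
  have D': "b' ^ 2 - 4 * a' * c' = D" using 1 f'(1) by Groebner_Basis.algebra
  have "a' > 0"
  proof -
    have eq: "4 * a * a' = (2 * a * p + b * r) ^ 2 + (- D) * r ^ 2" using 1(2) f'(1) by Groebner_Basis.algebra
    have "(2 * a * p + b * r) ^ 2 + (- D) * r ^ 2 > 0"
    proof (cases "r = 0")
      case True
      then have "p \<noteq> 0" using 1(1) by auto
      then show ?thesis using True f'(2) by simp
    next
      case False
      then have "(- D) * r ^ 2 > 0" using D by (intro mult_pos_pos) auto
      then show ?thesis by (rule add_nonneg_pos[rotated]) simp
    qed
    then have "0 < (4 * a) * a'" unfolding eq .
    then show ?thesis using f'(2) by (simp add: zero_less_mult_iff)
  qed
  moreover have "gcd a' (gcd b' c') = 1"
  proof -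
    let ?g = "gcd a' (gcd b' c')"
    have g: "?g dvd a'" "?g dvd b'" "?g dvd c'" by (auto intro: dvd_trans)
    have "?g dvd a" "?g dvd b" "?g dvd c" unfolding 2 using g by simp_all
    then have "?g dvd gcd a (gcd b c)" by simp
    then show ?thesis using f'(3) by simp
  qed
  ultimately show ?thesis using D' by (simp add: fg prim_pos_forms_def)
qed

text \<open>Gauss reduction by extremal choice: take the least leading coefficient a in the class
  and translate b into the interval from - a to a; exchanging the outer coefficients then gives a
  \<le> c by minimality.\<close>

lemma reduced_form_exists:
  assumes D: "D < 0" and f: "f \<in> prim_pos_forms D"
  obtains a b c where "form_equiv f (a, b, c)" "\<bar>b\<bar> \<le> a" "a \<le> c"
proof -
  define Q where "Q n \<longleftrightarrow> (\<exists>a b c. form_equiv f (a, b, c) \<and> nat a = n)" for n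
  have "\<exists>n. Q n" using form_equiv_refl unfolding Q_def by (cases f) blast
  then have least: "Q (LEAST n. Q n)" by (rule LeastI_ex)
  then obtain a b c where abc: "form_equiv f (a, b, c)" and n: "nat a = (LEAST n. Q n)" unfolding Q_def by blast
  have min: "a \<le> x" if "form_equiv f (x, y, z)" for x y z
  proof -
    have "(LEAST n. Q n) \<le> nat x" by (rule Least_le) (use that in \<open>auto simp: Q_def\<close>)
    moreover have "(x, y, z) \<in> prim_pos_forms D" by (rule form_equiv_prim[OF D f that])
    then have "x > 0" by (simp add: prim_pos_forms_def)
    ultimately show ?thesis using n by linarith
  qed
  have a: "a > 0" using form_equiv_prim[OF D f abc] by (simp add: prim_pos_forms_def)
  define k where "k = - ((b + a) div (2 * a))"
  define b' where "b' = b + 2 * a * k"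
  define c' where "c' = a * k ^ 2 + b * k + c"
  have "b' + a = (b + a) mod (2 * a)" unfolding b'_def k_def by (simp add: minus_mult_div_eq_mod[symmetric])
  then have "0 \<le> b' + a" "b' + a < 2 * a" using a by simp_all
  then have b': "\<bar>b'\<bar> \<le> a" by simp
  have "form_equiv (a, b, c) (a, b', c')" unfolding form_equiv_def prod.case
    by (rule exI[of _ 1], rule exI[of _ k], rule exI[of _ 0], rule exI[of _ 1]) (simp add: b'_def c'_def)
  then have e: "form_equiv f (a, b', c')" by (rule form_equiv_trans[OF abc])
  have "form_equiv (a, b', c') (c', - b', a)" unfolding form_equiv_def prod.case
    by (rule exI[of _ 0], rule exI[of _ 1], rule exI[of _ "-1"], rule exI[of _ 0]) simp
  then have "a \<le> c'" using min[OF form_equiv_trans[OF e]] by metis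
  with e b' show ?thesis by (rule that)
qed

text \<open>An infinite set has \<open>card\<close> 0, so every lower bound for
  \<open>class_number\<close> rests on this finiteness.\<close>

lemma finite_form_classes:
  assumes D: "D < 0"
  shows "finite (prim_pos_forms D // {(f, g). f \<in> prim_pos_forms D \<and> g \<in> prim_pos_forms D \<and> form_equiv f g})"
proof -
  let ?R = "{(f, g). f \<in> prim_pos_forms D \<and> g \<in> prim_pos_forms D \<and> form_equiv f g}"
  let ?B = "{1..- D} \<times> {D..- D} \<times> {1..D ^ 2 - D}"
  have "prim_pos_forms D // ?R \<subseteq> (\<lambda>g. ?R `` {g}) ` ?B"
  proof
    fix X assume "X \<in> prim_pos_forms D // ?R"
    then obtain f where f: "f \<in> prim_pos_forms D" "X = ?R `` {f}" by (elim quotientE)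
    obtain a b c where g: "form_equiv f (a, b, c)" "\<bar>b\<bar> \<le> a" "a \<le> c" by (rule reduced_form_exists[OF D f(1)])
    have gp: "(a, b, c) \<in> prim_pos_forms D" by (rule form_equiv_prim[OF D f(1) g(1)])
    then have eq: "b ^ 2 - 4 * a * c = D" and a: "a > 0" by (simp_all add: prim_pos_forms_def)
    have "a * a \<le> a * c" using a g(3) by (intro mult_left_mono) auto
    moreover have "b ^ 2 \<le> a * a" using g(2) by (metis abs_ge_zero abs_le_square_iff abs_of_nonneg order_trans power2_eq_square)
    moreover have "a \<le> a * a" using a by simp
    ultimately have aD: "a \<le> - D" using eq[unfolded mult.assoc] a by linarith
    have "b ^ 2 \<le> D ^ 2" using g(2) aD D by (intro abs_le_square_iff[THEN iffD1]) auto
    moreover have "c \<le> a * c" using a g(3) by simp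
    ultimately have "c \<le> D ^ 2 - D" using eq[unfolded mult.assoc] a g(3) by linarith
    then have "(a, b, c) \<in> ?B" using aD a g(2,3) by auto
    moreover have "X = ?R `` {(a, b, c)}"
      unfolding f(2) using f(1) gp form_equiv_trans[OF g(1)] form_equiv_trans[OF form_equiv_sym[OF g(1)]]
      by (simp add: Image_def) metis
    ultimately show "X \<in> (\<lambda>g. ?R `` {g}) ` ?B" by blast
  qed
  then show ?thesis by (rule finite_subset) simp
qed

lemma card_le_class_number:
  assumes D: "D < 0" and F: "\<And>x. x \<in> S \<Longrightarrow> F x \<in> prim_pos_forms D"
    and inj: "\<And>x y. x \<in> S \<Longrightarrow> y \<in> S \<Longrightarrow> x \<noteq> y \<Longrightarrow> \<not> form_equiv (F x) (F y)"
  shows "finite S" "card S \<le> class_number D"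
proof -
  let ?R = "{(f, g). f \<in> prim_pos_forms D \<and> g \<in> prim_pos_forms D \<and> form_equiv f g}"
  have inj': "inj_on (\<lambda>x. ?R `` {F x}) S"
  proof (rule inj_onI)
    fix x y assume xy: "x \<in> S" "y \<in> S" "?R `` {F x} = ?R `` {F y}"
    have "F y \<in> ?R `` {F y}" using F[OF xy(2)] form_equiv_refl by simp
    then have "form_equiv (F x) (F y)" unfolding xy(3)[symmetric] by simp
    then show "x = y" using inj[OF xy(1,2)] by blast
  qed
  have sub: "(\<lambda>x. ?R `` {F x}) ` S \<subseteq> prim_pos_forms D // ?R" by (rule image_subsetI) (rule quotientI[OF F])
  show "finite S" by (rule inj_on_finite[OF inj' sub finite_form_classes[OF D]])
  show "card S \<le> class_number D"
    unfolding class_number_def by (rule card_inj_on_le[OF inj' sub finite_form_classes[OF D]])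
qed

section \<open>Comparison of naive and canonical height\<close>

lemma hW_rat_quotient:
  assumes "n > 0"
  shows "hW_rat (rat_of_int m / rat_of_int n) = ln (real_of_int (max \<bar>m\<bar> n)) - ln (real_of_int (gcd m n))"
proof -
  let ?x = "rat_of_int m / rat_of_int n"
  obtain A Z where AZ: "xfrac (Some (?x, 0)) = (A, Z)" by fastforce
  obtain g where g: "g > 0" "m = g * A" "n = g * Z" by (rule xfrac_scale[OF AZ refl assms])
  have "gcd m n = g" using xfrac_coprime[OF AZ] g by (simp add: gcd_mult_left)
  moreover define M where "M = max \<bar>A\<bar> \<bar>Z\<bar>"
  have mM: "max \<bar>m\<bar> n = g * M"
    using g xfrac_nonneg[OF AZ] by (simp add: M_def abs_mult max_mult_distrib_left)
  have h: "hW_rat ?x = ln (real_of_int M)"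
    using hW_pt_xfrac[OF AZ] by (simp only: hW_pt_def option.case prod.case M_def)
  have pos: "real_of_int M > 0" "real_of_int g > 0"
    using g(1) xfrac_max_ge_1[OF AZ] by (simp_all only: of_int_0_less_iff M_def)
  have "ln (real_of_int (g * M)) = ln (real_of_int g) + ln (real_of_int M)"
    unfolding of_int_mult using pos by (simp only: ln_mult_pos)
  ultimately show ?thesis unfolding h mM by simp
qed

context elliptic_curve
begin

lemma hW_j_inv:
  "hW_rat (j_inv a b) = ln (max (6912 * \<bar>real_of_int a\<bar> ^ 3) \<bar>real_of_int (4 * a ^ 3 + 27 * b ^ 2)\<bar>)
    - ln (real_of_int (gcd (6912 * a ^ 3) (4 * a ^ 3 + 27 * b ^ 2)))"
proof -
  define \<Delta> where "\<Delta> = 4 * a ^ 3 + 27 * b ^ 2"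
  have \<Delta>: "\<Delta> \<noteq> 0" using disc by (simp add: \<Delta>_def)
  define m where "m = sgn \<Delta> * (6912 * a ^ 3)"
  have sg: "\<bar>sgn \<Delta>\<bar> = 1" "\<Delta> = sgn \<Delta> * \<bar>\<Delta>\<bar>" using \<Delta> by (auto simp: sgn_if)
  have "j_inv a b = rat_of_int (6912 * a ^ 3) / rat_of_int \<Delta>"
  proof -
    have "- 1728 * (4 * a) ^ 3 = - 16 * (6912 * a ^ 3)" by (simp add: power_mult_distrib)
    then show ?thesis unfolding j_inv_def ec_disc_def \<Delta>_def[symmetric]
      by (simp only: of_int_mult[of "- 16"])
  qed
  also have "\<dots> = rat_of_int m / rat_of_int \<bar>\<Delta>\<bar>" using \<Delta> by (cases "\<Delta> > 0") (auto simp: m_def sgn_if)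
  finally have j: "j_inv a b = rat_of_int m / rat_of_int \<bar>\<Delta>\<bar>" .
  have am: "\<bar>m\<bar> = 6912 * \<bar>a\<bar> ^ 3" using sg(1) by (simp add: m_def abs_mult power_abs)
  have "gcd m \<bar>\<Delta>\<bar> = gcd (6912 * a ^ 3) \<Delta>" 
  proof (cases "\<Delta> > 0")
    case True
    then have "m = 6912 * a ^ 3" "\<bar>\<Delta>\<bar> = \<Delta>" by (simp_all add: m_def)
    then show ?thesis by simp
  next
    case False
    then have "m = - (6912 * a ^ 3)" "\<bar>\<Delta>\<bar> = - \<Delta>" using \<Delta> by (simp_all add: m_def)
    then show ?thesis by (simp only: gcd_neg1 gcd_neg2)
  qed
  moreover have "hW_rat (j_inv a b) = ln (real_of_int (max \<bar>m\<bar> \<bar>\<Delta>\<bar>)) - ln (real_of_int (gcd m \<bar>\<Delta>\<bar>))"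
    unfolding j by (rule hW_rat_quotient) (use \<Delta> in simp)
  ultimately show ?thesis
    by (simp only: am \<Delta>_def[symmetric] of_int_max of_int_mult of_int_power of_int_abs of_int_numeral)
qed

lemma hW_disc: "hW_rat (of_int (ec_disc a b)) = ln (16 * \<bar>real_of_int (4 * a ^ 3 + 27 * b ^ 2)\<bar>)"
proof -
  have "\<bar>4 * a ^ 3 + 27 * b ^ 2\<bar> \<ge> 1" using disc by linarith
  then have 1: "max \<bar>ec_disc a b\<bar> 1 = 16 * \<bar>4 * a ^ 3 + 27 * b ^ 2\<bar>" unfolding ec_disc_def abs_mult by simp
  show ?thesis using hW_rat_quotient[of 1 "ec_disc a b"] unfolding 1 by simp
qed

text \<open>Twelve times the claim asks that 12 ln S + 4 ln K + 4 ln (4 |\<Delta>|) - 2 ln h - 4 ln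
  \<sigma> be at most three times the height of j plus twice that of the discriminant plus 40 - 12
  ln 4. The height of j is ln |\<Delta>| + ln J - ln c, so after cancelling 4 ln |\<Delta>| a single
  ln |\<Delta>| remains against 3 ln c.\<close>

lemma hW_pt_le_hhat:
  assumes P: "P \<in> carrier E"
  shows "hW_pt P \<le> hhat P + 2 * deltaE a b - ln 4"
proof -
  define \<Delta> where "\<Delta> = real_of_int (4 * a ^ 3 + 27 * b ^ 2)"
  define J where "J = max 1 (6912 * \<bar>real_of_int a\<bar> ^ 3 / \<bar>\<Delta>\<bar>)"
  define h where "h = real_of_int (twist_gcd a b)"
  define \<sigma> where "\<sigma> = real_of_int (three_gain a b)"
  define c where "c = real_of_int (gcd (6912 * a ^ 3) (4 * a ^ 3 + 27 * b ^ 2))"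
  have \<Delta>: "\<bar>\<Delta>\<bar> > 0" using disc by (simp add: \<Delta>_def del: of_int_add of_int_mult of_int_power)
  have J: "J > 0" by (simp add: J_def)
  have h: "h > 0" using twist_gcd_nonzero[OF disc] by (simp add: h_def twist_gcd_def)
  have \<sigma>: "\<sigma> > 0" by (simp add: \<sigma>_def three_gain_def)
  have c: "c > 0" using disc by (simp add: c_def)
  obtain x0 R S K :: real where k: "R > 0" "S \<ge> 1" "K \<ge> 1" "dup_bound (of_int a) (of_int b) x0 R K"
    "\<And>x. max \<bar>x\<bar> 1 \<le> S * max \<bar>x - x0\<bar> R" and SK: "S ^ 12 * K ^ 4 \<le> J ^ 3 * (exp 10 / 9216) ^ 4"
    unfolding J_def \<Delta>_def using dup_bound_exists[OF disc] by metis
  define Q where "Q n = P [^]\<^bsub>E\<^esub> (2 ^ n :: nat)" for n :: nat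
  define s where "s n = (case xfrac (Q n) of (A, Z) \<Rightarrow> mod_height a b x0 R A Z)" for n
  have Q: "Q n \<in> carrier E" for n using P by (simp add: Q_def)
  define t1 where "t1 = ln S + ln h / 6"
  define t2 where "t2 = ln (1 + \<bar>x0\<bar> + R)"
  define C where "C = ln K + ln (4 * \<bar>\<Delta>\<bar>) - ln h - ln \<sigma>"
  have lo: "hW_pt (Q n) \<le> s n + t1" for n
  proof -
    obtain A Z where AZ: "xfrac (Q n) = (A, Z)" by fastforce
    show ?thesis using hW_pt_le_mod_height[OF disc AZ k(2,1,5)] by (simp add: s_def AZ t1_def h_def)
  qed
  have up: "s n \<le> hW_pt (Q n) + t2" for n
  proof -
    obtain A Z where AZ: "xfrac (Q n) = (A, Z)" by fastforce
    show ?thesis using mod_height_le_hW_pt[OF disc AZ k(1)] by (simp add: s_def AZ t2_def)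
  qed
  have step: "s (Suc n) \<ge> 4 * s n - C" for n
  proof -
    obtain A Z where AZ: "xfrac (Q n) = (A, Z)" by fastforce
    obtain A' Z' where AZ': "xfrac (ec_add a (Q n) (Q n)) = (A', Z')" by fastforce
    have on: "on_curve a b (Q n)" using Q by (simp add: carrier_ec_group)
    have "Q (Suc n) = ec_add a (Q n) (Q n)" unfolding Q_def pow_two_Suc[OF P] mult_ec_group ..
    then have "s (Suc n) = mod_height a b x0 R A' Z'" by (simp add: s_def AZ')
    moreover have "s n = mod_height a b x0 R A Z" by (simp add: s_def AZ)
    ultimately show ?thesis
      using mod_height_double[OF disc on k(1,3,4) AZ AZ', folded \<Delta>_def h_def \<sigma>_def] unfolding C_def by linarith
  qed
  have hlim: "(\<lambda>n. hW_pt (Q n) / 4 ^ n) \<longlonglongrightarrow> hhat P" unfolding Q_def by (rule hhat_LIMSEQ[OF P])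
  have zero: "(\<lambda>n. t / 4 ^ n) \<longlonglongrightarrow> 0" for t :: real by (rule LIMSEQ_divide_realpow_zero) simp
  have "(\<lambda>n. s n / 4 ^ n) \<longlonglongrightarrow> hhat P"
  proof (rule tendsto_sandwich)
    show "(\<lambda>n. hW_pt (Q n) / 4 ^ n - t1 / 4 ^ n) \<longlonglongrightarrow> hhat P" using tendsto_diff[OF hlim zero[of t1]] by simp
    show "(\<lambda>n. hW_pt (Q n) / 4 ^ n + t2 / 4 ^ n) \<longlonglongrightarrow> hhat P" using tendsto_add[OF hlim zero[of t2]] by simp
    have "(hW_pt (Q n) - t1) / 4 ^ n \<le> s n / 4 ^ n" "s n / 4 ^ n \<le> (hW_pt (Q n) + t2) / 4 ^ n" for n
      using lo[of n] up[of n] by (auto intro!: divide_right_mono)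
    then show "\<forall>\<^sub>F n in sequentially. hW_pt (Q n) / 4 ^ n - t1 / 4 ^ n \<le> s n / 4 ^ n"
      "\<forall>\<^sub>F n in sequentially. s n / 4 ^ n \<le> hW_pt (Q n) / 4 ^ n + t2 / 4 ^ n"
      by (simp_all add: diff_divide_distrib add_divide_distrib)
  qed
  from tate_limit_ge[OF step this] have "s 0 - C / 3 \<le> hhat P" .
  moreover have "Q 0 = P" using P by (simp add: Q_def)
  ultimately have main: "hW_pt P \<le> hhat P + C / 3 + t1" using lo[of 0] by simp
  have "12 * ln S + 4 * ln K \<le> 3 * ln J + 40 - 4 * ln 9216"
  proof -
    have "ln (S ^ 12 * K ^ 4) \<le> ln (J ^ 3 * (exp 10 / 9216) ^ 4)" 
      by (subst ln_le_cancel_iff) (use k(2,3) J SK in \<open>auto intro!: mult_pos_pos zero_less_power\<close>)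
    moreover have "ln (S ^ 12 * K ^ 4) = 12 * ln S + 4 * ln K" using k(2,3) by (simp add: ln_mult ln_realpow)
    moreover have "ln (J ^ 3 * (exp 10 / 9216) ^ 4) = 3 * ln J + 40 - 4 * ln 9216"
    proof -
      have "ln (J ^ 3 * (exp 10 / 9216) ^ 4) = 3 * ln J + 4 * ln (exp 10 / 9216)"
        using J by (simp only: ln_mult ln_realpow zero_less_power zero_less_divide_iff exp_gt_zero) (simp add: ln_mult ln_realpow)
      also have "ln (exp 10 / 9216) = 10 - ln (9216::real)" by (simp add: ln_div)
      finally show ?thesis by simp
    qed
    ultimately show ?thesis by simp
  qed
  moreover have "ln c \<le> ln 20736 + ln h + 2 * ln \<sigma>"
  proof -
    have "twist_gcd a b > 0" "three_gain a b > 0" using h \<sigma> by (simp_all add: h_def \<sigma>_def)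
    then have "gcd (6912 * a ^ 3) (4 * a ^ 3 + 27 * b ^ 2) \<le> 20736 * twist_gcd a b * three_gain a b ^ 2"
      by (intro zdvd_imp_le j_content_dvd disc) (auto intro!: mult_pos_pos zero_less_power)
    then have "c \<le> real_of_int (20736 * twist_gcd a b * three_gain a b ^ 2)" unfolding c_def by (simp only: of_int_le_iff)
    then have "c \<le> 20736 * h * \<sigma> ^ 2" by (simp add: h_def \<sigma>_def)
    then have "ln c \<le> ln (20736 * h * \<sigma> ^ 2)" using c h \<sigma> by simp
    then show ?thesis using h \<sigma> by (simp add: ln_mult ln_realpow)
  qed
  \<comment> \<open>Of the three ln c, two are bounded by the preceding estimate, which consumes 2
    ln h and 4 ln \<sigma>, and the third by this one; the numerical constants then cancel
    exactly.\<close>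
  moreover have "ln c \<le> ln \<bar>\<Delta>\<bar>"
  proof -
    have "gcd (6912 * a ^ 3) (4 * a ^ 3 + 27 * b ^ 2) \<le> \<bar>4 * a ^ 3 + 27 * b ^ 2\<bar>"
      using disc by (intro zdvd_imp_le) auto
    then have "c \<le> real_of_int \<bar>4 * a ^ 3 + 27 * b ^ 2\<bar>" unfolding c_def by (simp only: of_int_le_iff)
    then have "c \<le> \<bar>\<Delta>\<bar>" by (simp only: of_int_abs \<Delta>_def)
    then show ?thesis using c by simp
  qed
  moreover have "hW_rat (j_inv a b) = ln \<bar>\<Delta>\<bar> + ln J - ln c"
  proof -
    have "max (6912 * \<bar>real_of_int a\<bar> ^ 3) \<bar>\<Delta>\<bar> = \<bar>\<Delta>\<bar> * J" using \<Delta>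
      by (simp add: J_def max_mult_distrib_left max.commute)
    then show ?thesis unfolding hW_j_inv \<Delta>_def[symmetric] c_def[symmetric] using \<Delta> J by (simp add: ln_mult)
  qed
  moreover have "hW_rat (of_int (ec_disc a b)) = ln 16 + ln \<bar>\<Delta>\<bar>"
    unfolding hW_disc \<Delta>_def[symmetric] using \<Delta> by (simp add: ln_mult)
  moreover have "ln (4 * \<bar>\<Delta>\<bar>) = ln 4 + ln \<bar>\<Delta>\<bar>" using \<Delta> by (simp add: ln_mult)
  moreover have "ln (4::real) = 2 * ln 2" "ln (16::real) = 4 * ln 2" "ln (9216::real) = 10 * ln 2 + 2 * ln 3"
    "ln (20736::real) = 8 * ln 2 + 4 * ln 3"
    using ln_realpow[of "2::real" 2] ln_realpow[of "2::real" 4] ln_realpow[of "2::real" 10] ln_realpow[of "3::real" 2]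
      ln_realpow[of "2::real" 8] ln_realpow[of "3::real" 4] ln_mult[of "1024::real" 9] ln_mult[of "256::real" 81] by simp_all
  ultimately show ?thesis using main unfolding deltaE_def C_def t1_def by argo
qed

end

section \<open>Lattice points in ellipsoids\<close>

lemma sum_double_Suc:
  fixes f :: "nat \<Rightarrow> nat \<Rightarrow> real"
  shows "(\<Sum>i<Suc n. \<Sum>j<Suc n. f i j) = (\<Sum>i<n. \<Sum>j<n. f i j) + (\<Sum>i<n. f i n) + (\<Sum>j<n. f n j) + f n n"
  by (simp add: sum.distrib)

text \<open>At the vector with entry 1 in place i and t in place n the form is M i i + 2 t M i n,
  affine in t, hence nonnegative for all t only if its slope is 0.\<close>

lemma psd_zero_diagonal:
  fixes M :: "nat \<Rightarrow> nat \<Rightarrow> real"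
  assumes sym: "M i n = M n i" and psd: "\<And>x. (\<Sum>i<Suc n. \<Sum>j<Suc n. M i j * x i * x j) \<ge> 0"
    and zero: "M n n = 0" and i: "i < n"
  shows "M i n = 0"
proof -
  have q: "M i i + 2 * t * M i n \<ge> 0" for t
  proof -
    define x where "x k = (if k = i then 1 else if k = n then t else (0::real))" for k
    have x: "x n = t" "x i = 1" using i by (simp_all add: x_def)
    have s: "(\<Sum>k<n. f k * x k) = f i" for f
    proof -
      have "(\<Sum>k<n. f k * x k) = (\<Sum>k<n. if k = i then f k else 0)" by (rule sum.cong) (auto simp: x_def)
      then show ?thesis using i by simp
    qed
    have "(\<Sum>k<n. \<Sum>j<n. M k j * x k * x j) = M i i"
    proof -
      have "(\<Sum>k<n. \<Sum>j<n. M k j * x k * x j) = (\<Sum>k<n. M k i * x k)" by (simp only: s)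
      then show ?thesis by (simp only: s)
    qed
    moreover have "(\<Sum>k<n. M k n * x k * x n) = M i n * t" unfolding x sum_distrib_right[symmetric] s ..
    moreover have "(\<Sum>j<n. M n j * x n * x j) = M n i * t" unfolding x s ..
    ultimately show ?thesis using psd[of x] unfolding sum_double_Suc by (simp add: zero sym algebra_simps)
  qed
  show ?thesis
  proof (rule ccontr)
    assume n0: "M i n \<noteq> 0"
    have "M i i + 2 * (- (M i i + 1) / (2 * M i n)) * M i n = - 1" using n0 by (simp add: field_simps)
    with q[of "- (M i i + 1) / (2 * M i n)"] show False by linarith
  qed
qed

text \<open>Induction step: completing the square in the last variable leaves the Schur complement, which is
  again positive semidefinite. If the last diagonal entry vanishes then so does its column, and
  the convention \<open>x / 0 = 0\<close> makes the formulas cover this case.\<close>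

lemma psd_triangular:
  fixes M :: "nat \<Rightarrow> nat \<Rightarrow> real"
  assumes "\<And>i j. M i j = M j i" and "\<And>x. (\<Sum>i<n. \<Sum>j<n. M i j * x i * x j) \<ge> 0"
  shows "\<exists>D L. (\<forall>k. D k \<ge> 0 \<and> L k k = 1 \<and> (\<forall>i>k. L k i = 0)) \<and>
    (\<forall>i<n. \<forall>j<n. M i j = (\<Sum>k<n. D k * L k i * L k j))"
  using assms
proof (induction n arbitrary: M)
  case 0
  show ?case by (intro exI[of _ "\<lambda>_. 0"] exI[of _ "\<lambda>k i. if i = k then 1 else 0"]) simp
next
  case (Suc n)
  note sym = Suc.prems(1) and psd = Suc.prems(2)
  define m where "m = M n n"
  define M' where "M' i j = M i j - M i n * M j n / m" for i j
  have col: "m = 0 \<Longrightarrow> i < n \<Longrightarrow> M i n = 0" for i using psd_zero_diagonal[OF sym psd, of i] by (simp add: m_def)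
  have m0: "m \<ge> 0"
  proof -
    define x where "x k = (if k = n then 1 else (0::real))" for k
    have "x n = 1" "\<And>k. k < n \<Longrightarrow> x k = 0" by (simp_all add: x_def)
    then show ?thesis using psd[of x] unfolding sum_double_Suc by (simp add: m_def)
  qed
  have psd': "(\<Sum>i<n. \<Sum>j<n. M' i j * x i * x j) \<ge> 0" for x
  proof -
    define s where "s = (\<Sum>i<n. M i n * x i)"
    define y where "y = x(n := - s / m)"
    have y: "y n = - s / m" "\<And>k. k < n \<Longrightarrow> y k = x k" by (simp_all add: y_def)
    have ms: "m * (s / m) = s"
    proof (cases "m = 0")
      case True
      then show ?thesis using col by (simp add: s_def)
    qed simp
    have "(\<Sum>i<n. \<Sum>j<n. M' i j * x i * x j) = (\<Sum>i<n. \<Sum>j<n. M i j * x i * x j) - s * s / m"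
    proof -
      have "s * s / m = (\<Sum>i<n. \<Sum>j<n. M i n * x i * (M j n * x j) / m)"
        unfolding s_def sum_product sum_divide_distrib ..
      then show ?thesis unfolding M'_def sum_subtractf[symmetric] by (simp add: algebra_simps sum_subtractf)
    qed
    moreover have "(\<Sum>i<Suc n. \<Sum>j<Suc n. M i j * y i * y j) = (\<Sum>i<n. \<Sum>j<n. M i j * x i * x j) - s * s / m"
    proof -
      have 1: "(\<Sum>i<n. \<Sum>j<n. M i j * y i * y j) = (\<Sum>i<n. \<Sum>j<n. M i j * x i * x j)" by (simp add: y)
      have 2: "(\<Sum>i<n. M i n * y i * y n) = s * (- s / m)" unfolding sum_distrib_right[symmetric] s_def by (simp add: y(2) y(1)[unfolded s_def])
      have 3: "(\<Sum>j<n. M n j * y n * y j) = s * (- s / m)"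
      proof -
        have "(\<Sum>j<n. M n j * y n * y j) = (\<Sum>i<n. M i n * y i * y n)" by (rule sum.cong) (simp_all add: sym[of n] algebra_simps)
        then show ?thesis using 2 by simp
      qed
      have 4: "M n n * y n * y n = s * (s / m)"
      proof -
        have "M n n * y n * y n = (m * (s / m)) * (s / m)" by (simp add: y m_def)
        then show ?thesis unfolding ms .
      qed
      show ?thesis unfolding sum_double_Suc 1 2 3 4 by (simp add: algebra_simps)
    qed
    ultimately show ?thesis using psd[of y] by simp
  qed
  have sym': "M' i j = M' j i" for i j by (simp add: M'_def sym[of i j] mult.commute)
  obtain D L where "(\<forall>k. D k \<ge> 0 \<and> L k k = 1 \<and> (\<forall>i>k. L k i = 0)) \<and>
      (\<forall>i<n. \<forall>j<n. M' i j = (\<Sum>k<n. D k * L k i * L k j))"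
    using Suc.IH[OF sym' psd'] by (elim exE)
  then have DL: "\<And>k. D k \<ge> 0" "\<And>k. L k k = 1" "\<And>k i. i > k \<Longrightarrow> L k i = 0"
    "\<And>i j. i < n \<Longrightarrow> j < n \<Longrightarrow> M' i j = (\<Sum>k<n. D k * L k i * L k j)" by simp_all
  define D' where "D' = D(n := m)"
  define L' where "L' = L(n := (\<lambda>i. if i = n then 1 else if i < n then M i n / m else 0))"
  have 1: "D' k \<ge> 0" "L' k k = 1" "i > k \<Longrightarrow> L' k i = 0" for k i
    using DL(1-3) m0 by (auto simp: D'_def L'_def)
  have old: "(\<Sum>k<n. D' k * L' k i * L' k j) = (\<Sum>k<n. D k * L k i * L k j)" for i j
    by (rule sum.cong) (simp_all add: D'_def L'_def)
  have z: "(\<Sum>k<n. D k * L k i * L k n) = 0" "(\<Sum>k<n. D k * L k n * L k j) = 0" for i j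
    by (rule sum.neutral, simp add: DL(3))+
  have mm: "m * (M i n / m) = M i n" if "i < n" for i using col[OF _ that] by (cases "m = 0") auto
  have "M i j = (\<Sum>k<Suc n. D' k * L' k i * L' k j)" if ij: "i < Suc n" "j < Suc n" for i j
  proof -
    have new: "D' n = m" "L' n n = 1" "\<And>i. i < n \<Longrightarrow> L' n i = M i n / m" by (simp_all add: D'_def L'_def)
    consider "i < n" "j < n" | "i < n" "j = n" | "i = n" "j < n" | "i = n" "j = n" using ij by linarith
    then show ?thesis
    proof cases
      case 1
      have "m * (M i n / m) * (M j n / m) = M i n * M j n / m" unfolding mm[OF 1(1)] by simp
      then show ?thesis unfolding sum.lessThan_Suc old new(1) new(3)[OF 1(1)] new(3)[OF 1(2)] DL(4)[OF 1, symmetric] M'_def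
        by simp
    next
      case 2
      show ?thesis unfolding 2(2) sum.lessThan_Suc old new(1,2) new(3)[OF 2(1)] z using mm[OF 2(1)] by (simp only: mult_1_right add_0_left)
    next
      case 3
      show ?thesis unfolding 3(1) sum.lessThan_Suc old new(1,2) new(3)[OF 3(2)] z sym[of n j] using mm[OF 3(2)]
        by (simp only: mult_1_right add_0_left)
    next
      case 4
      then show ?thesis by (simp add: old new z m_def)
    qed
  qed
  with 1 show ?case by blast
qed

text \<open>M is the transpose of L times D L, with triangular factors. The left side is Leibniz's
  formula in the shape used by \<open>regulator\<close>.\<close>

lemma det_triangular_product:
  fixes M :: "nat \<Rightarrow> nat \<Rightarrow> real"
  assumes L: "\<And>k. L k k = 1" "\<And>k i. i > k \<Longrightarrow> L k i = 0"
    and M: "\<And>i j. i < n \<Longrightarrow> j < n \<Longrightarrow> M i j = (\<Sum>k<n. D k * L k i * L k j)"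
  shows "(\<Sum>p | p permutes {..<n}. of_int (sign p) * (\<Prod>i<n. M i (p i))) = (\<Prod>k<n. D k)"
proof -
  define A where "A = Matrix.mat n n (\<lambda>(i, j). M i j)"
  define U where "U = Matrix.mat n n (\<lambda>(i, j). L i j)"
  define V where "V = Matrix.mat n n (\<lambda>(i, j). D i * L i j)"
  have c: "A \<in> carrier_mat n n" "U \<in> carrier_mat n n" "V \<in> carrier_mat n n" by (auto simp: A_def U_def V_def)
  have "A = transpose_mat U * V"
  proof (rule eq_matI)
    fix i j assume "i < dim_row (transpose_mat U * V)" "j < dim_col (transpose_mat U * V)"
    then have ij: "i < n" "j < n" using c by auto
    have "(transpose_mat U * V) $$ (i, j) = (\<Sum>k = 0..<n. L k i * (D k * L k j))"
      using ij c by (simp add: scalar_prod_def U_def V_def)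
    also have "\<dots> = (\<Sum>k<n. D k * L k i * L k j)" unfolding atLeast0LessThan by (rule sum.cong) simp_all
    finally show "A $$ (i, j) = (transpose_mat U * V) $$ (i, j)" using ij M by (simp add: A_def)
  qed (use c in auto)
  then have "Determinant.det A = Determinant.det U * Determinant.det V" using c by (simp add: Determinant.det_mult[of _ n] Determinant.det_transpose[OF c(2)])
  moreover have "Determinant.det U = prod_list (diag_mat U)"
    by (rule det_lower_triangular[OF _ c(2)]) (simp add: U_def L(2))
  moreover have "Determinant.det V = prod_list (diag_mat V)"
    by (rule det_lower_triangular[OF _ c(3)]) (simp add: V_def L(2))
  moreover have "prod_list (diag_mat U) = 1" "prod_list (diag_mat V) = (\<Prod>k<n. D k)"
    using c by (simp_all add: prod_list_diag_prod atLeast0LessThan U_def V_def L(1))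
  moreover have "Determinant.det A = (\<Sum>p | p permutes {..<n}. of_int (sign p) * (\<Prod>i<n. M i (p i)))"
    unfolding det_def'[OF c(1)] atLeast0LessThan
  proof (rule sum.cong[OF refl])
    fix p assume "p \<in> {p. p permutes {..<n}}"
    then have p: "p permutes {..<n}" by simp
    have "(\<Prod>i<n. A $$ (i, p i)) = (\<Prod>i<n. M i (p i))"
      by (rule prod.cong[OF refl]) (use permutes_in_image[OF p] in \<open>simp add: A_def\<close>)
    then show "signof p * (\<Prod>i<n. A $$ (i, p i)) = of_int (sign p) * (\<Prod>i<n. M i (p i))" by simp
  qed
  ultimately show ?thesis by simp
qed

section \<open>Volume of an ellipsoid and number of its lattice points\<close>

lemma nn_integral_triangular:
  fixes s :: "nat \<Rightarrow> real" and L :: "nat \<Rightarrow> nat \<Rightarrow> real" and F :: "(nat \<Rightarrow> real) \<Rightarrow> ennreal"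
  assumes s: "\<And>k. s k > 0" and F: "F \<in> borel_measurable (Pi\<^sub>M {..<n} (\<lambda>_. lborel))"
  shows "(\<integral>\<^sup>+y. F (\<lambda>k\<in>{..<n}. s k * (y k + (\<Sum>i<k. L k i * y i))) \<partial>Pi\<^sub>M {..<n} (\<lambda>_. lborel))
    = ennreal (\<Prod>k<n. 1 / s k) * (\<integral>\<^sup>+y. F y \<partial>Pi\<^sub>M {..<n} (\<lambda>_. lborel))"
  using F
proof (induction n arbitrary: F)
  case 0
  have e: "(\<lambda>k\<in>{..<0::nat}. s k * (y k + (\<Sum>i<k. L k i * y i))) = (\<lambda>k. undefined)" for y by auto
  show ?case unfolding e lessThan_0 by (simp add: PiM_empty nn_integral_count_space_finite)
next
  case (Suc n)
  interpret product_sigma_finite "\<lambda>_::nat. lborel :: real measure" by standard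
  define T where "T m y = (\<lambda>k\<in>{..<m}. s k * (y k + (\<Sum>i<k. L k i * y i)))" for m :: nat and y :: "nat \<Rightarrow> real"
  define W where "W m = Pi\<^sub>M {..<m} (\<lambda>_. lborel :: real measure)" for m :: nat
  have ins: "W (Suc n) = Pi\<^sub>M (insert n {..<n}) (\<lambda>_. lborel)" by (simp add: W_def lessThan_Suc)
  have comp: "(\<lambda>y. y i) \<in> borel_measurable (W m)" if "i < m" for i m
    using measurable_component_singleton[of i "{..<m}" "\<lambda>_. lborel :: real measure"] that by (simp add: W_def)
  have T: "T m \<in> measurable (W m) (W m)" for m
    unfolding T_def W_def[of m] proof (rule measurable_restrict)
    fix k assume "k \<in> {..<m}"
    then have km: "k < m" by simp
    have "(\<lambda>y. s k * (y k + (\<Sum>i<k. L k i * y i))) \<in> borel_measurable (W m)"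
      using km by (intro borel_measurable_times borel_measurable_const borel_measurable_add borel_measurable_sum comp) auto
    then show "(\<lambda>y. s k * (y k + (\<Sum>i<k. L k i * y i))) \<in> measurable (Pi\<^sub>M {..<m} (\<lambda>_. lborel)) lborel"
      by (simp add: W_def)
  qed
  have F: "F \<in> borel_measurable (W (Suc n))" using Suc.prems by (simp only: W_def)
  have pair: "(\<lambda>(x, t). x(n := t)) \<in> measurable (W n \<Otimes>\<^sub>M lborel) (W (Suc n))"
    unfolding ins W_def[of n] by (rule measurable_add_dim)
  have Fp: "(\<lambda>(x, t). F (x(n := t))) \<in> borel_measurable (W n \<Otimes>\<^sub>M lborel)"
    using measurable_compose[OF pair F] by (simp add: case_prod_beta')
  define G where "G z = (\<integral>\<^sup>+t. F (z(n := t)) \<partial>lborel)" for z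
  have G: "G \<in> borel_measurable (W n)" unfolding G_def using lborel.borel_measurable_nn_integral[OF Fp] by simp
  have sl: "(\<lambda>t. F (z(n := t))) \<in> borel_measurable borel" if "z \<in> space (W n)" for z
    using measurable_compose[OF measurable_Pair1'[OF that, of lborel] Fp] by simp
  \<comment> \<open>Component k involves coordinates up to k only, so for fixed x the last
    coordinate enters through an affine map with factor s n; the remaining integral is the induction
    hypothesis.\<close>
  have Tn: "T (Suc n) (x(n := t)) = (T n x)(n := s n * (\<Sum>i<n. L n i * x i) + s n * t)" for x t
  proof
    fix k
    consider "k < n" | "k = n" | "k > n" by linarith
    then show "T (Suc n) (x(n := t)) k = ((T n x)(n := s n * (\<Sum>i<n. L n i * x i) + s n * t)) k"
    proof cases
      case 1
      then have "(\<Sum>i<k. L k i * (x(n := t)) i) = (\<Sum>i<k. L k i * x i)" by (intro sum.cong) auto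
      then show ?thesis using 1 by (simp add: T_def)
    next
      case 2
      then have "(\<Sum>i<k. L k i * (x(n := t)) i) = (\<Sum>i<k. L k i * x i)" by (intro sum.cong) auto
      then show ?thesis using 2 by (simp add: T_def algebra_simps)
    qed (simp add: T_def)
  qed
  have inner: "(\<integral>\<^sup>+t. F (T (Suc n) (x(n := t))) \<partial>lborel) = ennreal (1 / s n) * G (T n x)" if x: "x \<in> space (W n)" for x
  proof -
    have z: "T n x \<in> space (W n)" using T x by (rule measurable_space)
    have "G (T n x) = ennreal \<bar>s n\<bar> * (\<integral>\<^sup>+t. F (T (Suc n) (x(n := t))) \<partial>lborel)"
      unfolding G_def Tn by (rule nn_integral_real_affine[OF sl[OF z]]) (use s[of n] in simp)
    then have "ennreal (1 / s n) * G (T n x) = (ennreal (1 / s n) * ennreal (s n)) * (\<integral>\<^sup>+t. F (T (Suc n) (x(n := t))) \<partial>lborel)"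
      using s[of n] by (simp add: mult.assoc)
    also have "ennreal (1 / s n) * ennreal (s n) = 1" using s[of n] by (simp add: ennreal_mult[symmetric])
    finally show ?thesis unfolding mult_1_left by (rule sym)
  qed
  have "(\<integral>\<^sup>+y. F (T (Suc n) y) \<partial>W (Suc n)) = (\<integral>\<^sup>+x. (\<integral>\<^sup>+t. F (T (Suc n) (x(n := t))) \<partial>lborel) \<partial>W n)"
    using product_nn_integral_insert[of "{..<n}" n "\<lambda>y. F (T (Suc n) y)"] measurable_compose[OF T[of "Suc n"] F]
    unfolding ins W_def[of n] by simp
  also have "\<dots> = (\<integral>\<^sup>+x. ennreal (1 / s n) * G (T n x) \<partial>W n)" by (rule nn_integral_cong) (rule inner)
  also have "\<dots> = ennreal (1 / s n) * (\<integral>\<^sup>+x. G (T n x) \<partial>W n)"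
    by (rule nn_integral_cmult) (rule measurable_compose[OF T G])
  also have "(\<integral>\<^sup>+x. G (T n x) \<partial>W n) = ennreal (\<Prod>k<n. 1 / s k) * (\<integral>\<^sup>+x. G x \<partial>W n)"
    unfolding W_def T_def by (rule Suc.IH[OF G[unfolded W_def]])
  also have "(\<integral>\<^sup>+x. G x \<partial>W n) = (\<integral>\<^sup>+y. F y \<partial>W (Suc n))"
    unfolding G_def ins using product_nn_integral_insert[of "{..<n}" n F] F unfolding ins W_def[of n] by simp
  also have "ennreal (1 / s n) * (ennreal (\<Prod>k<n. 1 / s k) * (\<integral>\<^sup>+y. F y \<partial>W (Suc n)))
    = ennreal (\<Prod>k<Suc n. 1 / s k) * (\<integral>\<^sup>+y. F y \<partial>W (Suc n))"
  proof -
    have "ennreal (\<Prod>k<Suc n. 1 / s k) = ennreal (1 / s n) * ennreal (\<Prod>k<n. 1 / s k)"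
      using s by (simp add: ennreal_mult[symmetric] prod_nonneg less_imp_le mult.commute)
    then show ?thesis by (simp only: mult.assoc)
  qed
  finally show ?case unfolding T_def W_def .
qed

text \<open>Square root of the diagonalised quadratic form, written as an L2 norm to inherit the
  triangle inequality; some D k may be 0, so in general it is a seminorm.\<close>

definition ellipsoid_norm :: "nat \<Rightarrow> (nat \<Rightarrow> real) \<Rightarrow> (nat \<Rightarrow> nat \<Rightarrow> real) \<Rightarrow> (nat \<Rightarrow> real) \<Rightarrow> real" where
  "ellipsoid_norm n D L y = L2_set (\<lambda>k. sqrt (D k) * (\<Sum>i<n. L k i * y i)) {..<n}"

lemma ellipsoid_norm_triangle:
  "ellipsoid_norm n D L (\<lambda>i. x i + y i) \<le> ellipsoid_norm n D L x + ellipsoid_norm n D L y"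
proof -
  have "ellipsoid_norm n D L (\<lambda>i. x i + y i) =
      L2_set (\<lambda>k. sqrt (D k) * (\<Sum>i<n. L k i * x i) + sqrt (D k) * (\<Sum>i<n. L k i * y i)) {..<n}"
    unfolding ellipsoid_norm_def by (simp add: sum.distrib distrib_left)
  also have "\<dots> \<le> ellipsoid_norm n D L x + ellipsoid_norm n D L y"
    unfolding ellipsoid_norm_def by (rule L2_set_triangle_ineq)
  finally show ?thesis .
qed

lemma ellipsoid_norm_scale:
  assumes "c \<ge> 0" shows "ellipsoid_norm n D L (\<lambda>i. c * x i) = c * ellipsoid_norm n D L x"
proof -
  have "ellipsoid_norm n D L (\<lambda>i. c * x i) = L2_set (\<lambda>k. c * (sqrt (D k) * (\<Sum>i<n. L k i * x i))) {..<n}"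
    unfolding ellipsoid_norm_def by (simp add: sum_distrib_left algebra_simps)
  then show ?thesis unfolding L2_set_right_distrib[OF assms, symmetric] ellipsoid_norm_def .
qed

lemma ellipsoid_norm_minus: "ellipsoid_norm n D L (\<lambda>i. - x i) = ellipsoid_norm n D L x"
  unfolding ellipsoid_norm_def L2_set_def by (simp add: sum_negf)

lemma ellipsoid_norm_square:
  assumes "\<And>k. D k \<ge> 0"
  shows "ellipsoid_norm n D L y ^ 2 = (\<Sum>i<n. \<Sum>j<n. (\<Sum>k<n. D k * L k i * L k j) * y i * y j)"
proof -
  have "ellipsoid_norm n D L y ^ 2 = (\<Sum>k<n. D k * (\<Sum>i<n. L k i * y i) ^ 2)"
    unfolding ellipsoid_norm_def L2_set_def using assms by (simp add: sum_nonneg power_mult_distrib)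
  also have "\<dots> = (\<Sum>k<n. \<Sum>i<n. \<Sum>j<n. D k * L k i * L k j * y i * y j)"
    unfolding power2_eq_square sum_product by (simp add: sum_distrib_left algebra_simps)
  also have "\<dots> = (\<Sum>i<n. \<Sum>j<n. \<Sum>k<n. D k * L k i * L k j * y i * y j)"
    by (subst sum.swap, rule sum.cong[OF refl], rule sum.swap)
  finally show ?thesis by (simp add: sum_distrib_right)
qed

lemma ellipsoid_norm_cong: "(\<And>i. i < n \<Longrightarrow> x i = y i) \<Longrightarrow> ellipsoid_norm n D L x = ellipsoid_norm n D L y"
  by (simp add: ellipsoid_norm_def)

text \<open>A convex function on a cube is largest at a vertex. Coordinates are moved to 0 or 1 one
  at a time; those from index k on have been moved already.\<close>

lemma ellipsoid_norm_cube:
  assumes vert: "\<And>\<delta>. (\<And>i. i < n \<Longrightarrow> \<delta> i = 0 \<or> \<delta> i = 1) \<Longrightarrow> ellipsoid_norm n D L \<delta> \<le> \<rho>"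
    and z: "\<And>i. i < n \<Longrightarrow> 0 \<le> z i \<and> z i \<le> 1"
  shows "ellipsoid_norm n D L z \<le> \<rho>"
proof -
  have "ellipsoid_norm n D L z \<le> \<rho>"
    if "k \<le> n" "\<And>i. i < n \<Longrightarrow> 0 \<le> z i \<and> z i \<le> 1" "\<And>i. k \<le> i \<Longrightarrow> i < n \<Longrightarrow> z i = 0 \<or> z i = 1" for k z
    using that
  proof (induction k arbitrary: z)
    case 0
    then show ?case by (intro vert) auto
  next
    case (Suc k)
    have k: "k < n" "0 \<le> z k" "z k \<le> 1" using Suc.prems(1) Suc.prems(2)[of k] by auto
    let ?N = "ellipsoid_norm n D L"
    have 0: "?N (z(k := 0)) \<le> \<rho>" using Suc.prems by (intro Suc.IH) (auto simp: le_Suc_eq Suc_le_eq)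
    have 1: "?N (z(k := 1)) \<le> \<rho>" using Suc.prems by (intro Suc.IH) (auto simp: le_Suc_eq Suc_le_eq)
    have eq: "z = (\<lambda>i. (1 - z k) * (z(k := 0)) i + z k * (z(k := 1)) i)" by (auto simp: algebra_simps)
    have "?N z \<le> ?N (\<lambda>i. (1 - z k) * (z(k := 0)) i) + ?N (\<lambda>i. z k * (z(k := 1)) i)"
      by (subst eq) (rule ellipsoid_norm_triangle)
    also have "\<dots> = (1 - z k) * ?N (z(k := 0)) + z k * ?N (z(k := 1))"
      using k by (simp only: ellipsoid_norm_scale diff_ge_0_iff_ge)
    also have "\<dots> \<le> (1 - z k) * \<rho> + z k * \<rho>" using 0 1 k by (intro add_mono mult_left_mono) auto
    finally show ?case by (simp add: algebra_simps)
  qed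
  from this[of n z] z show ?thesis by simp
qed

text \<open>The triangular map with diagonal sqrt (D k) pulls the ball of radius R back to the
  ellipsoid, so the volume of the ball is divided by the product of the diagonal.\<close>

lemma emeasure_ellipsoid:
  fixes n :: nat
  assumes D: "\<And>k. D k > 0" and L: "\<And>k. L k k = 1" "\<And>k i. i > k \<Longrightarrow> L k i = 0" and R: "R > 0"
  defines "W \<equiv> Pi\<^sub>M {..<n} (\<lambda>_. lborel :: real measure)"
  shows "emeasure W {y \<in> space W. ellipsoid_norm n D L y \<le> R} = ennreal (unit_ball_vol (real n) * R ^ n / sqrt (\<Prod>k<n. D k))"
    and "{y \<in> space W. ellipsoid_norm n D L y \<le> R} \<in> sets W"
proof -
  have comp: "(\<lambda>y. y i) \<in> borel_measurable W" if "i < n" for i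
    using measurable_component_singleton[of i "{..<n}" "\<lambda>_. lborel :: real measure"] that by (simp add: W_def)
  have mN: "ellipsoid_norm n D L \<in> borel_measurable W"
    unfolding ellipsoid_norm_def[abs_def] L2_set_def
    by (rule measurable_compose[OF _ borel_measurable_sqrt],
        intro borel_measurable_sum borel_measurable_power borel_measurable_times borel_measurable_const comp) simp
  show sets: "{y \<in> space W. ellipsoid_norm n D L y \<le> R} \<in> sets W"
    using mN by (intro borel_measurable_le borel_measurable_const) 
  let ?B = "{f. sqrt (\<Sum>i<n. (f i)\<^sup>2) \<le> R} \<inter> space W"
  have "(\<lambda>f. sqrt (\<Sum>i<n. (f i)\<^sup>2)) \<in> borel_measurable W"
    by (rule measurable_compose[OF _ borel_measurable_sqrt], intro borel_measurable_sum borel_measurable_power comp) simp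
  then have "{f \<in> space W. sqrt (\<Sum>i<n. (f i)\<^sup>2) \<le> R} \<in> sets W" by (intro borel_measurable_le borel_measurable_const)
  moreover have "?B = {f \<in> space W. sqrt (\<Sum>i<n. (f i)\<^sup>2) \<le> R}" by auto
  ultimately have B: "?B \<in> sets W" by simp
  define T where "T y = (\<lambda>k\<in>{..<n}. sqrt (D k) * (y k + (\<Sum>i<k. L k i * y i)))" for y :: "nat \<Rightarrow> real"
  have row: "(\<Sum>i<n. L k i * y i) = y k + (\<Sum>i<k. L k i * y i)" if "k < n" for k and y :: "nat \<Rightarrow> real"
  proof -
    have "(\<Sum>i<n. L k i * y i) = (\<Sum>i<Suc k. L k i * y i)"
      by (rule sum.mono_neutral_right) (use that L(2) in auto)
    then show ?thesis by (simp add: L(1))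
  qed
  have "sqrt (\<Sum>k<n. (T y k)\<^sup>2) = ellipsoid_norm n D L y" for y
    unfolding ellipsoid_norm_def L2_set_def T_def by (simp add: row)
  moreover have "T y \<in> space W" for y by (simp add: T_def W_def space_PiM)
  ultimately have ind: "indicator ?B (T y) = indicator {y \<in> space W. ellipsoid_norm n D L y \<le> R} y" if "y \<in> space W" for y
    using that by (simp add: indicator_def)
  have "emeasure W {y \<in> space W. ellipsoid_norm n D L y \<le> R} = (\<integral>\<^sup>+y. indicator {y \<in> space W. ellipsoid_norm n D L y \<le> R} y \<partial>W)"
    using sets by simp
  also have "\<dots> = (\<integral>\<^sup>+y. indicator ?B (T y) \<partial>W)" by (rule nn_integral_cong) (simp add: ind)
  also have "\<dots> = ennreal (\<Prod>k<n. 1 / sqrt (D k)) * (\<integral>\<^sup>+y. indicator ?B y \<partial>W)"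
    unfolding T_def W_def
    by (rule nn_integral_triangular) (use D B in \<open>auto simp: W_def\<close>)
  also have "(\<integral>\<^sup>+y. indicator ?B y \<partial>W) = ennreal (unit_ball_vol (real n) * R ^ n)"
    using emeasure_cball_aux[of "{..<n}" R] R B by (simp add: W_def)
  also have "(\<Prod>k<n. 1 / sqrt (D k)) = 1 / sqrt (\<Prod>k<n. D k)"
    by (induction n) (auto simp: real_sqrt_mult)
  also have "ennreal (1 / sqrt (\<Prod>k<n. D k)) * ennreal (unit_ball_vol (real n) * R ^ n)
    = ennreal (unit_ball_vol (real n) * R ^ n / sqrt (\<Prod>k<n. D k))"
    using R D by (subst ennreal_mult[symmetric]) (auto intro!: prod_nonneg prod_pos less_imp_le)
  finally show "emeasure W {y \<in> space W. ellipsoid_norm n D L y \<le> R} = ennreal (unit_ball_vol (real n) * R ^ n / sqrt (\<Prod>k<n. D k))" .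
qed

text \<open>A point y of the ellipsoid of radius R - \<rho> lies in the unit cube at floor y, and
  passing from y to floor y changes the norm by at most \<rho>. Hence the cubes at the points of S
  cover the smaller ellipsoid.\<close>

lemma lattice_point_count:
  fixes S :: "(nat \<Rightarrow> int) set"
  assumes D: "\<And>k. D k > 0" and L: "\<And>k. L k k = 1" "\<And>k i. i > k \<Longrightarrow> L k i = 0"
    and vert: "\<And>\<delta>. (\<And>i. i < n \<Longrightarrow> \<delta> i = 0 \<or> \<delta> i = 1) \<Longrightarrow> ellipsoid_norm n D L \<delta> \<le> \<rho>"
    and \<rho>: "\<rho> < R" and fin: "finite S"
    and S: "\<And>x. (\<And>i. i \<ge> n \<Longrightarrow> x i = 0) \<Longrightarrow> ellipsoid_norm n D L (\<lambda>i. of_int (x i)) \<le> R \<Longrightarrow> x \<in> S"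
  shows "unit_ball_vol (real n) * (R - \<rho>) ^ n / sqrt (\<Prod>k<n. D k) \<le> real (card S)"
proof -
  interpret product_sigma_finite "\<lambda>_::nat. lborel :: real measure" by standard
  define W where "W = Pi\<^sub>M {..<n} (\<lambda>_. lborel :: real measure)"
  let ?N = "ellipsoid_norm n D L"
  let ?A = "{y \<in> space W. ?N y \<le> R - \<rho>}"
  define Q where "Q x = Pi\<^sub>E {..<n} (\<lambda>i. {real_of_int (x i)..<real_of_int (x i) + 1})" for x :: "nat \<Rightarrow> int"
  have Q: "Q x \<in> sets W" "emeasure W (Q x) = 1" for x
  proof -
    show "Q x \<in> sets W" unfolding Q_def W_def by (intro sets_PiM_I_finite) auto
    show "emeasure W (Q x) = 1" unfolding Q_def W_def by (subst emeasure_PiM) auto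
  qed
  have sub: "?A \<subseteq> (\<Union>x\<in>S. Q x)"
  proof
    fix y assume "y \<in> ?A"
    then have y: "y \<in> space W" "?N y \<le> R - \<rho>" by auto
    define x where "x i = (if i < n then \<lfloor>y i\<rfloor> else 0)" for i
    have fl: "of_int (x i) = y i + - frac (y i)" if "i < n" for i using that by (simp add: x_def frac_def)
    have "?N (\<lambda>i. of_int (x i)) = ?N (\<lambda>i. y i + - frac (y i))" by (rule ellipsoid_norm_cong) (rule fl)
    also have "\<dots> \<le> ?N y + ?N (\<lambda>i. - frac (y i))" by (rule ellipsoid_norm_triangle)
    also have "?N (\<lambda>i. - frac (y i)) = ?N (\<lambda>i. frac (y i))" by (rule ellipsoid_norm_minus)
    also have "?N (\<lambda>i. frac (y i)) \<le> \<rho>" by (rule ellipsoid_norm_cube[OF vert]) (auto simp: less_imp_le[OF frac_lt_1])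
    finally have "?N (\<lambda>i. of_int (x i)) \<le> R" using y(2) by linarith
    then have "x \<in> S" by (intro S) (auto simp: x_def)
    moreover have "y \<in> Q x" using y(1) by (auto simp: Q_def W_def space_PiM PiE_iff x_def)
    ultimately show "y \<in> (\<Union>x\<in>S. Q x)" by blast
  qed
  have R: "R - \<rho> > 0" using \<rho> by simp
  have "ennreal (unit_ball_vol (real n) * (R - \<rho>) ^ n / sqrt (\<Prod>k<n. D k)) = emeasure W ?A"
    unfolding W_def using emeasure_ellipsoid(1)[where n = n and D = D and L = L, OF D L R] by simp
  also have "\<dots> \<le> emeasure W (\<Union>x\<in>S. Q x)" using sub by (rule emeasure_mono) (use fin Q(1) in auto)
  also have "\<dots> \<le> (\<Sum>x\<in>S. emeasure W (Q x))" using fin Q(1) by (intro emeasure_subadditive_finite) auto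
  also have "\<dots> = ennreal (real (card S))" by (simp add: Q(2) ennreal_of_nat_eq_real_of_nat)
  finally show ?thesis by (subst (asm) ennreal_le_iff) auto
qed

section \<open>The class number bound\<close>

text \<open>Scaling passes from integral to rational vectors, and floor (N y) / N approximates every
  real y.\<close>

lemma psd_of_int:
  fixes M :: "nat \<Rightarrow> nat \<Rightarrow> real"
  assumes int: "\<And>x :: nat \<Rightarrow> int. (\<Sum>i<n. \<Sum>j<n. M i j * of_int (x i) * of_int (x j)) \<ge> 0"
  shows "(\<Sum>i<n. \<Sum>j<n. M i j * y i * y j) \<ge> 0"
proof (rule LIMSEQ_le_const)
  have lim: "(\<lambda>N. of_int \<lfloor>real N * z\<rfloor> / real N) \<longlonglongrightarrow> z" for z :: real
  proof (rule LIM_zero_cancel, rule Lim_null_comparison)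
    show "\<forall>\<^sub>F N in sequentially. norm (of_int \<lfloor>real N * z\<rfloor> / real N - z) \<le> 1 / real N"
    proof (rule eventually_sequentiallyI[of 1])
      fix N :: nat assume N: "1 \<le> N"
      then have "of_int \<lfloor>real N * z\<rfloor> / real N - z = (of_int \<lfloor>real N * z\<rfloor> - real N * z) / real N"
        by (simp add: diff_divide_distrib)
      moreover have "\<bar>of_int \<lfloor>real N * z\<rfloor> - real N * z\<bar> \<le> 1" by linarith
      ultimately show "norm (of_int \<lfloor>real N * z\<rfloor> / real N - z) \<le> 1 / real N"
        using N by (simp add: abs_divide divide_right_mono)
    qed
    show "(\<lambda>N. 1 / real N) \<longlonglongrightarrow> 0" by (rule lim_1_over_n)
  qed
  let ?x = "\<lambda>N i. of_int \<lfloor>real N * y i\<rfloor> / real N"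
  show "(\<lambda>N. \<Sum>i<n. \<Sum>j<n. M i j * ?x N i * ?x N j) \<longlonglongrightarrow> (\<Sum>i<n. \<Sum>j<n. M i j * y i * y j)"
    by (intro tendsto_sum tendsto_mult tendsto_const lim)
  have "(\<Sum>i<n. \<Sum>j<n. M i j * ?x N i * ?x N j)
      = (\<Sum>i<n. \<Sum>j<n. M i j * of_int \<lfloor>real N * y i\<rfloor> * of_int \<lfloor>real N * y j\<rfloor>) / (real N * real N)" for N
    unfolding sum_divide_distrib by simp
  then show "\<exists>k. \<forall>N\<ge>k. 0 \<le> (\<Sum>i<n. \<Sum>j<n. M i j * ?x N i * ?x N j)"
    using int[of "\<lambda>i. \<lfloor>real N * y i\<rfloor>" for N] by simp
qed

section \<open>Heights of integral combinations and the regulator\<close>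

context elliptic_curve
begin

lemma lincomb_Suc:
  "Ps n \<in> carrier E \<Longrightarrow> ec_lincomb a c Ps (Suc n) = ec_lincomb a c Ps n \<otimes>\<^bsub>E\<^esub> Ps n [^]\<^bsub>E\<^esub> c n"
  by (simp add: mult_ec_group ec_mul_eq_pow)

lemma lincomb_closed: "(\<And>i. i < n \<Longrightarrow> Ps i \<in> carrier E) \<Longrightarrow> ec_lincomb a c Ps n \<in> carrier E"
proof (induction n)
  case (Suc n)
  then have "Ps n \<in> carrier E" "ec_lincomb a c Ps n \<in> carrier E" by simp_all
  then show ?case unfolding lincomb_Suc[where Ps = Ps and n = n, OF \<open>Ps n \<in> carrier E\<close>] by (intro m_closed int_pow_closed)
qed (simp add: carrier_ec_group)

lemma bil_lincomb:
  assumes "\<And>i. i < n \<Longrightarrow> Ps i \<in> carrier E" and Q: "Q \<in> carrier E"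
  shows "bil (ec_lincomb a c Ps n) Q = (\<Sum>i<n. of_int (c i) * bil (Ps i) Q)"
  using assms(1)
proof (induction n)
  case 0
  have "ec_lincomb a c Ps 0 = \<one>\<^bsub>E\<^esub>" by (simp add: one_ec_group)
  then show ?case using bil_one[OF Q] by simp
next
  case (Suc n)
  have P: "Ps n \<in> carrier E" "ec_lincomb a c Ps n \<in> carrier E" using Suc.prems lincomb_closed[of n Ps c] by simp_all
  show ?case unfolding lincomb_Suc[where Ps = Ps and n = n, OF P(1)] using Suc.IH Suc.prems P Q by (simp add: bil_add bil_int_pow)
qed

lemma hhat_lincomb:
  assumes P: "\<And>i. i < n \<Longrightarrow> Ps i \<in> carrier E"
  shows "hhat (ec_lincomb a c Ps n) / 2 = (\<Sum>i<n. \<Sum>j<n. height_pairing a (Ps i) (Ps j) * of_int (c i) * of_int (c j))"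
proof -
  let ?S = "ec_lincomb a c Ps n"
  have S: "?S \<in> carrier E" using P by (rule lincomb_closed)
  have "2 * hhat ?S = bil ?S ?S" using bil_self[OF S] by simp
  also have "\<dots> = (\<Sum>i<n. of_int (c i) * bil (Ps i) ?S)" using bil_lincomb[OF P S] by simp
  also have "\<dots> = (\<Sum>i<n. of_int (c i) * bil ?S (Ps i))" using P S bil_commute by (intro sum.cong) auto
  also have "\<dots> = (\<Sum>i<n. of_int (c i) * (\<Sum>j<n. of_int (c j) * bil (Ps j) (Ps i)))"
    using bil_lincomb[OF P P] by (intro sum.cong) auto
  also have "\<dots> = (\<Sum>i<n. \<Sum>j<n. 4 * (height_pairing a (Ps i) (Ps j) * of_int (c i) * of_int (c j)))"
    unfolding sum_distrib_left
  proof (intro sum.cong refl)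
    fix i j assume "i \<in> {..<n}" "j \<in> {..<n}"
    then have "bil (Ps j) (Ps i) = 4 * height_pairing a (Ps i) (Ps j)"
      using height_pairing_eq[OF P P, of i j] bil_commute[OF P P, of i j] by simp
    then show "of_int (c i) * (of_int (c j) * bil (Ps j) (Ps i)) = 4 * (height_pairing a (Ps i) (Ps j) * of_int (c i) * of_int (c j))"
      by simp
  qed
  finally show ?thesis by (simp add: sum_distrib_left[symmetric])
qed

lemma lincomb_diff:
  assumes "\<And>i. i < n \<Longrightarrow> Ps i \<in> carrier E"
  shows "ec_lincomb a (\<lambda>i. c i - c' i) Ps n = ec_lincomb a c Ps n \<otimes>\<^bsub>E\<^esub> inv\<^bsub>E\<^esub> ec_lincomb a c' Ps n"
  using assms
proof (induction n)
  case 0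
  have "\<one>\<^bsub>E\<^esub> = \<one>\<^bsub>E\<^esub> \<otimes>\<^bsub>E\<^esub> inv\<^bsub>E\<^esub> \<one>\<^bsub>E\<^esub>" by simp
  then show ?case by (simp only: ec_lincomb.simps(1) one_ec_group)
next
  case (Suc n)
  have P: "Ps n \<in> carrier E" "\<And>c. ec_lincomb a c Ps n \<in> carrier E" using Suc.prems lincomb_closed[of n Ps] by simp_all
  have rearr: "(x \<otimes>\<^bsub>E\<^esub> y) \<otimes>\<^bsub>E\<^esub> (z \<otimes>\<^bsub>E\<^esub> w) = (x \<otimes>\<^bsub>E\<^esub> z) \<otimes>\<^bsub>E\<^esub> (y \<otimes>\<^bsub>E\<^esub> w)"
    if "x \<in> carrier E" "y \<in> carrier E" "z \<in> carrier E" "w \<in> carrier E" for x y z w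
    using that by (simp only: m_ac m_closed)
  have "ec_lincomb a (\<lambda>i. c i - c' i) Ps (Suc n)
    = (ec_lincomb a c Ps n \<otimes>\<^bsub>E\<^esub> inv\<^bsub>E\<^esub> ec_lincomb a c' Ps n) \<otimes>\<^bsub>E\<^esub> (Ps n [^]\<^bsub>E\<^esub> c n \<otimes>\<^bsub>E\<^esub> inv\<^bsub>E\<^esub> (Ps n [^]\<^bsub>E\<^esub> c' n))"
    unfolding lincomb_Suc[where Ps = Ps and n = n, OF P(1)] int_pow_diff[OF P(1)] using Suc by simp
  also have "\<dots> = (ec_lincomb a c Ps n \<otimes>\<^bsub>E\<^esub> Ps n [^]\<^bsub>E\<^esub> c n) \<otimes>\<^bsub>E\<^esub> (inv\<^bsub>E\<^esub> ec_lincomb a c' Ps n \<otimes>\<^bsub>E\<^esub> inv\<^bsub>E\<^esub> (Ps n [^]\<^bsub>E\<^esub> c' n))"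
    using P by (intro rearr inv_closed int_pow_closed)
  also have "\<dots> = ec_lincomb a c Ps (Suc n) \<otimes>\<^bsub>E\<^esub> inv\<^bsub>E\<^esub> ec_lincomb a c' Ps (Suc n)"
    unfolding lincomb_Suc[where Ps = Ps and n = n, OF P(1)] using P by (simp only: inv_mult int_pow_closed)
  finally show ?case .
qed

lemma lincomb_pow:
  assumes "\<And>i. i < n \<Longrightarrow> Ps i \<in> carrier E"
  shows "ec_lincomb a (\<lambda>i. c i * k) Ps n = ec_lincomb a c Ps n [^]\<^bsub>E\<^esub> (k :: int)"
  using assms
proof (induction n)
  case 0
  have "\<one>\<^bsub>E\<^esub> = \<one>\<^bsub>E\<^esub> [^]\<^bsub>E\<^esub> k" by simp
  then show ?case by (simp only: ec_lincomb.simps(1) one_ec_group)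
next
  case (Suc n)
  have P: "Ps n \<in> carrier E" "\<And>c. ec_lincomb a c Ps n \<in> carrier E" using Suc.prems lincomb_closed[of n Ps] by simp_all
  show ?case unfolding lincomb_Suc[where Ps = Ps and n = n, OF P(1)] using Suc P by (simp add: int_pow_distrib int_pow_pow)
qed

lemma hhat_torsion:
  assumes P: "P \<in> carrier E" and g: "g \<in> carrier E" and n: "n > 0" "g [^]\<^bsub>E\<^esub> (n :: nat) = \<one>\<^bsub>E\<^esub>"
  shows "hhat (P \<otimes>\<^bsub>E\<^esub> g) = hhat P"
proof -
  have "real n ^ 2 * hhat g = 0" using hhat_pow[OF g, of n] n(2) by simp
  then have 1: "hhat g = 0" using n(1) by simp
  have "real n * bil g P = 0" using bil_pow[OF g P, of n] n(2) bil_one[OF P] by simp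
  then have "bil g P = 0" using n(1) by simp
  then have "bil P g = 0" using bil_commute[OF P g] by simp
  then show ?thesis using 1 by (simp add: bil_def)
qed

text \<open>The two combinations differ by the torsion point g' - g; multiplied by a positive
  integer that kills this point, the difference becomes a vanishing combination of independent
  points.\<close>

lemma lincomb_torsion_inj:
  assumes P: "\<And>i. i < r \<Longrightarrow> Ps i \<in> carrier E" and ind: "lin_indep a Ps r" and G: "tors_subgroup a b G"
    and g: "g \<in> G" "g' \<in> G" and x: "\<And>i. i \<ge> r \<Longrightarrow> x i = 0" "\<And>i. i \<ge> r \<Longrightarrow> x' i = 0"
    and eq: "ec_lincomb a x Ps r \<otimes>\<^bsub>E\<^esub> g = ec_lincomb a x' Ps r \<otimes>\<^bsub>E\<^esub> g'"
  shows "x = x'" "g = g'"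
proof -
  have cG: "h \<in> carrier E" if "h \<in> G" for h using G that by (simp add: tors_subgroup_def carrier_ec_group)
  note cg = cG[OF g(1)] cG[OF g(2)]
  let ?X = "ec_lincomb a x Ps r" and ?X' = "ec_lincomb a x' Ps r"
  have cX: "?X \<in> carrier E" "?X' \<in> carrier E" using P by (auto intro: lincomb_closed)
  define h where "h = g' \<otimes>\<^bsub>E\<^esub> inv\<^bsub>E\<^esub> g"
  have "ec_neg g \<in> G" using G g(1) by (simp add: tors_subgroup_def)
  then have "ec_add a g' (ec_neg g) \<in> G" using G g(2) by (simp add: tors_subgroup_def)
  then have h: "h \<in> G" by (simp add: h_def mult_ec_group inv_E[OF cg(1)])
  then obtain m where m: "m > 0" "ec_nmul a m h = None" using G by (auto simp: tors_subgroup_def)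
  have hm: "h [^]\<^bsub>E\<^esub> m = \<one>\<^bsub>E\<^esub>" using m(2) unfolding ec_nmul_eq_pow[OF cG[OF h]] one_ec_group .
  have "?X \<otimes>\<^bsub>E\<^esub> inv\<^bsub>E\<^esub> ?X' = h"
  proof -
    have "?X = ?X' \<otimes>\<^bsub>E\<^esub> g' \<otimes>\<^bsub>E\<^esub> inv\<^bsub>E\<^esub> g" using eq cX cg by (metis inv_solve_right m_closed)
    also have "\<dots> = h \<otimes>\<^bsub>E\<^esub> ?X'" unfolding h_def using cX cg by (simp only: m_ac m_closed inv_closed)
    finally have "?X = h \<otimes>\<^bsub>E\<^esub> ?X'" .
    then show ?thesis using cX cG[OF h] by (metis inv_solve_right)
  qed
  then have "ec_lincomb a (\<lambda>i. x i - x' i) Ps r = h" using lincomb_diff[where n = r and Ps = Ps and c = x and c' = x', OF P] by simp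
  then have "ec_lincomb a (\<lambda>i. (x i - x' i) * int m) Ps r = h [^]\<^bsub>E\<^esub> int m"
    using lincomb_pow[where n = r and Ps = Ps and c = "\<lambda>i. x i - x' i" and k = "int m", OF P] by simp
  also have "\<dots> = None" using hm by (simp add: int_pow_int one_ec_group)
  finally have z: "\<forall>i<r. (x i - x' i) * int m = 0" using ind unfolding lin_indep_def by blast
  show xx: "x = x'"
  proof
    fix i
    show "x i = x' i" using z m(1) x[of i] by (cases "i < r") auto
  qed
  show "g = g'" using eq cX cg unfolding xx by simp
qed

text \<open>The factor 2 in \<open>dP\<close> is the one between \<open>canon_height\<close> and
  \<open>hhat\<close>, so \<open>dP\<close> bounds \<open>hhat\<close> directly.\<close>

lemma dP_bounds:
  assumes P: "\<And>i. i < r \<Longrightarrow> Ps i \<in> carrier E"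
  shows "\<And>\<delta>. (\<And>i. i < r \<Longrightarrow> \<delta> i \<in> {-1, 0, 1}) \<Longrightarrow> (\<And>i. i \<ge> r \<Longrightarrow> \<delta> i = 0) \<Longrightarrow> hhat (ec_lincomb a \<delta> Ps r) \<le> dP a Ps r"
    and "dP a Ps r \<ge> 0"
proof -
  let ?S = "{\<delta> :: nat \<Rightarrow> int. (\<forall>i<r. \<delta> i \<in> {-1, 0, 1}) \<and> (\<forall>i\<ge>r. \<delta> i = 0)}"
  have "?S = {\<delta>. \<forall>i. (i \<in> {..<r} \<longrightarrow> \<delta> i \<in> {-1, 0, 1}) \<and> (i \<notin> {..<r} \<longrightarrow> \<delta> i = 0)}" by (auto simp: not_less)
  then have fin: "finite ?S" using finite_set_of_finite_funs[of "{..<r}" "{-1, 0, 1 :: int}" 0] by simp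
  have c: "2 * canon_height a (ec_lincomb a \<delta> Ps r) = hhat (ec_lincomb a \<delta> Ps r)" for \<delta>
    using canon_height_eq[OF lincomb_closed[where n = r and Ps = Ps and c = \<delta>, OF P]] by linarith
  have le: "hhat (ec_lincomb a \<delta> Ps r) \<le> dP a Ps r" if "\<delta> \<in> ?S" for \<delta>
    unfolding dP_def c using fin that by (intro Max_ge) auto
  then show "\<And>\<delta>. (\<And>i. i < r \<Longrightarrow> \<delta> i \<in> {-1, 0, 1}) \<Longrightarrow> (\<And>i. i \<ge> r \<Longrightarrow> \<delta> i = 0) \<Longrightarrow> hhat (ec_lincomb a \<delta> Ps r) \<le> dP a Ps r"
    by simp
  have "0 \<le> hhat (ec_lincomb a (\<lambda>_. 0) Ps r)" by (rule hhat_nonneg[OF lincomb_closed[OF P]])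
  also have "\<dots> \<le> dP a Ps r" by (rule le) simp
  finally show "dP a Ps r \<ge> 0" .
qed

text \<open>Only semidefiniteness of the height form is established, so some D k may be 0; as their
  product is the regulator, a nonzero regulator makes those with k < r positive.\<close>

lemma regulator_ellipsoid:
  assumes P: "\<And>i. i < r \<Longrightarrow> Ps i \<in> carrier E"
  obtains D L where "\<forall>k. D k \<ge> 0 \<and> L k k = 1 \<and> (\<forall>i>k. L k i = 0)" "regulator a Ps r = (\<Prod>k<r. D k)"
    "\<forall>x :: nat \<Rightarrow> int. ellipsoid_norm r D L (\<lambda>i. of_int (x i)) ^ 2 = hhat (ec_lincomb a x Ps r) / 2"
proof -
  define M where "M i j = (if i < r \<and> j < r then height_pairing a (Ps i) (Ps j) else 0)" for i j
  have M: "M i j = height_pairing a (Ps i) (Ps j)" if "i < r" "j < r" for i j using that by (simp add: M_def)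
  have sym: "M i j = M j i" for i j
  proof (cases "i < r \<and> j < r")
    case True
    then have "Ps i \<in> carrier E" "Ps j \<in> carrier E" using P by simp_all
    then show ?thesis using True bil_commute[of "Ps i" "Ps j"] by (simp add: M_def height_pairing_eq)
  qed (auto simp: M_def)
  have q: "(\<Sum>i<r. \<Sum>j<r. M i j * of_int (x i) * of_int (x j)) = hhat (ec_lincomb a x Ps r) / 2" for x :: "nat \<Rightarrow> int"
  proof -
    have "(\<Sum>i<r. \<Sum>j<r. M i j * of_int (x i) * of_int (x j))
        = (\<Sum>i<r. \<Sum>j<r. height_pairing a (Ps i) (Ps j) * of_int (x i) * of_int (x j))"
      by (intro sum.cong refl) (simp add: M)
    also have "\<dots> = hhat (ec_lincomb a x Ps r) / 2" by (rule hhat_lincomb[symmetric]) (rule P)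
    finally show ?thesis .
  qed
  have psd: "(\<Sum>i<r. \<Sum>j<r. M i j * y i * y j) \<ge> 0" for y :: "nat \<Rightarrow> real"
  proof (rule psd_of_int)
    fix x :: "nat \<Rightarrow> int"
    show "(\<Sum>i<r. \<Sum>j<r. M i j * of_int (x i) * of_int (x j)) \<ge> 0"
      unfolding q using hhat_nonneg[OF lincomb_closed[OF P]] by simp
  qed
  obtain D L where "(\<forall>k. D k \<ge> 0 \<and> L k k = 1 \<and> (\<forall>i>k. L k i = 0)) \<and>
      (\<forall>i<r. \<forall>j<r. M i j = (\<Sum>k<r. D k * L k i * L k j))"
    using psd_triangular[OF sym psd] by (elim exE)
  then have DL: "\<And>k. D k \<ge> 0" "\<And>k. L k k = 1" "\<And>k i. i > k \<Longrightarrow> L k i = 0"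
    "\<And>i j. i < r \<Longrightarrow> j < r \<Longrightarrow> M i j = (\<Sum>k<r. D k * L k i * L k j)" by simp_all
  have "regulator a Ps r = (\<Sum>p | p permutes {..<r}. of_int (sign p) * (\<Prod>i<r. M i (p i)))"
    unfolding regulator_def
  proof (intro sum.cong refl)
    fix p assume "p \<in> {p. p permutes {..<r}}"
    then have p: "p permutes {..<r}" by simp
    have "(\<Prod>i<r. height_pairing a (Ps i) (Ps (p i))) = (\<Prod>i<r. M i (p i))"
      by (rule prod.cong[OF refl]) (use permutes_in_image[OF p] in \<open>simp add: M\<close>)
    then show "of_int (sign p) * (\<Prod>i<r. height_pairing a (Ps i) (Ps (p i))) = of_int (sign p) * (\<Prod>i<r. M i (p i))" by simp
  qed
  also have "\<dots> = (\<Prod>k<r. D k)" using DL(2-4) by (rule det_triangular_product)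
  finally have reg: "regulator a Ps r = (\<Prod>k<r. D k)" .
  have "ellipsoid_norm r D L (\<lambda>i. of_int (x i)) ^ 2 = hhat (ec_lincomb a x Ps r) / 2" for x :: "nat \<Rightarrow> int"
    unfolding ellipsoid_norm_square[OF DL(1)] q[symmetric] by (intro sum.cong refl) (simp add: DL(4))
  then show ?thesis using DL(1-3) reg by (intro that[of D L]) simp_all
qed

end

lemma pow_minus_ge:
  fixes t \<rho> :: real
  assumes "0 \<le> \<rho>" "\<rho> \<le> t"
  shows "(t - \<rho>) ^ n \<ge> t ^ n - real n * \<rho> * t ^ (n - 1)"
proof (cases "t = 0")
  case False
  then have t: "t > 0" using assms by simp
  have "1 + real n * (- \<rho> / t) \<le> (1 + (- \<rho> / t)) ^ n"
    by (rule Bernoulli_inequality) (use assms t in \<open>simp add: field_simps\<close>)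
  then have "t ^ n * (1 + real n * (- \<rho> / t)) \<le> t ^ n * (1 + (- \<rho> / t)) ^ n" using t by (intro mult_left_mono) auto
  also have "t ^ n * (1 + (- \<rho> / t)) ^ n = (t - \<rho>) ^ n"
  proof -
    have "t * (1 + (- \<rho> / t)) = t - \<rho>" using t by (simp add: field_simps)
    then show ?thesis by (simp only: power_mult_distrib[symmetric])
  qed
  also have "t ^ n * (1 + real n * (- \<rho> / t)) = t ^ n - real n * \<rho> * t ^ (n - 1)"
    using t by (cases n) (simp_all add: field_simps)
  finally show ?thesis .
qed (use assms in simp)

section \<open>Points of small height and the final inequality\<close>

context map_suitable_curve
begin

text \<open>By the parallelogram law, points with \<open>hhat\<close> at most 2 t differ by a point
  with \<open>hhat\<close> at most 8 t, whose A and Z are at most exp (8 t + 2 \<delta>) / 4. The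
  two bounds on this number keep v (A v + u Z) below d and Z below v^2.\<close>

lemma card_points_le_class_number:
  assumes S: "S \<subseteq> carrier E" and ht: "\<And>P. P \<in> S \<Longrightarrow> hhat P \<le> 2 * t"
    and X: "(u * v + v ^ 2) * (exp (8 * t + 2 * deltaE a b) / 4) < d" "exp (8 * t + 2 * deltaE a b) / 4 < v ^ 2"
  shows "finite S" "card S \<le> class_number (- 4 * d)"
proof -
  have "\<forall>P\<in>carrier E. \<exists>\<alpha> \<beta>. form_data P \<alpha> \<beta>" by (meson form_data_exists)
  then obtain \<alpha> \<beta> where F: "\<And>P. P \<in> carrier E \<Longrightarrow> form_data P (\<alpha> P) (\<beta> P)" by metis
  define form where "form P = (\<alpha> P, 2 * \<beta> P, (\<beta> P ^ 2 + d) div \<alpha> P)" for P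
  have prim: "form P \<in> prim_pos_forms (- 4 * d)" if "P \<in> S" for P
    unfolding form_def by (rule form_data_prim[where P = P]) (use that S F in auto)
  have ineq: "\<not> form_equiv (form P) (form Q)" if PQ: "P \<in> S" "Q \<in> S" "P \<noteq> Q" for P Q
  proof -
    have c: "P \<in> carrier E" "Q \<in> carrier E" using PQ S by auto
    let ?R = "P \<otimes>\<^bsub>E\<^esub> inv\<^bsub>E\<^esub> Q"
    have R: "?R \<in> carrier E" using c by simp
    obtain A Z where AZ: "xfrac ?R = (A, Z)" by fastforce
    define H where "H = real_of_int (max \<bar>A\<bar> \<bar>Z\<bar>)"
    have H: "of_int A \<le> H" "of_int Z \<le> H" "H > 0" using xfrac_max_ge_1[OF AZ] by (auto simp: H_def simp del: of_int_abs)
    have "hhat ?R \<le> 8 * t"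
      using hhat_parallelogram_le[OF c] hhat_nonneg[of "P \<otimes>\<^bsub>E\<^esub> Q"] c ht[OF PQ(1)] ht[OF PQ(2)] by simp
    then have "ln H \<le> (8 * t + 2 * deltaE a b) - ln 4" using hW_pt_le_hhat[OF R] hW_pt_xfrac[OF AZ] by (simp add: H_def)
    then have "exp (ln H) \<le> exp ((8 * t + 2 * deltaE a b) - ln 4)" by simp
    then have HX: "H \<le> exp (8 * t + 2 * deltaE a b) / 4" using H(3) by (simp add: exp_diff)
    have "real_of_int Z < real_of_int (v ^ 2)" using H HX X(2) by linarith
    then have Z: "Z < v ^ 2" by (simp only: of_int_less_iff)
    have uv0: "real_of_int v \<ge> 0" "real_of_int u \<ge> 0" using uv by auto
    have "of_int (v * (A * v + u * Z)) = real_of_int (v * v) * of_int A + of_int (u * v) * of_int Z"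
      by (simp add: algebra_simps)
    also have "\<dots> \<le> of_int (v * v) * H + of_int (u * v) * H"
      using H uv0 by (intro add_mono mult_left_mono) auto
    also have "\<dots> = of_int (u * v + v ^ 2) * H" by (simp add: power2_eq_square algebra_simps)
    also have "\<dots> \<le> of_int (u * v + v ^ 2) * (exp (8 * t + 2 * deltaE a b) / 4)"
      using HX uv0 by (intro mult_left_mono) auto
    also have "\<dots> < of_int d" using X(1) by simp
    finally have "v * (A * v + u * Z) < d" by (simp only: of_int_less_iff)
    from form_inequiv[OF c PQ(3) F[OF c(1)] F[OF c(2)] AZ this Z] show ?thesis unfolding form_def .
  qed
  have neg: "- 4 * d < 0" using d_pos by simp
  show "finite S" by (rule card_le_class_number(1)[OF neg prim ineq])
  show "card S \<le> class_number (- 4 * d)" by (rule card_le_class_number(2)[OF neg prim ineq])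
qed

lemma class_number_lower_bound:
  fixes Ps :: "nat \<Rightarrow> ecpt" and r :: nat and G :: "ecpt set" and t :: real
  assumes P: "\<And>i. i < r \<Longrightarrow> Ps i \<in> carrier E" and ind: "lin_indep a Ps r" and G: "tors_subgroup a b G"
    and X: "(u * v + v ^ 2) * (exp (8 * t + 2 * deltaE a b) / 4) < d" "exp (8 * t + 2 * deltaE a b) / 4 < v ^ 2"
    and t: "t > 0"
  shows "cG a G Ps r * (t powr (real r / 2) - real r * sqrt (dP a Ps r) * t powr ((real r - 1) / 2))
    \<le> real (class_number (- 4 * d))"
proof -
  obtain D L where *: "\<forall>k. D k \<ge> 0 \<and> L k k = 1 \<and> (\<forall>i>k. L k i = 0)"
    and reg: "regulator a Ps r = (\<Prod>k<r. D k)"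
    and **: "\<forall>x :: nat \<Rightarrow> int. ellipsoid_norm r D L (\<lambda>i. of_int (x i)) ^ 2 = hhat (ec_lincomb a x Ps r) / 2"
    by (rule regulator_ellipsoid[where r = r and Ps = Ps]) (rule P, assumption, rule that)
  note DL = *[rule_format, THEN conjunct1] *[rule_format, THEN conjunct2, THEN conjunct1]
    *[rule_format, THEN conjunct2, THEN conjunct2, rule_format] and N = **[rule_format]
  \<comment> \<open>The squared ellipsoid norm is half of \<open>hhat\<close>, and at the vertices
    of the unit cube \<open>hhat\<close> is at most \<open>dP\<close>.\<close>
  define \<rho> where "\<rho> = sqrt (dP a Ps r / 2)"
  define K where "K = t powr (real r / 2) - real r * sqrt (dP a Ps r) * t powr ((real r - 1) / 2)"
  have d0: "dP a Ps r \<ge> 0" using dP_bounds(2)[OF P] .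
  have \<rho>: "0 \<le> \<rho>" "\<rho> \<le> sqrt (dP a Ps r)" using d0 by (simp_all add: \<rho>_def)
  have O0: "Omega r \<ge> 0" unfolding Omega_def by (intro divide_nonneg_nonneg Gamma_real_nonneg) auto
  have reg0: "regulator a Ps r \<ge> 0" unfolding reg using DL(1) by (intro prod_nonneg) auto
  have c0: "cG a G Ps r \<ge> 0" unfolding cG_def using O0 reg0 by (intro mult_nonneg_nonneg divide_nonneg_nonneg) auto
  have p1: "t powr (real r / 2) = sqrt t ^ r" using t
    by (simp add: powr_half_sqrt[symmetric] powr_realpow[symmetric] powr_powr)
  have p2: "real r * x * t powr ((real r - 1) / 2) = real r * x * sqrt t ^ (r - 1)" for x
  proof (cases r)
    case (Suc m)
    then show ?thesis using t by (simp add: powr_half_sqrt[symmetric] powr_realpow[symmetric] powr_powr)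
  qed simp
  show ?thesis
  \<comment> \<open>If K is not positive the claim is trivial. So it is if the regulator is 0, since
    division by 0 then makes \<open>cG\<close> vanish.\<close>
  proof (cases "K \<le> 0 \<or> cG a G Ps r = 0")
    case True
    then have "cG a G Ps r * K \<le> 0" using c0 by (auto intro: mult_nonneg_nonpos)
    then show ?thesis unfolding K_def by linarith
  next
    case False
    then have K: "K > 0" and cn: "cG a G Ps r \<noteq> 0" by auto
    have regn: "regulator a Ps r \<noteq> 0" using cn by (auto simp: cG_def)
    have \<rho>t: "\<rho> < sqrt t"
    proof (cases r)
      case 0
      \<comment> \<open>For r = 0 the positivity of K says nothing about \<rho>, but the maximum in
        \<open>dP\<close> runs over the zero vector alone.\<close>
      have "dP a Ps r = 0"
      proof -
        have "{\<delta> :: nat \<Rightarrow> int. (\<forall>i<r. \<delta> i \<in> {-1, 0, 1}) \<and> (\<forall>i\<ge>r. \<delta> i = 0)} = {\<lambda>_. 0}" using 0 by auto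
        moreover have "canon_height a None = 0" using canon_height_eq[of "\<one>\<^bsub>E\<^esub>"] by (simp add: one_ec_group[symmetric, of a b])
        ultimately show ?thesis unfolding dP_def using 0 by simp
      qed
      then show ?thesis using t by (simp add: \<rho>_def)
    next
      case (Suc m)
      have "K = sqrt t ^ m * (sqrt t - real r * sqrt (dP a Ps r))"
        unfolding K_def p1 p2 using Suc by (simp add: algebra_simps)
      then have "sqrt t - real r * sqrt (dP a Ps r) > 0" using K t by (simp add: zero_less_mult_iff)
      moreover have "real r * sqrt (dP a Ps r) \<ge> 1 * sqrt (dP a Ps r)" using Suc d0 by (intro mult_right_mono) auto
      ultimately show ?thesis using \<rho>(2) by linarith
    qed
    \<comment> \<open>\<open>lattice_point_count\<close> asks for positive entries at every index,
      so D is continued by 1 from r on.\<close>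
    define D' where "D' k = (if k < r then D k else 1)" for k
    have Dpos: "D' k > 0" for k
    proof (cases "k < r")
      case True
      then have "D k \<noteq> 0" using regn unfolding reg by auto
      then show ?thesis using DL(1)[of k] True by (simp add: D'_def)
    qed (simp add: D'_def)
    have prodD: "(\<Prod>k<r. D' k) = regulator a Ps r" unfolding reg by (rule prod.cong) (simp_all add: D'_def)
    have N': "ellipsoid_norm r D' L y = ellipsoid_norm r D L y" for y
      unfolding ellipsoid_norm_def by (rule L2_set_cong) (simp_all add: D'_def)
    have en0: "ellipsoid_norm r D L y \<ge> 0" for y unfolding ellipsoid_norm_def by (rule L2_set_nonneg)
    have Nle: "ellipsoid_norm r D L (\<lambda>i. of_int (x i)) \<le> sqrt s \<longleftrightarrow> hhat (ec_lincomb a x Ps r) \<le> 2 * s" for x :: "nat \<Rightarrow> int" and s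
    proof -
      have "ellipsoid_norm r D L (\<lambda>i. of_int (x i)) = sqrt (hhat (ec_lincomb a x Ps r) / 2)"
        using N[of x] en0 by (metis real_sqrt_unique)
      then show ?thesis by auto
    qed
    define S where "S = {x :: nat \<Rightarrow> int. (\<forall>i\<ge>r. x i = 0) \<and> hhat (ec_lincomb a x Ps r) \<le> 2 * t}"
    define pt where "pt = (\<lambda>(x, g). ec_lincomb a x Ps r \<otimes>\<^bsub>E\<^esub> g)"
    have cG: "g \<in> carrier E" if "g \<in> G" for g using G that by (simp add: tors_subgroup_def carrier_ec_group)
    have lc: "ec_lincomb a x Ps r \<in> carrier E" for x using P by (rule lincomb_closed)
    have inj: "inj_on pt (S \<times> G)"
    proof (rule inj_onI)
      fix z z' assume z: "z \<in> S \<times> G" "z' \<in> S \<times> G" "pt z = pt z'"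
      obtain x g x' g' where e: "z = (x, g)" "z' = (x', g')" by (cases z, cases z')
      have "x = x'" "g = g'"
        using lincomb_torsion_inj[OF P ind G, of g g' x x'] z unfolding e by (auto simp: S_def pt_def)
      then show "z = z'" unfolding e by simp
    qed
    have img: "pt ` (S \<times> G) \<subseteq> carrier E" using lc cG by (auto simp: pt_def)
    have ht: "hhat Q \<le> 2 * t" if Q: "Q \<in> pt ` (S \<times> G)" for Q
    proof -
      obtain x g where xg: "x \<in> S" "g \<in> G" "Q = ec_lincomb a x Ps r \<otimes>\<^bsub>E\<^esub> g" using Q by (auto simp: pt_def)
      obtain m where m: "m > 0" "ec_nmul a m g = None" using G xg(2) by (auto simp: tors_subgroup_def)
      have "g [^]\<^bsub>E\<^esub> m = \<one>\<^bsub>E\<^esub>" using m(2) unfolding ec_nmul_eq_pow[OF cG[OF xg(2)]] one_ec_group .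
      from hhat_torsion[OF lc cG[OF xg(2)] m(1) this] show ?thesis using xg(1,3) by (simp add: S_def)
    qed
    note card = card_points_le_class_number[OF img ht X]
    have "finite (S \<times> G)" using card(1) inj by (rule finite_imageD)
    moreover have "None \<in> G" using G by (simp add: tors_subgroup_def)
    ultimately have finS: "finite S" using finite_cartesian_productD1[of S G] by auto
    have SG: "real (card S) * real (card G) \<le> real (class_number (- 4 * d))"
    proof -
      have "card (S \<times> G) \<le> class_number (- 4 * d)" using card(2) card_image[OF inj] by simp
      then show ?thesis by (simp add: card_cartesian_product flip: of_nat_mult)
    qed
    have count: "unit_ball_vol (real r) * (sqrt t - \<rho>) ^ r / sqrt (\<Prod>k<r. D' k) \<le> real (card S)"
    proof (rule lattice_point_count[OF Dpos DL(2,3) _ \<rho>t finS])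
      fix \<delta> :: "nat \<Rightarrow> real" assume \<delta>: "\<And>i. i < r \<Longrightarrow> \<delta> i = 0 \<or> \<delta> i = 1"
      define \<epsilon> :: "nat \<Rightarrow> int" where "\<epsilon> i = (if i < r \<and> \<delta> i = 1 then 1 else 0)" for i
      have "ellipsoid_norm r D' L \<delta> = ellipsoid_norm r D L (\<lambda>i. of_int (\<epsilon> i))"
        unfolding N' by (rule ellipsoid_norm_cong) (use \<delta> in \<open>force simp: \<epsilon>_def\<close>)
      moreover have "hhat (ec_lincomb a \<epsilon> Ps r) \<le> dP a Ps r" by (rule dP_bounds(1)[OF P]) (auto simp: \<epsilon>_def)
      ultimately show "ellipsoid_norm r D' L \<delta> \<le> \<rho>" unfolding \<rho>_def by (simp add: Nle)
    next
      fix x :: "nat \<Rightarrow> int" assume "\<And>i. i \<ge> r \<Longrightarrow> x i = 0" "ellipsoid_norm r D' L (\<lambda>i. of_int (x i)) \<le> sqrt t"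
      then show "x \<in> S" by (simp add: S_def N' Nle)
    qed
    \<comment> \<open>Bernoulli's inequality splits the power of the difference into the two terms
      of the claim; passing from \<rho> to sqrt dP weakens the bound by a factor sqrt 2 in the
      second one.\<close>
    have "K \<le> (sqrt t - \<rho>) ^ r"
    proof -
      have "real r * \<rho> * sqrt t ^ (r - 1) \<le> real r * sqrt (dP a Ps r) * sqrt t ^ (r - 1)"
        using \<rho>(2) t by (intro mult_right_mono mult_left_mono) auto
      then show ?thesis using pow_minus_ge[OF \<rho>(1) less_imp_le[OF \<rho>t], of r] unfolding K_def p1 p2 by linarith
    qed
    have "cG a G Ps r * K \<le> cG a G Ps r * (sqrt t - \<rho>) ^ r"
      by (rule mult_left_mono[OF \<open>K \<le> (sqrt t - \<rho>) ^ r\<close> c0])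
    also have "\<dots> = real (card G) * (unit_ball_vol (real r) * (sqrt t - \<rho>) ^ r / sqrt (\<Prod>k<r. D' k))"
      unfolding prodD cG_def Omega_def unit_ball_vol_def by (simp add: mult.assoc mult.commute)
    also have "\<dots> \<le> real (card G) * real (card S)" by (rule mult_left_mono[OF count]) simp
    also have "\<dots> \<le> real (class_number (- 4 * d))" using SG by (simp only: mult.commute)
    finally show ?thesis unfolding K_def .
  qed
qed

end

lemma deltaE_ge: "deltaE a b \<ge> 5 / 3"
proof -
  have "hW_rat x \<ge> 0" for x
    using hW_pt_nonneg[of "Some (x, 0)"] by (simp add: hW_pt_def)
  then show ?thesis unfolding deltaE_def by (simp add: add_nonneg_nonneg)
qed

text \<open>Since (1 + \<epsilon>') (1 - \<epsilon>) = 1, raising bound-suitability to the power 1 -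
  \<epsilon> gives w / 4 * exp (2 (\<delta> + m)) < X < v^2 w for X = d powr (1 - \<epsilon>) and w
  = u v + v^2. The lower bound makes t = \<open>TE\<close> larger than m / 4, hence positive; the
  upper one says exp (8 t + 2 \<delta>) / 4 = X / w < v^2.\<close>

theorem theorem3p3:
  fixes a4 a6 u v :: int and r :: nat and Ps :: "nat \<Rightarrow> ecpt" and G :: "ecpt set"
    and \<epsilon> :: real
  assumes "4 * a4 ^ 3 + 27 * a6 ^ 2 \<noteq> 0"
    and "\<forall>i<r. on_curve a4 a6 (Ps i)"
    and "lin_indep a4 Ps r"
    and "tors_subgroup a4 a6 G"
    and "0 < \<epsilon>" and "\<epsilon> < 1 / 2"
    and "map_suitable a4 a6 u v"
    and "bound_suitable a4 a6 Ps r \<epsilon> u v"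
    and "- DE a4 a6 u v < 0" and "fund_disc (- DE a4 a6 u v)"
  shows "real (class_number (- DE a4 a6 u v)) \<ge>
    cG a4 G Ps r * (TE a4 a6 u v \<epsilon> powr (real r / 2)
      - real r * sqrt (dP a4 Ps r) * TE a4 a6 u v \<epsilon> powr ((real r - 1) / 2))"
proof -
  define d where "d = dE a4 a6 u v"
  have DE: "- DE a4 a6 u v = - 4 * d" by (simp add: DE_def d_def)
  have uv: "u > 0" "v > 0" "3 * u ^ 2 + a4 * v ^ 2 > 0" using assms(7) by (auto simp: map_suitable_def)
  have d0: "d > 0" using assms(9) unfolding DE by simp
  have "(- 4 * d) mod 4 = 0" "(- 4 * d) div 4 = - d" by simp_all
  \<comment> \<open>The discriminant - 4 d is even, so it is fundamental by the second alternative: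
    d is squarefree and - d is 2 or 3 modulo 4.\<close>
  then have f: "(- d) mod 4 \<in> {2, 3}" "squarefree d" using assms(10) unfolding DE fund_disc_def by auto
  from f(1) have "(- d) mod 4 = 2 \<or> (- d) mod 4 = 3" by auto
  then have "d mod 4 = 1 \<or> d mod 4 = 2" by presburger
  moreover have "d = v * (u ^ 3 + a4 * u * v ^ 2 - a6 * v ^ 3)" by (simp add: d_def dE_def)
  ultimately interpret map_suitable_curve a4 a6 u v d
    using assms(1) uv d0 f(2) by unfold_locales
  have P: "\<And>i. i < r \<Longrightarrow> Ps i \<in> carrier E" using assms(2) by (simp add: carrier_ec_group)
  define \<epsilon>' where "\<epsilon>' = \<epsilon> / (1 - \<epsilon>)"
  define w where "w = real_of_int (u * v + v ^ 2)"
  define X where "X = real_of_int d powr (1 - \<epsilon>)"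
  define \<delta> where "\<delta> = deltaE a4 a6"
  define m where "m = dP a4 Ps r"
  define t where "t = TE a4 a6 u v \<epsilon>"
  have e1: "1 + \<epsilon>' = 1 / (1 - \<epsilon>)" using assms(5,6) by (simp add: \<epsilon>'_def field_simps)
  have e2: "(1 + \<epsilon>') * (1 - \<epsilon>) = 1" "1 - \<epsilon> > 0" "1 + \<epsilon>' > 0" unfolding e1 using assms(6) by simp_all
  have "u * v \<ge> 1" "v ^ 2 \<ge> 1" using uv by (simp_all add: int_one_le_iff_zero_less)
  then have "u * v + v ^ 2 \<ge> 2" by linarith
  then have w: "w \<ge> 2" unfolding w_def by linarith
  have \<delta>: "\<delta> \<ge> 5 / 3" unfolding \<delta>_def by (rule deltaE_ge)
  have m0: "m \<ge> 0" unfolding m_def by (rule dP_bounds(2)[OF P])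
  have lo: "(w / 4) powr (1 + \<epsilon>') * exp (2 * (1 + \<epsilon>') * (\<delta> + m)) < real_of_int d"
    and hi: "real_of_int d < (real_of_int (v ^ 2) * w) powr (1 + \<epsilon>')"
    using assms(8) unfolding bound_suitable_def Let_def w_def \<delta>_def m_def d_def \<epsilon>'_def by simp_all
  have inv: "(y powr (1 + \<epsilon>')) powr (1 - \<epsilon>) = y" if "y > 0" for y :: real
    unfolding powr_powr e2(1) using that by simp
  define B where "B = w / 4 * exp (2 * (\<delta> + m))"
  have B0: "B > 0" using w by (simp add: B_def)
  have "(w / 4) powr (1 + \<epsilon>') * exp (2 * (1 + \<epsilon>') * (\<delta> + m)) = B powr (1 + \<epsilon>')"
  proof -
    have "exp (2 * (1 + \<epsilon>') * (\<delta> + m)) = exp (2 * (\<delta> + m)) powr (1 + \<epsilon>')" by (simp add: powr_def algebra_simps)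
    then show ?thesis unfolding B_def using w by (simp only: powr_mult)
  qed
  then have "B powr (1 + \<epsilon>') < real_of_int d" using lo by simp
  then have "(B powr (1 + \<epsilon>')) powr (1 - \<epsilon>) < X" unfolding X_def using e2(2) by (intro powr_less_mono2) auto
  then have BX: "B < X" unfolding inv[OF B0] .
  have XV: "X < real_of_int (v ^ 2) * w"
  proof -
    have vw: "real_of_int (v ^ 2) * w > 0" using uv(2) w by simp
    have "X < ((real_of_int (v ^ 2) * w) powr (1 + \<epsilon>')) powr (1 - \<epsilon>)"
      unfolding X_def using hi d0 e2(2) by (intro powr_less_mono2) auto
    then show ?thesis unfolding inv[OF vw] .
  qed
  \<comment> \<open>The constant 5/3 in \<open>deltaE\<close> makes the exponential at least 1 +
    10/3, so w \<ge> 2 suffices. It follows that X > 1, hence d > 1, and d powr (1 - \<epsilon>) < d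
    is strict.\<close>
  have "B > 1"
  proof -
    have "1 + 10 / 3 \<le> exp (10 / 3 :: real)" by (rule exp_ge_add_one_self)
    also have "\<dots> \<le> exp (2 * (\<delta> + m))" using \<delta> m0 by simp
    finally have "exp (2 * (\<delta> + m)) \<ge> 4" by simp
    then have "(1 / 2) * 4 \<le> w / 4 * exp (2 * (\<delta> + m))" using w by (intro mult_mono) auto
    then show ?thesis unfolding B_def by simp
  qed
  then have X1: "X > 1" using BX by simp
  have Xd: "X < real_of_int d"
  proof -
    have "d \<noteq> 1"
    proof
      assume "d = 1"
      then show False using X1 by (simp add: X_def)
    qed
    then have "real_of_int d > 1" using d0 by linarith
    then have "X < real_of_int d powr 1" unfolding X_def using assms(5) by (intro powr_less_mono) auto
    then show ?thesis using d0 by simp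
  qed
  have t: "8 * t + 2 * \<delta> = ln (4 * X / w)"
    unfolding t_def TE_def X_def w_def \<delta>_def d_def by simp
  have ex: "exp (8 * t + 2 * \<delta>) / 4 = X / w" unfolding t using X1 w by simp
  have tpos: "t > 0"
  proof -
    have "exp (2 * (\<delta> + m)) < 4 * X / w" using BX w by (simp add: B_def field_simps)
    then have "ln (exp (2 * (\<delta> + m))) < ln (4 * X / w)" using X1 w by (subst ln_less_cancel_iff) auto
    then show ?thesis using t m0 by simp
  qed
  have "cG a4 G Ps r * (t powr (real r / 2) - real r * sqrt (dP a4 Ps r) * t powr ((real r - 1) / 2))
    \<le> real (class_number (- 4 * d))"
  proof (rule class_number_lower_bound[OF P assms(3,4) _ _ tpos])
    show "(u * v + v ^ 2) * (exp (8 * t + 2 * deltaE a4 a6) / 4) < d"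
      unfolding \<delta>_def[symmetric] ex w_def[symmetric] using Xd w by simp
    show "exp (8 * t + 2 * deltaE a4 a6) / 4 < v ^ 2"
      unfolding \<delta>_def[symmetric] ex using XV w by (simp add: pos_divide_less_eq)
  qed
  then show ?thesis unfolding DE t_def .
qed

end
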